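(* Let $\zeta\in\mathbb C$ be a root of unity, $\ell=\mathrm{ord}(\zeta^2)$, and let $\mathcal T_\zeta(m)$ be the indecomposable tilting module for $U_\zeta=U_\zeta(\mathfrak{sl}_2)$ with highest weight $m\in\mathbb N$. Distinguish: case (1), either $m<\ell$ or $m\equiv-1\pmod\ell$; case (2), $m=a\ell+b$ with $a\ge1$ and $0\le b<\ell-1$. Then the dimension of the $t$-weight space of $\mathcal T_\zeta(m)$ is $$\dim\mathcal T_\zeta(m)_t=\begin{cases}1&\text{if }t=m-2i,\ 0\le i\le m,\text{ in case (1)},\\ 2&\text{if }t=m-2j,\ b+1\le j\le m-(b+1),\text{ in case (2)},\\ 1&\text{if }t=m-2j\text{ with }0\le j\le b\text{ or }m\ge j\ge m-b,\text{ in case (2)},\\ 0&\text{otherwise.}\end{cases}$$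
   Context: $U_\zeta=U_A\otimes_A\mathbb C$, where $A=\mathbb Z[q^{\pm1/2}]$, $U_A$ is Lusztig's integral (divided power) form of $U_q(\mathfrak{sl}_2)$ and $A\to\mathbb C$ sends $q\mapsto\zeta$. Weights are integers and modules are finite dimensional weight modules of type 1. The Weyl module $\Delta_\zeta(m)$ is $\Delta_A(m)\otimes_A\mathbb C$, where $\Delta_A(m)$ is the $U_A$-submodule generated by a highest weight vector in the simple module of highest weight $m$ over $\mathbb Q(q^{1/2})$. A tilting module is a module with both a filtration by Weyl modules and a filtration by dual Weyl modules; for each $m\in\mathbb N$ there is a unique indecomposable tilting module $\mathcal T_\zeta(m)$ with highest weight $m$. *)

theory Defs
  imports
    "HOL-Algebra.QuotRing"
    "HOL-Algebra.Generated_Rings"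
    "HOL-Algebra.Free_Abelian_Groups"
    "HOL-Computational_Algebra.Fraction_Field"
    "HOL-Number_Theory.Cong"
    "Jordan_Normal_Form.VS_Connect"
begin

hide_const (open) Multiset.mult Wellorder_Constructions.zero

section \<open>The ground rings\<close>

text \<open>The field \<open>\<rat>(q\<^sup>1\<^sup>/\<^sup>2)\<close> is the field of rational functions in the variable
  \<open>q_half\<close>; \<open>A = \<int>[q\<^sup>\<plusminus>\<^sup>1\<^sup>/\<^sup>2]\<close> is the subring \<open>laurent\<close>.\<close>

type_synonym qfield = "rat poly fract"

definition q_half :: qfield where
  "q_half = Fract [:0, 1:] 1"

definition q_par :: qfield where
  "q_par = q_half ^ 2"

definition laurent :: "qfield set" where
  "laurent = generate_ring class_ring {q_half, inverse q_half}"

definition laurent_ring :: "qfield ring" where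
  "laurent_ring = class_ring\<lparr>carrier := laurent\<rparr>"

definition q_int :: "int \<Rightarrow> qfield" where
  "q_int n = (q_par powi n - q_par powi (- n)) / (q_par - inverse q_par)"

definition q_fact :: "nat \<Rightarrow> qfield" where
  "q_fact n = (\<Prod>i = 1..n. q_int (int i))"

definition q_binom :: "int \<Rightarrow> nat \<Rightarrow> qfield" where
  "q_binom t r = (\<Prod>s = 1..r. q_int (t + 1 - int s) / q_int (int s))"


section \<open>The algebra \<open>U\<^sub>q(sl\<^sub>2)\<close>\<close>

text \<open>The free associative algebra on \<open>E, F, K, K\<^sup>-\<^sup>1\<close> is the monoid algebra of the monoid of
  words. That monoid is written additively because the convolution product of
  \<^typ>\<open>'a \<Rightarrow>\<^sub>0 'b\<close> is based on the addition of \<^typ>\<open>'a\<close>.\<close>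

datatype gen = Gen_E | Gen_F | Gen_K | Gen_Kinv

datatype word = Word (letters: "gen list")

instantiation word :: monoid_add
begin
definition zero_word :: word where "0 = Word []"
definition plus_word :: "word \<Rightarrow> word \<Rightarrow> word" where "v + w = Word (letters v @ letters w)"
instance by standard (simp_all add: zero_word_def plus_word_def)
end

type_synonym free_alg = "word \<Rightarrow>\<^sub>0 qfield"

definition fr_scalar :: "qfield \<Rightarrow> free_alg" where
  "fr_scalar c = Poly_Mapping.single 0 c"

definition fr_gen :: "gen \<Rightarrow> free_alg" where
  "fr_gen g = Poly_Mapping.single (Word [g]) 1"

definition uq_relators :: "free_alg set" where
  "uq_relators =
    (let E = fr_gen Gen_E; F = fr_gen Gen_F; K = fr_gen Gen_K; K' = fr_gen Gen_Kinv in
      {K * K' - 1,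
       K' * K - 1,
       K * E - fr_scalar (q_par ^ 2) * E * K,
       K * F - fr_scalar (inverse (q_par ^ 2)) * F * K,
       E * F - F * E - fr_scalar (inverse (q_par - inverse q_par)) * (K - K')})"

definition uq_ideal :: "free_alg set" where
  "uq_ideal = genideal class_ring uq_relators"

lemma uq_ideal: "ideal uq_ideal class_ring"
  unfolding uq_ideal_def by (rule ring.genideal_ideal[OF class_ring.ring_axioms]) simp

lemma uq_relators_subset: "uq_relators \<subseteq> uq_ideal"
  unfolding uq_ideal_def by (rule ring.genideal_self[OF class_ring.ring_axioms]) simp

lemma uq_ideal_minimal:
  assumes "ideal I (class_ring :: free_alg ring)" "uq_relators \<subseteq> I"
  shows "uq_ideal \<subseteq> I"
  unfolding uq_ideal_def by (rule ring.genideal_minimal[OF class_ring.ring_axioms]) fact+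

lemma uq_ideal_zero: "0 \<in> uq_ideal"
  and uq_ideal_add: "x \<in> uq_ideal \<Longrightarrow> y \<in> uq_ideal \<Longrightarrow> x + y \<in> uq_ideal"
  and uq_ideal_lmult: "x \<in> uq_ideal \<Longrightarrow> a * x \<in> uq_ideal"
  and uq_ideal_rmult: "x \<in> uq_ideal \<Longrightarrow> x * a \<in> uq_ideal"
proof -
  interpret I: ideal uq_ideal "class_ring :: free_alg ring" by (rule uq_ideal)
  show "0 \<in> uq_ideal" using I.zero_closed by simp
  show "x \<in> uq_ideal \<Longrightarrow> y \<in> uq_ideal \<Longrightarrow> x + y \<in> uq_ideal" using I.a_closed by simp
  show "x \<in> uq_ideal \<Longrightarrow> a * x \<in> uq_ideal" using I.I_l_closed[of x a] by simp
  show "x \<in> uq_ideal \<Longrightarrow> x * a \<in> uq_ideal" using I.I_r_closed[of x a] by simp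
qed

lemma uq_ideal_uminus: "x \<in> uq_ideal \<Longrightarrow> - x \<in> uq_ideal"
  using uq_ideal_lmult[of x "- 1"] by simp

lemma uq_ideal_diff: "x \<in> uq_ideal \<Longrightarrow> y \<in> uq_ideal \<Longrightarrow> x - y \<in> uq_ideal"
  using uq_ideal_add[of x "- y"] uq_ideal_uminus[of y] by simp

lemma class_ring_idealI:
  fixes I :: "'a :: ring_1 set"
  assumes "0 \<in> I" "\<And>x y. x \<in> I \<Longrightarrow> y \<in> I \<Longrightarrow> x + y \<in> I"
    "\<And>x a. x \<in> I \<Longrightarrow> a * x \<in> I" "\<And>x a. x \<in> I \<Longrightarrow> x * a \<in> I"
  shows "ideal I (class_ring :: 'a ring)"
proof (rule idealI)
  have R: "ring (class_ring :: 'a ring)" by (rule class_ring.ring_axioms)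
  then show "ring (class_ring :: 'a ring)" .
  have G: "group (add_monoid (class_ring :: 'a ring))"
    using R by (meson abelian_group.a_group ring.is_abelian_group)
  show "subgroup I (add_monoid (class_ring :: 'a ring))"
  proof (rule group.subgroupI[OF G])
    fix a :: 'a assume "a \<in> I"
    moreover have "inv\<^bsub>add_monoid class_ring\<^esub> a = - a"
      by (rule group.inv_equality[OF G]) simp_all
    ultimately show "inv\<^bsub>add_monoid class_ring\<^esub> a \<in> I" using assms(3)[of a "- 1"] by simp
  qed (use assms in auto)
qed (use assms in auto)

text \<open>Linear extension to the free algebra of a map \<open>h\<close> on words, along a map \<open>s\<close> of scalars.\<close>

definition fr_extend :: "(qfield \<Rightarrow> 'r) \<Rightarrow> (word \<Rightarrow> 'r) \<Rightarrow> free_alg \<Rightarrow> 'r :: ring_1" where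
  "fr_extend s h p = (\<Sum>w \<in> Poly_Mapping.keys p. s (Poly_Mapping.lookup p w) * h w)"

lemma fr_induct:
  fixes p :: free_alg
  assumes "\<And>w c. P (Poly_Mapping.single w c)" "\<And>x y. P x \<Longrightarrow> P y \<Longrightarrow> P (x + y)"
  shows "P p"
proof (induction p rule: update_induct)
  case const
  show ?case using assms(1)[of 0 0] by simp
next
  case (update f a b)
  have "Poly_Mapping.update a b f = f + Poly_Mapping.single a b"
    using update.hyps
    by (intro poly_mapping_eqI) (auto simp: lookup_update lookup_add lookup_single in_keys_iff when_def)
  then show ?case using update.IH assms by metis
qed

locale central_scalars =
  fixes s :: "qfield \<Rightarrow> 'r :: ring_1"
  assumes s_add: "s (a + b) = s a + s b"
    and s_mult: "s (a * b) = s a * s b"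
    and s_one: "s 1 = 1"
    and s_central: "s a * x = x * s a"
begin

lemma s_zero: "s 0 = 0"
  using s_add[of 0 0] by simp

lemma fr_extend_superset:
  assumes "finite W" "Poly_Mapping.keys p \<subseteq> W"
  shows "fr_extend s h p = (\<Sum>w \<in> W. s (Poly_Mapping.lookup p w) * h w)"
  unfolding fr_extend_def using assms
  by (intro sum.mono_neutral_left) (auto simp: s_zero in_keys_iff)

lemma fr_extend_zero: "fr_extend s h 0 = 0"
  by (simp add: fr_extend_def)

lemma fr_extend_add: "fr_extend s h (p + p') = fr_extend s h p + fr_extend s h p'"
proof -
  let ?W = "Poly_Mapping.keys p \<union> Poly_Mapping.keys p'"
  have "Poly_Mapping.keys (p + p') \<subseteq> ?W" by (rule Poly_Mapping.keys_add)
  then show ?thesis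
    by (simp add: fr_extend_superset[of ?W] lookup_add s_add distrib_right sum.distrib)
qed

lemma fr_extend_diff: "fr_extend s h (p - p') = fr_extend s h p - fr_extend s h p'"
  using fr_extend_add[of h "p - p'" p'] by simp

lemma fr_extend_single: "fr_extend s h (Poly_Mapping.single w c) = s c * h w"
  by (simp add: fr_extend_def s_zero)

lemma fr_extend_mult:
  assumes "\<And>v w. h (v + w) = h v * h w"
  shows "fr_extend s h (p * p') = fr_extend s h p * fr_extend s h p'"
proof (induction p rule: fr_induct)
  case (1 v c)
  show ?case
  proof (induction p' rule: fr_induct)
    case (1 w d)
    have "s c * s d * (h v * h w) = s c * h v * (s d * h w)"
      by (metis (no_types) mult.assoc s_central)
    then show ?case by (simp add: mult_single fr_extend_single assms s_mult)
  qed (simp add: fr_extend_add distrib_left)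
qed (simp add: fr_extend_add distrib_right)

lemma fr_extend_antimult:
  assumes "\<And>v w. h (v + w) = h w * h v"
  shows "fr_extend s h (p * p') = fr_extend s h p' * fr_extend s h p"
proof (induction p rule: fr_induct)
  case (1 v c)
  show ?case
  proof (induction p' rule: fr_induct)
    case (1 w d)
    have "s c * s d * (h w * h v) = s d * h w * (s c * h v)"
      by (metis (no_types) mult.assoc s_central)
    then show ?case by (simp add: mult_single fr_extend_single assms s_mult)
  qed (simp add: fr_extend_add distrib_left distrib_right)
qed (simp add: fr_extend_add distrib_left distrib_right)

end

text \<open>The counit shows that the quotient is not the zero ring, as required by \<^class>\<open>ring_1\<close>.\<close>

definition fr_counit :: "free_alg \<Rightarrow> qfield" where
  "fr_counit = fr_extend id
     (\<lambda>w. prod_list (map (\<lambda>g. if g = Gen_E \<or> g = Gen_F then 0 else 1) (letters w)))"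

lemma one_notin_uq_ideal: "1 \<notin> uq_ideal"
proof -
  interpret central_scalars "id :: qfield \<Rightarrow> qfield"
    by unfold_locales simp_all
  have mult: "fr_counit (p * p') = fr_counit p * fr_counit p'" for p p'
    unfolding fr_counit_def by (rule fr_extend_mult) (simp add: plus_word_def)
  have add: "fr_counit (p + p') = fr_counit p + fr_counit p'" for p p'
    unfolding fr_counit_def by (rule fr_extend_add)
  have diff: "fr_counit (p - p') = fr_counit p - fr_counit p'" for p p'
    unfolding fr_counit_def by (rule fr_extend_diff)
  have zero: "fr_counit 0 = 0" unfolding fr_counit_def by (rule fr_extend_zero)
  have gens: "fr_counit (fr_gen g) = (if g = Gen_E \<or> g = Gen_F then 0 else 1)" for g
    by (simp add: fr_counit_def fr_gen_def fr_extend_single)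
  have one: "fr_counit 1 = 1"
    using fr_extend_single[of _ 0 1] by (simp add: fr_counit_def) (simp add: zero_word_def)
  have "uq_ideal \<subseteq> {p. fr_counit p = 0}"
  proof (rule uq_ideal_minimal)
    show "ideal {p. fr_counit p = 0} (class_ring :: free_alg ring)"
      by (rule class_ring_idealI) (simp_all add: zero add mult)
    show "uq_relators \<subseteq> {p. fr_counit p = 0}"
      by (simp add: uq_relators_def Let_def diff mult gens one)
  qed
  then show ?thesis using one by auto
qed

quotient_type uq = free_alg / "\<lambda>x y. x - y \<in> uq_ideal"
proof (rule equivpI)
  show "reflp (\<lambda>x y. x - y \<in> uq_ideal)" by (simp add: reflp_def uq_ideal_zero)
  show "symp (\<lambda>x y. x - y \<in> uq_ideal)"
    proof (rule sympI)
    fix x y :: free_alg assume "x - y \<in> uq_ideal"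
    then have "- (x - y) \<in> uq_ideal" by (rule uq_ideal_uminus)
    then show "y - x \<in> uq_ideal" by simp
  qed
  show "transp (\<lambda>x y. x - y \<in> uq_ideal)"
    proof (rule transpI)
    fix x y z :: free_alg assume "x - y \<in> uq_ideal" "y - z \<in> uq_ideal"
    then have "(x - y) + (y - z) \<in> uq_ideal" by (rule uq_ideal_add)
    then show "x - z \<in> uq_ideal" by simp
  qed
qed

instantiation uq :: ring_1
begin

lift_definition zero_uq :: uq is 0 .
lift_definition one_uq :: uq is 1 .
lift_definition plus_uq :: "uq \<Rightarrow> uq \<Rightarrow> uq" is "(+)"
proof -
  fix a b c d :: free_alg assume "a - b \<in> uq_ideal" "c - d \<in> uq_ideal"
  then have "(a - b) + (c - d) \<in> uq_ideal" by (rule uq_ideal_add)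
  then show "(a + c) - (b + d) \<in> uq_ideal" by (simp add: algebra_simps)
qed
lift_definition uminus_uq :: "uq \<Rightarrow> uq" is uminus
proof -
  fix a b :: free_alg assume "a - b \<in> uq_ideal"
  then have "- (a - b) \<in> uq_ideal" by (rule uq_ideal_uminus)
  then show "- a - - b \<in> uq_ideal" by (simp add: algebra_simps)
qed
lift_definition minus_uq :: "uq \<Rightarrow> uq \<Rightarrow> uq" is "(-)"
proof -
  fix a b c d :: free_alg assume "a - b \<in> uq_ideal" "c - d \<in> uq_ideal"
  then have "(a - b) - (c - d) \<in> uq_ideal" by (rule uq_ideal_diff)
  then show "(a - c) - (b - d) \<in> uq_ideal" by (simp add: algebra_simps)
qed
lift_definition times_uq :: "uq \<Rightarrow> uq \<Rightarrow> uq" is "(*)"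
proof -
  fix a b c d :: free_alg assume "a - b \<in> uq_ideal" "c - d \<in> uq_ideal"
  then have "(a - b) * c + b * (c - d) \<in> uq_ideal"
    by (intro uq_ideal_add uq_ideal_lmult uq_ideal_rmult)
  then show "a * c - b * d \<in> uq_ideal" by (simp add: algebra_simps)
qed

instance
proof
  show "(0 :: uq) \<noteq> 1"
  proof transfer
    show "0 - (1 :: free_alg) \<notin> uq_ideal"
      using one_notin_uq_ideal uq_ideal_uminus[of "0 - 1"] by auto
  qed
qed (transfer; simp add: algebra_simps uq_ideal_zero)+

end

lift_definition uq_scalar :: "qfield \<Rightarrow> uq" is fr_scalar .
lift_definition uq_gen :: "gen \<Rightarrow> uq" is fr_gen .

abbreviation "U_E \<equiv> uq_gen Gen_E"
abbreviation "U_F \<equiv> uq_gen Gen_F"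
abbreviation "U_K \<equiv> uq_gen Gen_K"
abbreviation "U_Kinv \<equiv> uq_gen Gen_Kinv"

lemma uq_relations:
  shows "U_K * U_Kinv = 1"
    and "U_Kinv * U_K = 1"
    and "U_K * U_E = uq_scalar (q_par ^ 2) * U_E * U_K"
    and "U_K * U_F = uq_scalar (inverse (q_par ^ 2)) * U_F * U_K"
    and "U_E * U_F - U_F * U_E = uq_scalar (inverse (q_par - inverse q_par)) * (U_K - U_Kinv)"
  by (transfer, rule subsetD[OF uq_relators_subset], simp add: uq_relators_def Let_def)+

lemma central_scalars_uq_scalar: "central_scalars uq_scalar"
proof
  fix a b :: qfield and x :: uq
  show "uq_scalar (a + b) = uq_scalar a + uq_scalar b"
    by transfer (simp add: fr_scalar_def single_add uq_ideal_zero)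
  show "uq_scalar (a * b) = uq_scalar a * uq_scalar b"
    by transfer (simp add: fr_scalar_def mult_single uq_ideal_zero)
  show "uq_scalar 1 = 1"
    by transfer (simp add: fr_scalar_def uq_ideal_zero)
  show "uq_scalar a * x = x * uq_scalar a"
  proof transfer
    fix a :: qfield and x :: free_alg
    have "fr_scalar a * x = x * fr_scalar a"
    proof (induction x rule: fr_induct)
      case (1 w c)
      then show ?case by (simp add: fr_scalar_def mult_single mult.commute)
    qed (simp_all add: distrib_left distrib_right)
    then show "fr_scalar a * x - x * fr_scalar a \<in> uq_ideal" by (simp add: uq_ideal_zero)
  qed
qed

text \<open>The antipode for the comultiplication with \<open>\<Delta>(E) = E \<otimes> 1 + K \<otimes> E\<close> and
  \<open>\<Delta>(F) = F \<otimes> K\<^sup>-\<^sup>1 + 1 \<otimes> F\<close>. It reverses products.\<close>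

fun antipode_gen :: "gen \<Rightarrow> uq" where
  "antipode_gen Gen_E = - (U_Kinv * U_E)"
| "antipode_gen Gen_F = - (U_F * U_K)"
| "antipode_gen Gen_K = U_Kinv"
| "antipode_gen Gen_Kinv = U_K"

definition fr_antipode :: "free_alg \<Rightarrow> uq" where
  "fr_antipode = fr_extend uq_scalar (\<lambda>w. prod_list (map antipode_gen (rev (letters w))))"

context
begin

interpretation central_scalars uq_scalar by (rule central_scalars_uq_scalar)

lemma fr_antipode_mult: "fr_antipode (p * p') = fr_antipode p' * fr_antipode p"
  unfolding fr_antipode_def by (rule fr_extend_antimult) (simp add: plus_word_def)

lemma fr_antipode_add: "fr_antipode (p + p') = fr_antipode p + fr_antipode p'"
  unfolding fr_antipode_def by (rule fr_extend_add)

lemma fr_antipode_diff: "fr_antipode (p - p') = fr_antipode p - fr_antipode p'"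
  unfolding fr_antipode_def by (rule fr_extend_diff)

lemma fr_antipode_gen: "fr_antipode (fr_gen g) = antipode_gen g"
  by (simp add: fr_antipode_def fr_gen_def fr_extend_single s_one)

lemma fr_antipode_scalar: "fr_antipode (fr_scalar c) = uq_scalar c"
  by (simp add: fr_antipode_def fr_scalar_def fr_extend_single zero_word_def)

lemma fr_antipode_one: "fr_antipode 1 = 1"
  using fr_antipode_scalar[of 1] by (simp add: fr_scalar_def s_one)

lemma fr_antipode_relators:
  assumes "p \<in> uq_relators"
  shows "fr_antipode p = 0"
proof -
  define z where "z = uq_scalar (q_par ^ 2)"
  define z' where "z' = uq_scalar (inverse (q_par ^ 2))"
  define c where "c = uq_scalar (inverse (q_par - inverse q_par))"
  have z: "z * x = x * z" and z': "z' * x = x * z'" and c: "c * x = x * c" for x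
    unfolding z_def z'_def c_def by (rule s_central)+
  have q0: "q_par \<noteq> 0"
  proof -
    have "q_half \<noteq> 0" by (simp add: q_half_def Zero_fract_def eq_fract)
    then show ?thesis by (simp add: q_par_def)
  qed
  have zz': "z * z' = 1"
    using q0 by (simp add: z_def z'_def flip: s_mult s_one)
  note rels = uq_relations[folded z_def z'_def c_def]
  have EK: "U_E * U_Kinv = z * (U_Kinv * U_E)"
  proof -
    have "U_E * U_Kinv = (U_Kinv * U_K) * U_E * U_Kinv" by (simp add: rels(2))
    also have "\<dots> = U_Kinv * (U_K * U_E) * U_Kinv" by (simp only: mult.assoc)
    also have "\<dots> = (U_Kinv * z) * U_E * (U_K * U_Kinv)" by (simp only: rels(3) mult.assoc)
    also have "\<dots> = z * (U_Kinv * U_E)" by (simp only: rels(1) z[symmetric] mult.assoc mult_1_right)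
    finally show ?thesis .
  qed
  have FK: "U_F * U_Kinv = z' * (U_Kinv * U_F)"
  proof -
    have "U_F * U_Kinv = (U_Kinv * U_K) * U_F * U_Kinv" by (simp add: rels(2))
    also have "\<dots> = U_Kinv * (U_K * U_F) * U_Kinv" by (simp only: mult.assoc)
    also have "\<dots> = (U_Kinv * z') * U_F * (U_K * U_Kinv)" by (simp only: rels(4) mult.assoc)
    also have "\<dots> = z' * (U_Kinv * U_F)" by (simp only: rels(1) z'[symmetric] mult.assoc mult_1_right)
    finally show ?thesis .
  qed
  have one: "(U_Kinv * U_E) * U_Kinv = U_Kinv * ((U_Kinv * U_E) * z)"
    by (simp only: mult.assoc EK z)
  have two: "(U_F * U_K) * U_Kinv = U_Kinv * ((U_F * U_K) * z')"
  proof -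
    have "U_Kinv * ((U_F * U_K) * z') = U_Kinv * (z' * (U_F * U_K))" by (simp only: z')
    also have "\<dots> = (U_Kinv * z') * (U_F * U_K)" by (simp only: mult.assoc)
    also have "\<dots> = z' * (U_Kinv * U_F) * U_K" by (simp only: z'[of U_Kinv, symmetric] mult.assoc)
    also have "\<dots> = U_F * (U_Kinv * U_K)" by (simp only: FK[symmetric] mult.assoc)
    finally show ?thesis by (simp add: rels(1,2) mult.assoc)
  qed
  have three: "(U_Kinv * U_E) * (U_F * U_K) = U_E * U_F"
  proof -
    have "(U_Kinv * U_E) * (U_F * U_K) = (z * z') * ((U_Kinv * U_E) * (U_F * U_K))"
      by (simp only: zz' mult_1)
    also have "\<dots> = z * (z' * (U_Kinv * U_E)) * (U_F * U_K)" by (simp only: mult.assoc)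
    also have "\<dots> = z * ((U_Kinv * U_E) * z') * (U_F * U_K)" by (simp only: z')
    also have "\<dots> = (z * (U_Kinv * U_E)) * (z' * (U_F * U_K))" by (simp only: mult.assoc)
    also have "\<dots> = U_E * (U_Kinv * (z' * (U_F * U_K)))" by (simp only: EK[symmetric] mult.assoc)
    also have "\<dots> = U_E * (U_Kinv * ((U_F * U_K) * z'))" by (simp only: z')
    also have "\<dots> = U_E * ((U_F * U_K) * U_Kinv)" by (simp only: two)
    finally show ?thesis by (simp add: rels(1) mult.assoc)
  qed
  have four: "(U_F * U_K) * (U_Kinv * U_E) = U_F * U_E"
  proof -
    have "(U_F * U_K) * (U_Kinv * U_E) = U_F * (U_K * U_Kinv) * U_E" by (simp only: mult.assoc)
    then show ?thesis by (simp add: rels(1))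
  qed
  have "U_F * U_E - U_E * U_F = (U_Kinv - U_K) * c"
  proof -
    have "U_F * U_E - U_E * U_F = - (c * (U_K - U_Kinv))" by (simp flip: rels(5))
    also have "\<dots> = c * (U_Kinv - U_K)" by (simp add: algebra_simps)
    finally show ?thesis by (simp only: c)
  qed
  then have five: "(- (U_F * U_K)) * (- (U_Kinv * U_E)) - (- (U_Kinv * U_E)) * (- (U_F * U_K))
      - (U_Kinv - U_K) * c = 0"
    by (simp only: minus_mult_minus three four) simp
  from assms consider
      "p = fr_gen Gen_K * fr_gen Gen_Kinv - 1"
    | "p = fr_gen Gen_Kinv * fr_gen Gen_K - 1"
    | "p = fr_gen Gen_K * fr_gen Gen_E - fr_scalar (q_par ^ 2) * fr_gen Gen_E * fr_gen Gen_K"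
    | "p = fr_gen Gen_K * fr_gen Gen_F
         - fr_scalar (inverse (q_par ^ 2)) * fr_gen Gen_F * fr_gen Gen_K"
    | "p = fr_gen Gen_E * fr_gen Gen_F - fr_gen Gen_F * fr_gen Gen_E
         - fr_scalar (inverse (q_par - inverse q_par)) * (fr_gen Gen_K - fr_gen Gen_Kinv)"
    unfolding uq_relators_def Let_def by blast
  then show "fr_antipode p = 0"
  proof cases
    case 1
    then show ?thesis
      by (simp add: fr_antipode_diff fr_antipode_mult fr_antipode_gen fr_antipode_one rels(1))
  next
    case 2
    then show ?thesis
      by (simp add: fr_antipode_diff fr_antipode_mult fr_antipode_gen fr_antipode_one rels(2))
  next
    case 3
    then show ?thesis using one
      by (simp add: fr_antipode_diff fr_antipode_mult fr_antipode_gen fr_antipode_scalar z_def)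
  next
    case 4
    then show ?thesis using two
      by (simp add: fr_antipode_diff fr_antipode_mult fr_antipode_gen fr_antipode_scalar z'_def)
  next
    case 5
    show ?thesis unfolding 5(1)
      by (simp only: fr_antipode_diff fr_antipode_mult fr_antipode_gen fr_antipode_scalar
        antipode_gen.simps c_def[symmetric] five)
  qed
qed

lemma fr_antipode_ideal: "p \<in> uq_ideal \<Longrightarrow> fr_antipode p = 0"
proof -
  have "uq_ideal \<subseteq> {p. fr_antipode p = 0}"
  proof (rule uq_ideal_minimal)
    show "ideal {p. fr_antipode p = 0} (class_ring :: free_alg ring)"
      using fr_antipode_diff[of 0 0]
      by (intro class_ring_idealI) (simp_all add: fr_antipode_add fr_antipode_mult)
  qed (use fr_antipode_relators in auto)
  then show "p \<in> uq_ideal \<Longrightarrow> fr_antipode p = 0" by auto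
qed

end

lift_definition antipode :: "uq \<Rightarrow> uq" is fr_antipode
proof -
  fix x y :: free_alg assume "x - y \<in> uq_ideal"
  then have "fr_antipode (x - y) = 0" by (rule fr_antipode_ideal)
  then show "fr_antipode x = fr_antipode y" by (simp add: fr_antipode_diff)
qed

lemma antipode_add: "antipode (x + y) = antipode x + antipode y"
  by transfer (simp add: fr_antipode_add)

lemma antipode_mult: "antipode (x * y) = antipode y * antipode x"
  by transfer (simp add: fr_antipode_mult)

lemma antipode_scalar: "antipode (uq_scalar c) = uq_scalar c"
  by transfer (simp add: fr_antipode_scalar)

lemma antipode_gen: "antipode (uq_gen g) = antipode_gen g"
  by transfer (simp add: fr_antipode_gen)


section \<open>Lusztig's integral form\<close>

definition div_E :: "nat \<Rightarrow> uq" where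
  "div_E n = uq_scalar (inverse (q_fact n)) * U_E ^ n"

definition div_F :: "nat \<Rightarrow> uq" where
  "div_F n = uq_scalar (inverse (q_fact n)) * U_F ^ n"

definition U_A :: "uq set" where
  "U_A = generate_ring class_ring
     (uq_scalar ` laurent \<union> range div_E \<union> range div_F \<union> {U_K, U_Kinv})"

text \<open>\<open>K_binom r\<close> is the element
  \<open>[K; 0; r] = \<Prod>\<^bsub>s=1..r\<^esub> (K q\<^bsup>1-s\<^esup> - K\<^sup>-\<^sup>1 q\<^bsup>s-1\<^esup>) / (q\<^sup>s - q\<^bsup>-s\<^esup>)\<close> of the
  Cartan part of \<open>U\<^sub>A\<close>.\<close>

primrec K_binom :: "nat \<Rightarrow> uq" where
  "K_binom 0 = 1"
| "K_binom (Suc r) = K_binom r *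
     (uq_scalar (inverse (q_par powi (int r + 1) - q_par powi (- (int r + 1)))) *
      (uq_scalar (q_par powi (- int r)) * U_K - uq_scalar (q_par powi int r) * U_Kinv))"


section \<open>Modules over a not necessarily commutative ring\<close>

text \<open>The locale \<^locale>\<open>Module.module\<close> is restricted to commutative rings. As in the library, the
  ring operations which a record \<open>M\<close> of type \<open>('a, 'b) module\<close> carries on the module itself are
  irrelevant.\<close>

locale left_module = R?: ring R + M?: abelian_group M
  for R :: "('a, 'c) ring_scheme" (structure) and M :: "('a, 'b, 'd) module_scheme" (structure) +
  assumes smult_closed:
      "\<lbrakk>a \<in> carrier R; x \<in> carrier M\<rbrakk> \<Longrightarrow> a \<odot>\<^bsub>M\<^esub> x \<in> carrier M"
    and smult_l_distr:
      "\<lbrakk>a \<in> carrier R; b \<in> carrier R; x \<in> carrier M\<rbrakk> \<Longrightarrow>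
       (a \<oplus> b) \<odot>\<^bsub>M\<^esub> x = a \<odot>\<^bsub>M\<^esub> x \<oplus>\<^bsub>M\<^esub> b \<odot>\<^bsub>M\<^esub> x"
    and smult_r_distr:
      "\<lbrakk>a \<in> carrier R; x \<in> carrier M; y \<in> carrier M\<rbrakk> \<Longrightarrow>
       a \<odot>\<^bsub>M\<^esub> (x \<oplus>\<^bsub>M\<^esub> y) = a \<odot>\<^bsub>M\<^esub> x \<oplus>\<^bsub>M\<^esub> a \<odot>\<^bsub>M\<^esub> y"
    and smult_assoc1:
      "\<lbrakk>a \<in> carrier R; b \<in> carrier R; x \<in> carrier M\<rbrakk> \<Longrightarrow>
       (a \<otimes> b) \<odot>\<^bsub>M\<^esub> x = a \<odot>\<^bsub>M\<^esub> (b \<odot>\<^bsub>M\<^esub> x)"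
    and smult_one: "x \<in> carrier M \<Longrightarrow> \<one> \<odot>\<^bsub>M\<^esub> x = x"

definition quot_module :: "('a, 'b) module \<Rightarrow> 'b set \<Rightarrow> ('a, 'b set) module" where
  "quot_module M N =
    \<lparr>carrier = a_rcosets\<^bsub>M\<^esub> N, mult = rcoset_mult M N, one = N +>\<^bsub>M\<^esub> \<one>\<^bsub>M\<^esub>,
     zero = N, add = set_add M, smult = (\<lambda>a X. \<Union>x\<in>X. N +>\<^bsub>M\<^esub> (a \<odot>\<^bsub>M\<^esub> x))\<rparr>"

definition module_isomorphic :: "'a ring \<Rightarrow> ('a, 'b) module \<Rightarrow> ('a, 'c) module \<Rightarrow> bool" where
  "module_isomorphic R M N \<longleftrightarrow>
    (\<exists>f \<in> LinearCombinations.module_hom R M N. bij_betw f (carrier M) (carrier N))"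

definition simple_module :: "'a ring \<Rightarrow> ('a, 'b) module \<Rightarrow> bool" where
  "simple_module R M \<longleftrightarrow> left_module R M \<and> carrier M \<noteq> {\<zero>\<^bsub>M\<^esub>} \<and>
    (\<forall>N. Module.submodule N R M \<longrightarrow> N = {\<zero>\<^bsub>M\<^esub>} \<or> N = carrier M)"

definition indecomposable :: "'a ring \<Rightarrow> ('a, 'b) module \<Rightarrow> bool" where
  "indecomposable R M \<longleftrightarrow> carrier M \<noteq> {\<zero>\<^bsub>M\<^esub>} \<and>
    (\<forall>N N'. Module.submodule N R M \<and> Module.submodule N' R M \<and>
       N \<inter> N' = {\<zero>\<^bsub>M\<^esub>} \<and> N <+>\<^bsub>M\<^esub> N' = carrier M \<longrightarrow> N = {\<zero>\<^bsub>M\<^esub>} \<or> N' = {\<zero>\<^bsub>M\<^esub>})"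

definition filtration_by ::
  "'a ring \<Rightarrow> (('a, 'b set) module \<Rightarrow> bool) \<Rightarrow> ('a, 'b) module \<Rightarrow> bool" where
  "filtration_by R P M \<longleftrightarrow> (\<exists>(n :: nat) C.
     C 0 = {\<zero>\<^bsub>M\<^esub>} \<and> C n = carrier M \<and> (\<forall>i\<le>n. Module.submodule (C i) R M) \<and>
     (\<forall>i<n. C i \<subseteq> C (Suc i) \<and> P (quot_module (M\<lparr>carrier := C (Suc i)\<rparr>) (C i))))"


section \<open>Base change along \<open>A \<rightarrow> \<complex>\<close>\<close>

text \<open>Throughout, \<open>\<phi>\<close> is a ring homomorphism \<open>A \<rightarrow> \<complex>\<close>; its values outside \<^const>\<open>laurent\<close> are never
  used. For a module \<open>N\<close> over \<open>U\<^sub>A\<close>, the tensor product \<open>N \<otimes>\<^sub>A \<complex>\<close> is the free abelian group on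
  \<open>N \<times> \<complex>\<close> modulo the subgroup expressing that \<open>\<otimes>\<close> is biadditive and \<open>A\<close>-balanced.\<close>

definition tensor_relators :: "(qfield \<Rightarrow> complex) \<Rightarrow> (uq, 'w) module \<Rightarrow> ('w \<times> complex \<Rightarrow>\<^sub>0 int) set"
  where "tensor_relators \<phi> N =
    {frag_of (x \<oplus>\<^bsub>N\<^esub> y, c) - frag_of (x, c) - frag_of (y, c) | x y c.
       x \<in> carrier N \<and> y \<in> carrier N} \<union>
    {frag_of (x, c + d) - frag_of (x, c) - frag_of (x, d) | x c d. x \<in> carrier N} \<union>
    {frag_of (uq_scalar a \<odot>\<^bsub>N\<^esub> x, c) - frag_of (x, \<phi> a * c) | a x c.
       a \<in> laurent \<and> x \<in> carrier N}"

definition tensor_subgroup :: "(qfield \<Rightarrow> complex) \<Rightarrow> (uq, 'w) module \<Rightarrow> ('w \<times> complex \<Rightarrow>\<^sub>0 int) set"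
  where "tensor_subgroup \<phi> N =
    generate (free_Abelian_group (carrier N \<times> UNIV)) (tensor_relators \<phi> N)"

text \<open>The biadditive extension of \<open>(u \<otimes> c, x \<otimes> d) \<mapsto> u x \<otimes> c d\<close>.\<close>

definition tensor_act :: "('a \<Rightarrow> 'b \<Rightarrow> 'b) \<Rightarrow>
    ('a \<times> complex \<Rightarrow>\<^sub>0 int) \<Rightarrow> ('b \<times> complex \<Rightarrow>\<^sub>0 int) \<Rightarrow> ('b \<times> complex \<Rightarrow>\<^sub>0 int)" where
  "tensor_act act f g =
    frag_extend (\<lambda>(u, c). frag_extend (\<lambda>(x, d). frag_of (act u x, c * d)) g) f"

definition U_A_regular :: "(uq, uq) module" where
  "U_A_regular =
    \<lparr>carrier = U_A, mult = (*), one = 1, zero = 0, add = (+), smult = (*)\<rparr>"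

definition U_A_free :: "(uq \<times> complex \<Rightarrow>\<^sub>0 int) ring" where
  "U_A_free = \<lparr>carrier = carrier (free_Abelian_group (U_A \<times> UNIV)),
     mult = tensor_act (*), one = frag_of (1, 1), zero = 0, add = (+)\<rparr>"

type_synonym u_zeta = "(uq \<times> complex \<Rightarrow>\<^sub>0 int) set"

definition U_zeta :: "(qfield \<Rightarrow> complex) \<Rightarrow> u_zeta ring" where
  "U_zeta \<phi> = U_A_free Quot tensor_subgroup \<phi> U_A_regular"

definition pure_tensor :: "(qfield \<Rightarrow> complex) \<Rightarrow> uq \<Rightarrow> complex \<Rightarrow> u_zeta" where
  "pure_tensor \<phi> u c = tensor_subgroup \<phi> U_A_regular +>\<^bsub>U_A_free\<^esub> frag_of (u, c)"

definition antipode_zeta :: "(qfield \<Rightarrow> complex) \<Rightarrow> u_zeta \<Rightarrow> u_zeta" where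
  "antipode_zeta \<phi> X = (\<Union>f\<in>X. tensor_subgroup \<phi> U_A_regular +>\<^bsub>U_A_free\<^esub>
     frag_extend (\<lambda>(u, c). frag_of (antipode u, c)) f)"

definition base_change :: "(qfield \<Rightarrow> complex) \<Rightarrow> (uq, 'w) module \<Rightarrow>
    (u_zeta, ('w \<times> complex \<Rightarrow>\<^sub>0 int) set) module" where
  "base_change \<phi> N =
    (let G = free_Abelian_group (carrier N \<times> UNIV); H = tensor_subgroup \<phi> N in
      \<lparr>carrier = rcosets\<^bsub>G\<^esub> H, mult = (\<lambda>X Y. H), one = H, zero = H, add = set_mult G,
       smult = (\<lambda>X Y. \<Union>f\<in>X. \<Union>g\<in>Y. H #>\<^bsub>G\<^esub> tensor_act (smult N) f g)\<rparr>)"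


section \<open>Weight modules over \<open>U\<^sub>\<zeta>\<close>\<close>

text \<open>The complex vector space underlying a module over \<open>U\<^sub>\<zeta>\<close>.\<close>

definition cspace :: "(qfield \<Rightarrow> complex) \<Rightarrow> (u_zeta, 'v) module \<Rightarrow> (complex, 'v) module" where
  "cspace \<phi> M =
    \<lparr>carrier = carrier M, mult = mult M, one = one M, zero = zero M, add = add M,
     smult = (\<lambda>c x. pure_tensor \<phi> 1 c \<odot>\<^bsub>M\<^esub> x)\<rparr>"

text \<open>The action of \<open>K\<close> alone does not determine an integral weight when \<open>\<zeta>\<close> is a root of unity;
  on the weight space of weight \<open>t\<close>, the elements \<open>K\<close> and \<open>[K; 0; r]\<close> of the Cartan part act by
  the values of \<open>q\<^sup>t\<close> and of the quantum binomial coefficients at \<open>\<zeta>\<close>. Type 1 means that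
  \<open>K\<close> acts by \<open>\<zeta>\<^sup>t\<close> and not by \<open>- \<zeta>\<^sup>t\<close>.\<close>

definition weight_space :: "(qfield \<Rightarrow> complex) \<Rightarrow> (u_zeta, 'v) module \<Rightarrow> int \<Rightarrow> 'v set" where
  "weight_space \<phi> M t = {x \<in> carrier M.
     pure_tensor \<phi> U_K 1 \<odot>\<^bsub>M\<^esub> x = \<phi> (q_par powi t) \<odot>\<^bsub>cspace \<phi> M\<^esub> x \<and>
     (\<forall>r. pure_tensor \<phi> (K_binom r) 1 \<odot>\<^bsub>M\<^esub> x = \<phi> (q_binom t r) \<odot>\<^bsub>cspace \<phi> M\<^esub> x)}"

definition weight_dim :: "(qfield \<Rightarrow> complex) \<Rightarrow> (u_zeta, 'v) module \<Rightarrow> int \<Rightarrow> nat" where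
  "weight_dim \<phi> M t =
    vectorspace.dim class_ring ((cspace \<phi> M)\<lparr>carrier := weight_space \<phi> M t\<rparr>)"

text \<open>Weight spaces of distinct weights are independent, so that a module which is additively
  generated by its weight spaces is their direct sum.\<close>

definition weight_module :: "(qfield \<Rightarrow> complex) \<Rightarrow> (u_zeta, 'v) module \<Rightarrow> bool" where
  "weight_module \<phi> M \<longleftrightarrow> left_module (U_zeta \<phi>) M \<and> vectorspace.fin_dim class_ring (cspace \<phi> M) \<and>
     carrier M = generate (add_monoid M) (\<Union>t. weight_space \<phi> M t)"

definition highest_weight :: "(qfield \<Rightarrow> complex) \<Rightarrow> (u_zeta, 'v) module \<Rightarrow> int \<Rightarrow> bool" where
  "highest_weight \<phi> M m \<longleftrightarrow> weight_space \<phi> M m \<noteq> {\<zero>\<^bsub>M\<^esub>} \<and>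
     (\<forall>t. weight_space \<phi> M t \<noteq> {\<zero>\<^bsub>M\<^esub>} \<longrightarrow> t \<le> m)"


section \<open>Weyl modules, dual Weyl modules and tilting modules\<close>

definition highest_weight_vector :: "(uq, 'w) module \<Rightarrow> nat \<Rightarrow> 'w \<Rightarrow> bool" where
  "highest_weight_vector L m v \<longleftrightarrow> v \<in> carrier L \<and> v \<noteq> \<zero>\<^bsub>L\<^esub> \<and>
     U_E \<odot>\<^bsub>L\<^esub> v = \<zero>\<^bsub>L\<^esub> \<and> U_K \<odot>\<^bsub>L\<^esub> v = uq_scalar (q_par ^ m) \<odot>\<^bsub>L\<^esub> v"

definition weyl_lattice :: "(uq, 'w) module \<Rightarrow> 'w \<Rightarrow> (uq, 'w) module" where
  "weyl_lattice L v = L\<lparr>carrier := (\<lambda>u. u \<odot>\<^bsub>L\<^esub> v) ` U_A\<rparr>"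

text \<open>A simple module over \<open>U\<^sub>q\<close> is cyclic, hence isomorphic to a module whose elements are cosets
  in \<^typ>\<open>uq\<close>. So the type \<^typ>\<open>uq set\<close> below is no restriction on the simple module \<open>L\<close>.\<close>

definition is_weyl :: "(qfield \<Rightarrow> complex) \<Rightarrow> nat \<Rightarrow> (u_zeta, 'v) module \<Rightarrow> bool" where
  "is_weyl \<phi> m M \<longleftrightarrow> (\<exists>(L :: (uq, uq set) module) v.
     simple_module class_ring L \<and> highest_weight_vector L m v \<and>
     module_isomorphic (U_zeta \<phi>) M (base_change \<phi> (weyl_lattice L v)))"

definition complex_line :: "(complex, complex) module" where
  "complex_line = \<lparr>carrier = UNIV, mult = (*), one = 1, zero = 0, add = (+), smult = (*)\<rparr>"

definition dual_module :: "(qfield \<Rightarrow> complex) \<Rightarrow> (u_zeta, 'v) module \<Rightarrow> (u_zeta, 'v \<Rightarrow> complex) module"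
  where "dual_module \<phi> M =
    \<lparr>carrier = LinearCombinations.module_hom class_ring (cspace \<phi> M) complex_line \<inter>
       extensional (carrier M),
     mult = (\<lambda>f g. restrict (\<lambda>x. 0) (carrier M)),
     one = restrict (\<lambda>x. 0) (carrier M),
     zero = restrict (\<lambda>x. 0) (carrier M),
     add = (\<lambda>f g. restrict (\<lambda>x. f x + g x) (carrier M)),
     smult = (\<lambda>X f. restrict (\<lambda>x. f (antipode_zeta \<phi> X \<odot>\<^bsub>M\<^esub> x)) (carrier M))\<rparr>"

text \<open>For \<open>sl\<^sub>2\<close> every weight is conjugate to its negative, so the dual of the Weyl module of
  highest weight \<open>m\<close> again has highest weight \<open>m\<close>.\<close>

definition is_dual_weyl :: "(qfield \<Rightarrow> complex) \<Rightarrow> nat \<Rightarrow> (u_zeta, 'v) module \<Rightarrow> bool" where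
  "is_dual_weyl \<phi> m M \<longleftrightarrow> (\<exists>(L :: (uq, uq set) module) v.
     simple_module class_ring L \<and> highest_weight_vector L m v \<and>
     module_isomorphic (U_zeta \<phi>) M (dual_module \<phi> (base_change \<phi> (weyl_lattice L v))))"

definition tilting :: "(qfield \<Rightarrow> complex) \<Rightarrow> (u_zeta, 'v) module \<Rightarrow> bool" where
  "tilting \<phi> M \<longleftrightarrow> weight_module \<phi> M \<and>
     filtration_by (U_zeta \<phi>) (\<lambda>D. \<exists>k. is_weyl \<phi> k D) M \<and>
     filtration_by (U_zeta \<phi>) (\<lambda>D. \<exists>k. is_dual_weyl \<phi> k D) M"

definition indecomposable_tilting :: "(qfield \<Rightarrow> complex) \<Rightarrow> nat \<Rightarrow> (u_zeta, 'v) module \<Rightarrow> bool" where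
  "indecomposable_tilting \<phi> m T \<longleftrightarrow>
     tilting \<phi> T \<and> indecomposable (U_zeta \<phi>) T \<and> highest_weight \<phi> T (int m)"

end

theory Submission
  imports Defs "HOL-Library.Function_Algebras"
begin

text \<open>Let \<open>v \<noteq> 0\<close> have weight \<open>m\<close> and let \<open>\<nu>\<close> be a linear functional with \<open>\<nu> v = 1\<close>. In case (1)
  the scalars \<open>\<nu> (E\<^sup>(\<^sup>k\<^sup>) F\<^sup>(\<^sup>k\<^sup>) v)\<close>, quantum binomial coefficients of \<open>m\<close> over \<open>k\<close>, are all nonzero. So
  the submodule generated by \<open>v\<close> and the common kernel of the functionals \<open>\<nu> \<circ> E\<^sup>(\<^sup>k\<^sup>)\<close> are complementary
  submodules, and by indecomposability the \<open>F\<^sup>(\<^sup>k\<^sup>) v\<close> form a basis.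

  In case (2) some of these scalars vanish. The dual Weyl filtration makes \<open>E\<close> surjective onto
  the weight space of weight \<open>m - 2 b\<close>, and the Weyl filtration makes \<open>F\<close> injective on it. This yields a
  vector \<open>u\<close> with \<open>E u = F\<^sup>(\<^sup>b\<^sup>) v\<close> and a functional \<open>\<mu>\<close> with \<open>\<mu> \<circ> F = \<nu> \<circ> E\<^sup>(\<^sup>b\<^sup>)\<close>. The vectors \<open>F\<^sup>(\<^sup>k\<^sup>) v\<close> and
  \<open>F\<^sup>(\<^sup>k\<^sup>-\<^sup>b\<^sup>-\<^sup>1\<^sup>) u\<close> are paired with the functionals \<open>\<nu> \<circ> E\<^sup>(\<^sup>k\<^sup>)\<close> and \<open>\<mu> \<circ> E\<^sup>(\<^sup>k\<^sup>-\<^sup>b\<^sup>-\<^sup>1\<^sup>)\<close>, and the argument of case (1)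
  applies to the submodule generated by \<open>u\<close> and \<open>v\<close>.\<close>

section \<open>Quantum binomial coefficients at roots of unity\<close>

text \<open>The vector \<open>u\<close> cannot be found in the submodule generated by
  \<open>v\<close>: there the weight space of weight m - 2 (b + 1) is spanned by F^(b+1) v, and E
  F^(b+1) v is [m - b] = [a l] = 0 times F^(b) v. The weight of \<open>u\<close> is the mirror image
  of m in the wall a l - 1, and \<open>\<mu>\<close> is the dual construction. Both filtrations are
  exploited in the single weight m - 2 b: a factor has highest weight at most m, so this weight sits
  at an index j <= b of the factor, where the matrix entry of E or F is, up to a unit, [j + 1],
  nonzero because j + 1 < l. The obstacle is that one entry of the 2 by 2 pairing,
  \<open>\<mu>\<close> against \<open>u\<close>, is unknown. The determinant is visible only where
  the opposite entry vanishes, and the remaining k are reduced to such ones. This is done for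
  nonnegative weights, where k < a l; the negative weights follow by symmetry. All nonvanishing
  statements about binomial coefficients compare quotients and remainders modulo l, by the quantum
  Lucas theorem.\<close>

fun gauss_binom :: "'a::comm_ring_1 \<Rightarrow> nat \<Rightarrow> nat \<Rightarrow> 'a" where
  "gauss_binom Q n 0 = 1"
| "gauss_binom Q 0 (Suc k) = 0"
| "gauss_binom Q (Suc n) (Suc k) = Q ^ Suc k * gauss_binom Q n (Suc k) + gauss_binom Q n k"

lemma gauss_binom_eq_0: "n < k \<Longrightarrow> gauss_binom Q n k = 0"
  by (induction Q n k rule: gauss_binom.induct) auto

lemma gauss_binom_self [simp]: "gauss_binom Q n n = 1"
  by (induction n) (auto simp: gauss_binom_eq_0)

text \<open>The product formula cleared of denominators. It holds in every commutative ring, so it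
  can be used at a root of unity, where 1 - Q^(k+1) may vanish.\<close>

lemma gauss_binom_absorb:
  "(1 - Q ^ Suc k) * gauss_binom Q (Suc n) (Suc k) = (1 - Q ^ Suc n) * gauss_binom Q n k"
proof (induction n arbitrary: k)
  case 0
  then show ?case by (cases k) auto
next
  case (Suc n)
  show ?case
  proof (cases k)
    case 0
    define Y where "Y = gauss_binom Q (Suc n) (Suc 0)"
    have Y: "(1 - Q) * Y = 1 - Q ^ Suc n" using Suc.IH[of 0] by (simp add: Y_def)
    have "(1 - Q ^ Suc k) * gauss_binom Q (Suc (Suc n)) (Suc k) = (1 - Q) * (Q * Y + 1)"
      using 0 by (simp add: Y_def)
    also have "\<dots> = Q * ((1 - Q) * Y) + (1 - Q)" by (simp add: algebra_simps)
    finally show ?thesis unfolding Y using 0 by (simp add: algebra_simps)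
  next
    case (Suc j)
    have a: "gauss_binom Q n j = gauss_binom Q (Suc n) k - Q ^ k * gauss_binom Q n k"
      using Suc by simp
    have b: "(1 - Q ^ k) * gauss_binom Q (Suc n) k = (1 - Q ^ Suc n) * gauss_binom Q n j"
      using Suc.IH[of j] Suc by simp
    have c: "(1 - Q ^ Suc k) * gauss_binom Q (Suc n) (Suc k) = (1 - Q ^ Suc n) * gauss_binom Q n k"
      by (rule Suc.IH)
    have "(1 - Q ^ Suc k) * gauss_binom Q (Suc (Suc n)) (Suc k)
        = Q ^ Suc k * ((1 - Q ^ Suc k) * gauss_binom Q (Suc n) (Suc k))
          + (1 - Q ^ Suc k) * gauss_binom Q (Suc n) k"
      by (simp only: gauss_binom.simps) (simp add: algebra_simps)
    also have "\<dots> = Q * (Q ^ k * ((1 - Q ^ Suc n) * gauss_binom Q n k))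
        + (1 - Q ^ Suc k) * gauss_binom Q (Suc n) k"
      unfolding c by (simp add: algebra_simps)
    also have "Q ^ k * ((1 - Q ^ Suc n) * gauss_binom Q n k)
        = (1 - Q ^ Suc n) * gauss_binom Q (Suc n) k - (1 - Q ^ k) * gauss_binom Q (Suc n) k"
      unfolding b a by (simp add: algebra_simps del: gauss_binom.simps power_Suc)
    finally show ?thesis by (simp add: algebra_simps)
  qed
qed

locale q_order =
  fixes Q :: complex and l :: nat
  assumes l_pos: "0 < l" and Q_l: "Q ^ l = 1" and Q_less: "\<And>i. 0 < i \<Longrightarrow> i < l \<Longrightarrow> Q ^ i \<noteq> 1"
begin

lemma gauss_binom_small_nonzero: "k \<le> n \<Longrightarrow> n < l \<Longrightarrow> gauss_binom Q n k \<noteq> 0"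
proof (induction n arbitrary: k)
  case 0
  then show ?case by simp
next
  case (Suc n)
  show ?case
  proof (cases k)
    case (Suc j)
    have "(1 - Q ^ Suc n) * gauss_binom Q n j \<noteq> 0"
      using Suc Suc.prems Suc.IH[of j] Q_less[of "Suc n"] by (auto simp del: power_Suc)
    then show ?thesis using gauss_binom_absorb[of Q j n] Suc by auto
  qed simp
qed

text \<open>Absorption produces the factor 1 - Q^l = 0 on one side and the nonzero factor 1 - Q^k on
  the other.\<close>

lemma gauss_binom_order_zero: "0 < k \<Longrightarrow> k < l \<Longrightarrow> gauss_binom Q l k = 0"
proof -
  assume k: "0 < k" "k < l"
  obtain n j where "l = Suc n" "k = Suc j" using k by (metis gr0_conv_Suc less_trans)
  then have "(1 - Q ^ k) * gauss_binom Q l k = 0"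
    using gauss_binom_absorb[of Q j n] Q_l by simp
  then show ?thesis using Q_less[OF k] by simp
qed

text \<open>The quantum Lucas theorem, by induction along Pascal's rule. The power Q^k depends only
  on k mod l, and the four cases record whether the increments of n and of j = k - 1 carry into the
  quotient by l. When both carry, the rule becomes Pascal's rule for ordinary binomial
  coefficients.\<close>

lemma gauss_binom_lucas:
  "gauss_binom Q n k = of_nat (n div l choose (k div l)) * gauss_binom Q (n mod l) (k mod l)"
proof (induction n arbitrary: k)
  case 0
  show ?case
  proof (cases "k = 0")
    case False
    show ?thesis
    proof (cases "k < l")
      case True
      then show ?thesis using False by simp
    next
      case f: False
      then have "0 < k div l" using l_pos by (simp add: div_greater_zero_iff)
      then show ?thesis using False by (cases k) auto
    qed
  qed simp
next
  case (Suc n)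
  show ?case
  proof (cases k)
    case 0
    then show ?thesis by simp
  next
    case (Suc j)
    have Qmod: "Q ^ k = Q ^ (k mod l)"
      by (metis Q_l mult.commute mult_div_mod_eq power_add power_mult power_one mult_1)
    have rec: "gauss_binom Q (Suc n) k = Q ^ (k mod l) * gauss_binom Q n k + gauss_binom Q n j"
      using Suc Qmod by simp
    have modS: "Suc x mod l = (if Suc (x mod l) = l then 0 else Suc (x mod l))"
      and divS: "Suc x div l = (if Suc (x mod l) = l then Suc (x div l) else x div l)" for x
      using l_pos by (auto simp: mod_Suc div_Suc)
    define a b c d where "a = n div l" and "b = n mod l" and "c = j div l" and "d = j mod l"
    have b: "b < l" and d: "d < l" using l_pos by (auto simp: b_def d_def)
    have E: "gauss_binom Q n k = of_nat (a choose (k div l)) * gauss_binom Q b (k mod l)"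
      "gauss_binom Q n j = of_nat (a choose c) * gauss_binom Q b d"
      using Suc.IH by (auto simp: a_def b_def c_def d_def)
    consider "Suc d = l" "Suc b = l" | "Suc d = l" "Suc b < l" | "Suc d < l" "Suc b = l"
      | "Suc d < l" "Suc b < l" using b d by linarith
    then show ?thesis
    proof cases
      case 1
      have "b = d" using 1 by simp
      then have "gauss_binom Q b d = 1" by (simp add: gauss_binom_self)
      then show ?thesis using 1 unfolding rec E unfolding Suc
        by (simp add: modS divS flip: a_def b_def c_def d_def)
    next
      case 2
      then show ?thesis unfolding rec E unfolding Suc
        by (simp add: modS divS gauss_binom_eq_0 flip: a_def b_def c_def d_def)
    next
      \<comment> \<open>Here n + 1 is divisible by l but k is not. The right side vanishes because
        its Gaussian factor has top entry 0, and the left side is a multiple of the coefficient with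
        top entry l, which vanishes too.\<close>
      case 3
      have "gauss_binom Q (Suc b) (Suc d) = 0" using gauss_binom_order_zero[of "Suc d"] 3 by simp
      then have z: "Q ^ Suc d * gauss_binom Q b (Suc d) + gauss_binom Q b d = 0" by simp
      have "of_nat (a choose c) * (Q ^ Suc d * gauss_binom Q b (Suc d) + gauss_binom Q b d) = 0"
        unfolding z by simp
      then show ?thesis using 3 unfolding rec E unfolding Suc
        by (simp add: modS divS algebra_simps flip: a_def b_def c_def d_def)
    next
      case 4
      then show ?thesis unfolding rec E unfolding Suc
        by (simp add: modS divS algebra_simps flip: a_def b_def c_def d_def)
    qed
  qed
qed

text \<open>In characteristic zero the ordinary binomial factor of the Lucas formula vanishes only
  if k div l exceeds n div l, so no further digits have to be compared.\<close>

lemma gauss_binom_nonzero_iff: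
  "gauss_binom Q n k \<noteq> 0 \<longleftrightarrow> k div l \<le> n div l \<and> k mod l \<le> n mod l"
  using gauss_binom_small_nonzero[of "k mod l" "n mod l"] l_pos
  by (subst gauss_binom_lucas) (auto simp: gauss_binom_eq_0 binomial_eq_0_iff not_less intro: leI)

end

text \<open>\<open>\<beta> t r\<close> stands for the value at \<open>\<zeta>\<close> of the
  balanced quantum binomial coefficient with integer top entry t. It is described by Pascal's rule
  and not by a quotient, since the denominators may vanish at \<open>\<zeta>\<close>.\<close>

locale root_binom = q_order "\<zeta>\<^sup>2" l for \<zeta> :: complex and l :: nat +
  fixes \<beta> :: "int \<Rightarrow> nat \<Rightarrow> complex"
  assumes \<zeta>_nonzero: "\<zeta> \<noteq> 0"
    and binom_0_right [simp]: "\<beta> t 0 = 1"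
    and binom_0_left: "\<beta> 0 (Suc r) = 0"
    and binom_pascal:
      "\<beta> (t + 1) (Suc r) = \<zeta> ^ Suc r * \<beta> t (Suc r) + \<zeta> powi (int r - t) * \<beta> t r"
begin

text \<open>The balanced coefficient and the Gaussian one in \<open>\<zeta>\<^sup>2\<close> differ
  by a power of \<open>\<zeta>\<close>, so they vanish simultaneously.\<close>

lemma binom_conv_gauss:
  "\<beta> (int n) k = \<zeta> powi (- (int k * (int n - int k))) * gauss_binom (\<zeta>\<^sup>2) n k"
proof (induction n arbitrary: k)
  case 0
  then show ?case by (cases k) (auto simp: binom_0_left)
next
  case (Suc n)
  show ?case
  proof (cases k)
    case (Suc r)
    have c: "\<zeta> ^ Suc r = \<zeta> powi (int r + 1)"
      by (metis of_nat_Suc power_int_of_nat add.commute)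
    have c2: "(\<zeta>\<^sup>2) ^ Suc r = \<zeta> powi (2 * (int r + 1))"
      using c by (metis power_mult power_int_mult power_int_numeral mult.commute)
    have "\<beta> (int (Suc n)) k = \<zeta> powi (int r + 1) * \<beta> (int n) (Suc r) + \<zeta> powi (int r - int n) * \<beta> (int n) r"
      using binom_pascal[of "int n" r] c by (simp add: Suc add.commute)
    also have "\<dots> = (\<zeta> powi (int r + 1) * \<zeta> powi (- (int (Suc r) * (int n - int (Suc r))))) * gauss_binom (\<zeta>\<^sup>2) n (Suc r)
       + (\<zeta> powi (int r - int n) * \<zeta> powi (- (int r * (int n - int r)))) * gauss_binom (\<zeta>\<^sup>2) n r"
      unfolding Suc.IH by (simp only: mult.assoc)
    also have "\<zeta> powi (int r + 1) * \<zeta> powi (- (int (Suc r) * (int n - int (Suc r))))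
       = \<zeta> powi (- (int k * (int (Suc n) - int k))) * \<zeta> powi (2 * (int r + 1))"
      using \<zeta>_nonzero unfolding Suc by (simp add: algebra_simps flip: power_int_add)
    also have "\<zeta> powi (int r - int n) * \<zeta> powi (- (int r * (int n - int r)))
       = \<zeta> powi (- (int k * (int (Suc n) - int k)))"
      using \<zeta>_nonzero unfolding Suc by (simp add: algebra_simps flip: power_int_add)
    finally show ?thesis unfolding Suc gauss_binom.simps c2 by (simp add: algebra_simps)
  qed simp
qed

lemma binom_nonzero_iff:
  "\<beta> (int n) k \<noteq> 0 \<longleftrightarrow> k div l \<le> n div l \<and> k mod l \<le> n mod l"
  unfolding binom_conv_gauss using gauss_binom_nonzero_iff[of n k] \<zeta>_nonzero by simp

lemma binom_self: "\<beta> (int n) n = 1"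
  by (simp add: binom_conv_gauss)

end

section \<open>Graded modules over divided powers\<close>

lemmas vs_linear_0 = Modules.module_hom.zero[OF Vector_Spaces.module_hom_linearI]
  and vs_linear_add = Modules.module_hom.add[OF Vector_Spaces.module_hom_linearI]
  and vs_linear_diff = Modules.module_hom.diff[OF Vector_Spaces.module_hom_linearI]
  and vs_linear_scale = Modules.module_hom.scale[OF Vector_Spaces.module_hom_linearI]
  and vs_linear_sum = Modules.module_hom.sum[OF Vector_Spaces.module_hom_linearI]

text \<open>A weight module in coordinates, with \<open>e k\<close> and \<open>f k\<close> the
  divided powers. In \<open>e_f\<close> and \<open>f_e\<close> the Cartan factor between the divided
  powers has already been evaluated on a vector of weight t; the second relation is the first with t
  replaced by - t. The relations are required on the \<open>V t\<close> only, because the ambient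
  type may be larger than the module.\<close>

locale divided_power_module = root_binom \<zeta> l \<beta> + vector_space scale
  for \<zeta> :: complex and l :: nat and \<beta> :: "int \<Rightarrow> nat \<Rightarrow> complex"
    and scale :: "complex \<Rightarrow> 'w \<Rightarrow> 'w::ab_group_add" (infixr "*s" 75) +
  fixes V :: "int \<Rightarrow> 'w set" and e f :: "nat \<Rightarrow> 'w \<Rightarrow> 'w" and m :: nat
  assumes subspace_V: "subspace (V t)"
    and linear_e: "Vector_Spaces.linear scale scale (e k)"
    and linear_f: "Vector_Spaces.linear scale scale (f k)"
    and e_in: "x \<in> V t \<Longrightarrow> e k x \<in> V (t + 2 * int k)"
    and f_in: "x \<in> V t \<Longrightarrow> f k x \<in> V (t - 2 * int k)"
    and e_0: "x \<in> V t \<Longrightarrow> e 0 x = x"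
    and f_0: "x \<in> V t \<Longrightarrow> f 0 x = x"
    and e_e: "x \<in> V t \<Longrightarrow> e j (e k x) = \<beta> (int (j + k)) j *s e (j + k) x"
    and f_f: "x \<in> V t \<Longrightarrow> f j (f k x) = \<beta> (int (j + k)) j *s f (j + k) x"
    and e_f: "x \<in> V t \<Longrightarrow> e j (f k x) =
      (\<Sum>i\<le>min j k. \<beta> (t + int j - int k) i *s f (k - i) (e (j - i) x))"
    and f_e: "x \<in> V t \<Longrightarrow> f j (e k x) =
      (\<Sum>i\<le>min j k. \<beta> (- t + int j - int k) i *s e (k - i) (f (j - i) x))"
    and V_above: "int m < t \<Longrightarrow> V t = {0}"
    and V_bounded_below: "\<exists>B. \<forall>t<B. V t = {0}"
    and V_top: "V (int m) \<noteq> {0}"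
begin

lemma e_0_right [simp]: "e k 0 = 0" and f_0_right [simp]: "f k 0 = 0"
  by (rule vs_linear_0[OF linear_e], rule vs_linear_0[OF linear_f])

lemmas e_scale = vs_linear_scale[OF linear_e] and f_scale = vs_linear_scale[OF linear_f]
lemmas e_plus = vs_linear_add[OF linear_e] and f_plus = vs_linear_add[OF linear_f]
lemmas V_0 = subspace_0[OF subspace_V]

text \<open>A submodule is given by the family of its weight spaces, so intersections and sums can
  be formed weight by weight.\<close>

definition graded_submodule :: "(int \<Rightarrow> 'w set) \<Rightarrow> bool" where
  "graded_submodule N \<longleftrightarrow> (\<forall>t. subspace (N t) \<and> N t \<subseteq> V t \<and>
     (\<forall>x\<in>N t. \<forall>k. e k x \<in> N (t + 2 * int k) \<and> f k x \<in> N (t - 2 * int k)))"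

lemma graded_submoduleD:
  assumes "graded_submodule N"
  shows "subspace (N t)" "N t \<subseteq> V t" "x \<in> N t \<Longrightarrow> e k x \<in> N (t + 2 * int k)"
    "x \<in> N t \<Longrightarrow> f k x \<in> N (t - 2 * int k)"
  using assms by (auto simp: graded_submodule_def)

lemma graded_submodule_V: "graded_submodule V"
  using subspace_V e_in f_in by (auto simp: graded_submodule_def)

lemma graded_submodule_0: "graded_submodule (\<lambda>t. {0})"
  using V_0 by (auto simp: graded_submodule_def subspace_0)

lemma graded_submodule_Int:
  "graded_submodule M \<Longrightarrow> graded_submodule N \<Longrightarrow> graded_submodule (\<lambda>t. M t \<inter> N t)"
  by (auto simp: graded_submodule_def subspace_inter)

lemma graded_submodule_sum:
  assumes "graded_submodule M" "graded_submodule N"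
  shows "graded_submodule (\<lambda>t. {x + y | x y. x \<in> M t \<and> y \<in> N t})"
  unfolding graded_submodule_def
proof (intro allI conjI ballI)
  fix t
  show "subspace {x + y | x y. x \<in> M t \<and> y \<in> N t}"
    using assms by (intro subspace_sums graded_submoduleD)
  show "{x + y | x y. x \<in> M t \<and> y \<in> N t} \<subseteq> V t"
    using graded_submoduleD(2)[OF assms(1)] graded_submoduleD(2)[OF assms(2)]
      subspace_add[OF subspace_V] by blast
  fix x k assume "x \<in> {x + y | x y. x \<in> M t \<and> y \<in> N t}"
  then obtain y z where yz: "x = y + z" "y \<in> M t" "z \<in> N t" by blast
  show "e k x \<in> {x + y | x y. x \<in> M (t + 2 * int k) \<and> y \<in> N (t + 2 * int k)}"
    unfolding yz(1) e_plus
    using yz graded_submoduleD(3)[OF assms(1)] graded_submoduleD(3)[OF assms(2)] by blast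
  show "f k x \<in> {x + y | x y. x \<in> M (t - 2 * int k) \<and> y \<in> N (t - 2 * int k)}"
    unfolding yz(1) f_plus
    using yz graded_submoduleD(4)[OF assms(1)] graded_submoduleD(4)[OF assms(2)] by blast
qed

text \<open>On a lowest weight vector of weight \<open>- p\<close> the operator \<open>f p \<circ> e p\<close> is the identity, so the
  negative weights of a module are controlled by the positive ones.\<close>

lemma graded_submodule_low_weights:
  assumes M: "graded_submodule M" and M': "graded_submodule M'"
    and n: "- 1 \<le> n" and high: "\<And>t. n < t \<Longrightarrow> M' t \<subseteq> M t" and t: "t < - n"
  shows "M' t \<subseteq> M t"
proof -
  obtain B where B: "\<And>t. t < B \<Longrightarrow> V t = {0}" using V_bounded_below by blast
  \<comment> \<open>Induction on the distance of t from a lower bound B of the weights: all weights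
    below t are already settled.\<close>
  have "\<forall>t. t < - n \<longrightarrow> nat (t - B) < N \<longrightarrow> M' t \<subseteq> M t" for N
  proof (induction N)
    case (Suc N)
    show ?case
    proof (intro allI impI subsetI)
      fix t x assume t: "t < - n" "nat (t - B) < Suc N" and x: "x \<in> M' t"
      define p where "p = nat (- t)"
      have p: "int p = - t" using t n by (simp add: p_def)
      have xV: "x \<in> V t" using x graded_submoduleD(2)[OF M'] by blast
      have fM: "f r x \<in> M (t - 2 * int r)" if "r > 0" for r
      proof (cases "t - 2 * int r < B")
        case True
        then have "f r x = 0" using f_in[OF xV, of r] B by auto
        then show ?thesis using subspace_0[OF graded_submoduleD(1)[OF M]] by simp
      next
        case False
        then have "M' (t - 2 * int r) \<subseteq> M (t - 2 * int r)"
          using Suc.IH t that by auto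
        then show ?thesis using graded_submoduleD(4)[OF M' x] by blast
      qed
      have "e p x \<in> M' (int p)" using graded_submoduleD(3)[OF M' x, of p] p by (simp add: algebra_simps)
      then have "e p x \<in> M (int p)" using high[of "int p"] t p by (auto simp: subset_iff)
      from graded_submoduleD(4)[OF M this, of p]
      have fe: "f p (e p x) \<in> M t" using p by simp
      \<comment> \<open>Modulo \<open>M\<close> only the term i = p remains, and it equals x. Every
        other term passes through \<open>f (p - i) x\<close>, a vector of lower weight, which is in
        \<open>M\<close> by induction. The left side is in \<open>M\<close> because
        \<open>e p x\<close> has weight p > n.\<close>
      have "f p (e p x) = (\<Sum>i\<le>p. \<beta> (int p) i *s e (p - i) (f (p - i) x))"
        using f_e[OF xV, of p p] p by simp
      also have "\<dots> = (\<Sum>i<p. \<beta> (int p) i *s e (p - i) (f (p - i) x)) + x"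
        using xV by (simp add: lessThan_Suc_atMost[symmetric] binom_self f_0 e_0)
      finally have xeq: "x = f p (e p x) - (\<Sum>i<p. \<beta> (int p) i *s e (p - i) (f (p - i) x))"
        by simp
      have "(\<Sum>i<p. \<beta> (int p) i *s e (p - i) (f (p - i) x)) \<in> M t"
      proof (intro subspace_sum[OF graded_submoduleD(1)[OF M]] subspace_scale[OF graded_submoduleD(1)[OF M]])
        fix i assume "i \<in> {..<p}"
        then show "e (p - i) (f (p - i) x) \<in> M t"
          using graded_submoduleD(3)[OF M fM[of "p - i"], of "p - i"] by simp
      qed
      from subspace_diff[OF graded_submoduleD(1)[OF M] fe this] show "x \<in> M t"
        by (subst xeq)
    qed
  qed simp
  then show ?thesis using t by blast
qed

lemma V_below:
  assumes "t < - int m"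
  shows "V t = {0}"
  using graded_submodule_low_weights[OF graded_submodule_0 graded_submodule_V _ _ assms] V_above V_0
  by force

lemma ex_top_functional:
  "\<exists>v \<nu>. v \<in> V (int m) \<and> v \<noteq> 0 \<and> Vector_Spaces.linear scale (*) \<nu> \<and> \<nu> v = 1"
proof -
  obtain v where v: "v \<in> V (int m)" "v \<noteq> 0" using V_top V_0 by blast
  interpret vector_space_pair scale "(*) :: complex \<Rightarrow> complex \<Rightarrow> complex"
    by unfold_locales (auto simp: algebra_simps)
  have "independent {v}" using v by simp
  from linear_independent_extend[OF this, of "\<lambda>x. 1"] show ?thesis using v by auto
qed

end

section \<open>A top weight vector, its cyclic submodule and the annihilator of a functional\<close>

locale top_functional = divided_power_module \<zeta> l \<beta> scale V e f m
  for \<zeta> :: complex and l :: nat and \<beta> :: "int \<Rightarrow> nat \<Rightarrow> complex"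
    and scale :: "complex \<Rightarrow> 'w \<Rightarrow> 'w::ab_group_add" (infixr "*s" 75)
    and V :: "int \<Rightarrow> 'w set" and e f :: "nat \<Rightarrow> 'w \<Rightarrow> 'w" and m :: nat +
  fixes v :: 'w and \<nu> :: "'w \<Rightarrow> complex"
  assumes v_in: "v \<in> V (int m)" and linear_\<nu>: "Vector_Spaces.linear scale (*) \<nu>" and \<nu>_v: "\<nu> v = 1"
begin

lemma functional_simps:
  assumes "Vector_Spaces.linear scale (*) \<mu>"
  shows "\<mu> 0 = 0" "\<mu> (x + y) = \<mu> x + \<mu> y" "\<mu> (x - y) = \<mu> x - \<mu> y" "\<mu> (c *s x) = c * \<mu> x"
    "\<mu> (sum g A) = (\<Sum>a\<in>A. \<mu> (g a))"
  using vs_linear_0[OF assms] vs_linear_add[OF assms] vs_linear_diff[OF assms] vs_linear_scale[OF assms]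
    vs_linear_sum[OF assms] by auto

lemmas \<nu>_simps = functional_simps[OF linear_\<nu>]

lemma f_v_in: "f k v \<in> V (int m - 2 * int k)"
  using f_in[OF v_in] .

lemma f_v_0: "m < k \<Longrightarrow> f k v = 0"
  using f_v_in[of k] V_below by auto

text \<open>Since \<open>e r v\<close> lies above the top weight for r > 0, only the term i = k of
  the commutation formula can be nonzero.\<close>

lemma e_f_v: "k \<le> j \<Longrightarrow> e k (f j v) = \<beta> (int m + int k - int j) k *s f (j - k) v"
  and e_f_v_0: "j < k \<Longrightarrow> e k (f j v) = 0"
proof -
  have z: "e r v = 0" if "r > 0" for r using e_in[OF v_in, of r] V_above that by auto
  have *: "e k (f j v) = (\<Sum>i\<le>min k j. \<beta> (int m + int k - int j) i *s f (j - i) (e (k - i) v))"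
    by (rule e_f[OF v_in])
  show "e k (f j v) = 0" if "j < k"
    unfolding * using that by (intro sum.neutral) (auto simp: z)
  show "e k (f j v) = \<beta> (int m + int k - int j) k *s f (j - k) v" if "k \<le> j"
  proof -
    have "(\<Sum>i\<le>min k j. \<beta> (int m + int k - int j) i *s f (j - i) (e (k - i) v))
        = (\<Sum>i\<in>{k}. \<beta> (int m + int k - int j) i *s f (j - i) (e (k - i) v))"
      using that by (intro sum.mono_neutral_right) (auto simp: z)
    then show ?thesis using * by (simp add: e_0[OF v_in])
  qed
qed

lemma \<nu>_e_f_v: "\<nu> (e k (f k v)) = \<beta> (int m) k"
  using e_f_v[of k k] f_0[OF v_in] by (simp add: \<nu>_simps \<nu>_v)

text \<open>The transpose of \<open>e_f_v\<close>. The target has weight m, so a term with i < j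
  would apply \<open>f (j - i)\<close> to a vector of weight above m and is zero.\<close>

lemma \<nu>_e_f:
  assumes "x \<in> V t" "t - 2 * int j + 2 * int k = int m"
  shows "\<nu> (e k (f j x)) = (if j \<le> k then \<beta> (t + int k - int j) j * \<nu> (e (k - j) x) else 0)"
proof -
  have z: "f (j - i) (e (k - i) x) = 0" if "i < j" "i \<le> k" for i
  proof -
    have "e (k - i) x \<in> V (t + 2 * int (k - i))" using e_in[OF assms(1)] .
    moreover have "int m < t + 2 * int (k - i)" using that assms(2) by auto
    ultimately show ?thesis using V_above by auto
  qed
  have *: "e k (f j x) = (\<Sum>i\<le>min k j. \<beta> (t + int k - int j) i *s f (j - i) (e (k - i) x))"
    by (rule e_f[OF assms(1)])
  show ?thesis
  proof (cases "j \<le> k")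
    case True
    have "(\<Sum>i\<le>min k j. \<beta> (t + int k - int j) i *s f (j - i) (e (k - i) x))
        = (\<Sum>i\<in>{j}. \<beta> (t + int k - int j) i *s f (j - i) (e (k - i) x))"
      using True by (intro sum.mono_neutral_right) (auto simp: z)
    then show ?thesis using True * f_0[OF e_in[OF assms(1)]] by (simp add: \<nu>_simps)
  next
    case False
    then have "(\<Sum>i\<le>min k j. \<beta> (t + int k - int j) i *s f (j - i) (e (k - i) x)) = 0"
      by (intro sum.neutral) (auto simp: z)
    then show ?thesis using False * by (simp add: \<nu>_simps)
  qed
qed

text \<open>For a given t at most one k satisfies the condition. In weights that are not of the form
  m - 2 k nothing is required, and the annihilator is the whole weight space.\<close>

definition annihilator :: "int \<Rightarrow> 'w set" where
  "annihilator t = {x \<in> V t. \<forall>k. t + 2 * int k = int m \<longrightarrow> \<nu> (e k x) = 0}"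

lemma graded_submodule_annihilator: "graded_submodule annihilator"
  unfolding graded_submodule_def
proof (intro allI conjI ballI)
  fix t
  show "subspace (annihilator t)"
    unfolding subspace_def annihilator_def using subspace_V[of t]
    by (auto simp: subspace_def e_plus e_scale \<nu>_simps)
  show "annihilator t \<subseteq> V t" by (auto simp: annihilator_def)
  fix x k assume "x \<in> annihilator t"
  then have x: "x \<in> V t" and an: "\<And>k. t + 2 * int k = int m \<Longrightarrow> \<nu> (e k x) = 0"
    by (auto simp: annihilator_def)
  show "e k x \<in> annihilator (t + 2 * int k)"
    using e_in[OF x] by (auto simp: annihilator_def e_e[OF x] \<nu>_simps intro!: an)
  show "f k x \<in> annihilator (t - 2 * int k)"
    using f_in[OF x] by (auto simp: annihilator_def \<nu>_e_f[OF x] intro!: an)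
qed

lemma annihilator_complement:
  assumes "\<beta> (int m) k \<noteq> 0" "x \<in> V (int m - 2 * int k)"
  shows "\<exists>c. x - c *s f k v \<in> annihilator (int m - 2 * int k)"
proof
  let ?c = "\<nu> (e k x) / \<beta> (int m) k"
  show "x - ?c *s f k v \<in> annihilator (int m - 2 * int k)"
    using assms(1) subspace_diff[OF subspace_V assms(2) subspace_scale[OF subspace_V f_v_in[of k]]]
    by (auto simp: annihilator_def \<nu>_simps e_scale vs_linear_diff[OF linear_e] \<nu>_e_f_v)
qed

lemma f_v_annihilator:
  assumes "\<beta> (int m) k \<noteq> 0" "c *s f k v \<in> annihilator (int m - 2 * int k)"
  shows "c = 0"
  using assms by (auto simp: annihilator_def e_scale \<nu>_simps \<nu>_e_f_v)

definition cyclic_part :: "int \<Rightarrow> 'w set" where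
  "cyclic_part t = span {f k v | k. int m - 2 * int k = t}"

lemma f_v_cyclic_part: "int m - 2 * int k = t \<Longrightarrow> f k v \<in> cyclic_part t"
  unfolding cyclic_part_def by (rule span_base) auto

lemma subspace_cyclic_part: "subspace (cyclic_part t)"
  by (simp add: cyclic_part_def)

lemma cyclic_part_iff: "x \<in> cyclic_part (int m - 2 * int k) \<longleftrightarrow> (\<exists>c. x = c *s f k v)"
proof -
  have "{f j v | j. int m - 2 * int j = int m - 2 * int k} = {f k v}" by auto
  then show ?thesis by (auto simp: cyclic_part_def span_singleton)
qed

lemma cyclic_part_other: "(\<And>k. int m - 2 * int k \<noteq> t) \<Longrightarrow> cyclic_part t = {0}"
  by (simp add: cyclic_part_def)

lemma graded_submodule_span:
  assumes "\<And>t x. x \<in> S t \<Longrightarrow> x \<in> V t"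
    and "\<And>t x k. x \<in> S t \<Longrightarrow> e k x \<in> span (S (t + 2 * int k))"
    and "\<And>t x k. x \<in> S t \<Longrightarrow> f k x \<in> span (S (t - 2 * int k))"
  shows "graded_submodule (\<lambda>t. span (S t))"
  unfolding graded_submodule_def
proof (intro allI conjI ballI)
  fix t
  show "subspace (span (S t))" by simp
  show "span (S t) \<subseteq> V t" using assms(1) by (intro span_minimal subspace_V) auto
  fix x k assume x: "x \<in> span (S t)"
  show "e k x \<in> span (S (t + 2 * int k))"
    using x by (induction rule: span_induct_alt)
      (auto simp: e_plus e_scale intro!: span_add span_scale span_zero assms(2))
  show "f k x \<in> span (S (t - 2 * int k))"
    using x by (induction rule: span_induct_alt)
      (auto simp: f_plus f_scale intro!: span_add span_scale span_zero assms(3))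
qed

lemma e_f_v_cyclic: "e j (f k v) \<in> cyclic_part (int m - 2 * int k + 2 * int j)"
  and f_f_v_cyclic: "f j (f k v) \<in> cyclic_part (int m - 2 * int k - 2 * int j)"
  using e_f_v[of j k] e_f_v_0[of k j] subspace_0[OF subspace_cyclic_part]
  by (cases "j \<le> k"; auto simp: f_f[OF v_in] intro!: subspace_scale subspace_cyclic_part f_v_cyclic_part)+

lemma graded_submodule_cyclic_part: "graded_submodule cyclic_part"
  unfolding cyclic_part_def
  using f_v_in e_f_v_cyclic f_f_v_cyclic unfolding cyclic_part_def
  by (intro graded_submodule_span) auto

end

section \<open>Case (1): a rank one pairing in every weight\<close>

context divided_power_module
begin

lemma weights_top_nonvanishing:
  assumes indec: "\<And>M N. graded_submodule M \<Longrightarrow> graded_submodule N \<Longrightarrow> (\<And>t. M t \<inter> N t = {0}) \<Longrightarrow>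
      (\<And>t. V t = {x + y | x y. x \<in> M t \<and> y \<in> N t}) \<Longrightarrow> (\<forall>t. M t = {0}) \<or> (\<forall>t. N t = {0})"
    and nz: "\<And>k. k \<le> m \<Longrightarrow> \<beta> (int m) k \<noteq> 0"
  shows "k \<le> m \<Longrightarrow> \<exists>x. x \<noteq> 0 \<and> V (int m - 2 * int k) = range (\<lambda>c. c *s x)"
    and "(\<And>k. k \<le> m \<Longrightarrow> t \<noteq> int m - 2 * int k) \<Longrightarrow> V t = {0}"
proof -
  obtain v \<nu> where v: "v \<in> V (int m)" "v \<noteq> 0" "Vector_Spaces.linear scale (*) \<nu>" "\<nu> v = 1"
    using ex_top_functional by blast
  interpret top_functional \<zeta> l \<beta> scale V e f m v \<nu>
    by (intro top_functional.intro top_functional_axioms.intro divided_power_module_axioms v)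
  have zero: "x = 0" if x: "x \<in> cyclic_part t" "x \<in> annihilator t" for x t
  proof (cases "\<exists>k. t = int m - 2 * int k")
    case True
    then obtain k where t: "t = int m - 2 * int k" by blast
    then obtain c where "x = c *s f k v" using x(1) cyclic_part_iff by blast
    note k = t this
    show ?thesis using k x f_v_annihilator[of k c] nz[of k] f_v_0[of k] by (cases "k \<le> m") auto
  next
    case False
    then show ?thesis using x cyclic_part_other[of t] by auto
  qed
  have decomp: "\<exists>y z. x = y + z \<and> y \<in> cyclic_part t \<and> z \<in> annihilator t" if x: "x \<in> V t" for x t
  proof (cases "\<exists>k\<le>m. t = int m - 2 * int k")
    case True
    then obtain k where k: "k \<le> m" "t = int m - 2 * int k" by blast
    then obtain c where "x - c *s f k v \<in> annihilator t"
      using annihilator_complement[OF nz[OF k(1)]] x by auto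
    moreover have "c *s f k v \<in> cyclic_part t" using k cyclic_part_iff by auto
    moreover have "x = c *s f k v + (x - c *s f k v)" by simp
    ultimately show ?thesis by blast
  next
    case False
    have "x \<in> annihilator t"
    proof (cases "\<exists>k. t = int m - 2 * int k")
      case True
      then obtain k where k: "t = int m - 2 * int k" by blast
      then have "m < k" using False by auto
      then have "t < - int m" using k by linarith
      then have "x = 0" using V_below x by auto
      then show ?thesis using subspace_0[OF graded_submoduleD(1)[OF graded_submodule_annihilator]] by simp
    next
      case False
      then show ?thesis using x by (auto simp: annihilator_def algebra_simps)
    qed
    then show ?thesis using subspace_0[OF subspace_cyclic_part] by (metis add_0)
  qed
  have "V t = {x + y | x y. x \<in> cyclic_part t \<and> y \<in> annihilator t}" for t
    using decomp[of _ t] graded_submoduleD(2)[OF graded_submodule_annihilator, of t]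
      graded_submoduleD(2)[OF graded_submodule_cyclic_part, of t] subspace_add[OF subspace_V] by blast
  moreover have "cyclic_part t \<inter> annihilator t = {0}" for t
    using zero subspace_0[OF subspace_cyclic_part]
      subspace_0[OF graded_submoduleD(1)[OF graded_submodule_annihilator]] by blast
  ultimately have "(\<forall>t. cyclic_part t = {0}) \<or> (\<forall>t. annihilator t = {0})"
    by (intro indec graded_submodule_cyclic_part graded_submodule_annihilator)
  \<comment> \<open>The cyclic part contains \<open>v \<noteq> 0\<close>, so of the two
    complementary submodules it is the annihilator that vanishes.\<close>
  moreover have "v \<in> cyclic_part (int m)" using f_v_cyclic_part[of 0] f_0[OF v(1)] by simp
  ultimately have an: "annihilator t = {0}" for t using v(2) by blast
  have V: "V t = cyclic_part t" for t
    using decomp[of _ t] graded_submoduleD(2)[OF graded_submodule_cyclic_part, of t] an by force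
  show "\<exists>x. x \<noteq> 0 \<and> V (int m - 2 * int k) = range (\<lambda>c. c *s x)" if "k \<le> m"
  proof (intro exI conjI)
    show "f k v \<noteq> 0" using \<nu>_e_f_v[of k] nz[OF that] \<nu>_simps(1) by auto
    show "V (int m - 2 * int k) = range (\<lambda>c. c *s f k v)"
      unfolding V image_def by (auto simp: cyclic_part_iff)
  qed
  show "V t = {0}" if "\<And>k. k \<le> m \<Longrightarrow> t \<noteq> int m - 2 * int k"
  proof (cases "\<exists>k. t = int m - 2 * int k")
    case True
    then obtain k where k: "t = int m - 2 * int k" by blast
    then have "m < k" using that[of k] by linarith
    then have "t < - int m" using k by linarith
    then show ?thesis by (rule V_below)
  next
    case False
    then show ?thesis using V cyclic_part_other[of t] by auto
  qed
qed

end

section \<open>Case (2): the linked weights m and m - 2 (b + 1)\<close>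

context root_binom
begin

lemma binom_nonzero: "x \<le> y \<Longrightarrow> c \<le> d \<Longrightarrow> d < l \<Longrightarrow> \<beta> (int (y * l + d)) (x * l + c) \<noteq> 0"
  and binom_zero: "d < c \<Longrightarrow> c < l \<Longrightarrow> \<beta> (int (y * l + d)) (x * l + c) = 0"
  using binom_nonzero_iff[of "y * l + d" "x * l + c"] by auto

text \<open>The remainder of c l - 1 modulo l is l - 1, which no remainder exceeds, and k < c l
  bounds the quotient of k by c - 1.\<close>

lemma binom_pred_nonzero:
  assumes "k < c * l"
  shows "\<beta> (int (c * l) - 1) k \<noteq> 0"
proof -
  obtain c' where c: "c = Suc c'" using assms by (cases c) auto
  have "int (c * l) - 1 = int (c' * l + (l - 1))" using l_pos c by (simp add: of_nat_diff)
  moreover have "k div l \<le> c'" using assms c l_pos by (simp add: less_Suc_eq_le[symmetric] less_mult_imp_div_less)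
  then have "\<beta> (int (c' * l + (l - 1))) ((k div l) * l + k mod l) \<noteq> 0"
    by (rule binom_nonzero) (use l_pos mod_less_divisor[OF l_pos, of k] in linarith)+
  ultimately show ?thesis by simp
qed

lemma binom_small_nonzero: "k \<le> n \<Longrightarrow> n < l \<Longrightarrow> \<beta> (int n) k \<noteq> 0"
  using binom_nonzero[of 0 0 k n] by simp

end

text \<open>\<open>\<mu>\<close> is prescribed only on the image of \<open>f 1\<close> from weight m
  - 2 b. The value of \<open>\<mu>\<close> on \<open>u\<close> itself is left open, so the argument
  must avoid it.\<close>

locale linked_weights = top_functional \<zeta> l \<beta> scale V e f m v \<nu>
  for \<zeta> :: complex and l :: nat and \<beta> :: "int \<Rightarrow> nat \<Rightarrow> complex"
    and scale :: "complex \<Rightarrow> 'w \<Rightarrow> 'w::ab_group_add" (infixr "*s" 75)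
    and V :: "int \<Rightarrow> 'w set" and e f :: "nat \<Rightarrow> 'w \<Rightarrow> 'w" and m :: nat
    and v :: 'w and \<nu> :: "'w \<Rightarrow> complex" +
  fixes a b :: nat and u :: 'w and \<mu> :: "'w \<Rightarrow> complex"
  assumes a: "1 \<le> a" and b: "Suc b < l" and m: "m = a * l + b"
    and u_in: "u \<in> V (int m - 2 * int (Suc b))" and e_1_u: "e 1 u = f b v"
    and linear_\<mu>: "Vector_Spaces.linear scale (*) \<mu>"
    and \<mu>_f_1: "y \<in> V (int m - 2 * int b) \<Longrightarrow> \<mu> (f 1 y) = \<nu> (e b y)"
begin

lemmas \<mu>_simps = functional_simps[OF linear_\<mu>]

lemma l_le: "l \<le> a * l"
  using a by simp

text \<open>Up to the coefficient of s over s - 1, nonzero since s < l, the operator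
  \<open>e s\<close> is \<open>e (s - 1)\<close> after \<open>e 1\<close>, and
  \<open>e 1 u = f b v\<close> reduces the claim to \<open>e_f_v\<close>. The coefficient arising
  there has top entry m + (s - 1) - b = a l + (s - 1), with the same remainder modulo l as its lower
  entry.\<close>

lemma e_u:
  assumes "1 \<le> s" "s \<le> Suc b"
  shows "\<exists>c. c \<noteq> 0 \<and> e s u = c *s f (Suc b - s) v"
proof -
  obtain r where s: "s = Suc r" using assms by (cases s) auto
  have r: "r \<le> b" using assms s by simp
  have "\<beta> (int s) r *s e s u = e r (e 1 u)"
    using e_e[OF u_in, of r 1] s by simp
  also have "\<dots> = \<beta> (int (a * l + r)) r *s f (b - r) v"
    using e_f_v[OF r] m r by (simp add: e_1_u[simplified])
  finally have *: "\<beta> (int s) r *s e s u = \<beta> (int (a * l + r)) r *s f (b - r) v" .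
  have nz: "\<beta> (int s) r \<noteq> 0" using b r s by (intro binom_small_nonzero) auto
  have nz2: "\<beta> (int (a * l + r)) r \<noteq> 0" using binom_nonzero[of 0 a r r] b r by simp
  have "e s u = (inverse (\<beta> (int s) r) * \<beta> (int (a * l + r)) r) *s f (b - r) v"
    using arg_cong[OF *, of "\<lambda>x. inverse (\<beta> (int s) r) *s x"] nz by simp
  then show ?thesis using nz nz2 s
    by (intro exI[of _ "inverse (\<beta> (int s) r) * \<beta> (int (a * l + r)) r"]) simp
qed

lemma e_u_0: "Suc b < s \<Longrightarrow> e s u = 0"
  using e_in[OF u_in, of s] V_above by auto

lemma f_u_in: "f j u \<in> V (int m - 2 * int (Suc b + j))"
  using f_in[OF u_in, of j] by (simp add: algebra_simps)

definition pair_part :: "int \<Rightarrow> 'w set" where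
  "pair_part t = span ({f k v | k. int m - 2 * int k = t} \<union>
     {f j u | j. int m - 2 * int (Suc b + j) = t})"

lemma cyclic_subset_pair: "cyclic_part t \<subseteq> pair_part t"
  unfolding cyclic_part_def pair_part_def by (rule span_mono) auto

lemma subspace_pair_part: "subspace (pair_part t)"
  by (simp add: pair_part_def)

lemma f_u_pair_part: "int m - 2 * int (Suc b + j) = t \<Longrightarrow> f j u \<in> pair_part t"
  unfolding pair_part_def by (rule span_base) auto

lemma f_e_u_pair_part:
  assumes "int m - 2 * int (Suc b + j) + 2 * int s = t"
  shows "f j (e s u) \<in> pair_part t"
proof -
  consider "s = 0" | "1 \<le> s" "s \<le> Suc b" | "Suc b < s" by linarith
  then show ?thesis
  proof cases
    case 1
    then show ?thesis using f_u_pair_part[of j t] assms e_0[OF u_in] by simp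
  next
    case 2
    obtain c where c: "e s u = c *s f (Suc b - s) v" using e_u[OF 2] by blast
    have "int m - 2 * int (Suc b - s) - 2 * int j = t" using assms 2 by (simp add: of_nat_diff)
    then have "f j (f (Suc b - s) v) \<in> pair_part t"
      using f_f_v_cyclic[of j "Suc b - s"] cyclic_subset_pair by auto
    then show ?thesis unfolding c f_scale using subspace_scale[OF subspace_pair_part] by blast
  next
    case 3
    then show ?thesis using e_u_0 subspace_0[OF subspace_pair_part] by simp
  qed
qed

lemma graded_submodule_pair_part: "graded_submodule pair_part"
  unfolding pair_part_def
proof (rule graded_submodule_span)
  let ?S = "\<lambda>t. {f k v | k. int m - 2 * int k = t} \<union> {f j u | j. int m - 2 * int (Suc b + j) = t}"
  fix t x k assume "x \<in> ?S t"
  then consider i where "x = f i v" "t = int m - 2 * int i"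
    | i where "x = f i u" "t = int m - 2 * int (Suc b + i)" by auto
  note cs = this
  show "x \<in> V t" using cs f_v_in f_u_in by cases auto
  show "e k x \<in> span (?S (t + 2 * int k))"
    using cs unfolding pair_part_def[symmetric]
  proof cases
    case (1 i)
    then show "e k x \<in> pair_part (t + 2 * int k)"
      using e_f_v_cyclic[of k i] cyclic_subset_pair by auto
  next
    case (2 i)
    show "e k x \<in> pair_part (t + 2 * int k)"
      unfolding 2(1) e_f[OF u_in]
      by (intro subspace_sum subspace_scale subspace_pair_part f_e_u_pair_part) (auto simp: 2 of_nat_diff)
  qed
  show "f k x \<in> span (?S (t - 2 * int k))"
    using cs unfolding pair_part_def[symmetric]
  proof cases
    case (1 i)
    then show "f k x \<in> pair_part (t - 2 * int k)"
      using f_f_v_cyclic[of k i] cyclic_subset_pair by auto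
  next
    case (2 i)
    then show "f k x \<in> pair_part (t - 2 * int k)"
      by (auto simp: f_f[OF u_in] intro!: subspace_scale subspace_pair_part f_u_pair_part)
  qed
qed

lemma pair_part_high:
  assumes "k \<le> b"
  shows "pair_part (int m - 2 * int k) = cyclic_part (int m - 2 * int k)"
proof -
  have "{f j u | j. int m - 2 * int (Suc b + j) = int m - 2 * int k} = {}" using assms by auto
  then show ?thesis by (simp only: pair_part_def cyclic_part_def Un_empty_right)
qed

lemma pair_part_other:
  assumes "\<And>k. int m - 2 * int k \<noteq> t"
  shows "pair_part t = {0}"
proof -
  have "{f j u | j. int m - 2 * int (Suc b + j) = t} = {}" using assms by blast
  then show ?thesis using cyclic_part_other[OF assms] by (simp add: pair_part_def cyclic_part_def)
qed

lemma pair_part_iff: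
  assumes "b < k"
  shows "x \<in> pair_part (int m - 2 * int k) \<longleftrightarrow> (\<exists>A B. x = A *s f k v + B *s f (k - Suc b) u)"
proof -
  have "{f j v | j. int m - 2 * int j = int m - 2 * int k} \<union>
     {f j u | j. int m - 2 * int (Suc b + j) = int m - 2 * int k} = {f k v, f (k - Suc b) u}"
    (is "?X = _")
  proof -
    have 1: "int m - 2 * int j = int m - 2 * int k \<longleftrightarrow> j = k"
      and 2: "int m - 2 * int (Suc b + j) = int m - 2 * int k \<longleftrightarrow> j = k - Suc b" for j
      using assms by auto
    show ?thesis using assms unfolding 1 2 by (auto intro!: exI[of _ "k - Suc b"])
  qed
  then have "pair_part (int m - 2 * int k) = span {f k v, f (k - Suc b) u}"
    by (simp only: pair_part_def)
  then show ?thesis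
    by (auto simp: span_insert span_singleton image_iff diff_eq_eq add.commute)
qed

text \<open>The transpose of \<open>e_u\<close>: up to a nonzero coefficient, \<open>f s\<close> is
  \<open>f 1\<close> after \<open>f (s - 1)\<close>, so \<open>\<mu>_f_1\<close> trades
  \<open>\<mu>\<close> for \<open>\<nu>\<close>, and \<open>\<nu>_e_f\<close> removes the remaining
  power of f. For s > b + 1 the argument has weight above m and is zero.\<close>

lemma \<mu>_f:
  assumes "1 \<le> s"
  shows "\<exists>c. \<forall>y\<in>V (int m - 2 * int (Suc b) + 2 * int s). \<mu> (f s y) = c * \<nu> (e (Suc b - s) y)"
proof (cases "s \<le> Suc b")
  case True
  obtain r where s: "s = Suc r" using assms by (cases s) auto
  have nz: "\<beta> (int s) 1 \<noteq> 0" using b True assms by (intro binom_small_nonzero) auto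
  let ?t = "int m - 2 * int (Suc b) + 2 * int s"
  let ?c = "\<beta> (?t + int b - int r) r / \<beta> (int s) 1"
  show ?thesis
  proof (intro exI[of _ ?c] ballI)
    fix y assume y: "y \<in> V ?t"
    have "?t - 2 * int r = int m - 2 * int b" using s by simp
    then have "f r y \<in> V (int m - 2 * int b)" using f_in[OF y, of r] by (simp only:)
    then have "\<mu> (f 1 (f r y)) = \<nu> (e b (f r y))" by (rule \<mu>_f_1)
    also have "\<dots> = \<beta> (?t + int b - int r) r * \<nu> (e (b - r) y)"
      using \<nu>_e_f[OF y, of r b] True s by simp
    finally have "\<beta> (int s) 1 * \<mu> (f s y) = \<beta> (?t + int b - int r) r * \<nu> (e (b - r) y)"
      using f_f[OF y, of 1 r] s by (simp add: \<mu>_simps)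
    then show "\<mu> (f s y) = ?c * \<nu> (e (Suc b - s) y)" using nz s by (simp add: field_simps)
  qed
next
  case False
  then have "V (int m - 2 * int (Suc b) + 2 * int s) = {0}" by (intro V_above) simp
  then show ?thesis by (auto simp: \<mu>_simps \<nu>_simps)
qed

definition pair_annihilator :: "int \<Rightarrow> 'w set" where
  "pair_annihilator t =
    {x \<in> annihilator t. \<forall>j. t + 2 * int j = int m - 2 * int (Suc b) \<longrightarrow> \<mu> (e j x) = 0}"

text \<open>Stability under f is the delicate part. In the commutation formula the term without f is
  a value of \<open>\<mu> \<circ> e\<close>, which vanishes on x. Every other term has the form
  \<open>\<mu> (f s y)\<close> with s > 0, and \<open>\<mu>_f\<close> turns it into a value of
  \<open>\<nu> \<circ> e\<close>, which vanishes because x lies in the annihilator of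
  \<open>\<nu>\<close>.\<close>

lemma graded_submodule_pair_annihilator: "graded_submodule pair_annihilator"
  unfolding graded_submodule_def
proof (intro allI conjI ballI)
  fix t
  note ann = graded_submoduleD[OF graded_submodule_annihilator]
  show "subspace (pair_annihilator t)"
    unfolding subspace_def pair_annihilator_def using ann(1)[of t]
    by (auto simp: subspace_def e_plus e_scale \<mu>_simps)
  show "pair_annihilator t \<subseteq> V t" using ann(2)[of t] by (auto simp: pair_annihilator_def)
  fix x k assume x: "x \<in> pair_annihilator t"
  then have xa: "x \<in> annihilator t" by (simp add: pair_annihilator_def)
  have x\<mu>: "\<And>j. t + 2 * int j = int m - 2 * int (Suc b) \<Longrightarrow> \<mu> (e j x) = 0"
    using x by (simp add: pair_annihilator_def)
  have xV: "x \<in> V t" and x\<nu>: "\<And>j. t + 2 * int j = int m \<Longrightarrow> \<nu> (e j x) = 0"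
    using xa by (auto simp: annihilator_def)
  have "\<mu> (e j (e k x)) = 0" if "t + 2 * int k + 2 * int j = int m - 2 * int (Suc b)" for j
    using x\<mu>[of "j + k"] that by (simp add: e_e[OF xV] \<mu>_simps algebra_simps)
  then show "e k x \<in> pair_annihilator (t + 2 * int k)"
    using ann(3)[OF xa] by (auto simp: pair_annihilator_def)
  have "\<mu> (e j (f k x)) = 0" if t: "t - 2 * int k + 2 * int j = int m - 2 * int (Suc b)" for j
  proof -
    have "\<mu> (f (k - i) (e (j - i) x)) = 0" if i: "i \<le> j" "i \<le> k" for i
    proof (cases "i = k")
      case True
      then show ?thesis using x\<mu>[of "j - k"] t i f_0[OF e_in[OF xV]] by (simp add: of_nat_diff)
    next
      case False
      define s where "s = k - i"
      have s: "1 \<le> s" using False i by (simp add: s_def)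
      obtain c where c: "\<forall>y\<in>V (int m - 2 * int (Suc b) + 2 * int s). \<mu> (f s y) = c * \<nu> (e (Suc b - s) y)"
        using \<mu>_f[OF s] by blast
      have w: "t + 2 * int (j - i) = int m - 2 * int (Suc b) + 2 * int s"
        using t i by (simp add: s_def of_nat_diff)
      have y: "e (j - i) x \<in> V (int m - 2 * int (Suc b) + 2 * int s)"
        using e_in[OF xV, of "j - i"] w by simp
      show ?thesis
      proof (cases "s \<le> Suc b")
        case True
        have "\<nu> (e (Suc b - s) (e (j - i) x)) = 0"
          using x\<nu>[of "Suc b - s + (j - i)"] w True
          by (simp add: e_e[OF xV] \<nu>_simps of_nat_diff algebra_simps)
        then show ?thesis using c y by (simp add: s_def)
      next
        case False
        then have "e (j - i) x = 0" using y V_above by auto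
        then show ?thesis by (simp add: \<mu>_simps)
      qed
    qed
    then show ?thesis by (simp add: e_f[OF xV] \<mu>_simps)
  qed
  then show "f k x \<in> pair_annihilator (t - 2 * int k)"
    using ann(4)[OF xa] by (auto simp: pair_annihilator_def)
qed

lemma pair_annihilator_iff:
  assumes "b < k" "x \<in> V (int m - 2 * int k)"
  shows "x \<in> pair_annihilator (int m - 2 * int k) \<longleftrightarrow> \<nu> (e k x) = 0 \<and> \<mu> (e (k - Suc b) x) = 0"
proof -
  have 1: "int m - 2 * int k + 2 * int j = int m - 2 * int (Suc b) \<longleftrightarrow> j = k - Suc b"
    and 2: "int m - 2 * int k + 2 * int j = int m \<longleftrightarrow> j = k" for j
    using assms(1) by auto
  show ?thesis unfolding pair_annihilator_def annihilator_def 1 2 using assms(2) by blast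
qed

text \<open>Moving f to the front leaves \<open>e (Suc b) u\<close>, a nonzero multiple of
  \<open>v\<close>. The coefficient has top entry (m - 2 (b + 1)) + (b + 1) = a l - 1, so it is
  nonzero for k < a l.\<close>

lemma \<nu>_e_f_u:
  assumes "b < k" "k < a * l"
  shows "\<nu> (e k (f (k - Suc b) u)) \<noteq> 0"
proof -
  obtain c where c: "c \<noteq> 0" "e (Suc b) u = c *s f (Suc b - Suc b) v" using e_u[of "Suc b"] by auto
  have "\<nu> (e k (f (k - Suc b) u)) = \<beta> (int (a * l) - 1) (k - Suc b) * \<nu> (e (Suc b) u)"
    using \<nu>_e_f[OF u_in, of "k - Suc b" k] assms m by (simp add: of_nat_diff algebra_simps)
  moreover have "\<nu> (e (Suc b) u) = c" using c by (simp add: \<nu>_simps \<nu>_v f_0[OF v_in])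
  moreover have "\<beta> (int (a * l) - 1) (k - Suc b) \<noteq> 0" using assms by (intro binom_pred_nonzero) auto
  ultimately show ?thesis using c by simp
qed

text \<open>The mirror image of \<open>\<nu>_e_f_u\<close>, with the same top entry a l - 1. The
  remaining factor \<open>\<mu> (f (Suc b) v)\<close> is nonzero because \<open>\<mu>_f_1\<close>
  identifies it, up to a scalar, with the coefficient of m over b.\<close>

lemma \<mu>_e_f_v:
  assumes "b < k" "k < a * l"
  shows "\<mu> (e (k - Suc b) (f k v)) \<noteq> 0"
proof -
  have "\<mu> (f 1 (f b v)) = \<beta> (int m) b" using \<mu>_f_1[OF f_v_in] \<nu>_e_f_v by simp
  then have "\<beta> (int (1 + b)) 1 * \<mu> (f (1 + b) v) = \<beta> (int m) b"
    by (simp only: f_f[OF v_in] \<mu>_simps)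
  moreover have "\<beta> (int m) b \<noteq> 0" using binom_nonzero[of 0 a b b] b m by simp
  ultimately have nz: "\<mu> (f (Suc b) v) \<noteq> 0" by auto
  have "e (k - Suc b) (f k v) = \<beta> (int (a * l) - 1) (k - Suc b) *s f (Suc b) v"
    using e_f_v[of "k - Suc b" k] assms m by (simp add: of_nat_diff algebra_simps)
  moreover have "\<beta> (int (a * l) - 1) (k - Suc b) \<noteq> 0" using assms by (intro binom_pred_nonzero) auto
  ultimately show ?thesis using nz by (simp add: \<mu>_simps)
qed

text \<open>For k mod l > b the entry \<open>\<nu> (e k (f k v))\<close>, the coefficient of m over
  k, vanishes. The Gram matrix is then antitriangular with nonzero antidiagonal, whatever the
  unknown entry \<open>\<mu> (e (k - Suc b) (f (k - Suc b) u))\<close> is.\<close>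

lemma pair_independent_far:
  assumes k: "b < k" "k < a * l" "b < k mod l"
    and x: "A *s f k v + B *s f (k - Suc b) u \<in> pair_annihilator (int m - 2 * int k)"
  shows "A = 0 \<and> B = 0"
proof -
  have an: "\<nu> (e k (A *s f k v + B *s f (k - Suc b) u)) = 0"
    "\<mu> (e (k - Suc b) (A *s f k v + B *s f (k - Suc b) u)) = 0"
    using x pair_annihilator_iff[OF k(1)] graded_submoduleD(2)[OF graded_submodule_pair_annihilator]
    by blast+
  have "\<beta> (int m) k = 0"
    using binom_zero[of b "k mod l" a "k div l"] k(3) l_pos m by simp
  then have "B * \<nu> (e k (f (k - Suc b) u)) = 0"
    using an(1) by (simp add: e_plus e_scale \<nu>_simps \<nu>_e_f_v)
  then have B: "B = 0" using \<nu>_e_f_u[OF k(1,2)] by simp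
  then have "A * \<mu> (e (k - Suc b) (f k v)) = 0"
    using an(2) by (simp add: e_scale \<mu>_simps)
  then show ?thesis using B \<mu>_e_f_v[OF k(1,2)] by simp
qed

text \<open>Where the Gram matrix is not antitriangular, \<open>f\<close> moves the weight to the next wall and kills
  the coefficient of \<open>f k v\<close>; then \<open>e\<close> moves it to the previous wall, where \<open>f (k - Suc b) u\<close> has
  become a nonzero multiple of a vector \<open>f k' v\<close>.\<close>

lemma pair_independent:
  assumes k: "b < k" "k < a * l"
    and x: "A *s f k v + B *s f (k - Suc b) u \<in> pair_annihilator (int m - 2 * int k)"
  shows "A = 0 \<and> B = 0"
proof (cases "b < k mod l")
  case True
  then show ?thesis using pair_independent_far assms by blast
next
  case False
  define k0 k1 where "k0 = k mod l" and "k1 = k div l"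
  have kk: "k = k1 * l + k0" and k0: "k0 \<le> b" using False by (simp_all add: k0_def k1_def)
  have k1: "1 \<le> k1" using kk k0 k(1) by (cases k1) auto
  have "k1 * l < a * l" using kk k(2) by linarith
  then have "k1 < a" using mult_less_cancel2 by blast
  then have k1a: "Suc k1 * l \<le> a * l" using Suc_leI mult_le_mono1 by blast
  have k1l: "l \<le> k1 * l" using k1 by simp
  define j where "j = k - Suc b"
  have kj: "k = j + Suc b" using k(1) by (simp add: j_def)
  note pa = graded_submoduleD[OF graded_submodule_pair_annihilator]
  have A: "A = 0"
  proof -
    \<comment> \<open>The least shift for which (k + s) mod l exceeds b. Adding s causes no carry,
      as the new remainder is b + 1 < l, so the coefficient of s + k over s is nonzero.\<close>
    define s where "s = Suc b - k0"
    have ks: "k + s = k1 * l + Suc b" using kk k0 by (simp add: s_def)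
    have "f s (A *s f k v + B *s f j u)
        = (A * \<beta> (int (s + k)) s) *s f (k + s) v + (B * \<beta> (int (s + j)) s) *s f (k + s - Suc b) u"
      by (simp add: f_plus f_scale f_f[OF v_in] f_f[OF u_in] kj algebra_simps)
    moreover have "f s (A *s f k v + B *s f j u) \<in> pair_annihilator (int m - 2 * int (k + s))"
      using pa(4)[OF x, of s] by (simp add: j_def algebra_simps)
    moreover have "k + s < a * l" using ks k1a b by simp
    moreover have "b < (k + s) mod l" using ks b by simp
    ultimately have "A * \<beta> (int (s + k)) s = 0"
      using pair_independent_far[of "k + s"] k(1) by (metis trans_less_add1)
    moreover have "\<beta> (int (s + k)) s \<noteq> 0"
      using binom_nonzero[of 0 k1 s "Suc b"] ks b by (simp add: s_def add.commute)
    ultimately show ?thesis by simp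
  qed
  have B: "B = 0"
  proof -
    \<comment> \<open>This shift leads from k down to k' = k1 l - 1, whose remainder l - 1 exceeds
      b, so \<open>pair_independent_far\<close> applies again.\<close>
    define n where "n = Suc k0"
    define k' where "k' = k1 * l - 1"
    have k': "Suc k' = k1 * l" "k' = j + (Suc b - n)" "k' + n = k"
      using k1l k0 kj kk b by (auto simp: k'_def n_def)
    obtain c where c: "c \<noteq> 0" "e n u = c *s f (Suc b - n) v" using e_u[of n] k0 by (auto simp: n_def)
    have "int k0 + int k1 * int l = 1 + (int b + int j)"
      using arg_cong[OF kk, of int] kj by simp
    \<comment> \<open>The top entry of the binomial coefficients in the commutation formula is the
      multiple (a - k1) l of l. As n < l, all coefficients with i > 0 vanish and only the term i = 0
      is left.\<close>
    then have wt: "int m - 2 * int (Suc b) + int n - int j = int ((a - k1) * l + 0)"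
      using m kj kk \<open>k1 < a\<close> by (simp add: n_def of_nat_diff algebra_simps)
    have term0: "\<beta> (int m - 2 * int (Suc b) + int n - int j) i *s f (j - i) (e (n - i) u) = 0"
      if "i \<in> {..min n j} - {0}" for i
    proof -
      have "i < l" "0 < i" using that k0 b by (auto simp: n_def)
      then have "\<beta> (int ((a - k1) * l + 0)) (0 * l + i) = 0" by (intro binom_zero)
      then show ?thesis unfolding wt by simp
    qed
    have "e n (f j u) = (\<Sum>i\<in>{0}. \<beta> (int m - 2 * int (Suc b) + int n - int j) i *s f (j - i) (e (n - i) u))"
      unfolding e_f[OF u_in]
      by (rule sum.mono_neutral_right, simp, simp, rule ballI, rule term0)
    also have "\<dots> = c *s f j (f (Suc b - n) v)" by (simp add: c f_scale)
    also have "\<dots> = (c * \<beta> (int k') j) *s f k' v" using k' by (simp add: f_f[OF v_in])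
    finally have "e n (A *s f k v + B *s f j u) = (B * (c * \<beta> (int k') j)) *s f k' v + 0 *s f (k' - Suc b) u"
      by (simp add: A e_scale)
    moreover have "e n (A *s f k v + B *s f j u) \<in> pair_annihilator (int m - 2 * int k')"
      using pa(3)[OF x, of n] unfolding j_def k'(3)[symmetric] by (simp add: algebra_simps)
    moreover have "b < k'" "k' < a * l" using k' k1l b \<open>k1 * l < a * l\<close> by linarith+
    moreover have "k' = (k1 - 1) * l + (l - 1)"
      using k1 l_pos by (cases k1) (auto simp: k'_def)
    then have "k' mod l = (l - 1) mod l" by (simp only: mod_mult_self3)
    then have "k' mod l = l - 1" using l_pos by simp
    then have "b < k' mod l" using b by simp
    ultimately have "B * (c * \<beta> (int k') j) = 0"
      using pair_independent_far[of k'] by metis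
    moreover have "\<beta> (int k') j \<noteq> 0"
    proof -
      have "int k' = int (k1 * l) - 1" using k'(1) by linarith
      then show ?thesis using binom_pred_nonzero[of j k1] k' by simp
    qed
    ultimately show ?thesis using c by simp
  qed
  show ?thesis using A B by simp
qed

lemma binom_m_nonzero: "k \<le> b \<Longrightarrow> \<beta> (int m) k \<noteq> 0" "a * l \<le> k \<Longrightarrow> k \<le> m \<Longrightarrow> \<beta> (int m) k \<noteq> 0"
  using binom_nonzero[of 0 a k b] binom_nonzero[of a a "k - a * l" b] b m by auto

text \<open>A nonnegative weight m - 2 k forces k < a l, so k is either at most b, where a rank one
  pairing decides, or within the range of \<open>pair_independent\<close>. For negative weights the
  intersection, being a graded submodule, is compared with the zero submodule by
  \<open>graded_submodule_low_weights\<close>.\<close>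

lemma pair_part_Int_annihilator: "pair_part t \<inter> pair_annihilator t = {0}"
proof -
  note gs = graded_submodule_Int[OF graded_submodule_pair_part graded_submodule_pair_annihilator]
  have nonneg: "pair_part t \<inter> pair_annihilator t \<subseteq> {0}" if "- 1 < t" for t
  proof (cases "\<exists>k. t = int m - 2 * int k")
    case True
    then obtain k where t: "t = int m - 2 * int k" by blast
    show ?thesis
    proof (cases "k \<le> b")
      case True
      show ?thesis
      proof
        fix x assume x: "x \<in> pair_part t \<inter> pair_annihilator t"
        then obtain c where "x = c *s f k v" using pair_part_high[OF True] t cyclic_part_iff by auto
        then show "x \<in> {0}" using x t f_v_annihilator[OF binom_m_nonzero(1)[OF True], of c]
          by (auto simp: pair_annihilator_def)
      qed
    next
      case False
      have "k < a * l" using that t m b l_le by linarith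
      show ?thesis
      proof
        fix x assume x: "x \<in> pair_part t \<inter> pair_annihilator t"
        then obtain A B where AB: "x = A *s f k v + B *s f (k - Suc b) u"
          using pair_part_iff[of k] False t by auto
        then have "A = 0 \<and> B = 0"
          using pair_independent[of k A B] x \<open>k < a * l\<close> False t by simp
        then show "x \<in> {0}" using AB by simp
      qed
    qed
  next
    case False
    then show ?thesis using pair_part_other[of t] by auto
  qed
  have "pair_part t \<inter> pair_annihilator t \<subseteq> {0}"
  proof (cases "- 1 < t")
    case False
    then show ?thesis
      using graded_submodule_low_weights[OF graded_submodule_0 gs, of "- 1" t] nonneg by auto
  qed (use nonneg in auto)
  then show ?thesis using subspace_0[OF graded_submoduleD(1)[OF gs]] by blast
qed

lemma pair_decomposition: "V t = {x + y | x y. x \<in> pair_part t \<and> y \<in> pair_annihilator t}" (is "_ = ?S t")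
proof
  note gs = graded_submodule_sum[OF graded_submodule_pair_part graded_submodule_pair_annihilator]
  show "?S t \<subseteq> V t" by (rule graded_submoduleD(2)[OF gs])
  have nonneg: "V t \<subseteq> ?S t" if t1: "- 1 < t" for t
  proof
    fix x assume x: "x \<in> V t"
    have "\<exists>y\<in>pair_part t. x - y \<in> pair_annihilator t"
    proof (cases "\<exists>k. t = int m - 2 * int k")
      case True
      then obtain k where t: "t = int m - 2 * int k" by blast
      show ?thesis
      proof (cases "k \<le> b")
        case True
        obtain c where "x - c *s f k v \<in> annihilator t"
          using annihilator_complement[OF binom_m_nonzero(1)[OF True]] x t by blast
        then have "x - c *s f k v \<in> pair_annihilator t"
          using True t by (auto simp: pair_annihilator_def)
        moreover have "c *s f k v \<in> pair_part t" using pair_part_high[OF True] t cyclic_part_iff by auto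
        ultimately show ?thesis by blast
      next
        case False
        then have k: "b < k" "k < a * l" using t1 t m b l_le by linarith+
        define p q r s where "p = \<nu> (e k (f k v))" and "q = \<nu> (e k (f (k - Suc b) u))"
          and "r = \<mu> (e (k - Suc b) (f k v))" and "s = \<mu> (e (k - Suc b) (f (k - Suc b) u))"
        have inV: "A *s f k v + B *s f (k - Suc b) u \<in> V t" for A B
          using f_v_in[of k] f_u_in[of "k - Suc b"] t k
          by (intro subspace_add subspace_scale subspace_V) auto
        \<comment> \<open>If the determinant were zero, the vector with coefficients q and - p would
          pair to zero with both functionals. Independence then gives q = 0, contrary to
          \<open>\<nu>_e_f_u\<close>. So Cramer's rule can split every x.\<close>
        have "p * s - q * r \<noteq> 0"
        proof
          assume det: "p * s - q * r = 0"
          have "q *s f k v + (- p) *s f (k - Suc b) u \<in> pair_annihilator t"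
            using inV[of q "- p"] det unfolding t pair_annihilator_iff[OF k(1) inV[unfolded t]]
            by (simp add: e_plus e_scale vs_linear_diff[OF linear_e] \<nu>_simps \<mu>_simps algebra_simps
              flip: p_def q_def r_def s_def)
          then have "q = 0" using pair_independent[OF k, of q "- p"] t by simp
          then show False using \<nu>_e_f_u[OF k] by (simp add: q_def)
        qed
        then have "\<exists>A B. A * p + B * q = \<nu> (e k x) \<and> A * r + B * s = \<mu> (e (k - Suc b) x)"
          by (intro exI[of _ "(s * \<nu> (e k x) - q * \<mu> (e (k - Suc b) x)) / (p * s - q * r)"]
              exI[of _ "(p * \<mu> (e (k - Suc b) x) - r * \<nu> (e k x)) / (p * s - q * r)"])
            (simp add: divide_simps, simp add: algebra_simps)
        then obtain A B where AB: "A * p + B * q = \<nu> (e k x)" "A * r + B * s = \<mu> (e (k - Suc b) x)"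
          by blast
        let ?y = "A *s f k v + B *s f (k - Suc b) u"
        have d: "x - ?y \<in> V t" using x inV subspace_diff[OF subspace_V] by blast
        have "\<nu> (e k (x - ?y)) = 0 \<and> \<mu> (e (k - Suc b) (x - ?y)) = 0"
          using AB by (simp add: vs_linear_diff[OF linear_e] e_plus e_scale \<nu>_simps \<mu>_simps
            flip: p_def q_def r_def s_def)
        then have "x - ?y \<in> pair_annihilator t"
          using pair_annihilator_iff[OF k(1)] d t by blast
        moreover have "?y \<in> pair_part t" using pair_part_iff[OF k(1)] t by blast
        ultimately show ?thesis by blast
      qed
    next
      case False
      have "x \<in> pair_annihilator t"
        unfolding pair_annihilator_def annihilator_def
      proof (intro CollectI conjI x allI impI)
        show "\<nu> (e k x) = 0" if "t + 2 * int k = int m" for k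
          using False that by (metis add_diff_cancel_right')
        show "\<mu> (e j x) = 0" if "t + 2 * int j = int m - 2 * int (Suc b)" for j
        proof -
          have "t = int m - 2 * int (j + Suc b)" using that by simp
          then show ?thesis using False by blast
        qed
      qed
      then show ?thesis using subspace_0[OF subspace_pair_part] by (intro bexI[of _ 0]) auto
    qed
    then obtain y where "y \<in> pair_part t" "x - y \<in> pair_annihilator t" by blast
    moreover have "x = y + (x - y)" by simp
    ultimately show "x \<in> ?S t" by blast
  qed
  show "V t \<subseteq> ?S t"
  proof (cases "- 1 < t")
    case False
    then show ?thesis
      using graded_submodule_low_weights[OF gs graded_submodule_V, of "- 1" t] nonneg by auto
  qed (use nonneg in auto)
qed

end

context divided_power_module
begin

text \<open>The hypotheses \<open>inj\<close> and \<open>surj\<close> are what the two filtrations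
  of a tilting module contribute. They provide the functional \<open>\<mu>\<close> and the vector
  \<open>u\<close>, and the rest uses only complementary graded submodules.\<close>

lemma weights_linked:
  assumes indec: "\<And>M N. graded_submodule M \<Longrightarrow> graded_submodule N \<Longrightarrow> (\<And>t. M t \<inter> N t = {0}) \<Longrightarrow>
      (\<And>t. V t = {x + y | x y. x \<in> M t \<and> y \<in> N t}) \<Longrightarrow> (\<forall>t. M t = {0}) \<or> (\<forall>t. N t = {0})"
    and a: "1 \<le> a" and b: "Suc b < l" and m: "m = a * l + b"
    and inj: "\<And>x. x \<in> V (int m - 2 * int b) \<Longrightarrow> f 1 x = 0 \<Longrightarrow> x = 0"
    and surj: "\<And>y. y \<in> V (int m - 2 * int b) \<Longrightarrow> \<exists>x\<in>V (int m - 2 * int (Suc b)). e 1 x = y"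
  shows "b < k \<Longrightarrow> k < a * l \<Longrightarrow> \<exists>x y. (\<forall>A B. A *s x + B *s y = 0 \<longrightarrow> A = 0 \<and> B = 0) \<and>
      V (int m - 2 * int k) = {A *s x + B *s y | A B. True}"
    and "k \<le> b \<or> a * l \<le> k \<Longrightarrow> k \<le> m \<Longrightarrow> \<exists>x. x \<noteq> 0 \<and> V (int m - 2 * int k) = range (\<lambda>c. c *s x)"
    and "(\<And>k. k \<le> m \<Longrightarrow> t \<noteq> int m - 2 * int k) \<Longrightarrow> V t = {0}"
proof -
  obtain v \<nu> where v: "v \<in> V (int m)" "v \<noteq> 0" "Vector_Spaces.linear scale (*) \<nu>" "\<nu> v = 1"
    using ex_top_functional by blast
  interpret top_functional \<zeta> l \<beta> scale V e f m v \<nu>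
    by (intro top_functional.intro top_functional_axioms.intro divided_power_module_axioms v)
  obtain u where u: "u \<in> V (int m - 2 * int (Suc b))" "e 1 u = f b v"
    using surj[OF f_v_in] by blast
  interpret vp: vector_space_pair scale scale by unfold_locales
  have "inj_on (f 1) (V (int m - 2 * int b))"
  proof (rule inj_onI)
    fix x y assume xy: "x \<in> V (int m - 2 * int b)" "y \<in> V (int m - 2 * int b)" "f 1 x = f 1 y"
    have "f 1 (x - y) = 0" unfolding vs_linear_diff[OF linear_f] using xy(3) by simp
    then have "x - y = 0" by (rule inj[OF subspace_diff[OF subspace_V xy(1,2)]])
    then show "x = y" by simp
  qed
  \<comment> \<open>A linear left inverse g of \<open>f 1\<close> on the weight space makes
    \<open>\<nu> \<circ> (e b \<circ> g)\<close> a functional whose composition with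
    \<open>f 1\<close> is \<open>\<nu> \<circ> e b\<close>.\<close>
  from vp.linear_exists_left_inverse_on[OF linear_f subspace_V this]
  obtain g where g: "Vector_Spaces.linear scale scale g" "\<And>x. x \<in> V (int m - 2 * int b) \<Longrightarrow> g (f 1 x) = x"
    by blast
  have \<mu>: "Vector_Spaces.linear scale (*) (\<nu> \<circ> (e b \<circ> g))"
    by (intro Vector_Spaces.linear_compose[OF _ v(3)] Vector_Spaces.linear_compose[OF g(1) linear_e])
  interpret linked_weights \<zeta> l \<beta> scale V e f m v \<nu> a b u "\<nu> \<circ> (e b \<circ> g)"
  proof (rule linked_weights.intro[OF top_functional_axioms], rule linked_weights_axioms.intro)
    show "1 \<le> a" "Suc b < l" "m = a * l + b" by (rule a b m)+
    show "u \<in> V (int m - 2 * int (Suc b))" "e 1 u = f b v" by (rule u)+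
    show "Vector_Spaces.linear scale (*) (\<nu> \<circ> (e b \<circ> g))" by (rule \<mu>)
    show "(\<nu> \<circ> (e b \<circ> g)) (f 1 y) = \<nu> (e b y)" if "y \<in> V (int m - 2 * int b)" for y
      by (simp only: o_apply g(2)[OF that])
  qed
  note gp = graded_submoduleD[OF graded_submodule_pair_part]
  have "(\<forall>t. pair_part t = {0}) \<or> (\<forall>t. pair_annihilator t = {0})"
    by (intro indec graded_submodule_pair_part graded_submodule_pair_annihilator
        pair_part_Int_annihilator pair_decomposition)
  moreover have "v \<in> pair_part (int m)"
    using f_v_cyclic_part[of 0 "int m"] cyclic_subset_pair f_0[OF v(1)] by auto
  ultimately have an: "pair_annihilator t = {0}" for t using v(2) by blast
  have V: "V t = pair_part t" for t
    using pair_decomposition[of t] unfolding an by auto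
  show "\<exists>x y. (\<forall>A B. A *s x + B *s y = 0 \<longrightarrow> A = 0 \<and> B = 0) \<and>
      V (int m - 2 * int k) = {A *s x + B *s y | A B. True}" if k: "b < k" "k < a * l"
  proof (intro exI conjI allI impI)
    fix A B assume "A *s f k v + B *s f (k - Suc b) u = 0"
    then have "A *s f k v + B *s f (k - Suc b) u \<in> pair_annihilator (int m - 2 * int k)"
      using an by simp
    then show "A = 0" "B = 0" using pair_independent[OF k] by blast+
  next
    show "V (int m - 2 * int k) = {A *s f k v + B *s f (k - Suc b) u | A B. True}"
      unfolding V using pair_part_iff[OF k(1)] by blast
  qed
  have high: "V (int m - 2 * int k) = range (\<lambda>c. c *s f k v)" if k: "k \<le> b" for k
    unfolding V pair_part_high[OF k] image_def by (auto simp: cyclic_part_iff)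
  have low: "V (int m - 2 * int k) = range (\<lambda>c. c *s f k v)" if k: "a * l \<le> k" "k \<le> m" for k
  proof
    \<comment> \<open>A weight above a l - b - 2 that is congruent to m modulo 2 has index j <= b.
      There \<open>V\<close> is spanned by \<open>f j v\<close>, which pairs nontrivially, so the
      annihilator of \<open>\<nu>\<close> is zero. An index k >= a l has weight below - (a l - b -
      2), so the symmetry argument makes the annihilator vanish there as well, and one dimension
      remains.\<close>
    have ann_high: "annihilator t \<subseteq> {0}" if t: "int (a * l) - int b - 2 < t" for t
    proof
      fix x assume x: "x \<in> annihilator t"
      show "x \<in> {0}"
      proof (cases "\<exists>j\<le>b. t = int m - 2 * int j")
        case True
        then obtain j where j: "j \<le> b" "t = int m - 2 * int j" by blast
        then obtain c where c: "x = c *s f j v"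
          using high[OF j(1)] x graded_submoduleD(2)[OF graded_submodule_annihilator, of t] by auto
        then show ?thesis using f_v_annihilator[OF binom_m_nonzero(1)[OF j(1)]] x j by auto
      next
        case False
        have "\<not> (\<exists>j. t = int m - 2 * int j)"
        proof
          assume "\<exists>j. t = int m - 2 * int j"
          then obtain j where j: "t = int m - 2 * int j" by blast
          have "j \<le> b" using t j m by linarith
          then show False using j False by blast
        qed
        then have "pair_part t = {0}" using pair_part_other[of t] by auto
        then show ?thesis using V x graded_submoduleD(2)[OF graded_submodule_annihilator, of t] by auto
      qed
    qed
    have "annihilator (int m - 2 * int k) \<subseteq> {0}"
    proof (rule graded_submodule_low_weights[OF graded_submodule_0 graded_submodule_annihilator])
      show "- 1 \<le> int (a * l) - int b - 2" using l_le b by linarith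
      show "int m - 2 * int k < - (int (a * l) - int b - 2)" using k m b l_le by linarith
    qed (rule ann_high)
    then show "V (int m - 2 * int k) \<subseteq> range (\<lambda>c. c *s f k v)"
      using annihilator_complement[OF binom_m_nonzero(2)[OF k]] by fastforce
    show "range (\<lambda>c. c *s f k v) \<subseteq> V (int m - 2 * int k)"
      using f_v_in subspace_scale[OF subspace_V] by blast
  qed
  show "\<exists>x. x \<noteq> 0 \<and> V (int m - 2 * int k) = range (\<lambda>c. c *s x)" if k: "k \<le> b \<or> a * l \<le> k" "k \<le> m"
  proof (intro exI conjI)
    show "f k v \<noteq> 0" using \<nu>_e_f_v[of k] binom_m_nonzero[of k] k \<nu>_simps(1) by auto
    show "V (int m - 2 * int k) = range (\<lambda>c. c *s f k v)" using high low k by blast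
  qed
  show "V t = {0}" if t: "\<And>k. k \<le> m \<Longrightarrow> t \<noteq> int m - 2 * int k"
  proof (cases "\<exists>k. t = int m - 2 * int k")
    case True
    then obtain k where k: "t = int m - 2 * int k" by blast
    then have "m < k" using t[of k] by linarith
    then have "t < - int m" using k by linarith
    then show ?thesis by (rule V_below)
  next
    case False
    then show ?thesis using V pair_part_other[of t] by auto
  qed
qed

end

section \<open>Commutation relations in the quantum group\<close>

lemma q_half_power: "q_half ^ n = Fract (monom 1 n) 1"
proof (induction n)
  case 0
  then show ?case by (simp add: One_fract_def)
next
  case (Suc n)
  have "[:0, 1::rat:] = monom 1 1" by (simp add: monom_altdef)
  then show ?case using Suc by (simp add: q_half_def mult_monom)
qed

lemma q_half_nonzero [simp]: "q_half \<noteq> 0"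
  by (simp add: q_half_def Zero_fract_def eq_fract)

lemma q_par_nonzero [simp]: "q_par \<noteq> 0"
  by (simp add: q_par_def)

lemma q_par_power_neq_1: "0 < n \<Longrightarrow> q_par ^ n \<noteq> 1"
proof
  assume "0 < n" "q_par ^ n = 1"
  moreover have "q_par ^ n = Fract (monom (1::rat) (2 * n)) 1"
    unfolding q_par_def power_mult[symmetric] by (rule q_half_power)
  ultimately have "Fract (monom (1::rat) (2 * n)) 1 = Fract 1 1"
    by (simp add: One_fract_def)
  then have "monom (1::rat) (2 * n) = 1" by (simp add: eq_fract)
  then have "degree (monom (1::rat) (2 * n)) = 0" by simp
  then show False using \<open>0 < n\<close> by (simp add: degree_monom_eq)
qed

abbreviation qpow :: "int \<Rightarrow> qfield" where
  "qpow n \<equiv> q_par powi n"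

lemma qpow_add: "qpow (a + b) = qpow a * qpow b"
  by (simp add: power_int_add)

lemma qpow_eq_1_iff: "qpow n = 1 \<longleftrightarrow> n = 0"
proof
  assume *: "qpow n = 1"
  show "n = 0"
  proof (rule ccontr)
    assume "n \<noteq> 0"
    then consider "n > 0" | "- n > 0" by linarith
    then show False
    proof cases
      case 1
      then have "q_par ^ nat n = 1" using * by (simp add: power_int_nonneg_exp[symmetric])
      then show False using q_par_power_neq_1[of "nat n"] 1 by simp
    next
      case 2
      have "qpow (- n) = 1" using * by (simp add: power_int_minus)
      then have "q_par ^ nat (- n) = 1" using 2 by (simp add: power_int_nonneg_exp[symmetric])
      then show False using q_par_power_neq_1[of "nat (- n)"] 2 by simp
    qed
  qed
qed simp

lemma qpow_inj: "qpow a = qpow b \<longleftrightarrow> a = b"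
proof
  assume "qpow a = qpow b"
  then have "qpow (a - b) = 1" by (simp add: power_int_diff)
  then show "a = b" by (simp add: qpow_eq_1_iff)
qed simp

section \<open>Arithmetic of quantum integers and binomial coefficients\<close>

definition q_den :: qfield where
  "q_den = q_par - inverse q_par"

lemma q_den_nonzero [simp]: "q_den \<noteq> 0"
proof
  assume "q_den = 0"
  then have "qpow 1 = qpow (- 1)" by (simp add: q_den_def power_int_minus)
  then show False by (simp only: qpow_inj)
qed

lemma q_int_den: "q_int n * q_den = qpow n - qpow (- n)"
  unfolding q_int_def q_den_def[symmetric] by simp

lemma q_int_nonzero: "n \<noteq> 0 \<Longrightarrow> q_int n \<noteq> 0"
  using q_int_den[of n] qpow_inj[of n "- n"] by auto

lemma q_int_0 [simp]: "q_int 0 = 0"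
  by (simp add: q_int_def)

lemma q_int_1 [simp]: "q_int 1 = 1"
  using q_den_nonzero by (simp add: q_int_def power_int_minus q_den_def)

lemma q_int_Suc_nonzero [simp]: "q_int (1 + int n) \<noteq> 0" "q_int (int n + 1) \<noteq> 0"
  by (rule q_int_nonzero, simp)+

text \<open>After multiplication by q - 1/q the left side consists of four powers of q. The first
  hypothesis cancels two of them and the other hypotheses match the remaining two with the right
  side. The two conclusions serve the coefficients of K and of its inverse.\<close>

lemma q_int_three_term:
  assumes "c - x = d + y" "c + x = g + z" "d - y = g - z"
  shows "q_int x * qpow c + q_int y * qpow d = q_int z * qpow g"
    and "q_int x * qpow (- c) + q_int y * qpow (- d) = q_int z * qpow (- g)"
proof -
  have *: "q_int n * qpow r * q_den = qpow (n + r) - qpow (r - n)" for n r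
  proof -
    have "q_int n * qpow r * q_den = (q_int n * q_den) * qpow r" by simp
    then show ?thesis unfolding q_int_den by (simp add: algebra_simps flip: power_int_add)
  qed
  have e1: "x + c = z + g" "c - x = y + d" "d - y = g - z" using assms by linarith+
  have "(q_int x * qpow c + q_int y * qpow d) * q_den = q_int z * qpow g * q_den"
    unfolding distrib_right * e1 by simp
  then show "q_int x * qpow c + q_int y * qpow d = q_int z * qpow g" by simp
  have e: "x + - c = - d - y" "- c - x = - g - z" "y + - d = z + - g" using assms by linarith+
  have "(q_int x * qpow (- c) + q_int y * qpow (- d)) * q_den = q_int z * qpow (- g) * q_den"
    unfolding distrib_right * e by simp
  then show "q_int x * qpow (- c) + q_int y * qpow (- d) = q_int z * qpow (- g)" by simp
qed

lemma q_fact_Suc: "q_fact (Suc n) = q_int (int n + 1) * q_fact n"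
  by (simp add: q_fact_def add.commute)

lemma q_fact_0 [simp]: "q_fact 0 = 1"
  by (simp add: q_fact_def)

lemma q_fact_nonzero [simp]: "q_fact n \<noteq> 0"
  by (induction n) (auto simp: q_fact_Suc)

lemma q_binom_0_right [simp]: "q_binom t 0 = 1"
  by (simp add: q_binom_def)

lemma q_binom_tail: "q_int (int r + 1) * q_binom t (Suc r) = q_binom t r * q_int (t - int r)"
  by (simp add: q_binom_def add.commute)

lemma q_binom_head: "q_int (int r + 1) * q_binom t (Suc r) = q_int t * q_binom (t - 1) r"
proof (induction r)
  case 0
  then show ?case using q_binom_tail[of 0 t] by simp
next
  case (Suc r)
  have "q_int (int r + 1) * (q_int (int (Suc r) + 1) * q_binom t (Suc (Suc r)))
      = q_int (int r + 1) * (q_binom t (Suc r) * q_int (t - int (Suc r)))"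
    by (simp only: q_binom_tail)
  also have "\<dots> = (q_int (int r + 1) * q_binom t (Suc r)) * q_int (t - int (Suc r))"
    by simp
  also have "\<dots> = q_int t * (q_binom (t - 1) r * q_int (t - 1 - int r))"
    unfolding Suc by (simp add: algebra_simps)
  also have "\<dots> = q_int (int r + 1) * (q_int t * q_binom (t - 1) (Suc r))"
    unfolding q_binom_tail[symmetric] by (simp add: algebra_simps)
  finally show ?case by simp
qed

text \<open>Multiplied by [r + 1], this is the three-term identity [t - r] q^(r+1) + [r + 1] q^(r-t)
  = [t + 1]. The coefficients are powers of q, hence lie in A, so the rule survives
  specialization.\<close>

lemma q_binom_pascal:
  "q_binom (t + 1) (Suc r) = qpow (int r + 1) * q_binom t (Suc r) + qpow (int r - t) * q_binom t r"
proof -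
  have "q_int (t - int r) * qpow (int r + 1) + q_int (int r + 1) * qpow (int r - t) = q_int (t + 1) * qpow 0"
    by (rule q_int_three_term) auto
  then have a: "q_int (t + 1) = q_int (t - int r) * qpow (int r + 1) + q_int (int r + 1) * qpow (int r - t)"
    by simp
  have "q_int (int r + 1) * q_binom (t + 1) (Suc r) = q_int (t + 1) * q_binom t r"
    using q_binom_head[of r "t + 1"] by simp
  also have "\<dots> = qpow (int r + 1) * (q_binom t r * q_int (t - int r))
      + q_int (int r + 1) * (qpow (int r - t) * q_binom t r)"
    unfolding a by (simp add: algebra_simps)
  also have "\<dots> = q_int (int r + 1) * (qpow (int r + 1) * q_binom t (Suc r) + qpow (int r - t) * q_binom t r)"
    unfolding q_binom_tail[symmetric] by (simp add: algebra_simps)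
  finally show ?thesis by simp
qed

lemma q_binom_0_left: "q_binom 0 (Suc r) = 0"
  using q_binom_head[of r 0] by simp

lemma q_binom_1 [simp]: "q_binom t (Suc 0) = q_int t"
  using q_binom_tail[of 0 t] by simp

lemma q_binom_fact: "q_binom (int (a + b)) a * (q_fact a * q_fact b) = q_fact (a + b)"
proof (induction a)
  case (Suc a)
  have "q_binom (int (Suc a + b)) (Suc a) * (q_fact (Suc a) * q_fact b)
      = (q_int (int a + 1) * q_binom (int (Suc a + b)) (Suc a)) * (q_fact a * q_fact b)"
    by (simp add: q_fact_Suc algebra_simps)
  also have "\<dots> = q_int (int (a + b) + 1) * (q_binom (int (a + b)) a * (q_fact a * q_fact b))"
    unfolding q_binom_head by (simp add: algebra_simps)
  finally show ?case unfolding Suc using q_fact_Suc[of "a + b"] by simp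
qed simp

lemma q_binom_self [simp]: "q_binom (int n) n = 1"
  using q_binom_fact[of n 0] by simp

lemma laurent_closed [simp]:
  shows "1 \<in> laurent" "a \<in> laurent \<Longrightarrow> - a \<in> laurent"
    "a \<in> laurent \<Longrightarrow> b \<in> laurent \<Longrightarrow> a + b \<in> laurent"
    "a \<in> laurent \<Longrightarrow> b \<in> laurent \<Longrightarrow> a * b \<in> laurent"
  unfolding laurent_def
  using generate_ring.one[of "class_ring :: qfield ring"] generate_ring.a_inv[of _ "class_ring :: qfield ring"]
    generate_ring.eng_add[of _ "class_ring :: qfield ring"] generate_ring.eng_mult[of _ "class_ring :: qfield ring"]
  by (auto simp: class_ring_simps)

lemma laurent_0 [simp]: "0 \<in> laurent"
  using laurent_closed(3)[of 1 "- 1"] by simp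

lemma laurent_diff [simp]: "a \<in> laurent \<Longrightarrow> b \<in> laurent \<Longrightarrow> a - b \<in> laurent"
  using laurent_closed(3)[of a "- b"] by simp

lemma laurent_power: "a \<in> laurent \<Longrightarrow> a ^ n \<in> laurent"
  by (induction n) auto

lemma laurent_sum: "(\<And>i. i \<in> I \<Longrightarrow> g i \<in> laurent) \<Longrightarrow> sum g I \<in> laurent"
  by (induction I rule: infinite_finite_induct) auto

lemma qpow_laurent [simp]: "qpow n \<in> laurent"
proof -
  have h: "q_half \<in> laurent" "inverse q_half \<in> laurent"
    unfolding laurent_def by (auto intro: generate_ring.incl)
  have q: "q_par \<in> laurent" "inverse q_par \<in> laurent"
    using h by (auto simp: q_par_def laurent_power simp flip: power_inverse)
  show ?thesis
  proof (cases "n \<ge> 0")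
    case True
    then show ?thesis using q by (simp add: power_int_nonneg_exp laurent_power)
  next
    case False
    then have "qpow n = inverse q_par ^ nat (- n)"
      by (simp add: power_int_def)
    then show ?thesis using q by (simp add: laurent_power)
  qed
qed

lemma q_par_laurent [simp]: "q_par \<in> laurent" "q_par ^ n \<in> laurent"
  using qpow_laurent[of 1] qpow_laurent[of "int n"] by auto

text \<open>Pascal's rule carries integrality from t = 0 to all t: upward directly, and downward
  because q^(r+1) is invertible in A.\<close>

lemma q_binom_laurent [simp]: "q_binom t r \<in> laurent"
proof (induction r arbitrary: t)
  case (Suc r)
  show ?case
  proof (induction t rule: int_induct[where k = 0])
    case base
    then show ?case by (simp add: q_binom_0_left)
  next
    case (step1 i)
    then show ?case using Suc by (simp add: q_binom_pascal)
  next
    case (step2 i)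
    have "q_binom (i - 1) (Suc r) = qpow (- (int r + 1)) *
        (q_binom i (Suc r) - qpow (int r - (i - 1)) * q_binom (i - 1) r)"
    proof -
      have "qpow (- (int r + 1)) * (qpow (int r + 1) * x) = x" for x
        unfolding mult.assoc[symmetric] qpow_add[symmetric] by simp
      then show ?thesis using q_binom_pascal[of "i - 1" r] by simp
    qed
    then show ?case using step2 Suc by simp
  qed
qed simp

lemma q_int_laurent [simp]: "q_int n \<in> laurent"
  using q_binom_laurent[of n 1] by simp

section \<open>Divided powers and Cartan elements in the generic algebra\<close>

definition uq_scale :: "qfield \<Rightarrow> uq \<Rightarrow> uq" (infixr "*q" 75) where
  "a *q x = uq_scalar a * x"

interpretation uqs: central_scalars uq_scalar
  by (rule central_scalars_uq_scalar)

interpretation uqv: vector_space uq_scale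
  by unfold_locales (simp_all add: uq_scale_def uqs.s_add uqs.s_mult uqs.s_one distrib_left distrib_right mult.assoc)

lemma uq_scale_mult [simp]: "(a *q x) * y = a *q (x * y)" "x * (a *q y) = a *q (x * y)"
  by (simp_all add: uq_scale_def mult.assoc) (metis mult.assoc uqs.s_central)

lemma uq_scale_eq: "uq_scalar a * x = a *q x" "x * uq_scalar a = a *q x"
  by (simp_all add: uq_scale_def uqs.s_central)

lemma uq_cancel: "a *q x = a *q y \<Longrightarrow> a \<noteq> 0 \<Longrightarrow> x = y"
  using uqv.scale_left_imp_eq by blast

text \<open>The relations are isolated so that they can be instantiated twice: with the standard
  generators, and with E and F as well as K and its inverse exchanged.\<close>

locale q_triple =
  fixes E F K K' :: uq
  assumes KK': "K * K' = 1" and K'K: "K' * K = 1"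
    and KE: "K * E = qpow 2 *q (E * K)"
    and KF: "K * F = qpow (- 2) *q (F * K)"
    and EF: "E * F - F * E = inverse q_den *q (K - K')"
begin

lemma K'E: "K' * E = qpow (- 2) *q (E * K')"
proof -
  have "K' * E = K' * (E * (K * K'))" by (simp add: KK')
  also have "\<dots> = qpow (- 2) *q (K' * (qpow 2 *q (E * K)) * K')"
    by (simp add: mult.assoc power_int_minus)
  also have "\<dots> = qpow (- 2) *q (E * K')" by (simp only: KE[symmetric] K'K mult.assoc[symmetric] mult_1)
  finally show ?thesis .
qed

lemma K'F: "K' * F = qpow 2 *q (F * K')"
proof -
  have "K' * F = K' * (F * (K * K'))" by (simp add: KK')
  also have "\<dots> = qpow 2 *q (K' * (qpow (- 2) *q (F * K)) * K')"
    by (simp add: mult.assoc power_int_minus)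
  also have "\<dots> = qpow 2 *q (F * K')" by (simp only: KF[symmetric] K'K mult.assoc[symmetric] mult_1)
  finally show ?thesis .
qed

definition Kc :: "int \<Rightarrow> uq" where
  "Kc c = inverse q_den *q (qpow c *q K - qpow (- c) *q K')"

text \<open>Lusztig's Cartan element [K; c; r], with \<open>Kc c\<close> equal to [K; c; 1]. On a
  vector of weight t it acts as the quantum binomial coefficient of t + c over r.\<close>

primrec KB :: "int \<Rightarrow> nat \<Rightarrow> uq" where
  "KB c 0 = 1"
| "KB c (Suc r) = KB c r * (inverse (q_int (int r + 1)) *q Kc (c - int r))"

lemma Kc_comm: "Kc c * Kc d = Kc d * Kc c" and Kc_K': "Kc c * K' = K' * Kc c"
  by (simp_all add: Kc_def left_diff_distrib right_diff_distrib KK' K'K uqv.scale_right_diff_distrib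
      mult.commute)

lemma KB_Kc: "KB c r * Kc d = Kc d * KB c r" and KB_K': "KB c r * K' = K' * KB c r"
  by (induction r) (simp_all add: mult.assoc Kc_comm[of _ d] Kc_K',
      simp_all add: mult.assoc[symmetric])

lemma Kc_E: "Kc c * E = E * Kc (c + 2)" and Kc_F: "Kc c * F = F * Kc (c - 2)"
  by (simp_all add: Kc_def left_diff_distrib right_diff_distrib KE K'E KF K'F qpow_add[symmetric]
      algebra_simps del: power_int_numeral)

lemma KB_E: "KB c r * E = E * KB (c + 2) r"
proof (induction r)
  case (Suc r)
  have "Kc (c - int r) * E = E * Kc (c + 2 - int r)"
    using Kc_E[of "c - int r"] by (simp add: algebra_simps)
  then show ?case using Suc by (simp add: mult.assoc) (simp add: mult.assoc[symmetric])
qed simp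

lemma KB_tail: "q_int (int r + 1) *q KB c (Suc r) = KB c r * Kc (c - int r)"
  by simp

lemma KB_head: "q_int (int r + 1) *q KB c (Suc r) = Kc c * KB (c - 1) r"
proof (induction r)
  case (Suc r)
  have "q_int (int r + 1) *q (q_int (int (Suc r) + 1) *q KB c (Suc (Suc r)))
      = (q_int (int r + 1) *q KB c (Suc r)) * Kc (c - int (Suc r))"
    by (subst KB_tail) simp
  also have "\<dots> = Kc c * (KB (c - 1) r * Kc (c - 1 - int r))"
    unfolding Suc by (simp add: mult.assoc algebra_simps)
  also have "\<dots> = q_int (int r + 1) *q (Kc c * KB (c - 1) (Suc r))"
    by (simp only: KB_tail[symmetric] uq_scale_mult)
  finally show ?case by (rule uq_cancel) simp
qed simp

lemma Kc_three_term:
  assumes "c - x = d + y" "c + x = g + z" "d - y = g - z"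
  shows "q_int x *q Kc c + q_int y *q Kc d = q_int z *q Kc g"
proof -
  have "q_int x *q Kc c + q_int y *q Kc d
      = inverse q_den *q ((q_int x * qpow c + q_int y * qpow d) *q K
         - (q_int x * qpow (- c) + q_int y * qpow (- d)) *q K')"
    by (simp add: Kc_def uqv.scale_right_diff_distrib uqv.scale_left_distrib uqv.scale_right_distrib
        algebra_simps)
  also have "\<dots> = q_int z *q Kc g"
    unfolding q_int_three_term[OF assms]
    by (simp add: Kc_def uqv.scale_right_diff_distrib algebra_simps)
  finally show ?thesis .
qed

text \<open>The operator form of Pascal's rule, with \<open>K'\<close> in the place of q^(-t). Its
  coefficients are powers of q, so it links [K; c; r] for different c inside the integral
  form.\<close>

lemma KB_pascal:
  "KB (c + 1) (Suc r) = qpow (int r + 1) *q KB c (Suc r) + qpow (int r - c) *q (K' * KB c r)"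
proof -
  let ?n = "q_int (int r + 1)"
  have lin: "Kc (c + 1) = qpow (int r + 1) *q Kc (c - int r) + (?n * qpow (int r - c)) *q K'"
  proof -
    have d: "?n * qpow (int r - c) * q_den = qpow (2 * int r + 1 - c) - qpow (- c - 1)"
    proof -
      have "?n * qpow (int r - c) * q_den = (?n * q_den) * qpow (int r - c)" by simp
      also have "\<dots> = qpow (int r + 1 + (int r - c)) - qpow (- (int r + 1) + (int r - c))"
        unfolding q_int_den left_diff_distrib qpow_add ..
      also have "int r + 1 + (int r - c) = 2 * int r + 1 - c" by simp
      also have "- (int r + 1) + (int r - c) = - c - 1" by simp
      finally show ?thesis .
    qed
    have s: "(?n * qpow (int r - c)) *q K' =
        inverse q_den *q (qpow (2 * int r + 1 - c) *q K' - qpow (- c - 1) *q K')"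
      unfolding uqv.scale_left_diff_distrib[symmetric] d[symmetric] by simp
    have "qpow (int r + 1) *q Kc (c - int r)
        = inverse q_den *q (qpow (int r + 1 + (c - int r)) *q K - qpow (int r + 1 + - (c - int r)) *q K')"
      unfolding Kc_def uqv.scale_right_diff_distrib uqv.scale_scale qpow_add by (simp add: mult_ac)
    also have "int r + 1 + (c - int r) = c + 1" by simp
    also have "int r + 1 + - (c - int r) = 2 * int r + 1 - c" by simp
    finally have "qpow (int r + 1) *q Kc (c - int r) + (?n * qpow (int r - c)) *q K'
        = inverse q_den *q (qpow (c + 1) *q K - qpow (- c - 1) *q K')"
      unfolding s by (simp add: uqv.scale_right_diff_distrib)
    moreover have "- (c + 1) = - c - 1" by simp
    ultimately show ?thesis by (simp only: Kc_def)
  qed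
  have "?n *q KB (c + 1) (Suc r) = Kc (c + 1) * KB c r"
    using KB_head[of r "c + 1"] by simp
  also have "\<dots> = qpow (int r + 1) *q (KB c r * Kc (c - int r)) + ?n *q (qpow (int r - c) *q (K' * KB c r))"
    unfolding lin by (simp add: distrib_right KB_Kc)
  also have "\<dots> = ?n *q (qpow (int r + 1) *q KB c (Suc r) + qpow (int r - c) *q (K' * KB c r))"
    unfolding KB_tail[symmetric] by (simp add: uqv.scale_right_distrib mult.commute)
  finally show ?thesis by (rule uq_cancel) simp
qed

definition Ed :: "nat \<Rightarrow> uq" where "Ed n = inverse (q_fact n) *q E ^ n"
definition Fd :: "nat \<Rightarrow> uq" where "Fd n = inverse (q_fact n) *q F ^ n"

lemma Ed_0 [simp]: "Ed 0 = 1" and Fd_0 [simp]: "Fd 0 = 1"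
  by (simp_all add: Ed_def Fd_def)

lemma E_Ed: "E * Ed n = q_int (int n + 1) *q Ed (Suc n)"
  by (simp add: Ed_def q_fact_Suc)

lemma E_F_power: "E * F ^ Suc n = F ^ Suc n * E + q_int (int n + 1) *q (F ^ n * Kc (- int n))"
proof (induction n)
  case 0
  have "E * F = F * E + (E * F - F * E)" by simp
  then show ?case unfolding EF by (simp add: Kc_def)
next
  case (Suc n)
  have EF': "E * F = F * E + Kc 0"
  proof -
    have "E * F = F * E + (E * F - F * E)" by simp
    then show ?thesis unfolding EF by (simp add: Kc_def)
  qed
  have t: "Kc 0 + q_int (int n + 1) *q Kc (- int n - 2) = q_int (int n + 2) *q Kc (- int n - 1)"
    using Kc_three_term[of 0 1 "- int n - 2" "int n + 1" "- int n - 1" "int n + 2"] by simp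
  have "E * F ^ Suc (Suc n) = (E * F ^ Suc n) * F" by (simp add: power_Suc2 mult.assoc del: power_Suc)
  also have "\<dots> = F ^ Suc n * (E * F) + q_int (int n + 1) *q (F ^ n * (Kc (- int n) * F))"
    unfolding Suc by (simp add: distrib_right mult.assoc del: power_Suc)
  also have "\<dots> = F ^ Suc n * F * E + F ^ Suc n * (Kc 0 + q_int (int n + 1) *q Kc (- int n - 2))"
    unfolding EF' Kc_F by (simp add: distrib_left mult.assoc[symmetric] power_Suc2 del: power_Suc)
  moreover have "- int n - 1 = - int (Suc n)" "int n + 2 = int (Suc n) + 1" by simp_all
  ultimately show ?case unfolding t by (simp only: power_Suc2 mult.assoc uq_scale_mult)
qed

lemma E_Fd: "E * Fd (Suc n) = Fd (Suc n) * E + Fd n * Kc (- int n)"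
proof -
  have "inverse (q_fact (Suc n)) * q_int (int n + 1) = inverse (q_fact n)"
    by (simp add: q_fact_Suc field_simps)
  then show ?thesis unfolding Fd_def uq_scale_mult E_F_power uqv.scale_right_distrib by simp
qed

lemma Ed_Ed: "Ed a * Ed b = q_binom (int (a + b)) a *q Ed (a + b)"
proof -
  have "q_binom (int (a + b)) a * inverse (q_fact (a + b)) = inverse (q_fact a) * inverse (q_fact b)"
    using q_binom_fact[of a b] by (simp add: field_simps)
  then show ?thesis by (simp add: Ed_def power_add)
qed

text \<open>The terms with index beyond \<open>min a b\<close> are zero, which makes the sums below independent of
  the cut-off.\<close>

definition EF_term :: "nat \<Rightarrow> nat \<Rightarrow> nat \<Rightarrow> uq" where
  "EF_term a b i = (if i \<le> a \<and> i \<le> b then Fd (b - i) * KB (2 * int i - int a - int b) i * Ed (a - i) else 0)"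

text \<open>Induction on a by multiplying with one more E. Moving it through the term of index i
  gives \<open>P i\<close>, in which it reaches the divided power of E, and \<open>Q i\<close>, in
  which it meets an F and leaves a Cartan factor. \<open>P (Suc r)\<close> and \<open>Q r\<close>
  contain the same divided powers, and their sum is [a + 1] times the new term of index r +
  1.\<close>

lemma Ed_Fd_aux: "Ed a * Fd b = (\<Sum>i\<le>a. EF_term a b i)"
proof (induction a)
  case 0
  then show ?case by (simp add: EF_term_def)
next
  case (Suc a)
  define P where "P i = (if i \<le> b then q_int (int a + 1 - int i) *q
      (Fd (b - i) * KB (2 * int i - int a - int b - 2) i * Ed (Suc a - i)) else 0)" for i
  define Q where "Q i = (if i < b then Fd (b - Suc i) * (Kc (1 - int b + int i) *
      KB (2 * int i - int a - int b) i) * Ed (a - i) else 0)" for i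
  have step: "E * EF_term a b i = P i + Q i" if "i \<le> a" for i
  proof (cases "i < b")
    case True
    then obtain n where n: "b - i = Suc n" "b - Suc i = n" by (metis Suc_diff_Suc)
    have kc: "- int n = 1 - int b + int i" using n by linarith
    have eE: "E * Ed (a - i) = q_int (int a + 1 - int i) *q Ed (Suc a - i)"
      using that by (simp add: E_Ed Suc_diff_le of_nat_diff algebra_simps)
    have kb: "E * KB (2 * int i - int a - int b) i = KB (2 * int i - int a - int b - 2) i * E"
      by (simp add: KB_E)
    have "E * EF_term a b i = (E * Fd (b - i)) * KB (2 * int i - int a - int b) i * Ed (a - i)"
      using that True by (simp add: EF_term_def mult.assoc)
    also have "\<dots> = Fd (b - i) * (E * KB (2 * int i - int a - int b) i) * Ed (a - i) + Q i"
      using True unfolding n(1) E_Fd Q_def kc[symmetric] n(2) by (simp add: distrib_right mult.assoc)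
    also have "Fd (b - i) * (E * KB (2 * int i - int a - int b) i) * Ed (a - i) = P i"
      using True unfolding kb P_def by (simp add: mult.assoc eE)
    finally show ?thesis .
  next
    case False
    have eE: "E * Ed (a - i) = q_int (int a + 1 - int i) *q Ed (Suc a - i)"
      using that by (simp add: E_Ed Suc_diff_le of_nat_diff algebra_simps)
    have kb: "E * KB (2 * int i - int a - int b) i = KB (2 * int i - int a - int b - 2) i * E"
      by (simp add: KB_E)
    show ?thesis
    proof (cases "i = b")
      case True
      note eE' = eE[unfolded True]
      have "E * EF_term a b i = (E * KB (2 * int i - int a - int b) i) * Ed (a - i)"
        using that True by (simp add: EF_term_def mult.assoc)
      also have "\<dots> = P i + Q i" unfolding kb using True by (simp add: P_def Q_def mult.assoc eE')
      finally show ?thesis .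
    next
      case ne: False
      then show ?thesis using False by (simp add: P_def Q_def EF_term_def)
    qed
  qed
  have combine: "P (Suc r) + Q r = q_int (int a + 1) *q EF_term (Suc a) b (Suc r)" if "r \<le> a" for r
  proof (cases "Suc r \<le> b")
    case True
    let ?y = "2 * int r + 1 - int a - int b"
    \<comment> \<open>Multiplying by [r + 1] lets the tail and head rules split off one Cartan
      factor. What remains is a linear identity between elements \<open>Kc\<close>, supplied by the
      three-term relation.\<close>
    have "q_int (int r + 1) *q (q_int (int a - int r) *q KB (?y - 1) (Suc r)
        + Kc (int r + 1 - int b) * KB (?y - 1) r)
       = q_int (int a - int r) *q (KB (?y - 1) r * Kc (?y - 1 - int r))
        + q_int (int r + 1) *q (Kc (int r + 1 - int b) * KB (?y - 1) r)"
      unfolding uqv.scale_right_distrib KB_tail[symmetric] by (simp add: mult.commute)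
    also have "\<dots> = (q_int (int r + 1) *q Kc (int r + 1 - int b)
        + q_int (int a - int r) *q Kc (?y - 1 - int r)) * KB (?y - 1) r"
      by (simp add: KB_Kc distrib_right)
    also have "q_int (int r + 1) *q Kc (int r + 1 - int b) + q_int (int a - int r) *q Kc (?y - 1 - int r)
        = q_int (int a + 1) *q Kc ?y"
      by (rule Kc_three_term) auto
    also have "(q_int (int a + 1) *q Kc ?y) * KB (?y - 1) r
        = q_int (int r + 1) *q (q_int (int a + 1) *q KB ?y (Suc r))"
      by (simp only: uqv.scale_left_commute[of "q_int (int r + 1)" "q_int (int a + 1)"] KB_head uq_scale_mult)
    finally have id: "q_int (int a - int r) *q KB (?y - 1) (Suc r) + Kc (int r + 1 - int b) * KB (?y - 1) r
        = q_int (int a + 1) *q KB ?y (Suc r)" by (rule uq_cancel) simp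
    have i1: "2 * int (Suc r) - int a - int b - 2 = ?y - 1" "2 * int r - int a - int b = ?y - 1"
      "2 * int (Suc r) - int (Suc a) - int b = ?y" "int a + 1 - int (Suc r) = int a - int r"
      "1 - int b + int r = int r + 1 - int b" "Suc a - Suc r = a - r"
      by auto
    have "P (Suc r) + Q r = Fd (b - Suc r) * (q_int (int a - int r) *q KB (?y - 1) (Suc r)
        + Kc (int r + 1 - int b) * KB (?y - 1) r) * Ed (a - r)"
      using True unfolding P_def Q_def i1 by (simp only: if_True less_eq_Suc_le distrib_left distrib_right uq_scale_mult)
    then show ?thesis using True that unfolding id EF_term_def i1 by simp
  qed (simp add: P_def Q_def EF_term_def)
  have z: "P 0 = q_int (int a + 1) *q EF_term (Suc a) b 0"
    by (simp add: P_def EF_term_def)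
  have pa: "P (Suc a) = 0" by (simp add: P_def)
  have "q_int (int a + 1) *q (Ed (Suc a) * Fd b) = E * (Ed a * Fd b)"
    using E_Ed[of a] by (simp add: mult.assoc[symmetric])
  also have "\<dots> = (\<Sum>i\<le>a. P i) + (\<Sum>i\<le>a. Q i)"
    unfolding Suc by (simp add: sum_distrib_left step sum.distrib)
  also have "(\<Sum>i\<le>a. P i) = (\<Sum>i\<le>Suc a. P i)" using pa by simp
  also have "\<dots> = P 0 + (\<Sum>i\<le>a. P (Suc i))" by (rule sum.atMost_Suc_shift)
  also have "\<dots> + (\<Sum>i\<le>a. Q i) = P 0 + (\<Sum>i\<le>a. P (Suc i) + Q i)" by (simp add: sum.distrib)
  also have "\<dots> = q_int (int a + 1) *q (\<Sum>i\<le>Suc a. EF_term (Suc a) b i)"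
    unfolding sum.atMost_Suc_shift uqv.scale_right_distrib z uqv.scale_sum_right
    by (simp add: combine)
  finally show ?case by (rule uq_cancel) simp
qed

lemma Ed_Fd:
  "Ed a * Fd b = (\<Sum>i\<le>min a b. Fd (b - i) * KB (2 * int i - int a - int b) i * Ed (a - i))"
proof -
  have "(\<Sum>i\<le>a. EF_term a b i) = (\<Sum>i\<le>min a b. EF_term a b i)"
    by (intro sum.mono_neutral_right) (auto simp: EF_term_def)
  then show ?thesis unfolding Ed_Fd_aux by (simp add: EF_term_def)
qed

end

interpretation ut: q_triple U_E U_F U_K U_Kinv
  using uq_relations
  by unfold_locales (simp_all add: uq_scale_eq power_int_minus q_den_def mult.assoc)

text \<open>The relations are symmetric under exchanging E with F and K with its inverse, so every
  formula for E^(a) F^(b) also yields one for F^(a) E^(b).\<close>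

interpretation us: q_triple U_F U_E U_Kinv U_K
proof
  show "U_Kinv * U_K = 1" "U_K * U_Kinv = 1" by (rule uq_relations)+
  show "U_Kinv * U_F = qpow 2 *q (U_F * U_Kinv)" by (rule ut.K'F)
  show "U_Kinv * U_E = qpow (- 2) *q (U_E * U_Kinv)" by (rule ut.K'E)
  have "U_F * U_E - U_E * U_F = - (U_E * U_F - U_F * U_E)" by simp
  then show "U_F * U_E - U_E * U_F = inverse q_den *q (U_Kinv - U_K)"
    unfolding ut.EF by (simp add: uqv.scale_right_diff_distrib)
qed

lemma div_E_eq: "div_E = ut.Ed" "div_E = us.Fd" and div_F_eq: "div_F = ut.Fd" "div_F = us.Ed"
  by (rule ext, simp add: div_E_def div_F_def ut.Ed_def ut.Fd_def us.Ed_def us.Fd_def uq_scale_eq)+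

lemma swapped_Kc: "us.Kc c = - ut.Kc (- c)"
  by (simp add: ut.Kc_def us.Kc_def uqv.scale_right_diff_distrib)

text \<open>The operator form of the reflection rule for binomial coefficients with a negated top
  entry. It expresses the Cartan elements of the exchanged triple through the original ones.\<close>

lemma swapped_KB: "us.KB c r = (- 1) ^ r *q ut.KB (int r - 1 - c) r"
proof (induction r)
  case (Suc r)
  have "q_int (int r + 1) *q us.KB c (Suc r) = us.KB c r * us.Kc (c - int r)"
    by (rule us.KB_tail)
  also have "\<dots> = - ((- 1) ^ r *q (ut.KB (int r - 1 - c) r * ut.Kc (int r - c)))"
    unfolding swapped_Kc Suc by simp
  also have "ut.KB (int r - 1 - c) r * ut.Kc (int r - c) = q_int (int r + 1) *q ut.KB (int r - c) (Suc r)"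
    using ut.KB_head[of r "int r - c"] ut.KB_Kc by (simp add: algebra_simps)
  finally have "q_int (int r + 1) *q us.KB c (Suc r)
      = q_int (int r + 1) *q ((- 1) ^ Suc r *q ut.KB (int (Suc r) - 1 - c) (Suc r))"
    by simp
  then show ?case by (rule uq_cancel) simp
qed simp

lemma K_binom_eq: "K_binom r = ut.KB 0 r"
proof (induction r)
  case (Suc r)
  have "qpow (int r + 1) - qpow (- (int r + 1)) = q_int (int r + 1) * q_den"
    by (simp only: q_int_den)
  then have "inverse (qpow (int r + 1) - qpow (- (int r + 1)))
      = inverse (q_int (int r + 1)) * inverse q_den" by simp
  then show ?case using Suc by (simp only: K_binom.simps ut.KB.simps ut.Kc_def uq_scale_eq uqv.scale_scale) simp
qed simp

section \<open>Closure properties of the integral form\<close>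

lemma U_A_closed [simp]:
  shows "1 \<in> U_A" "x \<in> U_A \<Longrightarrow> - x \<in> U_A"
    "x \<in> U_A \<Longrightarrow> y \<in> U_A \<Longrightarrow> x + y \<in> U_A"
    "x \<in> U_A \<Longrightarrow> y \<in> U_A \<Longrightarrow> x * y \<in> U_A"
  unfolding U_A_def
  using generate_ring.one[of "class_ring :: uq ring"] generate_ring.a_inv[of _ "class_ring :: uq ring"]
    generate_ring.eng_add[of _ "class_ring :: uq ring"] generate_ring.eng_mult[of _ "class_ring :: uq ring"]
  by (auto simp: class_ring_simps)

lemma U_A_0 [simp]: "0 \<in> U_A"
  using U_A_closed(3)[of 1 "- 1"] by simp

lemma U_A_diff [simp]: "x \<in> U_A \<Longrightarrow> y \<in> U_A \<Longrightarrow> x - y \<in> U_A"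
  using U_A_closed(3)[of x "- y"] by simp

lemma U_A_sum: "(\<And>i. i \<in> I \<Longrightarrow> g i \<in> U_A) \<Longrightarrow> sum g I \<in> U_A"
  by (induction I rule: infinite_finite_induct) auto

lemma U_A_power: "x \<in> U_A \<Longrightarrow> x ^ n \<in> U_A"
  by (induction n) auto

lemma U_A_gens [simp]: "a \<in> laurent \<Longrightarrow> uq_scalar a \<in> U_A" "div_E n \<in> U_A" "div_F n \<in> U_A"
    "U_K \<in> U_A" "U_Kinv \<in> U_A"
  unfolding U_A_def by (rule generate_ring.incl, simp)+

lemma U_A_scale [simp]: "a \<in> laurent \<Longrightarrow> x \<in> U_A \<Longrightarrow> a *q x \<in> U_A"
  by (simp add: uq_scale_def)

lemma U_A_induct [consumes 1, case_names scalar E F K Kinv uminus add mult]: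
  assumes "u \<in> U_A" "\<And>a. a \<in> laurent \<Longrightarrow> P (uq_scalar a)" "\<And>n. P (div_E n)" "\<And>n. P (div_F n)"
    "P U_K" "P U_Kinv" "\<And>x. x \<in> U_A \<Longrightarrow> P x \<Longrightarrow> P (- x)"
    "\<And>x y. x \<in> U_A \<Longrightarrow> y \<in> U_A \<Longrightarrow> P x \<Longrightarrow> P y \<Longrightarrow> P (x + y)"
    "\<And>x y. x \<in> U_A \<Longrightarrow> y \<in> U_A \<Longrightarrow> P x \<Longrightarrow> P y \<Longrightarrow> P (x * y)"
  shows "P u"
  using assms(1)[unfolded U_A_def]
proof (induction rule: generate_ring.induct)
  case one
  then show ?case using assms(2)[of 1] by (simp add: uqs.s_one)
next
  case (incl h)
  then show ?case using assms(2-6) by auto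
next
  case (a_inv h)
  then show ?case using assms(7)[of h] by (simp add: U_A_def class_ring_simps)
next
  case (eng_add h1 h2)
  then show ?case using assms(8)[of h1 h2] by (simp add: U_A_def class_ring_simps)
next
  case (eng_mult h1 h2)
  then show ?case using assms(9)[of h1 h2] by (simp add: U_A_def class_ring_simps)
qed

text \<open>The Cartan elements are not among the generators. [K; 0; r] is the last term in the
  expansion of E^(r) F^(r), whose other terms contain Cartan elements of smaller index, and Pascal's
  rule then shifts c in both directions.\<close>

lemma KB_U_A: "ut.KB c r \<in> U_A"
proof (induction r arbitrary: c rule: less_induct)
  case (less r)
  show ?case
  proof (cases r)
    case (Suc r')
    have zero: "ut.KB 0 r \<in> U_A"
    proof -
      have "ut.Ed r * ut.Fd r = (\<Sum>i<r. ut.Fd (r - i) * ut.KB (2 * int i - int r - int r) i * ut.Ed (r - i)) + ut.KB 0 r"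
        unfolding ut.Ed_Fd by (simp add: lessThan_Suc_atMost[symmetric])
      then have "ut.KB 0 r = ut.Ed r * ut.Fd r
          - (\<Sum>i<r. ut.Fd (r - i) * ut.KB (2 * int i - int r - int r) i * ut.Ed (r - i))"
        by (simp add: algebra_simps)
      also have "\<dots> \<in> U_A"
        using less by (intro U_A_diff U_A_sum U_A_closed(4)) (auto simp flip: div_E_eq div_F_eq)
      finally show ?thesis .
    qed
    show ?thesis
    proof (induction c rule: int_induct[where k = 0])
      case base
      then show ?case by (rule zero)
    next
      case (step1 i)
      have "ut.KB i r' \<in> U_A" using less Suc by simp
      with step1 show ?case unfolding Suc ut.KB_pascal by (simp del: ut.KB.simps)
    next
      case (step2 i)
      have "ut.KB (i - 1) r' \<in> U_A" using less Suc by simp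
      moreover have "ut.KB (i - 1) r = qpow (- (int r' + 1)) *q
          (ut.KB i r - qpow (int r' - (i - 1)) *q (U_Kinv * ut.KB (i - 1) r'))"
      proof -
        have "qpow (- (int r' + 1)) *q (qpow (int r' + 1) *q x) = x" for x
          unfolding uqv.scale_scale qpow_add[symmetric] by simp
        then show ?thesis using ut.KB_pascal[of "i - 1" r'] unfolding Suc
          by (simp del: ut.KB.simps)
      qed
      ultimately show ?case using step2 by (simp del: ut.KB.simps)
    qed
  qed simp
qed

lemma K_binom_U_A [simp]: "K_binom r \<in> U_A"
  by (simp add: K_binom_eq KB_U_A)

lemma antipode_scale: "antipode (a *q x) = a *q antipode x"
  by (simp add: uq_scale_def antipode_mult antipode_scalar uqs.s_central)

lemma antipode_1 [simp]: "antipode 1 = 1"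
  using antipode_scalar[of 1] by (simp add: uqs.s_one)

lemma antipode_uminus: "antipode (- x) = - antipode x"
  using antipode_scale[of "- 1" x] by simp

lemma antipode_diff: "antipode (x - y) = antipode x - antipode y"
  using antipode_add[of x "- y"] by (simp add: antipode_uminus)

lemma antipode_Kc: "antipode (ut.Kc c) = us.Kc c"
  by (simp add: ut.Kc_def us.Kc_def antipode_scale antipode_diff antipode_gen)

lemma antipode_KB: "antipode (ut.KB c r) = us.KB c r"
  by (induction r) (simp_all add: antipode_mult antipode_scale antipode_Kc us.KB_Kc)

text \<open>Sorting the powers of - K^(-1) E and - F K produces only signs and powers of q, which
  are units of A, so the divided powers survive the antipode.\<close>

lemma antipode_div_U_A: "antipode (div_E n) \<in> U_A" "antipode (div_F n) \<in> U_A"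
proof -
  have ap: "antipode (x ^ n) = antipode x ^ n" for x
    by (induction n) (simp_all add: antipode_mult power_commutes)
  have KE: "U_E ^ n * U_Kinv = qpow (2 * int n) *q (U_Kinv * U_E ^ n)" for n
  proof (induction n)
    case (Suc n)
    have *: "U_E * U_Kinv = qpow 2 *q (U_Kinv * U_E)"
      unfolding ut.K'E by (simp add: power_int_minus)
    have "U_E ^ Suc n * U_Kinv = qpow (2 * int n) *q (U_E * U_Kinv * U_E ^ n)"
      by (simp add: mult.assoc Suc)
    then show ?case unfolding * by (simp add: mult.assoc qpow_add[symmetric] algebra_simps del: power_int_numeral)
  qed simp
  have KF: "U_K ^ n * U_F = qpow (- 2 * int n) *q (U_F * U_K ^ n)" for n
  proof (induction n)
    case (Suc n)
    have "U_K ^ Suc n * U_F = qpow (- 2 * int n) *q (U_K * U_F * U_K ^ n)"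
      by (simp add: mult.assoc Suc)
    then show ?case unfolding ut.KF by (simp add: mult.assoc qpow_add[symmetric] algebra_simps del: power_int_numeral)
  qed simp
  have E: "\<exists>a\<in>laurent. (- (U_Kinv * U_E)) ^ n = a *q (U_Kinv ^ n * U_E ^ n)"
  proof (induction n)
    case 0
    then show ?case by (intro bexI[of _ 1]) auto
  next
    case (Suc n)
    then obtain a where a: "a \<in> laurent" "(- (U_Kinv * U_E)) ^ n = a *q (U_Kinv ^ n * U_E ^ n)" by blast
    have "(- (U_Kinv * U_E)) ^ Suc n = - (a *q (U_Kinv ^ n * (U_E ^ n * U_Kinv) * U_E))"
      unfolding power_Suc2 a(2) by (simp add: mult.assoc)
    also have "\<dots> = (- (a * qpow (2 * int n))) *q (U_Kinv ^ Suc n * U_E ^ Suc n)"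
      unfolding KE power_Suc2 by (simp add: mult.assoc)
    finally show ?case using a(1) by (intro bexI[of _ "- (a * qpow (2 * int n))"]) auto
  qed
  have F: "\<exists>a\<in>laurent. (- (U_F * U_K)) ^ n = a *q (U_F ^ n * U_K ^ n)"
  proof (induction n)
    case 0
    then show ?case by (intro bexI[of _ 1]) auto
  next
    case (Suc n)
    then obtain a where a: "a \<in> laurent" "(- (U_F * U_K)) ^ n = a *q (U_F ^ n * U_K ^ n)" by blast
    have "(- (U_F * U_K)) ^ Suc n = - (a *q (U_F ^ n * (U_K ^ n * U_F) * U_K))"
      unfolding power_Suc2 a(2) by (simp add: mult.assoc)
    also have "\<dots> = (- (a * qpow (- 2 * int n))) *q (U_F ^ Suc n * U_K ^ Suc n)"
      unfolding KF power_Suc2 by (simp add: mult.assoc)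
    finally show ?case using a(1) by (intro bexI[of _ "- (a * qpow (- 2 * int n))"]) auto
  qed
  obtain a where a: "a \<in> laurent" "(- (U_Kinv * U_E)) ^ n = a *q (U_Kinv ^ n * U_E ^ n)" using E by blast
  have "antipode (div_E n) = a *q (U_Kinv ^ n * div_E n)"
    by (simp add: div_E_def uq_scale_eq antipode_scale ap antipode_gen a(2) mult.commute)
  then show "antipode (div_E n) \<in> U_A" using a(1) by (simp add: U_A_power)
  obtain b where b: "b \<in> laurent" "(- (U_F * U_K)) ^ n = b *q (U_F ^ n * U_K ^ n)" using F by blast
  have "antipode (div_F n) = b *q (div_F n * U_K ^ n)"
    by (simp add: div_F_def uq_scale_eq antipode_scale ap antipode_gen b(2) mult.commute)
  then show "antipode (div_F n) \<in> U_A" using b(1) by (simp add: U_A_power)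
qed

lemma antipode_U_A: "u \<in> U_A \<Longrightarrow> antipode u \<in> U_A"
  by (induction rule: U_A_induct)
    (simp_all add: antipode_scalar antipode_div_U_A antipode_gen antipode_uminus antipode_add antipode_mult)

section \<open>Modules over the specialized quantum group\<close>

lemma frag_extend_fun_diff: "frag_extend (\<lambda>k. F k - G k) c = frag_extend F c - frag_extend G c"
  using subset_UNIV by (induction c rule: frag_induction) (auto simp: frag_extend_diff)

lemma tensor_act_0 [simp]: "tensor_act act 0 g = 0" "tensor_act act f 0 = 0"
  by (auto simp: tensor_act_def intro!: frag_extend_eq_0 split: prod.split)

lemma tensor_act_diff_left: "tensor_act act (f - f') g = tensor_act act f g - tensor_act act f' g"
  by (simp add: tensor_act_def frag_extend_diff)

lemma tensor_act_diff_right: "tensor_act act f (g - g') = tensor_act act f g - tensor_act act f g'"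
  by (simp add: tensor_act_def frag_extend_diff case_prod_unfold frag_extend_fun_diff)

lemma tensor_act_frag_of [simp]:
  "tensor_act act (frag_of (u, c)) (frag_of (x, d)) = frag_of (act u x, c * d)"
  by (simp add: tensor_act_def)

lemma free_frag_induct [consumes 1, case_names diff zero frag]:
  assumes "Poly_Mapping.keys x \<subseteq> S"
    and "\<And>x y. Poly_Mapping.keys x \<subseteq> S \<Longrightarrow> Poly_Mapping.keys y \<subseteq> S \<Longrightarrow> P x \<Longrightarrow> P y \<Longrightarrow> P (x - y)"
    and "P 0" and "\<And>a. a \<in> S \<Longrightarrow> P (frag_of a)"
  shows "P x"
  using free_Abelian_group_induct[of x S P] assms by blast

section \<open>Cosets and the tensor product as a quotient of a free abelian group\<close>

definition diff_closed :: "'a::ab_group_add set \<Rightarrow> bool" where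
  "diff_closed H \<longleftrightarrow> 0 \<in> H \<and> (\<forall>x\<in>H. \<forall>y\<in>H. x - y \<in> H)"

lemma diff_closedD:
  assumes "diff_closed H"
  shows "0 \<in> H" "x \<in> H \<Longrightarrow> y \<in> H \<Longrightarrow> x - y \<in> H" "x \<in> H \<Longrightarrow> - x \<in> H"
    "x \<in> H \<Longrightarrow> y \<in> H \<Longrightarrow> x + y \<in> H"
proof -
  show 0: "0 \<in> H" and d: "x \<in> H \<Longrightarrow> y \<in> H \<Longrightarrow> x - y \<in> H" for x y
    using assms by (auto simp: diff_closed_def)
  show m: "x \<in> H \<Longrightarrow> - x \<in> H" for x using d[OF 0, of x] by simp
  show "x \<in> H \<Longrightarrow> y \<in> H \<Longrightarrow> x + y \<in> H" using d[of x "- y"] m[of y] by simp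
qed

text \<open>A common concrete form for the cosets in \<open>base_change\<close> and in
  \<open>U_zeta\<close>, independent of the group or ring record in which they were formed.\<close>

definition coset :: "'a::ab_group_add set \<Rightarrow> 'a \<Rightarrow> 'a set" where
  "coset H g = (\<lambda>h. h + g) ` H"

lemma mem_coset: "f \<in> coset H g \<longleftrightarrow> f - g \<in> H"
  unfolding coset_def by (auto intro: image_eqI[of _ _ "f - g"])

lemma coset_eq_iff:
  assumes "diff_closed H"
  shows "coset H g = coset H g' \<longleftrightarrow> g - g' \<in> H"
proof
  assume "coset H g = coset H g'"
  then have "g \<in> coset H g'" using diff_closedD(1)[OF assms] by (auto simp: mem_coset)
  then show "g - g' \<in> H" by (simp add: mem_coset)
next
  assume *: "g - g' \<in> H"
  have "f - g \<in> H \<longleftrightarrow> f - g' \<in> H" for f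
    using diff_closedD(4)[OF assms _ *, of "f - g"] diff_closedD(2)[OF assms _ *, of "f - g'"] by auto
  then show "coset H g = coset H g'" by (auto simp: mem_coset)
qed

lemma coset_0 [simp]: "coset H 0 = H"
  by (simp add: coset_def)

lemma r_coset_free: "H #>\<^bsub>free_Abelian_group S\<^esub> g = coset H g"
  by (auto simp: r_coset_def coset_def)

lemma coset_add:
  assumes "diff_closed H"
  shows "(\<Union>h\<in>coset H f. \<Union>k\<in>coset H g. {h + k}) = coset H (f + g)"
proof
  note D = diff_closedD[OF assms]
  show "(\<Union>h\<in>coset H f. \<Union>k\<in>coset H g. {h + k}) \<subseteq> coset H (f + g)"
  proof clarsimp
    fix h k assume "h \<in> coset H f" "k \<in> coset H g"
    then have "(h - f) + (k - g) \<in> H" using D(4) by (simp add: mem_coset)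
    then show "h + k \<in> coset H (f + g)" by (simp add: mem_coset algebra_simps)
  qed
  show "coset H (f + g) \<subseteq> (\<Union>h\<in>coset H f. \<Union>k\<in>coset H g. {h + k})"
  proof
    fix x assume "x \<in> coset H (f + g)"
    then have "x - g \<in> coset H f" "g \<in> coset H g" using D(1) by (auto simp: mem_coset algebra_simps)
    moreover have "x = (x - g) + g" by simp
    ultimately show "x \<in> (\<Union>h\<in>coset H f. \<Union>k\<in>coset H g. {h + k})" by blast
  qed
qed

locale specialization =
  fixes \<phi> :: "qfield \<Rightarrow> complex"
  assumes \<phi>_hom: "\<phi> \<in> Ring.ring_hom laurent_ring class_ring"
begin

lemma \<phi>_add: "a \<in> laurent \<Longrightarrow> b \<in> laurent \<Longrightarrow> \<phi> (a + b) = \<phi> a + \<phi> b"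
  and \<phi>_mult: "a \<in> laurent \<Longrightarrow> b \<in> laurent \<Longrightarrow> \<phi> (a * b) = \<phi> a * \<phi> b"
  and \<phi>_1 [simp]: "\<phi> 1 = 1"
  using \<phi>_hom by (auto simp: Ring.ring_hom_def laurent_ring_def)

lemma \<phi>_0 [simp]: "\<phi> 0 = 0"
  using \<phi>_add[of 0 0] by simp

lemma \<phi>_uminus: "a \<in> laurent \<Longrightarrow> \<phi> (- a) = - \<phi> a"
  using \<phi>_add[of a "- a"] by (simp add: minus_unique)

lemma \<phi>_sum: "(\<And>i. i \<in> I \<Longrightarrow> g i \<in> laurent) \<Longrightarrow> \<phi> (sum g I) = (\<Sum>i\<in>I. \<phi> (g i))"
  by (induction I rule: infinite_finite_induct) (auto simp: \<phi>_add laurent_sum)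

end

text \<open>Only what the tensor product construction uses is assumed. Both a Weyl lattice and the
  regular module \<open>U_A_regular\<close> are instances, so the multiplication of
  \<open>U_zeta\<close> and the action on a base change are treated together.\<close>

locale lattice = specialization \<phi> for \<phi> :: "qfield \<Rightarrow> complex" +
  fixes N :: "(uq, 'w) module" (structure)
  assumes add_closed: "x \<in> carrier N \<Longrightarrow> y \<in> carrier N \<Longrightarrow> x \<oplus> y \<in> carrier N"
    and act_closed: "u \<in> U_A \<Longrightarrow> x \<in> carrier N \<Longrightarrow> u \<odot>\<^bsub>N\<^esub> x \<in> carrier N"
    and act_add_left: "u \<in> U_A \<Longrightarrow> u' \<in> U_A \<Longrightarrow> x \<in> carrier N \<Longrightarrow> (u + u') \<odot>\<^bsub>N\<^esub> x = u \<odot>\<^bsub>N\<^esub> x \<oplus> u' \<odot>\<^bsub>N\<^esub> x"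
    and act_add_right: "u \<in> U_A \<Longrightarrow> x \<in> carrier N \<Longrightarrow> y \<in> carrier N \<Longrightarrow> u \<odot>\<^bsub>N\<^esub> (x \<oplus> y) = u \<odot>\<^bsub>N\<^esub> x \<oplus> u \<odot>\<^bsub>N\<^esub> y"
    and act_mult: "u \<in> U_A \<Longrightarrow> u' \<in> U_A \<Longrightarrow> x \<in> carrier N \<Longrightarrow> (u * u') \<odot>\<^bsub>N\<^esub> x = u \<odot>\<^bsub>N\<^esub> (u' \<odot>\<^bsub>N\<^esub> x)"
    and act_1: "x \<in> carrier N \<Longrightarrow> 1 \<odot>\<^bsub>N\<^esub> x = x"
begin

abbreviation "H \<equiv> tensor_subgroup \<phi> N"

lemma tensor_relators_carrier:
  "r \<in> tensor_relators \<phi> N \<Longrightarrow> Poly_Mapping.keys r \<subseteq> carrier N \<times> UNIV"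
  unfolding tensor_relators_def
  using add_closed act_closed U_A_gens(1)
  by (elim UnE CollectE exE conjE; hypsubst)
    (auto dest!: subsetD[OF keys_diff] simp del: keys_diff)

lemma tensor_subgroup_carrier: "x \<in> H \<Longrightarrow> Poly_Mapping.keys x \<subseteq> carrier N \<times> UNIV"
  unfolding tensor_subgroup_def
proof (induction rule: generate.induct)
  case (incl h)
  then show ?case using tensor_relators_carrier by blast
next
  case (inv h)
  then have "h \<in> carrier (free_Abelian_group (carrier N \<times> UNIV))"
    using tensor_relators_carrier by simp
  then show ?case using inv tensor_relators_carrier by (simp add: inv_free_Abelian_group)
next
  case (eng h1 h2)
  then show ?case using keys_add[of h1 h2] by auto
qed simp

lemma tensor_relators_subset: "r \<in> tensor_relators \<phi> N \<Longrightarrow> r \<in> H"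
  unfolding tensor_subgroup_def by (rule generate.incl)

lemma tensor_subgroup_induct [consumes 1, case_names relator zero diff]:
  assumes "x \<in> H" "\<And>r. r \<in> tensor_relators \<phi> N \<Longrightarrow> P r" "P 0" "\<And>x y. P x \<Longrightarrow> P y \<Longrightarrow> P (x - y)"
  shows "P x"
  using assms(1) unfolding tensor_subgroup_def
proof (induction rule: generate.induct)
  case (inv h)
  then have "inv\<^bsub>free_Abelian_group (carrier N \<times> UNIV)\<^esub> h = 0 - h"
    using tensor_relators_carrier by (simp add: inv_free_Abelian_group)
  then show ?case using assms(4)[OF assms(3) assms(2)[OF inv]] by simp
next
  case (eng h1 h2)
  have "h1 + h2 = h1 - (0 - h2)" by simp
  then show ?case using assms(4)[OF eng.IH(1) assms(4)[OF assms(3) eng.IH(2)]] by simp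
qed (use assms in auto)

lemma diff_closed_H: "diff_closed H"
  unfolding diff_closed_def
proof (intro conjI ballI)
  let ?G = "free_Abelian_group (carrier N \<times> (UNIV :: complex set))"
  show z: "0 \<in> H" unfolding tensor_subgroup_def
    using generate.one[of ?G] by simp
  have add: "x \<in> H \<Longrightarrow> y \<in> H \<Longrightarrow> x + y \<in> H" for x y
    unfolding tensor_subgroup_def using generate.eng[of x ?G _ y] by simp
  have "- x \<in> H" if "x \<in> H" for x
    using that unfolding tensor_subgroup_def
  proof (induction rule: generate.induct)
    case one
    then show ?case using z by (simp add: tensor_subgroup_def)
  next
    case (incl h)
    then have "inv\<^bsub>?G\<^esub> h = - h" using tensor_relators_carrier by (simp add: inv_free_Abelian_group)
    then show ?case using generate.inv[OF incl, of ?G] by simp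
  next
    case (inv h)
    then have "inv\<^bsub>?G\<^esub> h = - h" using tensor_relators_carrier by (simp add: inv_free_Abelian_group)
    then show ?case using generate.incl[OF inv, of ?G] by simp
  next
    case (eng h1 h2)
    have "- (h1 + h2) = - h1 + - h2" by simp
    then show ?case using add[of "- h1" "- h2"] eng by (simp add: tensor_subgroup_def)
  qed
  then show "x - y \<in> H" if "x \<in> H" "y \<in> H" for x y
    using add[of x "- y"] that by simp
qed

lemmas H_closed = diff_closedD[OF diff_closed_H]

lemma relator_add_left: "x \<in> carrier N \<Longrightarrow> y \<in> carrier N \<Longrightarrow> frag_of (x \<oplus> y, c) - frag_of (x, c) - frag_of (y, c) \<in> H"
  and relator_add_right: "x \<in> carrier N \<Longrightarrow> frag_of (x, c + d) - frag_of (x, c) - frag_of (x, d) \<in> H"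
  and relator_scalar: "x \<in> carrier N \<Longrightarrow> a \<in> laurent \<Longrightarrow> frag_of (uq_scalar a \<odot>\<^bsub>N\<^esub> x, c) - frag_of (x, \<phi> a * c) \<in> H"
  by (rule tensor_relators_subset, unfold tensor_relators_def, blast)+

abbreviation free :: "('w \<times> complex \<Rightarrow>\<^sub>0 int) \<Rightarrow> bool" where
  "free g \<equiv> Poly_Mapping.keys g \<subseteq> carrier N \<times> UNIV"

abbreviation free_U :: "(uq \<times> complex \<Rightarrow>\<^sub>0 int) \<Rightarrow> bool" where
  "free_U f \<equiv> Poly_Mapping.keys f \<subseteq> U_A \<times> UNIV"

abbreviation tact where "tact \<equiv> tensor_act (smult N)"

lemma free_tact: "free_U f \<Longrightarrow> free g \<Longrightarrow> free (tact f g)"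
proof (induction f rule: free_frag_induct)
  case (diff f f')
  then show ?case by (auto simp: tensor_act_diff_left dest!: subsetD[OF keys_diff])
next
  case (frag a)
  obtain u c where a: "a = (u, c)" "u \<in> U_A" using frag by auto
  from \<open>free g\<close> show ?case unfolding a(1)
  proof (induction g rule: free_frag_induct)
    case (diff g g')
    then show ?case by (auto simp: tensor_act_diff_right dest!: subsetD[OF keys_diff])
  qed (auto simp: act_closed a)
qed auto

text \<open>Half of the well-definedness of the action on the tensor product. For the A-balanced
  relators it rests on the centrality of the scalars.\<close>

lemma tact_H_right: "free_U f \<Longrightarrow> g \<in> H \<Longrightarrow> tact f g \<in> H"
proof (induction f rule: free_frag_induct)
  case (diff f f')
  then show ?case by (simp add: tensor_act_diff_left H_closed)
next
  case (frag a)
  obtain u c where a: "a = (u, c)" "u \<in> U_A" using frag by auto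
  from \<open>g \<in> H\<close> show ?case unfolding a(1)
  proof (induction g rule: tensor_subgroup_induct)
    case (relator r)
    then consider x y d where "r = frag_of (x \<oplus> y, d) - frag_of (x, d) - frag_of (y, d)" "x \<in> carrier N" "y \<in> carrier N"
      | x d d' where "r = frag_of (x, d + d') - frag_of (x, d) - frag_of (x, d')" "x \<in> carrier N"
      | b x d where "r = frag_of (uq_scalar b \<odot>\<^bsub>N\<^esub> x, d) - frag_of (x, \<phi> b * d)" "b \<in> laurent" "x \<in> carrier N"
      unfolding tensor_relators_def by blast
    then show ?case
    proof cases
      case 1
      then show ?thesis using a
        by (simp add: tensor_act_diff_right act_add_right relator_add_left act_closed)
    next
      case 2
      then show ?thesis using a relator_add_right[of "u \<odot>\<^bsub>N\<^esub> x" "c * d" "c * d'"]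
        by (simp add: tensor_act_diff_right act_closed distrib_left)
    next
      case 3
      have "u \<odot>\<^bsub>N\<^esub> (uq_scalar b \<odot>\<^bsub>N\<^esub> x) = uq_scalar b \<odot>\<^bsub>N\<^esub> (u \<odot>\<^bsub>N\<^esub> x)"
        using 3 a act_mult[of u "uq_scalar b" x] act_mult[of "uq_scalar b" u x] by (simp add: uqs.s_central)
      then show ?thesis using 3 a relator_scalar[of "u \<odot>\<^bsub>N\<^esub> x" b "c * d"]
        by (simp add: tensor_act_diff_right act_closed mult.left_commute)
    qed
  qed (simp_all add: tensor_act_diff_right H_closed)
qed (simp add: H_closed)

end

lemma regular_simps [simp]: "carrier U_A_regular = U_A" "smult U_A_regular = (*)" "add U_A_regular = (+)"
  by (simp_all add: U_A_regular_def)

lemma (in specialization) lattice_regular: "lattice \<phi> U_A_regular"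
  by unfold_locales (auto simp: algebra_simps)

context lattice
begin

interpretation reg: lattice \<phi> U_A_regular
  by (rule lattice_regular)

abbreviation "HU \<equiv> tensor_subgroup \<phi> U_A_regular"

text \<open>The other half, for relators in the algebra factor. Balancedness in U_A turns into
  balancedness in the module because u acts associatively.\<close>

lemma tact_H_left: "free g \<Longrightarrow> f \<in> HU \<Longrightarrow> tact f g \<in> H"
proof (induction g rule: free_frag_induct)
  case (diff g g')
  then show ?case by (simp add: tensor_act_diff_right H_closed)
next
  case (frag a)
  obtain x d where a: "a = (x, d)" "x \<in> carrier N" using frag by auto
  from \<open>f \<in> HU\<close> show ?case unfolding a(1)
  proof (induction f rule: reg.tensor_subgroup_induct)
    case (relator r)
    then consider u u' c where "r = frag_of (u + u', c) - frag_of (u, c) - frag_of (u', c)" "u \<in> U_A" "u' \<in> U_A"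
      | u c c' where "r = frag_of (u, c + c') - frag_of (u, c) - frag_of (u, c')" "u \<in> U_A"
      | b u c where "r = frag_of (uq_scalar b * u, c) - frag_of (u, \<phi> b * c)" "b \<in> laurent" "u \<in> U_A"
      unfolding tensor_relators_def regular_simps by blast
    then show ?case
    proof cases
      case 1
      then show ?thesis using a
        by (simp add: tensor_act_diff_left act_add_left relator_add_left act_closed)
    next
      case 2
      then show ?thesis using a relator_add_right[of "u \<odot>\<^bsub>N\<^esub> x" "c * d" "c' * d"]
        by (simp add: tensor_act_diff_left act_closed distrib_right)
    next
      case 3
      then show ?thesis using a relator_scalar[of "u \<odot>\<^bsub>N\<^esub> x" b "c * d"]
        by (simp add: tensor_act_diff_left act_closed act_mult mult.assoc)
    qed
  qed (simp_all add: tensor_act_diff_left H_closed)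
qed (simp add: H_closed)

lemma tact_cong:
  assumes "free_U f" "free g'" "f' - f \<in> HU" "g' - g \<in> H"
  shows "tact f' g' - tact f g \<in> H"
proof -
  have "tact f' g' - tact f g = tact (f' - f) g' + tact f (g' - g)"
    by (simp add: tensor_act_diff_left tensor_act_diff_right)
  then show ?thesis using tact_H_left[OF assms(2,3)] tact_H_right[OF assms(1,4)] H_closed(4) by simp
qed

lemma free_coset: "free g \<Longrightarrow> g' \<in> coset H g \<Longrightarrow> free g'"
proof -
  assume g: "free g" and "g' \<in> coset H g"
  then have "free (g' - g)" using tensor_subgroup_carrier by (simp add: mem_coset)
  then have "free ((g' - g) + g)" using g keys_add[of "g' - g" g] by blast
  then show "free g'" by simp
qed

text \<open>The definitions form a union over all representatives. Since all of them give the same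
  coset, the union is computed by a single choice.\<close>

lemma UN_coset_tact:
  assumes "free_U f" "free g"
  shows "(\<Union>f'\<in>coset HU f. \<Union>g'\<in>coset H g. coset H (tact f' g')) = coset H (tact f g)"
proof -
  have "coset H (tact f' g') = coset H (tact f g)" if "f' \<in> coset HU f" "g' \<in> coset H g" for f' g'
    unfolding coset_eq_iff[OF diff_closed_H]
    using that assms free_coset by (intro tact_cong) (auto simp: mem_coset)
  moreover have "f \<in> coset HU f" "g \<in> coset H g"
    using H_closed(1) reg.H_closed(1) by (auto simp: mem_coset)
  ultimately show ?thesis by blast
qed

lemma carrier_base_change: "carrier (base_change \<phi> N) = coset H ` {g. free g}"
  by (auto simp: base_change_def Let_def RCOSETS_def r_coset_free)

lemma base_change_add: "coset H f \<oplus>\<^bsub>base_change \<phi> N\<^esub> coset H g = coset H (f + g)"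
  by (simp add: base_change_def Let_def set_mult_def coset_add[OF diff_closed_H])

lemma base_change_smult:
  "free_U f \<Longrightarrow> free g \<Longrightarrow> coset HU f \<odot>\<^bsub>base_change \<phi> N\<^esub> coset H g = coset H (tact f g)"
  using UN_coset_tact by (simp add: base_change_def Let_def r_coset_free)

end

section \<open>The specialized algebra and its antipode\<close>

context specialization
begin

interpretation reg: lattice \<phi> U_A_regular
  by (rule lattice_regular)

abbreviation "HU \<equiv> tensor_subgroup \<phi> U_A_regular"
abbreviation "Z \<equiv> U_zeta \<phi>"
abbreviation free_U :: "(uq \<times> complex \<Rightarrow>\<^sub>0 int) \<Rightarrow> bool" where
  "free_U f \<equiv> Poly_Mapping.keys f \<subseteq> U_A \<times> UNIV"

lemma a_r_coset_U_A_free: "A +>\<^bsub>U_A_free\<^esub> g = coset A g"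
  by (auto simp: a_r_coset_def r_coset_def coset_def U_A_free_def)

lemma pure_tensor_eq: "pure_tensor \<phi> u c = coset HU (frag_of (u, c))"
  by (simp add: pure_tensor_def a_r_coset_U_A_free)

lemma carrier_Z: "carrier Z = coset HU ` {f. free_U f}"
  unfolding U_zeta_def FactRing_def A_RCOSETS_def RCOSETS_def
  using a_r_coset_U_A_free by (auto simp: a_r_coset_def U_A_free_def)

lemma Z_add: "coset HU f \<oplus>\<^bsub>Z\<^esub> coset HU g = coset HU (f + g)"
  by (simp add: U_zeta_def FactRing_def set_add_def set_mult_def U_A_free_def coset_add[OF reg.diff_closed_H])

lemma Z_one: "\<one>\<^bsub>Z\<^esub> = pure_tensor \<phi> 1 1"
  by (simp add: U_zeta_def FactRing_def pure_tensor_def) (simp add: U_A_free_def)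

lemma Z_mult: "free_U f \<Longrightarrow> free_U g \<Longrightarrow> coset HU f \<otimes>\<^bsub>Z\<^esub> coset HU g = coset HU (tensor_act (*) f g)"
  using reg.UN_coset_tact[of f g]
  by (simp add: U_zeta_def FactRing_def rcoset_mult_def a_r_coset_U_A_free)
    (simp add: U_A_free_def)

lemma pure_tensor_carrier [simp]: "u \<in> U_A \<Longrightarrow> pure_tensor \<phi> u c \<in> carrier Z"
  by (auto simp: pure_tensor_eq carrier_Z)

lemma pure_tensor_mult:
  "u \<in> U_A \<Longrightarrow> u' \<in> U_A \<Longrightarrow> pure_tensor \<phi> u c \<otimes>\<^bsub>Z\<^esub> pure_tensor \<phi> u' c' = pure_tensor \<phi> (u * u') (c * c')"
  by (simp add: pure_tensor_eq Z_mult)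

lemma pure_tensor_add_left:
  "u \<in> U_A \<Longrightarrow> u' \<in> U_A \<Longrightarrow> pure_tensor \<phi> (u + u') c = pure_tensor \<phi> u c \<oplus>\<^bsub>Z\<^esub> pure_tensor \<phi> u' c"
  using reg.relator_add_left[of u u' c]
  by (simp add: pure_tensor_eq Z_add coset_eq_iff[OF reg.diff_closed_H] diff_diff_eq)

lemma pure_tensor_add_right:
  "u \<in> U_A \<Longrightarrow> pure_tensor \<phi> u (c + c') = pure_tensor \<phi> u c \<oplus>\<^bsub>Z\<^esub> pure_tensor \<phi> u c'"
  using reg.relator_add_right[of u c c']
  by (simp add: pure_tensor_eq Z_add coset_eq_iff[OF reg.diff_closed_H] diff_diff_eq)

lemma pure_tensor_scalar:
  "u \<in> U_A \<Longrightarrow> a \<in> laurent \<Longrightarrow> pure_tensor \<phi> (uq_scalar a * u) c = pure_tensor \<phi> u (\<phi> a * c)"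
  using reg.relator_scalar[of u a c]
  by (simp add: pure_tensor_eq coset_eq_iff[OF reg.diff_closed_H])

lemma Z_induct [consumes 1, case_names tensor add]:
  assumes "X \<in> carrier Z" "\<And>u c. u \<in> U_A \<Longrightarrow> P (pure_tensor \<phi> u c)"
    "\<And>X Y. X \<in> carrier Z \<Longrightarrow> Y \<in> carrier Z \<Longrightarrow> P X \<Longrightarrow> P Y \<Longrightarrow> P (X \<oplus>\<^bsub>Z\<^esub> Y)"
  shows "P X"
proof -
  obtain f where f: "X = coset HU f" "free_U f" using assms(1) by (auto simp: carrier_Z)
  have neg: "coset HU (- frag_of (u, c)) = pure_tensor \<phi> u (- c)" if "u \<in> U_A" for u c
  proof -
    have "- frag_of (u, c) - frag_of (u, - c)
        = (frag_of (u, c + - c) - frag_of (u, c) - frag_of (u, - c)) + (frag_of (u, 0 + 0) - frag_of (u, 0) - frag_of (u, 0))"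
      by simp
    also have "\<dots> \<in> HU" using that
      by (intro reg.H_closed(4) reg.relator_add_right) simp_all
    finally show ?thesis by (simp add: pure_tensor_eq coset_eq_iff[OF reg.diff_closed_H])
  qed
  \<comment> \<open>The induction runs over differences of formal sums while the hypotheses only
    treat sums, so the claim is carried for f and - f together. A negated generator is harmless
    because - (u \<otimes> c) = u \<otimes> (- c).\<close>
  have "free_U f \<and> P (coset HU f) \<and> P (coset HU (- f))"
    using f(2)
  proof (induction f rule: free_frag_induct)
    case zero
    have "pure_tensor \<phi> 0 0 = coset HU 0"
      unfolding pure_tensor_eq coset_eq_iff[OF reg.diff_closed_H]
      using reg.H_closed(3)[OF reg.relator_add_left[of 0 0 0]] by simp
    then show ?case using assms(2)[of 0 0] by simp
  next
    case (diff x y)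
    have "free_U (x - y)" using diff keys_diff[of x y] by blast
    moreover have "coset HU (x - y) = coset HU x \<oplus>\<^bsub>Z\<^esub> coset HU (- y)" by (simp add: Z_add)
    moreover have "coset HU (- (x - y)) = coset HU (- x) \<oplus>\<^bsub>Z\<^esub> coset HU y" by (simp add: Z_add)
    ultimately show ?case using diff assms(3) by (auto simp: carrier_Z)
  next
    case (frag a)
    then obtain u c where a: "a = (u, c)" "u \<in> U_A" by auto
    show ?case using a assms(2)[of u c] assms(2)[of u "- c"] neg[of u c] by (simp add: pure_tensor_eq)
  qed
  then show ?thesis using f by blast
qed

definition frag_antipode :: "(uq \<times> complex \<Rightarrow>\<^sub>0 int) \<Rightarrow> (uq \<times> complex \<Rightarrow>\<^sub>0 int)" where
  "frag_antipode = frag_extend (\<lambda>(u, c). frag_of (antipode u, c))"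

lemma frag_antipode_HU: "f \<in> HU \<Longrightarrow> frag_antipode f \<in> HU"
proof (induction f rule: reg.tensor_subgroup_induct)
  case (relator r)
  then consider u u' c where "r = frag_of (u + u', c) - frag_of (u, c) - frag_of (u', c)" "u \<in> U_A" "u' \<in> U_A"
    | u c c' where "r = frag_of (u, c + c') - frag_of (u, c) - frag_of (u, c')" "u \<in> U_A"
    | b u c where "r = frag_of (uq_scalar b * u, c) - frag_of (u, \<phi> b * c)" "b \<in> laurent" "u \<in> U_A"
    unfolding tensor_relators_def regular_simps by blast
  then show ?case
  proof cases
    case 1
    then show ?thesis
      using reg.relator_add_left[of "antipode u" "antipode u'" c]
      by (simp add: frag_antipode_def frag_extend_diff antipode_add antipode_U_A)
  next
    case 2
    then show ?thesis
      using reg.relator_add_right[of "antipode u" c c']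
      by (simp add: frag_antipode_def frag_extend_diff antipode_U_A)
  next
    case 3
    then show ?thesis
      using reg.relator_scalar[of "antipode u" b c]
      by (simp add: frag_antipode_def frag_extend_diff antipode_mult antipode_scalar antipode_U_A
          uqs.s_central)
  qed
qed (simp_all add: frag_antipode_def frag_extend_diff reg.H_closed)

lemma antipode_zeta_coset: "antipode_zeta \<phi> (coset HU f) = coset HU (frag_antipode f)"
proof -
  have "coset HU (frag_antipode f') = coset HU (frag_antipode f)" if "f' \<in> coset HU f" for f'
    using that frag_antipode_HU[of "f' - f"]
    by (simp add: mem_coset coset_eq_iff[OF reg.diff_closed_H] frag_antipode_def frag_extend_diff)
  moreover have "f \<in> coset HU f" using reg.H_closed(1) by (simp add: mem_coset)
  ultimately show ?thesis
    unfolding antipode_zeta_def a_r_coset_U_A_free frag_antipode_def[symmetric] by blast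
qed

lemma antipode_zeta_pure_tensor: "antipode_zeta \<phi> (pure_tensor \<phi> u c) = pure_tensor \<phi> (antipode u) c"
  by (simp add: pure_tensor_eq antipode_zeta_coset frag_antipode_def)

end

section \<open>Modules over the specialized algebra: integral action and complex scalars\<close>

locale zeta_module = specialization \<phi> + left_module "U_zeta \<phi>" M
  for \<phi> :: "qfield \<Rightarrow> complex" and M :: "(u_zeta, 'v) module"
begin

definition act :: "uq \<Rightarrow> 'v \<Rightarrow> 'v" where "act u x = pure_tensor \<phi> u 1 \<odot>\<^bsub>M\<^esub> x"
definition scal :: "complex \<Rightarrow> 'v \<Rightarrow> 'v" where "scal c x = pure_tensor \<phi> 1 c \<odot>\<^bsub>M\<^esub> x"

lemma act_closed [simp]: "u \<in> U_A \<Longrightarrow> x \<in> carrier M \<Longrightarrow> act u x \<in> carrier M"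
  and scal_closed [simp]: "x \<in> carrier M \<Longrightarrow> scal c x \<in> carrier M"
  by (auto simp: act_def scal_def intro!: smult_closed)

lemma pure_tensor_smult:
  "u \<in> U_A \<Longrightarrow> x \<in> carrier M \<Longrightarrow> pure_tensor \<phi> u c \<odot>\<^bsub>M\<^esub> x = scal c (act u x)"
  using pure_tensor_mult[of 1 u c 1] by (simp add: act_def scal_def smult_assoc1[symmetric])

lemma act_mult: "u \<in> U_A \<Longrightarrow> u' \<in> U_A \<Longrightarrow> x \<in> carrier M \<Longrightarrow> act (u * u') x = act u (act u' x)"
  using pure_tensor_mult[of u u' 1 1] by (simp add: act_def smult_assoc1[symmetric])

lemma scal_mult: "x \<in> carrier M \<Longrightarrow> scal (c * d) x = scal c (scal d x)"
  using pure_tensor_mult[of 1 1 c d] by (simp add: scal_def smult_assoc1[symmetric])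

lemma act_scal: "u \<in> U_A \<Longrightarrow> x \<in> carrier M \<Longrightarrow> act u (scal c x) = scal c (act u x)"
  using pure_tensor_mult[of u 1 1 c] pure_tensor_smult[of u x c]
  by (simp add: act_def scal_def smult_assoc1[symmetric])

lemma act_1 [simp]: "x \<in> carrier M \<Longrightarrow> act 1 x = x" and scal_1 [simp]: "x \<in> carrier M \<Longrightarrow> scal 1 x = x"
  using smult_one[of x] Z_one by (auto simp: act_def scal_def)

lemma act_add_left: "u \<in> U_A \<Longrightarrow> u' \<in> U_A \<Longrightarrow> x \<in> carrier M \<Longrightarrow> act (u + u') x = act u x \<oplus>\<^bsub>M\<^esub> act u' x"
  by (simp add: act_def pure_tensor_add_left smult_l_distr)

lemma scal_add_left: "x \<in> carrier M \<Longrightarrow> scal (c + d) x = scal c x \<oplus>\<^bsub>M\<^esub> scal d x"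
  by (simp add: scal_def pure_tensor_add_right smult_l_distr)

lemma act_add_right: "u \<in> U_A \<Longrightarrow> x \<in> carrier M \<Longrightarrow> y \<in> carrier M \<Longrightarrow> act u (x \<oplus>\<^bsub>M\<^esub> y) = act u x \<oplus>\<^bsub>M\<^esub> act u y"
  by (simp add: act_def smult_r_distr)

lemma scal_add_right: "x \<in> carrier M \<Longrightarrow> y \<in> carrier M \<Longrightarrow> scal c (x \<oplus>\<^bsub>M\<^esub> y) = scal c x \<oplus>\<^bsub>M\<^esub> scal c y"
  by (simp add: scal_def smult_r_distr)

lemma act_scale: "u \<in> U_A \<Longrightarrow> a \<in> laurent \<Longrightarrow> x \<in> carrier M \<Longrightarrow> act (a *q u) x = scal (\<phi> a) (act u x)"
  using pure_tensor_scalar[of u a 1] pure_tensor_smult[of u x "\<phi> a"] by (simp add: act_def uq_scale_def)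

lemma module_cspace: "Module.module class_ring (cspace \<phi> M)"
proof (rule moduleI)
  show "cring (class_ring :: complex ring)" by (rule class_cring.cring_axioms)
  show "abelian_group (cspace \<phi> M)"
  proof (rule abelian_groupI)
    fix x assume "x \<in> carrier (cspace \<phi> M)"
    then show "\<exists>y\<in>carrier (cspace \<phi> M). y \<oplus>\<^bsub>cspace \<phi> M\<^esub> x = \<zero>\<^bsub>cspace \<phi> M\<^esub>"
      by (intro bexI[of _ "\<ominus>\<^bsub>M\<^esub> x"]) (auto simp: cspace_def M.l_neg)
  qed (auto simp: cspace_def M.a_ac)
qed (auto simp: cspace_def scal_def[symmetric] scal_mult scal_add_left scal_add_right)

lemma vectorspace_cspace: "vectorspace class_ring (cspace \<phi> M)"
  using module_cspace class_field by (simp add: vectorspace_def)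

text \<open>Pure tensors generate the specialized algebra, and u \<otimes> c acts as u followed by
  the scalar c. So stability under scalars and the generators of U_A suffices; elements of A act
  through \<open>\<phi>\<close>.\<close>

lemma submoduleI:
  assumes N: "N \<subseteq> carrier M" "\<zero>\<^bsub>M\<^esub> \<in> N" "\<And>x y. x \<in> N \<Longrightarrow> y \<in> N \<Longrightarrow> x \<oplus>\<^bsub>M\<^esub> y \<in> N"
    and scal: "\<And>c x. x \<in> N \<Longrightarrow> scal c x \<in> N"
    and gen: "\<And>n x. x \<in> N \<Longrightarrow> act (div_E n) x \<in> N" "\<And>n x. x \<in> N \<Longrightarrow> act (div_F n) x \<in> N"
      "\<And>x. x \<in> N \<Longrightarrow> act U_K x \<in> N" "\<And>x. x \<in> N \<Longrightarrow> act U_Kinv x \<in> N"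
  shows "Module.submodule N Z M"
proof -
  have neg: "\<ominus>\<^bsub>M\<^esub> x = scal (- 1) x" if "x \<in> carrier M" for x
  proof -
    have "scal 0 x \<oplus>\<^bsub>M\<^esub> scal 0 x = scal 0 x" using that scal_add_left[of x 0 0] by simp
    then have "scal 0 x = \<zero>\<^bsub>M\<^esub>" using that by (simp add: M.add.l_cancel_one)
    then have "scal (- 1) x \<oplus>\<^bsub>M\<^esub> x = \<zero>\<^bsub>M\<^esub>" using that scal_add_left[of x "- 1" 1] by simp
    then show ?thesis using that by (simp add: M.minus_equality)
  qed
  have neg_act: "act (- u) x = scal (- 1) (act u x)" if "u \<in> U_A" "x \<in> carrier M" for u x
    using act_scale[of u "- 1" x] that by (simp add: \<phi>_uminus)
  have act_N: "\<forall>x\<in>N. act u x \<in> N" if "u \<in> U_A" for u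
    using that
  proof (induction rule: U_A_induct)
    case (scalar a)
    have "act (a *q 1) x = scal (\<phi> a) (act 1 x)" if "x \<in> N" for x
      using scalar that N(1) by (intro act_scale) auto
    then show ?case using N(1) scal by (auto simp: uq_scale_def)
  qed (use N gen scal in \<open>auto simp: act_add_left act_mult neg_act subset_iff\<close>)
  have smult_N: "\<forall>x\<in>N. X \<odot>\<^bsub>M\<^esub> x \<in> N" if "X \<in> carrier Z" for X
    using that
  proof (induction rule: Z_induct)
    case (tensor u c)
    then show ?case using N(1) act_N scal by (auto simp: pure_tensor_smult subset_iff)
  next
    case (add X Y)
    then show ?case using N by (auto simp: smult_l_distr subset_iff)
  qed
  have "subgroup N (add_monoid M)"
  proof (rule M.add.subgroupI)
    show "N \<noteq> {}" using N(2) by blast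
    show "\<ominus>\<^bsub>M\<^esub> x \<in> N" if "x \<in> N" for x using that neg N(1) scal by auto
  qed (use N in auto)
  then show ?thesis
    using smult_N by (intro Module.submodule.intro Module.submodule_axioms.intro) auto
qed

lemma submoduleD:
  assumes "Module.submodule N Z M"
  shows "N \<subseteq> carrier M" "\<zero>\<^bsub>M\<^esub> \<in> N" "x \<in> N \<Longrightarrow> y \<in> N \<Longrightarrow> x \<oplus>\<^bsub>M\<^esub> y \<in> N"
    "x \<in> N \<Longrightarrow> scal c x \<in> N" "u \<in> U_A \<Longrightarrow> x \<in> N \<Longrightarrow> act u x \<in> N" "x \<in> N \<Longrightarrow> \<ominus>\<^bsub>M\<^esub> x \<in> N"
proof -
  have sg: "subgroup N (add_monoid M)" and sm: "\<And>X x. X \<in> carrier Z \<Longrightarrow> x \<in> N \<Longrightarrow> X \<odot>\<^bsub>M\<^esub> x \<in> N"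
    using Module.submodule.axioms(1)[OF assms] Module.submodule.smult_closed[OF assms] by auto
  show "N \<subseteq> carrier M" using subgroup.subset[OF sg] by simp
  show "\<zero>\<^bsub>M\<^esub> \<in> N" using subgroup.one_closed[OF sg] by simp
  show "x \<in> N \<Longrightarrow> y \<in> N \<Longrightarrow> x \<oplus>\<^bsub>M\<^esub> y \<in> N" using subgroup.m_closed[OF sg] by simp
  show "x \<in> N \<Longrightarrow> scal c x \<in> N" using sm by (simp add: scal_def)
  show "u \<in> U_A \<Longrightarrow> x \<in> N \<Longrightarrow> act u x \<in> N" using sm by (simp add: act_def)
  show "x \<in> N \<Longrightarrow> \<ominus>\<^bsub>M\<^esub> x \<in> N" using subgroup.m_inv_closed[OF sg] by (simp add: a_inv_def)
qed

end

section \<open>Weyl modules and dual Weyl modules\<close>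

lemma uq_induct [case_names scalar gen add mult]:
  assumes "\<And>c. P (uq_scalar c)" "\<And>g. P (uq_gen g)" "\<And>x y. P x \<Longrightarrow> P y \<Longrightarrow> P (x + y)"
    "\<And>x y. P x \<Longrightarrow> P y \<Longrightarrow> P (x * y)"
  shows "P u"
proof -
  obtain p where abs_uq: "u = abs_uq p"
    by (induction u rule: uq.abs_induct) blast
  have "P (abs_uq p)"
  proof (induction p rule: fr_induct)
    case (1 w c)
    have "P (abs_uq (Poly_Mapping.single (Word gs) c))" for gs
    proof (induction gs)
      case Nil
      have "abs_uq (Poly_Mapping.single (Word []) c) = uq_scalar c"
        by (simp add: uq_scalar.abs_eq fr_scalar_def zero_word_def)
      then show ?case using assms(1) by simp
    next
      case (Cons g gs)
      have "Poly_Mapping.single (Word (g # gs)) c = fr_gen g * Poly_Mapping.single (Word gs) c"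
        by (simp add: fr_gen_def mult_single plus_word_def)
      then have "abs_uq (Poly_Mapping.single (Word (g # gs)) c)
          = uq_gen g * abs_uq (Poly_Mapping.single (Word gs) c)"
        by (simp add: uq_gen.abs_eq times_uq.abs_eq)
      then show ?case using assms(2,4) Cons by simp
    qed
    from this[of "letters w"] show ?case by simp
  next
    case (2 x y)
    then show ?case using assms(3) by (simp add: plus_uq.abs_eq[symmetric])
  qed
  then show ?thesis using abs_uq by simp
qed

lemma (in q_triple) KB_F: "KB c r * F = F * KB (c - 2) r"
proof (induction r)
  case (Suc r)
  have "Kc (c - int r) * F = F * Kc (c - 2 - int r)"
    using Kc_F[of "c - int r"] by (simp add: algebra_simps)
  then show ?case using Suc by (simp add: mult.assoc) (simp add: mult.assoc[symmetric])
qed simp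

lemma (in q_triple) KB_E_power: "KB c r * E ^ k = E ^ k * KB (c + 2 * int k) r"
  and KB_F_power: "KB c r * F ^ k = F ^ k * KB (c - 2 * int k) r"
proof (induction k arbitrary: c)
  case (Suc k)
  { case 1
    have "KB c r * E ^ Suc k = E * (KB (c + 2) r * E ^ k)" by (simp add: KB_E mult.assoc[symmetric])
    then show ?case unfolding Suc by (simp add: mult.assoc algebra_simps) }
  { case 2
    have "KB c r * F ^ Suc k = F * (KB (c - 2) r * F ^ k)" by (simp add: KB_F mult.assoc[symmetric])
    then show ?case unfolding Suc by (simp add: mult.assoc algebra_simps) }
qed simp_all

lemma (in q_triple) KB_Ed: "KB c r * Ed k = Ed k * KB (c + 2 * int k) r"
  and KB_Fd: "KB c r * Fd k = Fd k * KB (c - 2 * int k) r"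
  by (simp_all add: Ed_def Fd_def KB_E_power KB_F_power)

lemma (in q_triple) K_Ed: "K * Ed k = qpow (2 * int k) *q (Ed k * K)"
  and K_Fd: "K * Fd k = qpow (- 2 * int k) *q (Fd k * K)"
proof -
  have "K * E ^ k = qpow (2 * int k) *q (E ^ k * K)"
  proof (induction k)
    case (Suc k)
    have "K * E ^ Suc k = qpow 2 *q (E * (K * E ^ k))"
      by (simp add: KE mult.assoc[symmetric] del: power_int_numeral)
    then show ?case unfolding Suc
      by (simp add: mult.assoc qpow_add[symmetric] algebra_simps del: power_int_numeral)
  qed simp
  then show "K * Ed k = qpow (2 * int k) *q (Ed k * K)"
    by (simp add: Ed_def mult.commute)
  have "K * F ^ k = qpow (- 2 * int k) *q (F ^ k * K)"
  proof (induction k)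
    case (Suc k)
    have "K * F ^ Suc k = qpow (- 2) *q (F * (K * F ^ k))"
      by (simp add: KF mult.assoc[symmetric] del: power_int_numeral)
    then show ?case unfolding Suc
      by (simp add: mult.assoc qpow_add[symmetric] algebra_simps del: power_int_numeral)
  qed simp
  then show "K * Fd k = qpow (- 2 * int k) *q (Fd k * K)"
    by (simp add: Fd_def mult.commute)
qed

lemma q_int_uminus: "q_int (- n) = - q_int n"
  by (simp add: q_int_def minus_divide_left)

lemma q_binom_neg: "q_binom (- t) r = (- 1) ^ r * q_binom (t + int r - 1) r"
proof (induction r)
  case (Suc r)
  have a: "q_int (- t - int r) = - q_int (t + int r)"
    using q_int_uminus[of "t + int r"] by simp
  have "q_int (int r + 1) * q_binom (- t) (Suc r) = q_binom (- t) r * q_int (- t - int r)"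
    by (rule q_binom_tail)
  also have "\<dots> = - ((- 1) ^ r * (q_int (t + int r) * q_binom (t + int r - 1) r))"
    unfolding Suc a by simp
  also have "q_int (t + int r) * q_binom (t + int r - 1) r = q_int (int r + 1) * q_binom (t + int r) (Suc r)"
    by (rule q_binom_head[symmetric])
  finally have "q_int (int r + 1) * q_binom (- t) (Suc r)
      = q_int (int r + 1) * ((- 1) ^ Suc r * q_binom (t + int (Suc r) - 1) (Suc r))"
    by simp
  then show ?case by (metis mult_cancel_left q_int_Suc_nonzero(2))
qed simp

lemma q_binom_nonzero: "k \<le> n \<Longrightarrow> q_binom (int n) k \<noteq> 0"
  using q_binom_fact[of k "n - k"] by auto

section \<open>The generic simple module as the algebra modulo a maximal left ideal\<close>

definition left_ideal :: "uq set \<Rightarrow> bool" where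
  "left_ideal J \<longleftrightarrow> diff_closed J \<and> (\<forall>u. \<forall>x\<in>J. u * x \<in> J)"

text \<open>The annihilator of a highest weight vector of weight \<open>n\<close> in a simple module. Elements of the
  module are represented by elements of the algebra modulo \<open>J\<close>.\<close>

locale highest_weight_ideal =
  fixes J :: "uq set" and n :: nat
  assumes J: "left_ideal J" and E_J: "U_E \<in> J" and K_J: "U_K - qpow (int n) *q 1 \<in> J" and one_J: "1 \<notin> J"
    and maximal: "\<And>J'. left_ideal J' \<Longrightarrow> J \<subseteq> J' \<Longrightarrow> 1 \<notin> J' \<Longrightarrow> J' \<subseteq> J"
begin

lemma J_mult: "x \<in> J \<Longrightarrow> u * x \<in> J"
  using J by (auto simp: left_ideal_def)

lemma J_scale: "x \<in> J \<Longrightarrow> a *q x \<in> J"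
  by (simp add: uq_scale_def J_mult)

lemma J_scaleD: "a *q x \<in> J \<Longrightarrow> a \<noteq> 0 \<Longrightarrow> x \<in> J"
  using J_scale[of "a *q x" "inverse a"] by simp

lemmas J_closed = diff_closedD[OF conjunct1[OF J[unfolded left_ideal_def]]]

lemma J_sum: "(\<And>i. i \<in> I \<Longrightarrow> g i \<in> J) \<Longrightarrow> sum g I \<in> J"
  by (induction I rule: infinite_finite_induct) (auto simp: J_closed)

definition cong_J :: "uq \<Rightarrow> uq \<Rightarrow> bool" (infix "\<approx>\<^sub>J" 50) where
  "x \<approx>\<^sub>J y \<longleftrightarrow> x - y \<in> J"

lemma cong_J_refl [simp]: "x \<approx>\<^sub>J x"
  by (simp add: cong_J_def J_closed)

lemma cong_J_sym: "x \<approx>\<^sub>J y \<Longrightarrow> y \<approx>\<^sub>J x"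
  using J_closed(3)[of "x - y"] by (simp add: cong_J_def)

lemma cong_J_trans [trans]: "x \<approx>\<^sub>J y \<Longrightarrow> y \<approx>\<^sub>J z \<Longrightarrow> x \<approx>\<^sub>J z"
  using J_closed(4)[of "x - y" "y - z"] by (simp add: cong_J_def)

lemma cong_J_mult: "x \<approx>\<^sub>J y \<Longrightarrow> u * x \<approx>\<^sub>J u * y"
  using J_mult[of "x - y" u] by (simp add: cong_J_def right_diff_distrib)

lemma cong_J_scale: "x \<approx>\<^sub>J y \<Longrightarrow> a *q x \<approx>\<^sub>J a *q y"
  using J_scale[of "x - y" a] by (simp add: cong_J_def uqv.scale_right_diff_distrib)

lemma cong_J_add: "x \<approx>\<^sub>J y \<Longrightarrow> x' \<approx>\<^sub>J y' \<Longrightarrow> x + x' \<approx>\<^sub>J y + y'"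
  using J_closed(4)[of "x - y" "x' - y'"] by (simp add: cong_J_def algebra_simps)

lemma cong_J_diff: "x \<approx>\<^sub>J y \<Longrightarrow> x' \<approx>\<^sub>J y' \<Longrightarrow> x - x' \<approx>\<^sub>J y - y'"
  using J_closed(2)[of "x - y" "x' - y'"] by (simp add: cong_J_def algebra_simps)

lemma cong_J_sum: "(\<And>i. i \<in> I \<Longrightarrow> g i \<approx>\<^sub>J h i) \<Longrightarrow> sum g I \<approx>\<^sub>J sum h I"
  by (induction I rule: infinite_finite_induct) (auto intro: cong_J_add)

lemma cong_J_0: "x \<approx>\<^sub>J 0 \<longleftrightarrow> x \<in> J"
  by (simp add: cong_J_def)

lemma cong_J_mem: "x \<approx>\<^sub>J y \<Longrightarrow> x \<in> J \<Longrightarrow> y \<in> J"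
  using J_closed(2)[of x "x - y"] by (simp add: cong_J_def)

lemma K_cong: "U_K \<approx>\<^sub>J qpow (int n) *q 1"
  using K_J by (simp add: cong_J_def)

lemma Kinv_cong: "U_Kinv \<approx>\<^sub>J qpow (- int n) *q 1"
proof -
  have "1 \<approx>\<^sub>J qpow (int n) *q U_Kinv"
    using cong_J_mult[OF K_cong, of U_Kinv] by (simp add: ut.K'K)
  from cong_J_scale[OF this, of "qpow (- int n)"] have "qpow (- int n) *q 1 \<approx>\<^sub>J U_Kinv"
    by (simp add: power_int_minus)
  then show ?thesis by (rule cong_J_sym)
qed

lemma Kc_cong: "ut.Kc c \<approx>\<^sub>J q_int (int n + c) *q 1"
proof -
  have "ut.Kc c \<approx>\<^sub>J inverse q_den *q (qpow c *q (qpow (int n) *q 1) - qpow (- c) *q (qpow (- int n) *q 1))"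
    unfolding ut.Kc_def by (intro cong_J_scale cong_J_diff K_cong Kinv_cong)
  also have "\<dots> = (inverse q_den * (q_int (int n + c) * q_den)) *q 1"
    unfolding q_int_den by (simp add: uqv.scale_right_diff_distrib uqv.scale_left_diff_distrib
      right_diff_distrib qpow_add[symmetric] algebra_simps del: power_int_of_nat)
  also have "inverse q_den * (q_int (int n + c) * q_den) = q_int (int n + c)"
    by (simp add: mult.commute mult.assoc)
  finally show ?thesis .
qed

lemma KB_cong: "ut.KB c r \<approx>\<^sub>J q_binom (int n + c) r *q 1"
proof (induction r)
  case (Suc r)
  have "ut.KB c (Suc r) \<approx>\<^sub>J ut.KB c r * (inverse (q_int (int r + 1)) *q (q_int (int n + (c - int r)) *q 1))"
    unfolding ut.KB.simps by (intro cong_J_mult cong_J_scale Kc_cong)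
  also have "\<dots> = (inverse (q_int (int r + 1)) * q_int (int n + (c - int r))) *q ut.KB c r" by simp
  also have "\<dots> \<approx>\<^sub>J (inverse (q_int (int r + 1)) * q_int (int n + (c - int r))) *q (q_binom (int n + c) r *q 1)"
    by (intro cong_J_scale Suc)
  also have "\<dots> = (inverse (q_int (int r + 1)) * (q_int (int r + 1) * q_binom (int n + c) (Suc r))) *q 1"
    unfolding q_binom_tail by (simp add: mult_ac diff_add_eq[symmetric] add_diff_eq)
  also have "inverse (q_int (int r + 1)) * (q_int (int r + 1) * q_binom (int n + c) (Suc r))
      = q_binom (int n + c) (Suc r)"
    by (simp add: mult.assoc[symmetric])
  finally show ?case .
qed simp

abbreviation "w \<equiv> div_F"

lemma w_eq: "w = ut.Fd"
  by (rule div_F_eq)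

lemma w_0 [simp]: "w 0 = 1"
  by (simp add: w_eq)

lemma K_w: "U_K * w i \<approx>\<^sub>J qpow (int n - 2 * int i) *q w i"
proof -
  have "U_K * w i = qpow (- 2 * int i) *q (w i * U_K)" unfolding w_eq by (rule ut.K_Fd)
  also have "\<dots> \<approx>\<^sub>J qpow (- 2 * int i) *q (w i * (qpow (int n) *q 1))"
    by (intro cong_J_scale cong_J_mult K_cong)
  also have "\<dots> = qpow (int n - 2 * int i) *q w i"
    by (simp add: qpow_add[symmetric] del: power_int_of_nat)
  finally show ?thesis .
qed

lemma Kinv_w: "U_Kinv * w i \<approx>\<^sub>J qpow (2 * int i - int n) *q w i"
proof -
  have "U_Kinv * w i = qpow (2 * int i) *q (w i * U_Kinv)"
    unfolding div_F_eq(2) using us.K_Ed[of i] by simp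
  also have "\<dots> \<approx>\<^sub>J qpow (2 * int i) *q (w i * (qpow (- int n) *q 1))"
    by (intro cong_J_scale cong_J_mult Kinv_cong)
  also have "\<dots> = qpow (2 * int i - int n) *q w i"
    by (simp add: qpow_add[symmetric] del: power_int_of_nat)
  finally show ?thesis .
qed

lemma KB_w: "ut.KB c r * w i \<approx>\<^sub>J q_binom (int n - 2 * int i + c) r *q w i"
proof -
  have "ut.KB c r * w i = w i * ut.KB (c - 2 * int i) r" unfolding w_eq by (rule ut.KB_Fd)
  also have "\<dots> \<approx>\<^sub>J w i * (q_binom (int n + (c - 2 * int i)) r *q 1)"
    by (intro cong_J_mult KB_cong)
  also have "int n + (c - 2 * int i) = int n - 2 * int i + c" by simp
  finally show ?thesis by simp
qed

lemma F_w: "div_F k * w i = q_binom (int (k + i)) k *q w (k + i)"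
  unfolding div_F_eq(2) by (rule us.Ed_Ed)

text \<open>In the expansion of E^(k) F^(i) every term with s < k ends in a positive power of E and
  lies in \<open>J\<close>. The term s = k contains no E, and its Cartan factor is a scalar modulo
  \<open>J\<close>.\<close>

lemma E_w: "k \<le> i \<Longrightarrow> div_E k * w i \<approx>\<^sub>J q_binom (int n - int i + int k) k *q w (i - k)"
  and E_w_0: "i < k \<Longrightarrow> div_E k * w i \<approx>\<^sub>J 0"
proof -
  let ?t = "\<lambda>s. ut.Fd (i - s) * ut.KB (2 * int s - int k - int i) s * ut.Ed (k - s)"
  have z: "?t s \<in> J" if "s < k" for s
  proof -
    obtain r where "k - s = Suc r" using \<open>s < k\<close> by (metis Suc_diff_Suc)
    then have "ut.Ed (k - s) = inverse (q_fact (k - s)) *q (U_E ^ r * U_E)"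
      by (simp only: ut.Ed_def power_Suc2)
    then show ?thesis using E_J by (simp add: J_mult J_scale)
  qed
  have sum: "div_E k * w i = (\<Sum>s\<le>min k i. ?t s)"
    unfolding div_E_eq(1) w_eq by (rule ut.Ed_Fd)
  show "div_E k * w i \<approx>\<^sub>J 0" if "i < k"
    unfolding cong_J_0 sum using that by (intro J_sum z) auto
  show "div_E k * w i \<approx>\<^sub>J q_binom (int n - int i + int k) k *q w (i - k)" if "k \<le> i"
  proof -
    have "div_E k * w i = (\<Sum>s<k. ?t s) + ?t k"
      unfolding sum using that by (simp add: lessThan_Suc_atMost[symmetric])
    also have "\<dots> \<approx>\<^sub>J 0 + w (i - k) * (q_binom (int n + (2 * int k - int k - int i)) k *q 1)"
    proof (rule cong_J_add)
      show "(\<Sum>s<k. ?t s) \<approx>\<^sub>J 0" unfolding cong_J_0 by (intro J_sum z) auto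
      show "?t k \<approx>\<^sub>J w (i - k) * (q_binom (int n + (2 * int k - int k - int i)) k *q 1)"
        unfolding w_eq using cong_J_mult[OF KB_cong] by simp
    qed
    also have "int n + (2 * int k - int k - int i) = int n - int i + int k" by simp
    finally show ?thesis by simp
  qed
qed

text \<open>The eigenvalues q^(n-2i) of K are pairwise distinct for generic q, and applying K -
  q^(n-2k) removes the index k. The conclusion is membership in \<open>J\<close> and not a vanishing
  coefficient, since \<open>w i\<close> itself may belong to \<open>J\<close>.\<close>

lemma w_independent:
  "finite I \<Longrightarrow> (\<Sum>i\<in>I. c i *q w i) \<in> J \<Longrightarrow> i \<in> I \<Longrightarrow> c i *q w i \<in> J"
proof (induction I arbitrary: c i rule: finite_induct)
  case (insert k I)
  define S where "S = (\<Sum>i\<in>insert k I. c i *q w i)"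
  have S: "S \<in> J" using insert.prems by (simp add: S_def)
  define d where "d i = c i * (qpow (int n - 2 * int i) - qpow (int n - 2 * int k))" for i
  have "U_K * S - qpow (int n - 2 * int k) *q S \<in> J"
    using S by (intro J_closed(2) J_mult J_scale)
  moreover have "U_K * S - qpow (int n - 2 * int k) *q S \<approx>\<^sub>J (\<Sum>i\<in>I. d i *q w i)"
  proof -
    have "U_K * S - qpow (int n - 2 * int k) *q S
        = (\<Sum>i\<in>insert k I. c i *q (U_K * w i) - (qpow (int n - 2 * int k) * c i) *q w i)"
      by (simp add: S_def sum_distrib_left uqv.scale_sum_right sum_subtractf)
    also have "\<dots> \<approx>\<^sub>J (\<Sum>i\<in>insert k I. c i *q (qpow (int n - 2 * int i) *q w i) - (qpow (int n - 2 * int k) * c i) *q w i)"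
      by (intro cong_J_sum cong_J_diff cong_J_scale K_w) auto
    also have "\<dots> = (\<Sum>i\<in>insert k I. d i *q w i)"
      by (intro sum.cong refl) (simp add: d_def right_diff_distrib uqv.scale_left_diff_distrib mult.commute)
    also have "\<dots> = (\<Sum>i\<in>I. d i *q w i)" using insert.hyps by (simp add: d_def)
    finally show ?thesis .
  qed
  ultimately have dS: "(\<Sum>i\<in>I. d i *q w i) \<in> J"
    by (rule cong_J_mem[rotated])
  have dJ: "d i *q w i \<in> J" if "i \<in> I" for i by (rule insert.IH[OF dS that])
  have cJ: "c i *q w i \<in> J" if "i \<in> I" for i
  proof (rule J_scaleD)
    show "qpow (int n - 2 * int i) - qpow (int n - 2 * int k) \<noteq> 0"
      using insert.hyps that by (auto simp: qpow_inj)
    show "(qpow (int n - 2 * int i) - qpow (int n - 2 * int k)) *q c i *q w i \<in> J"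
      using dJ[OF that] by (simp add: d_def mult.commute)
  qed
  have "c k *q w k = S - (\<Sum>i\<in>I. c i *q w i)" using insert.hyps by (simp add: S_def)
  then have "c k *q w k \<in> J" using S cJ by (simp add: J_closed J_sum)
  then show ?case using cJ insert.prems by blast
qed simp

text \<open>Applying E^(i) returns the nonzero multiple [n choose i] of 1 modulo
  \<open>J\<close>.\<close>

lemma w_notin: "i \<le> n \<Longrightarrow> w i \<notin> J"
proof
  assume i: "i \<le> n" and "w i \<in> J"
  then have "div_E i * w i \<in> J" by (simp add: J_mult)
  then have "q_binom (int n) i *q 1 \<in> J"
    using cong_J_mem[OF E_w[of i i]] by simp
  then show False using J_scaleD q_binom_nonzero[OF i] one_J by blast
qed

text \<open>Needed for two choices of parameters: all coefficients with k = n + 1 describe a left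
  ideal to be shown equal to \<open>J\<close>, and Laurent coefficients with k = 0 describe the
  lattice generated by the highest weight vector.\<close>

definition rep :: "qfield set \<Rightarrow> nat \<Rightarrow> uq \<Rightarrow> bool" where
  "rep R k u \<longleftrightarrow> (\<exists>N c. (\<forall>i. c i \<in> R \<and> (i < k \<longrightarrow> c i = 0) \<and> (N \<le> i \<longrightarrow> c i = 0)) \<and>
     u \<approx>\<^sub>J (\<Sum>i<N. c i *q w i))"

definition subring_like :: "qfield set \<Rightarrow> bool" where
  "subring_like R \<longleftrightarrow> 0 \<in> R \<and> 1 \<in> R \<and> (\<forall>a\<in>R. \<forall>b\<in>R. a + b \<in> R \<and> a * b \<in> R)"

lemma rep_0:
  assumes "subring_like R" "u \<in> J"
  shows "rep R k u"
  using assms unfolding rep_def by (intro exI[of _ 0] exI[of _ "\<lambda>_. 0"]) (auto simp: subring_like_def cong_J_0)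

lemma rep_cong: "rep R k u \<Longrightarrow> u' \<approx>\<^sub>J u \<Longrightarrow> rep R k u'"
  unfolding rep_def using cong_J_trans by blast

lemma rep_add:
  assumes R: "subring_like R" and "rep R k u" "rep R k u'"
  shows "rep R k (u + u')"
proof -
  obtain N c where c: "\<And>i. c i \<in> R \<and> (i < k \<longrightarrow> c i = 0) \<and> (N \<le> i \<longrightarrow> c i = 0)" "u \<approx>\<^sub>J (\<Sum>i<N. c i *q w i)"
    using assms(2) unfolding rep_def by blast
  obtain N' c' where c': "\<And>i. c' i \<in> R \<and> (i < k \<longrightarrow> c' i = 0) \<and> (N' \<le> i \<longrightarrow> c' i = 0)" "u' \<approx>\<^sub>J (\<Sum>i<N'. c' i *q w i)"
    using assms(3) unfolding rep_def by blast
  have ext: "(\<Sum>i<N. c i *q w i) = (\<Sum>i<max N N'. c i *q w i)"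
    "(\<Sum>i<N'. c' i *q w i) = (\<Sum>i<max N N'. c' i *q w i)"
    using c(1) c'(1) by (auto intro!: sum.mono_neutral_left ballI simp: not_less simp del: not_le) (metis not_le)+
  have "u + u' \<approx>\<^sub>J (\<Sum>i<max N N'. (c i + c' i) *q w i)"
    using cong_J_add[OF c(2) c'(2)] unfolding ext by (simp add: uqv.scale_left_distrib sum.distrib)
  then show ?thesis unfolding rep_def using c(1) c'(1) R
    by (intro exI[of _ "max N N'"] exI[of _ "\<lambda>i. c i + c' i"]) (auto simp: subring_like_def)
qed

lemma rep_scale:
  assumes R: "subring_like R" and "rep R k u" "a \<in> R"
  shows "rep R k (a *q u)"
proof -
  obtain N c where c: "\<And>i. c i \<in> R \<and> (i < k \<longrightarrow> c i = 0) \<and> (N \<le> i \<longrightarrow> c i = 0)" "u \<approx>\<^sub>J (\<Sum>i<N. c i *q w i)"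
    using assms(2) unfolding rep_def by blast
  have "a *q u \<approx>\<^sub>J (\<Sum>i<N. (a * c i) *q w i)"
    using cong_J_scale[OF c(2), of a] by (simp add: uqv.scale_sum_right)
  then show ?thesis unfolding rep_def using c(1) R assms(3)
    by (intro exI[of _ N] exI[of _ "\<lambda>i. a * c i"]) (auto simp: subring_like_def)
qed

lemma rep_w:
  assumes "subring_like R" "k \<le> i" "a \<in> R"
  shows "rep R k (a *q w i)"
proof -
  have "(\<Sum>j<Suc i. (if j = i then a else 0) *q w j) = a *q w i"
    by (simp add: if_distrib[of "\<lambda>a. a *q _"] cong: if_cong)
  then show ?thesis using assms unfolding rep_def
    by (intro exI[of _ "Suc i"] exI[of _ "\<lambda>j. if j = i then a else 0"]) (auto simp: subring_like_def)
qed

lemma rep_sum: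
  "subring_like R \<Longrightarrow> (\<And>i. i \<in> I \<Longrightarrow> rep R k (g i)) \<Longrightarrow> rep R k (sum g I)"
  by (induction I rule: infinite_finite_induct) (auto intro: rep_add rep_0 simp: J_closed)

lemma rep_mult:
  assumes R: "subring_like R" and g: "\<And>i. k \<le> i \<Longrightarrow> rep R k (g * w i)" and "rep R k u"
  shows "rep R k (g * u)"
proof -
  obtain N c where c: "\<And>i. c i \<in> R \<and> (i < k \<longrightarrow> c i = 0) \<and> (N \<le> i \<longrightarrow> c i = 0)" "u \<approx>\<^sub>J (\<Sum>i<N. c i *q w i)"
    using assms(3) unfolding rep_def by blast
  have "g * u \<approx>\<^sub>J (\<Sum>i<N. c i *q (g * w i))"
    using cong_J_mult[OF c(2), of g] by (simp add: sum_distrib_left)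
  moreover have "rep R k (\<Sum>i<N. c i *q (g * w i))"
  proof (rule rep_sum[OF R])
    fix i
    show "rep R k (c i *q (g * w i))"
    proof (cases "i < k")
      case True
      then have "c i = 0" using c(1) by blast
      then show ?thesis using rep_0[OF R] by (simp add: J_closed)
    next
      case False
      then show ?thesis using rep_scale[OF R g] c(1) by simp
    qed
  qed
  ultimately show ?thesis using rep_cong by blast
qed

lemma subring_like_UNIV: "subring_like UNIV" and subring_like_laurent: "subring_like laurent"
  by (auto simp: subring_like_def)

text \<open>The elements represented by the \<open>w i\<close> with i > n form a left ideal
  containing \<open>J\<close>. It is proper by independence of K-eigenvectors, so maximality of
  \<open>J\<close> forces it into \<open>J\<close>.\<close>

lemma w_in: "n < i \<Longrightarrow> w i \<in> J"
proof -
  define J' where "J' = {u. rep UNIV (Suc n) u}"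
  note U = subring_like_UNIV
  have gens: "rep UNIV (Suc n) (uq_gen g * w i)" if i: "Suc n \<le> i" for g i
  proof (cases g)
    case Gen_E
    \<comment> \<open>E is the only generator that lowers the index. At the boundary i = n + 1 its
      coefficient is [0] = 0, so the range i > n is not left.\<close>
    have "uq_gen Gen_E * w i \<approx>\<^sub>J q_int (int n - int i + 1) *q w (i - 1)"
      using E_w[of 1 i] i by (simp add: div_E_def q_fact_def uqs.s_one)
    moreover have "rep UNIV (Suc n) (q_int (int n - int i + 1) *q w (i - 1))"
    proof (cases "i = Suc n")
      case True
      then show ?thesis using rep_0[OF U] by (simp add: J_closed)
    next
      case False
      then show ?thesis using i by (intro rep_w[OF U]) auto
    qed
    ultimately show ?thesis using rep_cong Gen_E by blast
  next
    case Gen_F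
    have "uq_gen Gen_F * w i = q_binom (int (1 + i)) 1 *q w (1 + i)"
      using F_w[of 1 i] by (simp add: div_F_def q_fact_def uqs.s_one)
    then show ?thesis using rep_w[OF U, of "Suc n" "1 + i"] i Gen_F by simp
  next
    case Gen_K
    then show ?thesis using rep_cong[OF rep_w[OF U, of "Suc n" i] K_w] i by simp
  next
    case Gen_Kinv
    then show ?thesis using rep_cong[OF rep_w[OF U, of "Suc n" i] Kinv_w] i by simp
  qed
  have mult: "\<forall>x. rep UNIV (Suc n) x \<longrightarrow> rep UNIV (Suc n) (u * x)" for u
  proof (induction u rule: uq_induct)
    case (scalar c)
    then show ?case using rep_scale[OF U] by (simp add: uq_scale_eq)
  next
    case (gen g)
    then show ?case using rep_mult[OF U gens] by blast
  next
    case (add x y)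
    then show ?case using rep_add[OF U] by (simp add: distrib_right)
  qed (simp add: mult.assoc)
  have "left_ideal J'"
    unfolding left_ideal_def diff_closed_def
  proof (intro conjI ballI allI)
    fix x y assume xy: "x \<in> J'" "y \<in> J'"
    have "rep UNIV (Suc n) (x + (- 1) *q y)"
      using xy by (intro rep_add[OF U] rep_scale[OF U]) (auto simp: J'_def)
    then show "x - y \<in> J'" by (simp add: J'_def)
  qed (use mult rep_0[OF U] J_closed(1) in \<open>auto simp: J'_def\<close>)
  moreover have "J \<subseteq> J'" using rep_0[OF U] by (auto simp: J'_def)
  moreover have "1 \<notin> J'"
  proof
    assume "1 \<in> J'"
    then obtain N c where c: "\<And>i. i < Suc n \<Longrightarrow> c i = 0" "1 \<approx>\<^sub>J (\<Sum>i<N. c i *q w i)"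
      unfolding J'_def rep_def by blast
    \<comment> \<open>The membership of 1 - (sum of the \<open>c i *q w i\<close>) in
      \<open>J\<close> is rewritten as one combination over i <= N with coefficient 1 at
      \<open>w 0 = 1\<close>. The correction \<open>d'\<close> restores the entry at index N, which
      the given sum does not contain.\<close>
    define d where "d i = (if i = 0 then 1 else - c i)" for i
    have "(\<Sum>i<Suc N. d i *q w i) = 1 - (\<Sum>i<N. c (Suc i) *q w (Suc i))"
      unfolding sum.lessThan_Suc_shift by (simp add: d_def sum_negf)
    also have "(\<Sum>i<N. c (Suc i) *q w (Suc i)) = (\<Sum>i<Suc N. c i *q w i)"
      unfolding sum.lessThan_Suc_shift using c(1)[of 0] by simp
    finally have s: "(\<Sum>i<Suc N. d i *q w i) = (1 - (\<Sum>i<N. c i *q w i)) - c N *q w N" by simp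
    define d' where "d' i = (if i = N then d i + c N else d i)" for i
    have "(\<Sum>i<Suc N. d' i *q w i) = (\<Sum>i<Suc N. d i *q w i) + c N *q w N"
      by (simp add: d'_def uqv.scale_left_distrib)
    then have "(\<Sum>i<Suc N. d' i *q w i) \<in> J" using s c(2) by (simp add: cong_J_def)
    then have "d' 0 *q w 0 \<in> J" by (rule w_independent[rotated]) auto
    moreover have "d' 0 = 1" using c(1)[of 0] by (auto simp: d'_def d_def)
    ultimately show False using one_J by simp
  qed
  ultimately have "J' \<subseteq> J" by (rule maximal)
  then show "w i \<in> J" if "n < i"
    using rep_w[OF U, of "Suc n" i 1] that by (auto simp: J'_def)
qed

definition cf :: "uq \<Rightarrow> nat \<Rightarrow> qfield" where
  "cf u = (SOME c. (\<forall>i. c i \<in> laurent) \<and> u \<approx>\<^sub>J (\<Sum>i\<le>n. c i *q w i))"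

text \<open>Each generator of U_A sends \<open>w i\<close> to a Laurent combination of such elements
  modulo \<open>J\<close>, and those with index above n lie in \<open>J\<close>. So the
  \<open>w i\<close> with i <= n span the lattice over A.\<close>

lemma ex_cf:
  assumes "u \<in> U_A"
  shows "\<exists>c. (\<forall>i. c i \<in> laurent) \<and> u \<approx>\<^sub>J (\<Sum>i\<le>n. c i *q w i)"
proof -
  note U = subring_like_laurent
  have "\<forall>x. rep laurent 0 x \<longrightarrow> rep laurent 0 (u * x)"
    using assms
  proof (induction rule: U_A_induct)
    case (scalar c)
    then show ?case using rep_scale[OF U] by (simp add: uq_scale_eq)
  next
    case (E k)
    have "rep laurent 0 (div_E k * w i)" for i
      using rep_cong[OF rep_w[OF U] E_w[of k i]] rep_cong[OF rep_0[OF U] E_w_0[of i k]]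
      by (cases "k \<le> i") (auto simp: J_closed)
    then show ?case using rep_mult[OF U] by blast
  next
    case (F k)
    have "rep laurent 0 (div_F k * w i)" for i
      unfolding F_w by (intro rep_w[OF U]) auto
    then show ?case using rep_mult[OF U] by blast
  next
    case K
    show ?case using rep_mult[OF U rep_cong[OF rep_w[OF U] K_w]] by simp
  next
    case Kinv
    show ?case using rep_mult[OF U rep_cong[OF rep_w[OF U] Kinv_w]] by simp
  next
    case (uminus x)
    have "- (x * y) = (- 1) *q (x * y)" for y by simp
    then show ?case using uminus rep_scale[OF U, of 0 _ "- 1"] by (metis laurent_closed(1,2) mult_minus_left)
  next
    case (add x y)
    then show ?case using rep_add[OF U] by (simp add: distrib_right)
  qed (simp add: mult.assoc)
  moreover have "rep laurent 0 1" using rep_w[OF U, of 0 0 1] by simp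
  ultimately have "rep laurent 0 u" by fastforce
  then obtain N c where c: "\<And>i. c i \<in> laurent \<and> (N \<le> i \<longrightarrow> c i = 0)" "u \<approx>\<^sub>J (\<Sum>i<N. c i *q w i)"
    unfolding rep_def by blast
  have "(\<Sum>i<N. c i *q w i) = (\<Sum>i<max N (Suc n). c i *q w i)"
    using c(1) by (auto intro!: sum.mono_neutral_left) (metis not_le)
  also have "\<dots> \<approx>\<^sub>J (\<Sum>i<max N (Suc n). if i \<le> n then c i *q w i else 0)"
    by (intro cong_J_sum) (auto simp: cong_J_0 intro!: J_scale w_in)
  also have "\<dots> = (\<Sum>i\<le>n. c i *q w i)"
    by (intro sum.mono_neutral_cong_right) auto
  finally show ?thesis using c cong_J_trans by blast
qed

lemma cf_laurent [simp]: "u \<in> U_A \<Longrightarrow> cf u i \<in> laurent"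
  and cf_cong: "u \<in> U_A \<Longrightarrow> u \<approx>\<^sub>J (\<Sum>i\<le>n. cf u i *q w i)"
  using someI_ex[OF ex_cf, of u] unfolding cf_def by blast+

lemma cf_unique:
  assumes "u \<in> U_A" "u \<approx>\<^sub>J (\<Sum>i\<le>n. d i *q w i)" "i \<le> n"
  shows "cf u i = d i"
proof -
  have "(\<Sum>i\<le>n. cf u i *q w i) \<approx>\<^sub>J (\<Sum>i\<le>n. d i *q w i)"
    using cf_cong[OF assms(1)] assms(2) cong_J_sym cong_J_trans by blast
  then have "(\<Sum>i\<le>n. (cf u i - d i) *q w i) \<in> J"
    by (simp add: cong_J_def uqv.scale_left_diff_distrib sum_subtractf)
  then have "(cf u i - d i) *q w i \<in> J" by (rule w_independent[rotated]) (use assms(3) in auto)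
  then show ?thesis using J_scaleD w_notin[OF assms(3)] by fastforce
qed

lemma cf_eqI: "u \<in> U_A \<Longrightarrow> u' \<in> U_A \<Longrightarrow> u \<approx>\<^sub>J u' \<Longrightarrow> i \<le> n \<Longrightarrow> cf u i = cf u' i"
  using cf_unique cf_cong cong_J_trans by blast

lemma cf_add: "u \<in> U_A \<Longrightarrow> u' \<in> U_A \<Longrightarrow> i \<le> n \<Longrightarrow> cf (u + u') i = cf u i + cf u' i"
  using cong_J_add[OF cf_cong cf_cong, of u u']
  by (intro cf_unique) (auto simp: uqv.scale_left_distrib sum.distrib)

lemma cf_scale: "u \<in> U_A \<Longrightarrow> a \<in> laurent \<Longrightarrow> i \<le> n \<Longrightarrow> cf (a *q u) i = a * cf u i"
  using cong_J_scale[OF cf_cong, of u a]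
  by (intro cf_unique) (auto simp: uqv.scale_sum_right)

lemma cf_mult:
  assumes "u \<in> U_A" "x \<in> U_A" "i \<le> n"
  shows "cf (u * x) i = (\<Sum>j\<le>n. cf (u * w j) i * cf x j)"
proof (rule cf_unique[OF _ _ assms(3)])
  have "u * x \<approx>\<^sub>J (\<Sum>j\<le>n. cf x j *q (u * w j))"
    using cong_J_mult[OF cf_cong[OF assms(2)], of u] by (simp add: sum_distrib_left)
  also have "\<dots> \<approx>\<^sub>J (\<Sum>j\<le>n. cf x j *q (\<Sum>i\<le>n. cf (u * w j) i *q w i))"
    using assms by (intro cong_J_sum cong_J_scale cf_cong) auto
  also have "\<dots> = (\<Sum>j\<le>n. \<Sum>i\<le>n. (cf (u * w j) i * cf x j) *q w i)"
    by (simp add: uqv.scale_sum_right mult.commute)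
  also have "\<dots> = (\<Sum>i\<le>n. (\<Sum>j\<le>n. cf (u * w j) i * cf x j) *q w i)"
    unfolding uqv.scale_sum_left by (rule sum.swap)
  finally show "u * x \<approx>\<^sub>J (\<Sum>i\<le>n. (\<Sum>j\<le>n. cf (u * w j) i * cf x j) *q w i)" .
qed (use assms in auto)

lemma cf_monomial:
  assumes "u \<in> U_A" "u \<approx>\<^sub>J a *q w k" "i \<le> n"
  shows "cf u i = (if i = k then a else 0)"
proof (cases "k \<le> n")
  case True
  then have "(\<Sum>j\<le>n. (if j = k then a else 0) *q w j) = a *q w k"
    by (simp add: if_distrib[of "\<lambda>a. a *q _"] cong: if_cong)
  then show ?thesis using cf_unique[of u "\<lambda>j. if j = k then a else 0"] assms by simp
next
  case False
  then have "u \<approx>\<^sub>J 0" using assms(2) w_in[of k] J_scale cong_J_trans[of u "a *q w k" 0] by (simp add: cong_J_0)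
  then show ?thesis using cf_unique[of u "\<lambda>j. 0"] assms False by simp
qed

end

definition frag_lin :: "('a \<Rightarrow> complex) \<Rightarrow> ('a \<Rightarrow>\<^sub>0 int) \<Rightarrow> complex" where
  "frag_lin h g = (\<Sum>k\<in>Poly_Mapping.keys g. of_int (Poly_Mapping.lookup g k) * h k)"

lemma frag_lin_superset:
  "finite S \<Longrightarrow> Poly_Mapping.keys g \<subseteq> S \<Longrightarrow> frag_lin h g = (\<Sum>k\<in>S. of_int (Poly_Mapping.lookup g k) * h k)"
  unfolding frag_lin_def by (intro sum.mono_neutral_left) (auto simp: in_keys_iff)

lemma frag_lin_0 [simp]: "frag_lin h 0 = 0" and frag_lin_of [simp]: "frag_lin h (frag_of k) = h k"
  by (simp_all add: frag_lin_def)

lemma frag_lin_add: "frag_lin h (f + g) = frag_lin h f + frag_lin h g"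
proof -
  let ?S = "Poly_Mapping.keys f \<union> Poly_Mapping.keys g"
  have "Poly_Mapping.keys (f + g) \<subseteq> ?S" by (rule Poly_Mapping.keys_add)
  then show ?thesis
    by (simp add: frag_lin_superset[of ?S] lookup_add distrib_right sum.distrib)
qed

lemma frag_lin_diff: "frag_lin h (f - g) = frag_lin h f - frag_lin h g"
  using frag_lin_add[of h "f - g" g] by simp

lemma frag_lin_sum: "frag_lin h (sum g I) = (\<Sum>i\<in>I. frag_lin h (g i))"
  by (induction I rule: infinite_finite_induct) (auto simp: frag_lin_add)

section \<open>A basis of the base change of a Weyl lattice\<close>

locale weyl_datum = specialization \<phi> for \<phi> :: "qfield \<Rightarrow> complex" +
  fixes L :: "(uq, 'w) module" and v :: 'w and n :: nat
  assumes simple: "simple_module class_ring L" and hw: "highest_weight_vector L n v"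
begin

sublocale L: left_module "class_ring :: uq ring" L
  using simple by (simp add: simple_module_def)

lemma v_in [simp]: "v \<in> carrier L" and v_nz: "v \<noteq> \<zero>\<^bsub>L\<^esub>"
  using hw by (auto simp: highest_weight_vector_def)

lemma L_smult_closed [simp]: "x \<in> carrier L \<Longrightarrow> u \<odot>\<^bsub>L\<^esub> x \<in> carrier L"
  using L.smult_closed by simp

lemma L_add_left: "x \<in> carrier L \<Longrightarrow> (u + u') \<odot>\<^bsub>L\<^esub> x = u \<odot>\<^bsub>L\<^esub> x \<oplus>\<^bsub>L\<^esub> u' \<odot>\<^bsub>L\<^esub> x"
  using L.smult_l_distr[of u u' x] by simp

lemma L_add_right: "x \<in> carrier L \<Longrightarrow> y \<in> carrier L \<Longrightarrow> u \<odot>\<^bsub>L\<^esub> (x \<oplus>\<^bsub>L\<^esub> y) = u \<odot>\<^bsub>L\<^esub> x \<oplus>\<^bsub>L\<^esub> u \<odot>\<^bsub>L\<^esub> y"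
  using L.smult_r_distr[of u x y] by simp

lemma L_mult: "x \<in> carrier L \<Longrightarrow> (u * u') \<odot>\<^bsub>L\<^esub> x = u \<odot>\<^bsub>L\<^esub> (u' \<odot>\<^bsub>L\<^esub> x)"
  using L.smult_assoc1[of u u' x] by simp

lemma L_one [simp]: "x \<in> carrier L \<Longrightarrow> 1 \<odot>\<^bsub>L\<^esub> x = x"
  using L.smult_one[of x] by simp

lemma L_zero_left [simp]: "x \<in> carrier L \<Longrightarrow> 0 \<odot>\<^bsub>L\<^esub> x = \<zero>\<^bsub>L\<^esub>"
  using L_add_left[of x 0 0] by (simp add: L.M.add.l_cancel_one)

lemma L_zero_right [simp]: "u \<odot>\<^bsub>L\<^esub> \<zero>\<^bsub>L\<^esub> = \<zero>\<^bsub>L\<^esub>"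
  using L_add_right[of "\<zero>\<^bsub>L\<^esub>" "\<zero>\<^bsub>L\<^esub>" u] L.M.add.l_cancel_one[of "u \<odot>\<^bsub>L\<^esub> \<zero>\<^bsub>L\<^esub>" "u \<odot>\<^bsub>L\<^esub> \<zero>\<^bsub>L\<^esub>"] by simp

lemma L_uminus: "x \<in> carrier L \<Longrightarrow> (- u) \<odot>\<^bsub>L\<^esub> x = \<ominus>\<^bsub>L\<^esub> (u \<odot>\<^bsub>L\<^esub> x)"
  using L_add_left[of x "- u" u] by (simp add: L.M.minus_equality[symmetric])

lemma L_diff_eq_0: "x \<in> carrier L \<Longrightarrow> (u - u') \<odot>\<^bsub>L\<^esub> x = \<zero>\<^bsub>L\<^esub> \<longleftrightarrow> u \<odot>\<^bsub>L\<^esub> x = u' \<odot>\<^bsub>L\<^esub> x"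
proof -
  assume x: "x \<in> carrier L"
  have "u \<odot>\<^bsub>L\<^esub> x = (u - u') \<odot>\<^bsub>L\<^esub> x \<oplus>\<^bsub>L\<^esub> u' \<odot>\<^bsub>L\<^esub> x"
    using L_add_left[OF x, of "u - u'" u'] by simp
  then show ?thesis using x L.M.add.r_cancel_one[of "u' \<odot>\<^bsub>L\<^esub> x" "(u - u') \<odot>\<^bsub>L\<^esub> x"] by auto
qed

definition J :: "uq set" where "J = {u. u \<odot>\<^bsub>L\<^esub> v = \<zero>\<^bsub>L\<^esub>}"

lemma left_ideal_J: "left_ideal J"
  unfolding left_ideal_def diff_closed_def by (auto simp: J_def L_mult L_diff_eq_0)

sublocale highest_weight_ideal J n
proof
  show "left_ideal J" by (rule left_ideal_J)
  show "U_E \<in> J" using hw by (simp add: J_def highest_weight_vector_def)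
  show "U_K - qpow (int n) *q 1 \<in> J"
    using hw by (simp add: J_def L_diff_eq_0 highest_weight_vector_def uq_scale_def)
  show "1 \<notin> J" using v_nz by (simp add: J_def)
next
  fix J' assume J': "left_ideal J'" "J \<subseteq> J'" "1 \<notin> J'"
  note J'c = diff_closedD[OF conjunct1[OF J'(1)[unfolded left_ideal_def]]]
  \<comment> \<open>The submodule \<open>J' v\<close> is zero or everything by simplicity. In the
    second case v = u v for some u in \<open>J'\<close>, so 1 - u annihilates v and 1 would lie in
    \<open>J'\<close>.\<close>
  define N where "N = (\<lambda>u. u \<odot>\<^bsub>L\<^esub> v) ` J'"
  have "subgroup N (add_monoid L)"
  proof (rule L.M.add.subgroupI)
    show "N \<subseteq> carrier L" by (auto simp: N_def)
    show "N \<noteq> {}" using J'c(1) by (auto simp: N_def)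
    show "\<ominus>\<^bsub>L\<^esub> x \<in> N" if "x \<in> N" for x
      using that J'c(3) by (auto simp: N_def L_uminus[symmetric])
    show "x \<oplus>\<^bsub>L\<^esub> y \<in> N" if "x \<in> N" "y \<in> N" for x y
      using that J'c(4) by (auto simp: N_def L_add_left[symmetric])
  qed
  moreover have "u \<odot>\<^bsub>L\<^esub> x \<in> N" if "x \<in> N" for u x
    using that J'(1) by (auto simp: N_def L_mult[symmetric] left_ideal_def)
  ultimately have "Module.submodule N class_ring L"
    by (intro Module.submodule.intro Module.submodule_axioms.intro) auto
  then have "N = {\<zero>\<^bsub>L\<^esub>} \<or> N = carrier L" using simple by (simp add: simple_module_def)
  then show "J' \<subseteq> J"
  proof
    assume "N = {\<zero>\<^bsub>L\<^esub>}"
    then show ?thesis by (auto simp: N_def J_def)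
  next
    assume "N = carrier L"
    then obtain u where u: "u \<in> J'" "u \<odot>\<^bsub>L\<^esub> v = v" using v_in unfolding N_def by (metis imageE)
    then have "1 - u \<in> J" by (simp add: J_def L_diff_eq_0)
    then have "(1 - u) + u \<in> J'" using J'(2) u J'c(4) by blast
    then show ?thesis using J'(3) by simp
  qed
qed

abbreviation "W \<equiv> weyl_lattice L v"

lemma W_simps [simp]: "carrier W = (\<lambda>u. u \<odot>\<^bsub>L\<^esub> v) ` U_A" "add W = add L" "smult W = smult L"
  by (simp_all add: weyl_lattice_def)

sublocale W: lattice \<phi> W
  by unfold_locales (auto simp: L_add_left[symmetric] L_mult[symmetric] distrib_left distrib_right mult.assoc)

lemma smult_v_eq_iff: "u \<odot>\<^bsub>L\<^esub> v = u' \<odot>\<^bsub>L\<^esub> v \<longleftrightarrow> cong_J u u'"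
  unfolding cong_J_def by (simp add: J_def L_diff_eq_0)

definition xc :: "'w \<Rightarrow> nat \<Rightarrow> qfield" where
  "xc x = cf (SOME u. u \<in> U_A \<and> u \<odot>\<^bsub>L\<^esub> v = x)"

lemma xc_eq: "u \<in> U_A \<Longrightarrow> i \<le> n \<Longrightarrow> xc (u \<odot>\<^bsub>L\<^esub> v) i = cf u i"
proof -
  assume u: "u \<in> U_A" "i \<le> n"
  let ?u = "SOME u'. u' \<in> U_A \<and> u' \<odot>\<^bsub>L\<^esub> v = u \<odot>\<^bsub>L\<^esub> v"
  have "?u \<in> U_A \<and> ?u \<odot>\<^bsub>L\<^esub> v = u \<odot>\<^bsub>L\<^esub> v" by (rule someI[of _ u]) (simp add: u)
  then show ?thesis unfolding xc_def using u by (intro cf_eqI) (auto simp: smult_v_eq_iff)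
qed

text \<open>The coordinate along F^(i) v, defined on formal sums of tensors. It vanishes on the
  relators, hence descends to the base change.\<close>

definition \<chi> :: "nat \<Rightarrow> ('w \<times> complex \<Rightarrow>\<^sub>0 int) \<Rightarrow> complex" where
  "\<chi> i = frag_lin (\<lambda>(x, d). \<phi> (xc x i) * d)"

lemma \<chi>_of: "u \<in> U_A \<Longrightarrow> i \<le> n \<Longrightarrow> \<chi> i (frag_of (u \<odot>\<^bsub>L\<^esub> v, d)) = \<phi> (cf u i) * d"
  by (simp add: \<chi>_def xc_eq)

lemma \<chi>_0 [simp]: "\<chi> i 0 = 0" and \<chi>_add: "\<chi> i (f + g) = \<chi> i f + \<chi> i g"
  and \<chi>_diff: "\<chi> i (f - g) = \<chi> i f - \<chi> i g" and \<chi>_sum: "\<chi> i (sum h I) = (\<Sum>j\<in>I. \<chi> i (h j))"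
  by (simp_all add: \<chi>_def frag_lin_add frag_lin_diff frag_lin_sum)

lemma \<chi>_H:
  assumes "g \<in> W.H" "i \<le> n"
  shows "\<chi> i g = 0"
  using assms(1)
proof (induction g rule: W.tensor_subgroup_induct)
  case (relator r)
  then consider x y c where "r = frag_of (x \<oplus>\<^bsub>L\<^esub> y, c) - frag_of (x, c) - frag_of (y, c)" "x \<in> carrier W" "y \<in> carrier W"
    | x c d where "r = frag_of (x, c + d) - frag_of (x, c) - frag_of (x, d)" "x \<in> carrier W"
    | a x c where "r = frag_of (uq_scalar a \<odot>\<^bsub>L\<^esub> x, c) - frag_of (x, \<phi> a * c)" "a \<in> laurent" "x \<in> carrier W"
    unfolding tensor_relators_def W_simps(2,3) by blast
  then show ?case
  proof cases
    case 1
    then obtain u u' where "x = u \<odot>\<^bsub>L\<^esub> v" "y = u' \<odot>\<^bsub>L\<^esub> v" "u \<in> U_A" "u' \<in> U_A" by auto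
    then show ?thesis using 1(1) assms(2)
      by (simp add: \<chi>_diff L_add_left[symmetric] \<chi>_of cf_add \<phi>_add distrib_right)
  next
    case 2
    then obtain u where "x = u \<odot>\<^bsub>L\<^esub> v" "u \<in> U_A" by auto
    then show ?thesis using 2(1) assms(2) by (simp add: \<chi>_diff \<chi>_of distrib_left)
  next
    case 3
    then obtain u where u: "x = u \<odot>\<^bsub>L\<^esub> v" "u \<in> U_A" by auto
    have "uq_scalar a \<odot>\<^bsub>L\<^esub> x = (a *q u) \<odot>\<^bsub>L\<^esub> v" by (simp add: u uq_scale_def L_mult)
    then show ?thesis using 3(1,2) assms(2) u by (simp add: \<chi>_diff \<chi>_of cf_scale \<phi>_mult)
  qed
qed (simp_all add: \<chi>_diff)

abbreviation "bs i \<equiv> w i \<odot>\<^bsub>L\<^esub> v"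

lemma cf_w: "i \<le> n \<Longrightarrow> cf (w j) i = (if i = j then 1 else 0)"
  using cf_monomial[of "w j" 1 j i] by simp

lemma \<chi>_basis: "i \<le> n \<Longrightarrow> \<chi> i (\<Sum>j\<le>n. frag_of (bs j, c j)) = c i"
  by (simp add: \<chi>_sum \<chi>_of cf_w if_distrib[of \<phi>] if_distrib[of "\<lambda>x. x * _"] cong: if_cong)

lemma bs_in: "bs i \<in> carrier W"
  by simp

text \<open>The spanning half of the statement that the F^(i) v \<otimes> 1 with i <= n form a
  basis; \<open>\<chi>_basis\<close> together with \<open>\<chi>_H\<close> is the independence
  half.\<close>

lemma expand:
  assumes "W.free g"
  shows "g - (\<Sum>i\<le>n. frag_of (bs i, \<chi> i g)) \<in> W.H"
  using assms
proof (induction g rule: free_frag_induct)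
  case (diff f g)
  have "(\<Sum>i\<le>n. frag_of (bs i, \<chi> i f)) - (\<Sum>i\<le>n. frag_of (bs i, \<chi> i g)) - (\<Sum>i\<le>n. frag_of (bs i, \<chi> i (f - g)))
      = (\<Sum>i\<le>n. frag_of (bs i, \<chi> i f) - frag_of (bs i, \<chi> i g) - frag_of (bs i, \<chi> i (f - g)))"
    by (simp add: sum_subtractf)
  also have "\<dots> \<in> W.H"
  proof -
    have "frag_of (bs i, \<chi> i f) - frag_of (bs i, \<chi> i g) - frag_of (bs i, \<chi> i (f - g)) \<in> W.H" for i
      using W.relator_add_right[OF bs_in, of i "\<chi> i g" "\<chi> i (f - g)"] by (simp add: \<chi>_diff)
    then have "(\<Sum>i\<in>I. frag_of (bs i, \<chi> i f) - frag_of (bs i, \<chi> i g) - frag_of (bs i, \<chi> i (f - g))) \<in> W.H" for I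
      by (induction I rule: infinite_finite_induct) (auto intro: W.H_closed)
    then show ?thesis .
  qed
  finally have "(\<Sum>i\<le>n. frag_of (bs i, \<chi> i f)) - (\<Sum>i\<le>n. frag_of (bs i, \<chi> i g))
      - (\<Sum>i\<le>n. frag_of (bs i, \<chi> i (f - g))) \<in> W.H" .
  from W.H_closed(4)[OF W.H_closed(2)[OF diff(3,4)] this] show ?case by (simp add: algebra_simps)
next
  case zero
  have "frag_of (bs i, 0) \<in> W.H" for i
    using W.H_closed(3)[OF W.relator_add_right[OF bs_in, of i 0 0]] by simp
  then have "(\<Sum>i\<in>I. frag_of (bs i, 0)) \<in> W.H" for I
    by (induction I rule: infinite_finite_induct) (auto intro: W.H_closed)
  then have "- (\<Sum>i\<le>n. frag_of (bs i, 0)) \<in> W.H" by (rule W.H_closed(3))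
  then show ?case by simp
next
  case (frag a)
  then obtain u d where a: "a = (u \<odot>\<^bsub>L\<^esub> v, d)" "u \<in> U_A" by auto
  \<comment> \<open>An additivity relator splits off one summand at a time, and a balancing relator
    then moves its Laurent coefficient into the complex factor.\<close>
  have part: "(\<Sum>i<k. cf u i *q w i) \<in> U_A \<and>
      frag_of ((\<Sum>i<k. cf u i *q w i) \<odot>\<^bsub>L\<^esub> v, d) - (\<Sum>i<k. frag_of (bs i, \<phi> (cf u i) * d)) \<in> W.H" for k
  proof (induction k)
    case 0
    have "frag_of (0 \<odot>\<^bsub>L\<^esub> v, d) \<in> W.H"
    proof -
      have z: "0 \<odot>\<^bsub>L\<^esub> v \<in> carrier W" by (simp only: W_simps) (rule imageI, simp)
      show ?thesis using W.H_closed(3)[OF W.relator_add_left[OF z z, of d]] by simp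
    qed
    then show ?case by simp
  next
    case (Suc k)
    let ?S = "\<Sum>i<k. cf u i *q w i"
    have inW: "?S \<odot>\<^bsub>L\<^esub> v \<in> carrier W" "(cf u k *q w k) \<odot>\<^bsub>L\<^esub> v \<in> carrier W"
      unfolding W_simps using Suc a(2) by auto
    have r1: "frag_of (?S \<odot>\<^bsub>L\<^esub> v \<oplus>\<^bsub>L\<^esub> (cf u k *q w k) \<odot>\<^bsub>L\<^esub> v, d) - frag_of (?S \<odot>\<^bsub>L\<^esub> v, d)
        - frag_of ((cf u k *q w k) \<odot>\<^bsub>L\<^esub> v, d) \<in> W.H"
      using W.relator_add_left[OF inW, of d] by simp
    have r2: "frag_of ((cf u k *q w k) \<odot>\<^bsub>L\<^esub> v, d) - frag_of (bs k, \<phi> (cf u k) * d) \<in> W.H"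
      using W.relator_scalar[OF bs_in, of "cf u k" k d] a(2) by (simp add: uq_scale_def L_mult)
    have "frag_of ((\<Sum>i<Suc k. cf u i *q w i) \<odot>\<^bsub>L\<^esub> v, d) - (\<Sum>i<Suc k. frag_of (bs i, \<phi> (cf u i) * d))
       = (frag_of (?S \<odot>\<^bsub>L\<^esub> v \<oplus>\<^bsub>L\<^esub> (cf u k *q w k) \<odot>\<^bsub>L\<^esub> v, d) - frag_of (?S \<odot>\<^bsub>L\<^esub> v, d)
        - frag_of ((cf u k *q w k) \<odot>\<^bsub>L\<^esub> v, d))
       + (frag_of (?S \<odot>\<^bsub>L\<^esub> v, d) - (\<Sum>i<k. frag_of (bs i, \<phi> (cf u i) * d)))
       + (frag_of ((cf u k *q w k) \<odot>\<^bsub>L\<^esub> v, d) - frag_of (bs k, \<phi> (cf u k) * d))"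
      by (simp add: L_add_left)
    also have "\<dots> \<in> W.H" using r1 r2 Suc by (intro W.H_closed(4)) auto
    finally show ?case using Suc a(2) by simp
  qed
  have e: "(\<Sum>i\<le>n. cf u i *q w i) \<odot>\<^bsub>L\<^esub> v = u \<odot>\<^bsub>L\<^esub> v"
    unfolding smult_v_eq_iff by (rule cong_J_sym[OF cf_cong[OF a(2)]])
  have "(\<Sum>i\<le>n. frag_of (bs i, \<chi> i (frag_of a))) = (\<Sum>i\<le>n. frag_of (bs i, \<phi> (cf u i) * d))"
    using a by (intro sum.cong refl) (simp add: \<chi>_of)
  then show ?case using part[of "Suc n"] a(1) unfolding lessThan_Suc_atMost e by simp
qed

lemma \<chi>_tact:
  assumes "W.free g" "u \<in> U_A" "i \<le> n"
  shows "\<chi> i (W.tact (frag_of (u, c)) g) = c * (\<Sum>j\<le>n. \<phi> (cf (u * w j) i) * \<chi> j g)"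
  using assms(1)
proof (induction g rule: free_frag_induct)
  case (diff f g)
  then show ?case by (simp add: tensor_act_diff_right \<chi>_diff right_diff_distrib sum_subtractf)
next
  case (frag a)
  then obtain x d where a: "a = (x \<odot>\<^bsub>L\<^esub> v, d)" "x \<in> U_A" by auto
  have "\<chi> i (W.tact (frag_of (u, c)) (frag_of a)) = \<phi> (cf (u * x) i) * (c * d)"
    using a assms by (simp add: L_mult[symmetric] \<chi>_of)
  also have "\<phi> (cf (u * x) i) = (\<Sum>j\<le>n. \<phi> (cf (u * w j) i) * \<phi> (cf x j))"
    unfolding cf_mult[OF assms(2) a(2) assms(3)] using assms a by (simp add: \<phi>_sum \<phi>_mult)
  finally show ?case using a by (simp add: \<chi>_of sum_distrib_left sum_distrib_right mult_ac)
qed simp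

abbreviation "B \<equiv> base_change \<phi> W"

definition \<kappa> :: "('w \<times> complex \<Rightarrow>\<^sub>0 int) set \<Rightarrow> nat \<Rightarrow> complex" where
  "\<kappa> X i = \<chi> i (SOME g. W.free g \<and> X = coset W.H g)"

lemma \<kappa>_coset: "W.free g \<Longrightarrow> i \<le> n \<Longrightarrow> \<kappa> (coset W.H g) i = \<chi> i g"
proof -
  assume g: "W.free g" "i \<le> n"
  let ?g = "SOME g'. W.free g' \<and> coset W.H g = coset W.H g'"
  have "W.free ?g \<and> coset W.H g = coset W.H ?g" by (rule someI[of _ g]) (intro conjI g(1) refl)
  then have "g - ?g \<in> W.H" by (simp add: coset_eq_iff[OF W.diff_closed_H])
  then have "\<chi> i (g - ?g) = 0" using \<chi>_H g by blast
  then show ?thesis by (simp add: \<kappa>_def \<chi>_diff)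
qed

lemma W_free_add: "W.free f \<Longrightarrow> W.free g \<Longrightarrow> W.free (f + g)"
  using Poly_Mapping.keys_add[of f g] by blast

lemma W_free_basis: "W.free (\<Sum>j\<in>I. frag_of (bs j, c j))"
proof (rule order_trans[OF Poly_Mapping.keys_sum])
  show "(\<Union>j\<in>I. Poly_Mapping.keys (frag_of (bs j, c j))) \<subseteq> carrier W \<times> UNIV"
    using bs_in by (auto simp del: W_simps)
qed

lemma \<kappa>_add: "X \<in> carrier B \<Longrightarrow> Y \<in> carrier B \<Longrightarrow> i \<le> n \<Longrightarrow> \<kappa> (X \<oplus>\<^bsub>B\<^esub> Y) i = \<kappa> X i + \<kappa> Y i"
  using W_free_add by (auto simp: W.carrier_base_change W.base_change_add \<kappa>_coset \<chi>_add simp del: W_simps)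

lemma B_smult_coset:
  assumes "W.free g" "u \<in> U_A"
  shows "pure_tensor \<phi> u c \<odot>\<^bsub>B\<^esub> coset W.H g = coset W.H (W.tact (frag_of (u, c)) g)"
    and "W.free (W.tact (frag_of (u, c)) g)"
proof -
  have fu: "W.free_U (frag_of (u, c))" using assms(2) by simp
  show "pure_tensor \<phi> u c \<odot>\<^bsub>B\<^esub> coset W.H g = coset W.H (W.tact (frag_of (u, c)) g)"
    unfolding pure_tensor_eq by (rule W.base_change_smult[OF fu assms(1)])
  show "W.free (W.tact (frag_of (u, c)) g)" by (rule W.free_tact[OF fu assms(1)])
qed

lemma \<kappa>_smult:
  assumes "X \<in> carrier B" "u \<in> U_A" "i \<le> n"
  shows "\<kappa> (pure_tensor \<phi> u c \<odot>\<^bsub>B\<^esub> X) i = c * (\<Sum>j\<le>n. \<phi> (cf (u * w j) i) * \<kappa> X j)"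
proof -
  obtain g where g: "X = coset W.H g" "W.free g" using assms(1) unfolding W.carrier_base_change by blast
  have "(\<Sum>j\<le>n. \<phi> (cf (u * w j) i) * \<chi> j g) = (\<Sum>j\<le>n. \<phi> (cf (u * w j) i) * \<kappa> X j)"
    using g by (intro sum.cong refl) (simp add: \<kappa>_coset del: W_simps)
  then show ?thesis
    unfolding g(1) B_smult_coset(1)[OF g(2) assms(2)] \<kappa>_coset[OF B_smult_coset(2)[OF g(2) assms(2)] assms(3)]
      \<chi>_tact[OF g(2) assms(2,3)] by simp
qed

lemma \<kappa>_scal: "X \<in> carrier B \<Longrightarrow> i \<le> n \<Longrightarrow> \<kappa> (pure_tensor \<phi> 1 c \<odot>\<^bsub>B\<^esub> X) i = c * \<kappa> X i"
  by (simp add: \<kappa>_smult cf_w if_distrib[of \<phi>] if_distrib[of "\<lambda>x. x * _"] cong: if_cong)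

lemma \<kappa>_surj: "\<exists>X\<in>carrier B. \<forall>i\<le>n. \<kappa> X i = c i"
  using W_free_basis[of c "{..n}"] \<chi>_basis
  by (intro bexI[of _ "coset W.H (\<Sum>j\<le>n. frag_of (bs j, c j))"])
    (auto simp: W.carrier_base_change \<kappa>_coset simp del: W_simps)

lemma B_expand: "X \<in> carrier B \<Longrightarrow> X = coset W.H (\<Sum>j\<le>n. frag_of (bs j, \<kappa> X j))"
proof -
  assume "X \<in> carrier B"
  then obtain g where g: "X = coset W.H g" "W.free g" unfolding W.carrier_base_change by blast
  have "(\<Sum>j\<le>n. frag_of (bs j, \<kappa> X j)) = (\<Sum>j\<le>n. frag_of (bs j, \<chi> j g))"
    using g by (intro sum.cong refl) (simp add: \<kappa>_coset del: W_simps)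
  then show ?thesis
    unfolding g(1) coset_eq_iff[OF W.diff_closed_H] using expand[OF g(2)] by simp
qed

lemma \<kappa>_inj: "X \<in> carrier B \<Longrightarrow> Y \<in> carrier B \<Longrightarrow> (\<And>i. i \<le> n \<Longrightarrow> \<kappa> X i = \<kappa> Y i) \<Longrightarrow> X = Y"
  using B_expand[of X] B_expand[of Y] by simp

lemma B_add_closed: "X \<in> carrier B \<Longrightarrow> Y \<in> carrier B \<Longrightarrow> X \<oplus>\<^bsub>B\<^esub> Y \<in> carrier B"
  using W_free_add by (auto simp: W.carrier_base_change W.base_change_add simp del: W_simps)

lemma B_smult_closed: "X \<in> carrier B \<Longrightarrow> u \<in> U_A \<Longrightarrow> pure_tensor \<phi> u c \<odot>\<^bsub>B\<^esub> X \<in> carrier B"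
  unfolding W.carrier_base_change by (auto simp: B_smult_coset simp del: W_simps intro!: imageI)

definition bb :: "nat \<Rightarrow> ('w \<times> complex \<Rightarrow>\<^sub>0 int) set" where
  "bb j = coset W.H (frag_of (bs j, 1))"

lemma bb_in: "bb j \<in> carrier B"
  by (auto simp: bb_def W.carrier_base_change bs_in simp del: W_simps)

lemma \<kappa>_bb: "i \<le> n \<Longrightarrow> \<kappa> (bb j) i = (if i = j then 1 else 0)"
  by (simp add: bb_def \<kappa>_coset \<chi>_of cf_w)

lemma functional_expand:
  assumes f: "f \<in> LinearCombinations.module_hom class_ring (cspace \<phi> B) complex_line" and X: "X \<in> carrier B"
  shows "f X = (\<Sum>j\<le>n. \<kappa> X j * f (bb j))"
proof -
  have add: "f (Y \<oplus>\<^bsub>B\<^esub> Y') = f Y + f Y'" if "Y \<in> carrier B" "Y' \<in> carrier B" for Y Y'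
    using f that by (simp add: LinearCombinations.module_hom_def cspace_def complex_line_def)
  have sc: "f (pure_tensor \<phi> 1 c \<odot>\<^bsub>B\<^esub> Y) = c * f Y" if "Y \<in> carrier B" for c Y
    using f that by (simp add: LinearCombinations.module_hom_def cspace_def complex_line_def)
  have "f (coset W.H (\<Sum>j<k. frag_of (bs j, c j))) = (\<Sum>j<k. c j * f (bb j))" for k c
  proof (induction k)
    case 0
    have "coset W.H 0 \<in> carrier B" unfolding W.carrier_base_change by (intro imageI) simp
    then have "f (coset W.H 0 \<oplus>\<^bsub>B\<^esub> coset W.H 0) = f (coset W.H 0) + f (coset W.H 0)" by (rule add) fact
    then show ?case using W.base_change_add[of 0 0] by simp
  next
    case (Suc k)
    have fr: "W.free (frag_of (bs k, 1))" using bs_in by simp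
    have "pure_tensor \<phi> 1 (c k) \<odot>\<^bsub>B\<^esub> bb k = coset W.H (frag_of (bs k, c k))"
      using fr unfolding bb_def pure_tensor_eq by (subst W.base_change_smult) simp_all
    then have "f (coset W.H (frag_of (bs k, c k))) = c k * f (bb k)"
      using sc[OF bb_in] by metis
    moreover have "coset W.H (\<Sum>j<k. frag_of (bs j, c j)) \<in> carrier B"
      "coset W.H (frag_of (bs k, c k)) \<in> carrier B"
      using W_free_basis[of c "{..<k}"] W_free_basis[of c "{k}"]
      by (auto simp: W.carrier_base_change simp del: W_simps)
    ultimately show ?case using add Suc by (simp add: W.base_change_add[symmetric])
  qed
  from this[of "\<kappa> X" "Suc n"] show ?thesis
    using B_expand[OF X] by (simp add: lessThan_Suc_atMost)
qed

end

section \<open>Coordinates on the factors of a filtration\<close>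

context zeta_module
begin

text \<open>A common interface for Weyl and dual Weyl factors: P identifies the quotient of C' by C
  with a space of n + 1 coordinates in which index i has weight n - 2 i. P is constrained only on C'
  and for i <= n.\<close>

definition coordinates :: "'v set \<Rightarrow> 'v set \<Rightarrow> nat \<Rightarrow> ('v \<Rightarrow> nat \<Rightarrow> complex) \<Rightarrow> bool" where
  "coordinates C C' n P \<longleftrightarrow>
     (\<forall>x\<in>C'. \<forall>y\<in>C'. \<forall>i\<le>n. P (x \<oplus>\<^bsub>M\<^esub> y) i = P x i + P y i) \<and>
     (\<forall>c. \<forall>x\<in>C'. \<forall>i\<le>n. P (scal c x) i = c * P x i) \<and>
     (\<forall>x\<in>C'. x \<in> C \<longleftrightarrow> (\<forall>i\<le>n. P x i = 0)) \<and>
     (\<forall>c. \<exists>x\<in>C'. \<forall>i\<le>n. P x i = c i) \<and>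
     (\<forall>x\<in>C'. \<forall>i\<le>n. P (act U_K x) i = \<phi> (qpow (int n - 2 * int i)) * P x i \<and>
        (\<forall>r. P (act (K_binom r) x) i = \<phi> (q_binom (int n - 2 * int i) r) * P x i))"

text \<open>The projection composed with an isomorphism. The kernel is described by p x = p 0,
  because nothing is known about the zero entry of the record B.\<close>

definition quotient_map :: "'v set \<Rightarrow> 'v set \<Rightarrow> (u_zeta, 'b) module \<Rightarrow> ('v \<Rightarrow> 'b) \<Rightarrow> bool" where
  "quotient_map C C' B p \<longleftrightarrow> (\<forall>x\<in>C'. \<forall>y\<in>C'. p (x \<oplus>\<^bsub>M\<^esub> y) = p x \<oplus>\<^bsub>B\<^esub> p y) \<and>
     (\<forall>u\<in>U_A. \<forall>x\<in>C'. p (act u x) = pure_tensor \<phi> u 1 \<odot>\<^bsub>B\<^esub> p x) \<and>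
     (\<forall>c. \<forall>x\<in>C'. p (scal c x) = pure_tensor \<phi> 1 c \<odot>\<^bsub>B\<^esub> p x) \<and>
     p ` C' = carrier B \<and> (\<forall>x\<in>C'. x \<in> C \<longleftrightarrow> p x = p \<zero>\<^bsub>M\<^esub>)"

lemma quotient_mapD:
  assumes "quotient_map C C' B p"
  shows "x \<in> C' \<Longrightarrow> y \<in> C' \<Longrightarrow> p (x \<oplus>\<^bsub>M\<^esub> y) = p x \<oplus>\<^bsub>B\<^esub> p y"
    and "u \<in> U_A \<Longrightarrow> x \<in> C' \<Longrightarrow> p (act u x) = pure_tensor \<phi> u 1 \<odot>\<^bsub>B\<^esub> p x"
    and "p ` C' = carrier B" and "x \<in> C' \<Longrightarrow> x \<in> C \<longleftrightarrow> p x = p \<zero>\<^bsub>M\<^esub>"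
    and "x \<in> C' \<Longrightarrow> p (scal c x) = pure_tensor \<phi> 1 c \<odot>\<^bsub>B\<^esub> p x"
  using assms by (simp_all add: quotient_map_def)

lemma quotient_projection:
  assumes C: "Module.submodule C Z M" and C': "Module.submodule C' Z M" and sub: "C \<subseteq> C'"
    and iso: "module_isomorphic Z (quot_module (M\<lparr>carrier := C'\<rparr>) C) B"
  shows "\<exists>p. quotient_map C C' B p"
proof -
  define D where "D = quot_module (M\<lparr>carrier := C'\<rparr>) C"
  note sC = submoduleD[OF C] and sC' = submoduleD[OF C']
  define r where "r x = (\<lambda>h. h \<oplus>\<^bsub>M\<^esub> x) ` C" for x
  have rc: "C +>\<^bsub>M\<lparr>carrier := C'\<rparr>\<^esub> x = r x" for x
    by (auto simp: a_r_coset_def r_coset_def r_def)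
  have mem: "y \<in> r x \<longleftrightarrow> y \<oplus>\<^bsub>M\<^esub> (\<ominus>\<^bsub>M\<^esub> x) \<in> C" if "x \<in> carrier M" "y \<in> carrier M" for x y
  proof
    assume "y \<in> r x"
    then obtain h where "h \<in> C" "y = h \<oplus>\<^bsub>M\<^esub> x" by (auto simp: r_def)
    then show "y \<oplus>\<^bsub>M\<^esub> (\<ominus>\<^bsub>M\<^esub> x) \<in> C"
      using that sC(1) by (simp add: M.a_assoc M.r_neg subset_iff)
  next
    assume *: "y \<oplus>\<^bsub>M\<^esub> (\<ominus>\<^bsub>M\<^esub> x) \<in> C"
    have "y = (y \<oplus>\<^bsub>M\<^esub> (\<ominus>\<^bsub>M\<^esub> x)) \<oplus>\<^bsub>M\<^esub> x" using that by (simp add: M.a_assoc M.l_neg)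
    then show "y \<in> r x" unfolding r_def using * by blast
  qed
  have r_eq: "r x = r y \<longleftrightarrow> x \<oplus>\<^bsub>M\<^esub> (\<ominus>\<^bsub>M\<^esub> y) \<in> C" if xy: "x \<in> carrier M" "y \<in> carrier M" for x y
  proof
    assume "r x = r y"
    moreover have "x \<in> r x" using mem[OF xy(1) xy(1)] sC(2) xy by (simp add: M.r_neg)
    ultimately show "x \<oplus>\<^bsub>M\<^esub> (\<ominus>\<^bsub>M\<^esub> y) \<in> C" using mem xy by blast
  next
    assume d: "x \<oplus>\<^bsub>M\<^esub> (\<ominus>\<^bsub>M\<^esub> y) \<in> C"
    have "h \<oplus>\<^bsub>M\<^esub> x \<in> r y" if "h \<in> C" for h
    proof -
      have "(h \<oplus>\<^bsub>M\<^esub> x) \<oplus>\<^bsub>M\<^esub> (\<ominus>\<^bsub>M\<^esub> y) = h \<oplus>\<^bsub>M\<^esub> (x \<oplus>\<^bsub>M\<^esub> (\<ominus>\<^bsub>M\<^esub> y))"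
        using that xy sC(1) by (simp add: M.a_assoc subset_iff)
      then show ?thesis using mem[of y "h \<oplus>\<^bsub>M\<^esub> x"] sC(1,3) d that xy by (simp add: subset_iff)
    qed
    moreover have "h \<oplus>\<^bsub>M\<^esub> y \<in> r x" if "h \<in> C" for h
    proof -
      have "(h \<oplus>\<^bsub>M\<^esub> y) \<oplus>\<^bsub>M\<^esub> (\<ominus>\<^bsub>M\<^esub> x) = h \<oplus>\<^bsub>M\<^esub> (\<ominus>\<^bsub>M\<^esub> (x \<oplus>\<^bsub>M\<^esub> (\<ominus>\<^bsub>M\<^esub> y)))"
        using that xy sC(1) by (simp add: M.minus_add M.a_ac subset_iff)
      then show ?thesis using mem[of x "h \<oplus>\<^bsub>M\<^esub> y"] sC(1,3,6) d that xy by (simp add: subset_iff)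
    qed
    ultimately show "r x = r y" by (auto simp: r_def[of x] r_def[of y])
  qed
  have D_carrier: "carrier D = r ` C'"
    by (auto simp: D_def quot_module_def A_RCOSETS_def RCOSETS_def r_coset_def r_def)
  have D_add: "r x \<oplus>\<^bsub>D\<^esub> r y = r (x \<oplus>\<^bsub>M\<^esub> y)" if xy: "x \<in> carrier M" "y \<in> carrier M" for x y
  proof -
    have "r x \<oplus>\<^bsub>D\<^esub> r y = (\<Union>h\<in>r x. \<Union>k\<in>r y. {h \<oplus>\<^bsub>M\<^esub> k})"
      by (simp add: D_def quot_module_def set_add_def set_mult_def)
    also have "\<dots> = r (x \<oplus>\<^bsub>M\<^esub> y)"
    proof
      show "(\<Union>h\<in>r x. \<Union>k\<in>r y. {h \<oplus>\<^bsub>M\<^esub> k}) \<subseteq> r (x \<oplus>\<^bsub>M\<^esub> y)"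
      proof clarsimp
        fix h k assume "h \<in> r x" "k \<in> r y"
        then obtain h' k' where hk: "h' \<in> C" "k' \<in> C" "h = h' \<oplus>\<^bsub>M\<^esub> x" "k = k' \<oplus>\<^bsub>M\<^esub> y"
          by (auto simp: r_def)
        then have "h \<oplus>\<^bsub>M\<^esub> k = (h' \<oplus>\<^bsub>M\<^esub> k') \<oplus>\<^bsub>M\<^esub> (x \<oplus>\<^bsub>M\<^esub> y)"
          using sC(1) xy by (simp add: M.a_ac subset_iff)
        then show "h \<oplus>\<^bsub>M\<^esub> k \<in> r (x \<oplus>\<^bsub>M\<^esub> y)" unfolding r_def using sC(3) hk by blast
      qed
      show "r (x \<oplus>\<^bsub>M\<^esub> y) \<subseteq> (\<Union>h\<in>r x. \<Union>k\<in>r y. {h \<oplus>\<^bsub>M\<^esub> k})"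
      proof
        fix z assume "z \<in> r (x \<oplus>\<^bsub>M\<^esub> y)"
        then obtain h where h: "h \<in> C" "z = h \<oplus>\<^bsub>M\<^esub> (x \<oplus>\<^bsub>M\<^esub> y)" by (auto simp: r_def)
        then have "z = (h \<oplus>\<^bsub>M\<^esub> x) \<oplus>\<^bsub>M\<^esub> (\<zero>\<^bsub>M\<^esub> \<oplus>\<^bsub>M\<^esub> y)" using sC(1) xy by (simp add: M.a_ac subset_iff)
        then show "z \<in> (\<Union>h\<in>r x. \<Union>k\<in>r y. {h \<oplus>\<^bsub>M\<^esub> k})" unfolding r_def using h(1) sC(2) by blast
      qed
    qed
    finally show ?thesis .
  qed
  have D_smult: "X \<odot>\<^bsub>D\<^esub> r x = r (X \<odot>\<^bsub>M\<^esub> x)" if x: "x \<in> carrier M" and X: "X \<in> carrier Z" for X x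
  proof -
    have "r (X \<odot>\<^bsub>M\<^esub> (h \<oplus>\<^bsub>M\<^esub> x)) = r (X \<odot>\<^bsub>M\<^esub> x)" if h: "h \<in> C" for h
    proof -
      have hM: "h \<in> carrier M" using h sC(1) by blast
      have "X \<odot>\<^bsub>M\<^esub> (h \<oplus>\<^bsub>M\<^esub> x) \<oplus>\<^bsub>M\<^esub> (\<ominus>\<^bsub>M\<^esub> (X \<odot>\<^bsub>M\<^esub> x)) = X \<odot>\<^bsub>M\<^esub> h"
        using hM x X by (simp add: smult_r_distr smult_closed M.a_assoc M.r_neg)
      moreover have "X \<odot>\<^bsub>M\<^esub> h \<in> C" by (rule Module.submodule.smult_closed[OF C X h])
      ultimately show ?thesis
        using r_eq[of "X \<odot>\<^bsub>M\<^esub> (h \<oplus>\<^bsub>M\<^esub> x)" "X \<odot>\<^bsub>M\<^esub> x"] hM x X by (simp add: smult_closed)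
    qed
    moreover have "X \<odot>\<^bsub>D\<^esub> r x = (\<Union>y\<in>r x. r (X \<odot>\<^bsub>M\<^esub> y))"
      by (simp add: D_def quot_module_def rc)
    ultimately show ?thesis using sC(2) by (auto simp: r_def[of x])
  qed
  obtain f where f: "f \<in> LinearCombinations.module_hom Z D B" "bij_betw f (carrier D) (carrier B)"
    using iso by (auto simp: module_isomorphic_def D_def)
  have f_add: "f (X \<oplus>\<^bsub>D\<^esub> Y) = f X \<oplus>\<^bsub>B\<^esub> f Y" if "X \<in> carrier D" "Y \<in> carrier D" for X Y
    using f(1) that by (simp add: LinearCombinations.module_hom_def)
  have f_smult: "f (a \<odot>\<^bsub>D\<^esub> X) = a \<odot>\<^bsub>B\<^esub> f X" if "a \<in> carrier Z" "X \<in> carrier D" for a X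
    using f(1) that by (simp add: LinearCombinations.module_hom_def)
  show ?thesis
    unfolding quotient_map_def
  proof (intro exI[of _ "\<lambda>x. f (r x)"] conjI ballI allI)
    fix x y assume "x \<in> C'" "y \<in> C'"
    then show "f (r (x \<oplus>\<^bsub>M\<^esub> y)) = f (r x) \<oplus>\<^bsub>B\<^esub> f (r y)"
      using f_add[of "r x" "r y"] D_add[of x y] sC'(1) by (simp add: D_carrier subset_iff)
  next
    fix u x assume "u \<in> U_A" "x \<in> C'"
    then show "f (r (act u x)) = pure_tensor \<phi> u 1 \<odot>\<^bsub>B\<^esub> f (r x)"
      using f_smult[of "pure_tensor \<phi> u 1" "r x"] D_smult[of x "pure_tensor \<phi> u 1"] sC'(1)
      by (auto simp: D_carrier act_def)
  next
    fix c x assume "x \<in> C'"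
    then show "f (r (scal c x)) = pure_tensor \<phi> 1 c \<odot>\<^bsub>B\<^esub> f (r x)"
      using f_smult[of "pure_tensor \<phi> 1 c" "r x"] D_smult[of x "pure_tensor \<phi> 1 c"] sC'(1)
      by (auto simp: D_carrier scal_def)
  next
    show "(\<lambda>x. f (r x)) ` C' = carrier B"
      using f(2) by (auto simp: D_carrier bij_betw_def)
  next
    fix x assume x: "x \<in> C'"
    have "f (r x) = f (r \<zero>\<^bsub>M\<^esub>) \<longleftrightarrow> r x = r \<zero>\<^bsub>M\<^esub>"
      using f(2) x sC'(2) by (auto simp: bij_betw_def D_carrier inj_on_def)
    also have "\<dots> \<longleftrightarrow> x \<in> C"
      using r_eq[of x "\<zero>\<^bsub>M\<^esub>"] M.minus_equality[of "\<zero>\<^bsub>M\<^esub>" "\<zero>\<^bsub>M\<^esub>"] x sC'(1)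
      by (simp add: subset_iff)
    finally show "x \<in> C \<longleftrightarrow> f (r x) = f (r \<zero>\<^bsub>M\<^esub>)" by simp
  qed
qed

text \<open>The extra clause is the matrix of F: the basis vector i - 1 goes to [i] times the basis
  vector i. It is recorded for the injectivity of F.\<close>

lemma weyl_coordinates:
  assumes C: "Module.submodule C Z M" and C': "Module.submodule C' Z M" and sub: "C \<subseteq> C'"
    and weyl: "is_weyl \<phi> n (quot_module (M\<lparr>carrier := C'\<rparr>) C)"
  shows "\<exists>P. coordinates C C' n P \<and> (\<forall>x\<in>C'. \<forall>i\<le>n. P (act (div_F 1) x) i =
      (if i = 0 then 0 else \<phi> (q_int (int i)) * P x (i - 1)))"
proof -
  obtain L :: "(uq, uq set) module" and v where L: "simple_module class_ring L" "highest_weight_vector L n v"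
    "module_isomorphic Z (quot_module (M\<lparr>carrier := C'\<rparr>) C) (base_change \<phi> (weyl_lattice L v))"
    using weyl unfolding is_weyl_def by blast
  interpret weyl_datum \<phi> L v n by unfold_locales (use L in auto)
  obtain p where p0: "quotient_map C C' B p" using quotient_projection[OF C C' sub L(3)] by blast
  note p = quotient_mapD[OF p0]
  have pB: "p x \<in> carrier B" if "x \<in> C'" for x using p(3) that by blast
  note sC' = submoduleD[OF C']
  have P_act: "\<kappa> (p (act u x)) i = (\<Sum>j\<le>n. \<phi> (cf (u * w j) i) * \<kappa> (p x) j)" if "u \<in> U_A" "x \<in> C'" "i \<le> n" for u x i
    using that by (simp add: p(2) \<kappa>_smult pB)
  have diag: "\<kappa> (p (act u x)) i = \<phi> (a i) * \<kappa> (p x) i"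
    if "u \<in> U_A" "\<And>j. cong_J (u * w j) (a j *q w j)" "x \<in> C'" "i \<le> n" for u a x i
  proof -
    have "cf (u * w j) i = (if i = j then a j else 0)" for j
      using cf_monomial[of "u * w j" "a j" j i] that by simp
    then show ?thesis using that by (simp add: P_act if_distrib[of \<phi>] if_distrib[of "\<lambda>x. x * _"] cong: if_cong)
  qed
  have zero: "\<kappa> (p \<zero>\<^bsub>M\<^esub>) i = 0" if "i \<le> n" for i
    using \<kappa>_add[OF pB pB that, of "\<zero>\<^bsub>M\<^esub>" "\<zero>\<^bsub>M\<^esub>"] p(1)[of "\<zero>\<^bsub>M\<^esub>" "\<zero>\<^bsub>M\<^esub>"] sC'(2) by simp
  have "coordinates C C' n (\<lambda>x. \<kappa> (p x))"
    unfolding coordinates_def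
  proof (intro conjI ballI allI impI)
    fix x y i assume "x \<in> C'" "y \<in> C'" "i \<le> n"
    then show "\<kappa> (p (x \<oplus>\<^bsub>M\<^esub> y)) i = \<kappa> (p x) i + \<kappa> (p y) i" by (simp add: p(1) \<kappa>_add pB)
  next
    fix c x i assume "x \<in> C'" "i \<le> n"
    then show "\<kappa> (p (scal c x)) i = c * \<kappa> (p x) i" by (simp add: p(5) \<kappa>_scal pB)
  next
    fix x assume x: "x \<in> C'"
    then show "x \<in> C \<longleftrightarrow> (\<forall>i\<le>n. \<kappa> (p x) i = 0)"
      using p(4)[OF x] zero \<kappa>_inj[OF pB pB, of x "\<zero>\<^bsub>M\<^esub>"] sC'(2) by auto
  next
    fix c
    obtain X where "X \<in> carrier B" "\<forall>i\<le>n. \<kappa> X i = c i" using \<kappa>_surj by blast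
    then show "\<exists>x\<in>C'. \<forall>i\<le>n. \<kappa> (p x) i = c i" using p(3) by (metis imageE)
  next
    fix x i assume x: "x \<in> C'" "i \<le> n"
    show "\<kappa> (p (act U_K x)) i = \<phi> (qpow (int n - 2 * int i)) * \<kappa> (p x) i"
      by (rule diag[OF _ K_w x]) simp
    show "\<kappa> (p (act (K_binom r) x)) i = \<phi> (q_binom (int n - 2 * int i) r) * \<kappa> (p x) i" for r
      by (rule diag[OF _ _ x]) (use KB_w[of 0 r] in \<open>simp_all add: K_binom_eq KB_U_A\<close>)
  qed
  moreover have "\<kappa> (p (act (div_F 1) x)) i = (if i = 0 then 0 else \<phi> (q_int (int i)) * \<kappa> (p x) (i - 1))"
    if x: "x \<in> C'" "i \<le> n" for x i
  proof -
    have "cf (div_F 1 * w j) i = (if i = 1 + j then q_int (int (1 + j)) else 0)" for j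
      using cf_monomial[of "div_F 1 * w j" "q_int (int (1 + j))" "1 + j" i] F_w[of 1 j] x by simp
    then have "\<kappa> (p (act (div_F 1) x)) i = (\<Sum>j\<le>n. if i = 1 + j then \<phi> (q_int (int (1 + j))) * \<kappa> (p x) j else 0)"
      using x by (simp add: P_act if_distrib[of \<phi>] if_distrib[of "\<lambda>x. x * _"] cong: if_cong)
    also have "\<dots> = (if i = 0 then 0 else \<phi> (q_int (int i)) * \<kappa> (p x) (i - 1))"
    proof (cases i)
      case (Suc k)
      have "(\<Sum>j\<le>n. if i = 1 + j then \<phi> (q_int (int (1 + j))) * \<kappa> (p x) j else 0)
          = (\<Sum>j\<le>n. if j = k then \<phi> (q_int (int (1 + k))) * \<kappa> (p x) k else 0)"
        using Suc by (intro sum.cong) auto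
      then show ?thesis using Suc x(2) by simp
    qed simp
    finally show ?thesis .
  qed
  ultimately show ?thesis by blast
qed

text \<open>Evaluation at \<open>w j\<close> has weight 2 j - n on the dual, so coordinate i is
  evaluation at \<open>w (n - i)\<close>. E acts through its antipode - K^(-1) E: here E contributes
  [i + 1] and K^(-1) contributes q^(n-2i-2), which gives the entry of the last clause.\<close>

lemma dual_weyl_coordinates:
  assumes C: "Module.submodule C Z M" and C': "Module.submodule C' Z M" and sub: "C \<subseteq> C'"
    and dual: "is_dual_weyl \<phi> n (quot_module (M\<lparr>carrier := C'\<rparr>) C)"
  shows "\<exists>P. coordinates C C' n P \<and> (\<forall>x\<in>C'. \<forall>i\<le>n. P (act (div_E 1) x) i =
      (if i = n then 0 else \<phi> (- q_int (int i + 1) * qpow (int n - 2 * int i - 2)) * P x (i + 1)))"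
proof -
  obtain L :: "(uq, uq set) module" and v where L: "simple_module class_ring L" "highest_weight_vector L n v"
    "module_isomorphic Z (quot_module (M\<lparr>carrier := C'\<rparr>) C) (dual_module \<phi> (base_change \<phi> (weyl_lattice L v)))"
    using dual unfolding is_dual_weyl_def by blast
  interpret weyl_datum \<phi> L v n by unfold_locales (use L in auto)
  let ?D = "dual_module \<phi> B"
  obtain p where p0: "quotient_map C C' ?D p" using quotient_projection[OF C C' sub L(3)] by blast
  note p = quotient_mapD[OF p0]
  have pD: "p x \<in> LinearCombinations.module_hom class_ring (cspace \<phi> B) complex_line" "p x \<in> extensional (carrier B)"
    if "x \<in> C'" for x
    using p(3) that by (auto simp: dual_module_def)
  note sC' = submoduleD[OF C']
  define Q where "Q x j = p x (bb j)" for x j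
  have Q_add: "Q (x \<oplus>\<^bsub>M\<^esub> y) j = Q x j + Q y j" if "x \<in> C'" "y \<in> C'" for x y j
    using that by (simp add: Q_def p(1)) (simp add: dual_module_def bb_in)
  have Q_act: "Q (act u x) j = (\<Sum>i\<le>n. \<phi> (cf (antipode u * w j) i) * Q x i)" if "u \<in> U_A" "x \<in> C'" "j \<le> n" for u x j
  proof -
    have "Q (act u x) j = p x (pure_tensor \<phi> (antipode u) 1 \<odot>\<^bsub>B\<^esub> bb j)"
      using that by (simp add: Q_def p(2)) (simp add: dual_module_def bb_in antipode_zeta_pure_tensor)
    also have "\<dots> = (\<Sum>i\<le>n. \<kappa> (pure_tensor \<phi> (antipode u) 1 \<odot>\<^bsub>B\<^esub> bb j) i * Q x i)"
      unfolding Q_def using that by (intro functional_expand pD B_smult_closed bb_in antipode_U_A)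
    also have "\<dots> = (\<Sum>i\<le>n. \<phi> (cf (antipode u * w j) i) * Q x i)"
      using that by (intro sum.cong refl)
        (simp add: \<kappa>_smult bb_in antipode_U_A \<kappa>_bb if_distrib[of "\<lambda>x. _ * x"] cong: if_cong)
    finally show ?thesis .
  qed
  have diag: "Q (act u x) j = \<phi> (a j) * Q x j"
    if "u \<in> U_A" "\<And>j. cong_J (antipode u * w j) (a j *q w j)" "x \<in> C'" "j \<le> n" for u a x j
  proof -
    have "cf (antipode u * w j) i = (if i = j then a j else 0)" if "i \<le> n" for i
      using cf_monomial[of "antipode u * w j" "a j" j i] that \<open>u \<in> U_A\<close> \<open>\<And>j. cong_J (antipode u * w j) (a j *q w j)\<close>
      by (simp add: antipode_U_A)
    then show ?thesis using that by (simp add: Q_act if_distrib[of \<phi>] if_distrib[of "\<lambda>x. x * _"] cong: if_cong)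
  qed
  have Q_eq: "p x = p y" if "x \<in> C'" "y \<in> C'" "\<And>j. j \<le> n \<Longrightarrow> Q x j = Q y j" for x y
  proof (rule extensionalityI[OF pD(2)[OF that(1)] pD(2)[OF that(2)]])
    fix X assume X: "X \<in> carrier B"
    show "p x X = p y X"
      using that functional_expand[OF pD(1) X] by (simp add: Q_def)
  qed
  have zero: "Q \<zero>\<^bsub>M\<^esub> j = 0" for j
    using Q_add[of "\<zero>\<^bsub>M\<^esub>" "\<zero>\<^bsub>M\<^esub>" j] sC'(2) by simp
  have "coordinates C C' n (\<lambda>x i. Q x (n - i))"
    unfolding coordinates_def
  proof (intro conjI ballI allI impI)
    fix x y i assume "x \<in> C'" "y \<in> C'"
    then show "Q (x \<oplus>\<^bsub>M\<^esub> y) (n - i) = Q x (n - i) + Q y (n - i)" by (rule Q_add)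
  next
    fix c x i assume x: "x \<in> C'"
    have "p (scal c x) (bb j) = p x (pure_tensor \<phi> 1 c \<odot>\<^bsub>B\<^esub> bb j)" for j
      using x by (simp add: p(5)) (simp add: dual_module_def bb_in antipode_zeta_pure_tensor)
    moreover have "p x (pure_tensor \<phi> 1 c \<odot>\<^bsub>B\<^esub> bb j) = c * p x (bb j)" for j
      using pD(1)[OF x] bb_in[of j]
      by (simp add: LinearCombinations.module_hom_def cspace_def complex_line_def)
    ultimately show "Q (scal c x) (n - i) = c * Q x (n - i)" by (simp add: Q_def)
  next
    fix x assume x: "x \<in> C'"
    have "(\<forall>i\<le>n. Q x (n - i) = 0) \<longleftrightarrow> (\<forall>j\<le>n. Q x j = 0)"
      by (metis diff_diff_cancel diff_le_self)
    moreover have "(\<forall>j\<le>n. Q x j = 0) \<longleftrightarrow> p x = p \<zero>\<^bsub>M\<^esub>"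
      using Q_eq[OF x sC'(2)] zero by (auto simp: Q_def)
    ultimately show "x \<in> C \<longleftrightarrow> (\<forall>i\<le>n. Q x (n - i) = 0)" using p(4)[OF x] by simp
  next
    fix c :: "nat \<Rightarrow> complex"
    define g where "g = restrict (\<lambda>X. \<Sum>i\<le>n. c (n - i) * \<kappa> X i) (carrier B)"
    have "g \<in> carrier ?D"
      unfolding dual_module_def LinearCombinations.module_hom_def cspace_def complex_line_def g_def
      by (auto simp: \<kappa>_add B_add_closed B_smult_closed \<kappa>_scal sum.distrib distrib_left sum_distrib_left mult_ac)
    then obtain x where x: "x \<in> C'" "g = p x" using p(3) by blast
    have "Q x (n - i) = c i" if "i \<le> n" for i
    proof -
      have "Q x (n - i) = (\<Sum>k\<le>n. c (n - k) * \<kappa> (bb (n - i)) k)"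
        by (simp add: Q_def x(2)[symmetric] g_def bb_in)
      also have "\<dots> = c (n - (n - i))"
        by (simp add: \<kappa>_bb if_distrib[of "\<lambda>x. _ * x"] cong: if_cong)
      finally show ?thesis using that by simp
    qed
    then show "\<exists>x\<in>C'. \<forall>i\<le>n. Q x (n - i) = c i" using x(1) by blast
  next
    fix x i assume x: "x \<in> C'" "i \<le> n"
    have n: "n - i \<le> n" by simp
    have e: "2 * int (n - i) - int n = int n - 2 * int i" using x(2) by (simp add: of_nat_diff)
    have "Q (act U_K x) (n - i) = \<phi> (qpow (2 * int (n - i) - int n)) * Q x (n - i)"
      by (rule diag[OF _ _ x(1) n]) (simp_all add: antipode_gen Kinv_w)
    then show "Q (act U_K x) (n - i) = \<phi> (qpow (int n - 2 * int i)) * Q x (n - i)" by (simp only: e)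
    fix r
    \<comment> \<open>The antipode turns [K; 0; r] into its analogue for the inverse of K. Rewriting
      this through K gives a sign (-1)^r, which cancels against the sign of the negated top
      entry.\<close>
    have kb: "cong_J (antipode (K_binom r) * w j) (q_binom (2 * int j - int n) r *q w j)" for j
    proof -
      have "antipode (K_binom r) * w j = (- 1) ^ r *q (ut.KB (int r - 1) r * w j)"
        by (simp add: K_binom_eq antipode_KB swapped_KB)
      also have "cong_J \<dots> ((- 1) ^ r *q (q_binom (int n - 2 * int j + (int r - 1)) r *q w j))"
        by (intro cong_J_scale KB_w)
      also have "\<dots> = q_binom (2 * int j - int n) r *q w j"
        using q_binom_neg[of "int n - 2 * int j" r] by (simp add: algebra_simps)
      finally show ?thesis .
    qed
    have "Q (act (K_binom r) x) (n - i) = \<phi> (q_binom (2 * int (n - i) - int n) r) * Q x (n - i)"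
      by (rule diag[OF _ kb x(1) n]) simp
    then show "Q (act (K_binom r) x) (n - i) = \<phi> (q_binom (int n - 2 * int i) r) * Q x (n - i)"
      by (simp only: e)
  qed
  moreover have "Q (act (div_E 1) x) (n - i) =
      (if i = n then 0 else \<phi> (- q_int (int i + 1) * qpow (int n - 2 * int i - 2)) * Q x (n - (i + 1)))"
    if x: "x \<in> C'" "i \<le> n" for x i
  proof -
    have ap: "antipode (div_E 1) = - (U_Kinv * div_E 1)"
      by (simp add: div_E_def q_fact_def uqs.s_one antipode_gen)
    show ?thesis
    proof (cases "i = n")
      case True
      have "cong_J (div_E 1 * w 0) 0" by (rule E_w_0) simp
      from cong_J_mult[OF this, of "- U_Kinv"] have "cong_J (antipode (div_E 1) * w 0) (0 *q w 0)"
        by (simp add: ap[simplified] mult.assoc)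
      then have "cf (antipode (div_E 1) * w 0) k = 0" if "k \<le> n" for k
        using cf_monomial[of "antipode (div_E 1) * w 0" 0 0 k] that by (simp add: antipode_U_A)
      then show ?thesis using True x by (simp add: Q_act)
    next
      case False
      then have i: "i < n" using x by simp
      let ?a = "- q_int (int i + 1) * qpow (int n - 2 * int i - 2)"
      have e1: "int n - int (n - i) + int 1 = int i + 1" "n - i - 1 = n - (i + 1)" using i by auto
      have "cong_J (div_E 1 * w (n - i)) (q_int (int i + 1) *q w (n - (i + 1)))"
        using E_w[of 1 "n - i"] i unfolding e1 by simp
      from cong_J_mult[OF this, of "- U_Kinv"]
      have "cong_J (antipode (div_E 1) * w (n - i)) ((- q_int (int i + 1)) *q (U_Kinv * w (n - (i + 1))))"
        by (simp add: ap[simplified] mult.assoc)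
      also have "cong_J \<dots> ((- q_int (int i + 1)) *q (qpow (2 * int (n - (i + 1)) - int n) *q w (n - (i + 1))))"
        by (intro cong_J_scale Kinv_w)
      also have "2 * int (n - (i + 1)) - int n = int n - 2 * int i - 2" using i by (simp add: of_nat_diff)
      finally have *: "cong_J (antipode (div_E 1) * w (n - i)) (?a *q w (n - (i + 1)))" by simp
      have "cf (antipode (div_E 1) * w (n - i)) k = (if k = n - (i + 1) then ?a else 0)" if "k \<le> n" for k
        using cf_monomial[OF _ * that] by (simp add: antipode_U_A)
      then show ?thesis using False x
        by (simp add: Q_act if_distrib[of \<phi>] if_distrib[of "\<lambda>x. x * _"] cong: if_cong)
    qed
  qed
  ultimately show ?thesis by (intro exI[of _ "\<lambda>x i. Q x (n - i)"]) blast
qed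

end

section \<open>Weight spaces\<close>

context specialization
begin

lemma \<phi>_inverse_qpow: "\<phi> (qpow t) * \<phi> (qpow (- t)) = 1"
  using \<phi>_mult[of "qpow t" "qpow (- t)"] by (simp add: qpow_add[symmetric] del: power_int_minus)

lemma \<phi>_qpow_nonzero: "\<phi> (qpow t) \<noteq> 0"
  using \<phi>_inverse_qpow[of t] by auto

lemma \<phi>_power: "a \<in> laurent \<Longrightarrow> \<phi> (a ^ n) = \<phi> a ^ n"
  by (induction n) (auto simp: \<phi>_mult laurent_power)

lemma \<phi>_qpow: "\<phi> (qpow t) = \<phi> q_par powi t"
proof (cases "0 \<le> t")
  case True
  then show ?thesis by (simp add: power_int_nonneg_exp \<phi>_power)
next
  case False
  then have "\<phi> (qpow (- t)) = \<phi> q_par powi (- t)" by (simp add: power_int_nonneg_exp \<phi>_power del: power_int_minus)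
  then show ?thesis using \<phi>_inverse_qpow[of t]
    by (metis inverse_unique mult.commute power_int_minus inverse_inverse_eq)
qed

lemma \<phi>_q_binom_pascal:
  "\<phi> (q_binom (t + 1) (Suc r)) = \<phi> q_par ^ Suc r * \<phi> (q_binom t (Suc r)) + \<phi> q_par powi (int r - t) * \<phi> (q_binom t r)"
proof -
  have "qpow (int r + 1) = q_par ^ Suc r"
    by (metis add.commute of_nat_Suc power_int_of_nat)
  then show ?thesis by (simp add: q_binom_pascal \<phi>_add \<phi>_mult \<phi>_power \<phi>_qpow)
qed

text \<open>By Pascal's rule, whose coefficients involve \<open>q\<^sup>t\<close>, the quantum binomial coefficients at \<open>t\<close>
  determine those at all shifts \<open>t + c\<close>.\<close>

lemma weights_separated:
  assumes K: "\<phi> (qpow t) = \<phi> (qpow s)" and B: "\<And>r. \<phi> (q_binom t r) = \<phi> (q_binom s r)"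
  shows "t = s"
proof -
  let ?\<zeta> = "\<phi> q_par"
  have z: "?\<zeta> \<noteq> 0" using \<phi>_qpow_nonzero[of 1] by simp
  have K': "?\<zeta> powi (c - t) = ?\<zeta> powi (c - s)" for c
    using K z by (simp add: \<phi>_qpow power_int_diff)
  have shift: "\<phi> (q_binom (t + c) r) = \<phi> (q_binom (s + c) r)" for c r
  proof (induction r arbitrary: c)
    case (Suc r)
    have e: "?\<zeta> powi (int r - (t + c)) = ?\<zeta> powi (int r - (s + c))" for c
      using K'[of "int r - c"] by (simp add: algebra_simps)
    show ?case
    proof (induction c rule: int_induct[where k = 0])
      case (step1 i)
      then show ?case
        using \<phi>_q_binom_pascal[of "t + i" r] \<phi>_q_binom_pascal[of "s + i" r] Suc[of i] e[of i]
        by (simp add: add.assoc)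
    next
      case (step2 i)
      have "?\<zeta> ^ Suc r * \<phi> (q_binom (t + (i - 1)) (Suc r)) = ?\<zeta> ^ Suc r * \<phi> (q_binom (s + (i - 1)) (Suc r))"
        using \<phi>_q_binom_pascal[of "t + (i - 1)" r] \<phi>_q_binom_pascal[of "s + (i - 1)" r] Suc[of "i - 1"]
          e[of "i - 1"] step2 by (simp add: add.assoc)
      then show ?case using z by simp
    qed (simp add: B)
  qed simp
  \<comment> \<open>A shift by - x makes the top entries 0 and r + 1 = y - x > 0, and over r + 1
    these give the values 0 and 1.\<close>
  have no: "\<not> x < y" if "\<And>c r. \<phi> (q_binom (x + c) r) = \<phi> (q_binom (y + c) r)" for x y
  proof
    assume "x < y"
    then obtain r where r: "y - x = int (Suc r)"
      by (metis diff_gt_0_iff_gt gr0_implies_Suc of_nat_0_less_iff zero_less_imp_eq_int)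
    have "y + - x = int (Suc r)" using r by simp
    then have "\<phi> (q_binom 0 (Suc r)) = \<phi> (q_binom (int (Suc r)) (Suc r))"
      using that[of "- x" "Suc r"] by simp
    then show False unfolding q_binom_0_left q_binom_self by simp
  qed
  show ?thesis using no[OF shift] no[OF shift[symmetric]] by simp
qed

end

context zeta_module
begin

abbreviation "WS \<equiv> weight_space \<phi> M"

lemma weight_space_iff:
  "x \<in> WS t \<longleftrightarrow> x \<in> carrier M \<and> act U_K x = scal (\<phi> (qpow t)) x \<and>
    (\<forall>r. act (K_binom r) x = scal (\<phi> (q_binom t r)) x)"
  by (simp add: weight_space_def act_def scal_def cspace_def)

lemma weight_space_carrier: "x \<in> WS t \<Longrightarrow> x \<in> carrier M"
  by (simp add: weight_space_iff)

lemma act_Kinv: "x \<in> WS t \<Longrightarrow> act U_Kinv x = scal (\<phi> (qpow (- t))) x"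
proof -
  assume x: "x \<in> WS t"
  then have xM: "x \<in> carrier M" by (rule weight_space_carrier)
  have "x = act (U_Kinv * U_K) x" using xM by (simp add: ut.K'K)
  also have "\<dots> = scal (\<phi> (qpow t)) (act U_Kinv x)"
    using x by (simp add: act_mult xM weight_space_iff act_scal)
  finally have "scal (\<phi> (qpow (- t))) x = scal (\<phi> (qpow (- t)) * \<phi> (qpow t)) (act U_Kinv x)"
    using xM by (subst scal_mult) simp_all
  then show ?thesis using \<phi>_inverse_qpow[of t] xM by (simp only: mult.commute act_closed U_A_gens scal_1)
qed

text \<open>Weight vectors are defined by the elements [K; 0; r] alone. Pascal's rule passes from c
  to c + 1 and, as q^(r+1) acts invertibly, also from c to c - 1.\<close>

lemma act_KB: "x \<in> WS t \<Longrightarrow> act (ut.KB c r) x = scal (\<phi> (q_binom (t + c) r)) x"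
proof -
  assume x: "x \<in> WS t"
  then have xM [simp]: "x \<in> carrier M" by (rule weight_space_carrier)
  have pascal: "act (ut.KB (c + 1) (Suc r)) x =
      scal (\<phi> (qpow (int r + 1))) (act (ut.KB c (Suc r)) x) \<oplus>\<^bsub>M\<^esub>
      scal (\<phi> (qpow (int r - (t + c))) * \<phi> (q_binom (t + c) r)) x"
    if IH: "act (ut.KB c r) x = scal (\<phi> (q_binom (t + c) r)) x" for c r
  proof -
    have "act (U_Kinv * ut.KB c r) x = scal (\<phi> (q_binom (t + c) r)) (act U_Kinv x)"
      by (simp add: act_mult KB_U_A IH act_scal)
    also have "\<dots> = scal (\<phi> (q_binom (t + c) r) * \<phi> (qpow (- t))) x"
      using x by (simp add: act_Kinv scal_mult)
    finally have "scal (\<phi> (qpow (int r - c))) (act (U_Kinv * ut.KB c r) x)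
        = scal (\<phi> (qpow (int r - c)) * (\<phi> (q_binom (t + c) r) * \<phi> (qpow (- t)))) x"
      by (simp add: scal_mult)
    also have "\<phi> (qpow (int r - c)) * (\<phi> (q_binom (t + c) r) * \<phi> (qpow (- t)))
        = \<phi> (qpow (int r - c) * qpow (- t)) * \<phi> (q_binom (t + c) r)"
      by (simp add: \<phi>_mult del: power_int_minus)
    also have "qpow (int r - c) * qpow (- t) = qpow (int r - (t + c))"
      unfolding qpow_add[symmetric] by (simp add: algebra_simps)
    finally show ?thesis
      unfolding ut.KB_pascal by (simp add: act_add_left act_scale KB_U_A del: ut.KB.simps)
  qed
  show ?thesis
  proof (induction r arbitrary: c)
    case (Suc r)
    have num: "\<phi> (q_binom (t + c + 1) (Suc r)) = \<phi> (qpow (int r + 1)) * \<phi> (q_binom (t + c) (Suc r))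
        + \<phi> (qpow (int r - (t + c))) * \<phi> (q_binom (t + c) r)" for c
      by (simp add: q_binom_pascal \<phi>_add \<phi>_mult)
    show ?case
    proof (induction c rule: int_induct[where k = 0])
      case base
      have "act (K_binom (Suc r)) x = scal (\<phi> (q_binom t (Suc r))) x" using x unfolding weight_space_iff by blast
      then show ?case unfolding K_binom_eq by simp
    next
      case (step1 i)
      show ?case
        unfolding pascal[OF Suc] step1(2) add.assoc[symmetric] num
        by (simp only: scal_add_left scal_mult xM)
    next
      case (step2 i)
      have "scal (\<phi> (q_binom (t + i) (Suc r))) x =
          scal (\<phi> (qpow (int r + 1))) (act (ut.KB (i - 1) (Suc r)) x) \<oplus>\<^bsub>M\<^esub>
          scal (\<phi> (qpow (int r - (t + (i - 1)))) * \<phi> (q_binom (t + (i - 1)) r)) x"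
        using pascal[OF Suc, of "i - 1"] step2(2) by simp
      moreover have "scal (\<phi> (q_binom (t + i) (Suc r))) x =
          scal (\<phi> (qpow (int r + 1))) (scal (\<phi> (q_binom (t + (i - 1)) (Suc r))) x) \<oplus>\<^bsub>M\<^esub>
          scal (\<phi> (qpow (int r - (t + (i - 1)))) * \<phi> (q_binom (t + (i - 1)) r)) x"
        using num[of "i - 1"] by (simp add: scal_add_left scal_mult)
      ultimately have "scal (\<phi> (qpow (int r + 1))) (act (ut.KB (i - 1) (Suc r)) x)
          = scal (\<phi> (qpow (int r + 1))) (scal (\<phi> (q_binom (t + (i - 1)) (Suc r))) x)"
        by (metis KB_U_A M.add.right_cancel act_closed scal_closed xM)
      then have "scal (\<phi> (qpow (- (int r + 1))) * \<phi> (qpow (int r + 1))) (act (ut.KB (i - 1) (Suc r)) x)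
          = scal (\<phi> (qpow (- (int r + 1))) * \<phi> (qpow (int r + 1))) (scal (\<phi> (q_binom (t + (i - 1)) (Suc r))) x)"
        by (simp only: scal_mult act_closed KB_U_A xM scal_closed)
      then show ?case
        using \<phi>_inverse_qpow[of "int r + 1"]
        by (simp only: mult.commute[of "\<phi> (qpow (- (int r + 1)))"] scal_1 act_closed KB_U_A xM scal_closed)
    qed
  qed simp
qed

lemma act_swapped_KB: "x \<in> WS t \<Longrightarrow> act (us.KB c r) x = scal (\<phi> (q_binom (- t + c) r)) x"
proof -
  assume x: "x \<in> WS t"
  have e: "t + (int r - 1 - c) = (t - c) + int r - 1" "- t + c = - (t - c)" by simp_all
  have s: "(- 1) ^ r \<in> laurent" by (rule laurent_power) simp
  have "act (us.KB c r) x = scal (\<phi> ((- 1) ^ r)) (scal (\<phi> (q_binom (t + (int r - 1 - c)) r)) x)"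
    unfolding swapped_KB using x s by (simp add: act_scale act_KB KB_U_A weight_space_carrier)
  also have "\<dots> = scal (\<phi> (q_binom (- t + c) r)) x"
    unfolding e q_binom_neg using x s by (simp add: \<phi>_mult scal_mult weight_space_carrier)
  finally show ?thesis .
qed

lemma act_div_E_weight: "x \<in> WS t \<Longrightarrow> act (div_E k) x \<in> WS (t + 2 * int k)"
  and act_div_F_weight: "x \<in> WS t \<Longrightarrow> act (div_F k) x \<in> WS (t - 2 * int k)"
proof -
  assume x: "x \<in> WS t"
  then have xM [simp]: "x \<in> carrier M" by (rule weight_space_carrier)
  have K: "act U_K x = scal (\<phi> (qpow t)) x" using x by (simp add: weight_space_iff)
  have comm: "act u (act v x) = scal c (act v x)"
    if "u \<in> U_A" "v \<in> U_A" "u' \<in> U_A" "u * v = d *q (v * u')" "d \<in> laurent" "act u' x = scal c' x" "c = \<phi> d * c'" for u v u' d c c'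
  proof -
    have "act u (act v x) = act (d *q (v * u')) x" using that by (simp add: act_mult[symmetric])
    also have "\<dots> = scal (\<phi> d) (act v (scal c' x))" using that by (simp add: act_scale act_mult)
    finally show ?thesis using that by (simp add: act_scal scal_mult)
  qed
  have "act U_K (act (div_E k) x) = scal (\<phi> (qpow (t + 2 * int k))) (act (div_E k) x)"
  proof (rule comm[of _ _ U_K "qpow (2 * int k)" "\<phi> (qpow t)"])
    show "U_K * div_E k = qpow (2 * int k) *q (div_E k * U_K)" unfolding div_E_eq(1) by (rule ut.K_Ed)
    have "qpow (t + 2 * int k) = qpow (2 * int k) * qpow t"
      unfolding qpow_add[symmetric] by (simp only: add.commute)
    then show "\<phi> (qpow (t + 2 * int k)) = \<phi> (qpow (2 * int k)) * \<phi> (qpow t)" by (simp only: \<phi>_mult qpow_laurent)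
  qed (simp_all add: K)
  moreover have "act (K_binom r) (act (div_E k) x) = scal (\<phi> (q_binom (t + 2 * int k) r)) (act (div_E k) x)" for r
  proof (rule comm[of _ _ "ut.KB (2 * int k) r" 1 "\<phi> (q_binom (t + 2 * int k) r)"])
    show "K_binom r * div_E k = 1 *q (div_E k * ut.KB (2 * int k) r)"
      unfolding div_E_eq(1) K_binom_eq using ut.KB_Ed[of 0 r k] by simp
  qed (simp_all add: KB_U_A act_KB[OF x])
  ultimately show "act (div_E k) x \<in> WS (t + 2 * int k)" by (simp add: weight_space_iff)
  have "act U_K (act (div_F k) x) = scal (\<phi> (qpow (t - 2 * int k))) (act (div_F k) x)"
  proof (rule comm[of _ _ U_K "qpow (- 2 * int k)" "\<phi> (qpow t)"])
    show "U_K * div_F k = qpow (- 2 * int k) *q (div_F k * U_K)" unfolding div_F_eq(1) by (rule ut.K_Fd)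
    have "qpow (t - 2 * int k) = qpow (- 2 * int k) * qpow t" unfolding qpow_add[symmetric] by simp
    then show "\<phi> (qpow (t - 2 * int k)) = \<phi> (qpow (- 2 * int k)) * \<phi> (qpow t)" by (simp only: \<phi>_mult qpow_laurent)
  qed (simp_all add: K)
  moreover have "act (K_binom r) (act (div_F k) x) = scal (\<phi> (q_binom (t - 2 * int k) r)) (act (div_F k) x)" for r
  proof (rule comm[of _ _ "ut.KB (- 2 * int k) r" 1 "\<phi> (q_binom (t - 2 * int k) r)"])
    show "K_binom r * div_F k = 1 *q (div_F k * ut.KB (- 2 * int k) r)"
      unfolding div_F_eq(1) K_binom_eq using ut.KB_Fd[of 0 r k] by simp
  qed (simp_all add: KB_U_A act_KB[OF x])
  ultimately show "act (div_F k) x \<in> WS (t - 2 * int k)" by (simp add: weight_space_iff)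
qed

lemma weight_space_closed:
  "\<zero>\<^bsub>M\<^esub> \<in> WS t" "x \<in> WS t \<Longrightarrow> y \<in> WS t \<Longrightarrow> x \<oplus>\<^bsub>M\<^esub> y \<in> WS t" "x \<in> WS t \<Longrightarrow> scal c x \<in> WS t"
proof -
  have z: "act u \<zero>\<^bsub>M\<^esub> = \<zero>\<^bsub>M\<^esub>" if "u \<in> U_A" for u
    using act_add_right[of u "\<zero>\<^bsub>M\<^esub>" "\<zero>\<^bsub>M\<^esub>"] that by (simp add: M.add.l_cancel_one)
  have z': "scal c \<zero>\<^bsub>M\<^esub> = \<zero>\<^bsub>M\<^esub>" for c
    using scal_add_right[of "\<zero>\<^bsub>M\<^esub>" "\<zero>\<^bsub>M\<^esub>" c] by (simp add: M.add.l_cancel_one)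
  show "\<zero>\<^bsub>M\<^esub> \<in> WS t" by (simp add: weight_space_iff z z')
  show "x \<in> WS t \<Longrightarrow> y \<in> WS t \<Longrightarrow> x \<oplus>\<^bsub>M\<^esub> y \<in> WS t"
    by (simp add: weight_space_iff act_add_right scal_add_right)
  show "x \<in> WS t \<Longrightarrow> scal c x \<in> WS t"
    by (auto simp: weight_space_iff act_scal scal_mult[symmetric] mult.commute)
qed

text \<open>The module is a carrier set with record operations, whereas the graded argument runs in
  a vector space occupying a whole type. Coordinates in a finite basis embed the module linearly
  into the functions \<open>'v \<Rightarrow> complex\<close>, with g a left inverse of h on the
  carrier.\<close>

lemma linear_model:
  assumes "vectorspace.fin_dim class_ring (cspace \<phi> M)"
  shows "\<exists>(g :: ('v \<Rightarrow> complex) \<Rightarrow> 'v) h. (\<forall>a. g a \<in> carrier M) \<and> (\<forall>a b. g (a + b) = g a \<oplus>\<^bsub>M\<^esub> g b) \<and>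
     (\<forall>c a. g (\<lambda>i. c * a i) = scal c (g a)) \<and> (\<forall>x\<in>carrier M. g (h x) = x) \<and>
     (\<forall>x\<in>carrier M. \<forall>y\<in>carrier M. h (x \<oplus>\<^bsub>M\<^esub> y) = h x + h y) \<and>
     (\<forall>c. \<forall>x\<in>carrier M. h (scal c x) = (\<lambda>i. c * h x i))"
proof -
  interpret vs: vectorspace class_ring "cspace \<phi> M" by (rule vectorspace_cspace)
  obtain A where A: "finite A" "vs.basis A" using vs.finite_basis_exists[OF assms] by blast
  have AM: "A \<subseteq> carrier (cspace \<phi> M)" using A(2) by (simp add: vs.basis_def)
  define g where "g a = vs.lincomb a A" for a
  have cs: "carrier (cspace \<phi> M) = carrier M" "\<And>x y. x \<oplus>\<^bsub>cspace \<phi> M\<^esub> y = x \<oplus>\<^bsub>M\<^esub> y"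
    "\<And>c x. c \<odot>\<^bsub>cspace \<phi> M\<^esub> x = scal c x"
    by (simp_all add: cspace_def scal_def)
  have g1: "g a \<in> carrier M" for a
    using vs.lincomb_closed[OF AM, of a] by (simp add: g_def cs)
  have g2: "g (a + b) = g a \<oplus>\<^bsub>M\<^esub> g b" for a b
    using vs.lincomb_sum[OF A(1) AM, of a b] by (simp add: g_def cs plus_fun_def)
  have g3: "g (\<lambda>i. c * a i) = scal c (g a)" for c a
    using vs.lincomb_smult[OF AM, of a c] by (simp add: g_def cs)
  have ex: "\<exists>!a. a \<in> A \<rightarrow>\<^sub>E UNIV \<and> g a = x" if "x \<in> carrier M" for x
    using vs.basis_criterion[OF A(1) AM] A(2) that by (simp add: g_def cs)
  have g_restrict: "g a = g (restrict a A)" for a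
    unfolding g_def vs.lincomb_def using AM by (intro vs.finsum_cong') (auto simp: cs cspace_def scal_def[symmetric])
  have uniq: "\<forall>i\<in>A. a i = b i" if "g a = g b" for a b
  proof -
    have "restrict a A = restrict b A"
      using ex[OF g1[of a]] g_restrict[of a] g_restrict[of b] that by (metis restrict_PiE_iff UNIV_I)
    then show ?thesis by (metis restrict_apply')
  qed
  \<comment> \<open>With coordinates outside A set to 0, h x is the only preimage of x under g
    supported in A. This uniqueness yields the linearity of h.\<close>
  define h where "h x = (\<lambda>i. if i \<in> A then (SOME a. g a = x) i else 0)" for x
  have gh: "g (h x) = x" if "x \<in> carrier M" for x
  proof -
    have s: "g (SOME a. g a = x) = x" using ex[OF that] by (metis (mono_tags) someI_ex)
    have "restrict (h x) A = restrict (SOME a. g a = x) A" by (auto simp: h_def restrict_def)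
    then show ?thesis using g_restrict[of "h x"] g_restrict[of "SOME a. g a = x"] s by simp
  qed
  have h_eq: "h x = a" if "g a = x" "\<And>i. i \<notin> A \<Longrightarrow> a i = 0" for x a
  proof
    fix i
    have "g (h x) = g a" using gh[of x] g1[of a] that(1) by simp
    then have "\<forall>i\<in>A. h x i = a i" by (rule uniq)
    then show "h x i = a i" using that(2)[of i] by (cases "i \<in> A") (auto simp: h_def)
  qed
  show ?thesis
  proof (intro exI[of _ g] exI[of _ h] conjI allI ballI g1 g2 g3 gh)
    fix x y assume "x \<in> carrier M" "y \<in> carrier M"
    then show "h (x \<oplus>\<^bsub>M\<^esub> y) = h x + h y" by (intro h_eq) (simp_all add: g2 gh, simp add: h_def)
  next
    fix c x assume "x \<in> carrier M"
    then show "h (scal c x) = (\<lambda>i. c * h x i)" by (intro h_eq) (simp_all add: g3 gh, simp add: h_def)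
  qed auto
qed

end

section \<open>Transport of the action to a space of functions\<close>

locale modelled_module = zeta_module \<phi> M
  for \<phi> :: "qfield \<Rightarrow> complex" and M :: "(u_zeta, 'v) module" +
  fixes g :: "('v \<Rightarrow> complex) \<Rightarrow> 'v" and h :: "'v \<Rightarrow> 'v \<Rightarrow> complex"
  assumes g_in [simp]: "g a \<in> carrier M" and g_add: "g (a + b) = g a \<oplus>\<^bsub>M\<^esub> g b"
    and g_scale: "g (\<lambda>i. c * a i) = scal c (g a)" and gh [simp]: "x \<in> carrier M \<Longrightarrow> g (h x) = x"
    and h_add: "x \<in> carrier M \<Longrightarrow> y \<in> carrier M \<Longrightarrow> h (x \<oplus>\<^bsub>M\<^esub> y) = h x + h y"
    and h_scal: "x \<in> carrier M \<Longrightarrow> h (scal c x) = (\<lambda>i. c * h x i)"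
begin

definition fscale :: "complex \<Rightarrow> ('v \<Rightarrow> complex) \<Rightarrow> 'v \<Rightarrow> complex" (infixr "*f" 75) where
  "c *f a = (\<lambda>i. c * a i)"

sublocale fv: vector_space fscale
  by unfold_locales (auto simp: fscale_def fun_eq_iff algebra_simps)

text \<open>Unification produces \<open>\<eta>\<close>-expanded sums, which these rules would rewrite pointwise.\<close>

declare plus_fun_apply [simp del] zero_fun_apply [simp del] minus_apply [simp del] uminus_apply [simp del]

lemma g_fscale: "g (c *f a) = scal c (g a)" and h_fscale: "x \<in> carrier M \<Longrightarrow> h (scal c x) = c *f h x"
  by (simp_all add: fscale_def g_scale h_scal)

lemma h_inj: "x \<in> carrier M \<Longrightarrow> y \<in> carrier M \<Longrightarrow> h x = h y \<longleftrightarrow> x = y"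
  by (metis gh)

lemma h_zero [simp]: "h \<zero>\<^bsub>M\<^esub> = 0"
  using h_add[of "\<zero>\<^bsub>M\<^esub>" "\<zero>\<^bsub>M\<^esub>"] by simp

lemma h_eq_0: "x \<in> carrier M \<Longrightarrow> h x = 0 \<longleftrightarrow> x = \<zero>\<^bsub>M\<^esub>"
  using h_inj[of x "\<zero>\<^bsub>M\<^esub>"] by simp

text \<open>Defined on all functions, so that linearity holds on the whole type. The unit of U_A
  acts as h composed with g, which is the identity only on the image of h.\<close>

definition op :: "uq \<Rightarrow> ('v \<Rightarrow> complex) \<Rightarrow> 'v \<Rightarrow> complex" where
  "op u a = h (act u (g a))"

lemma op_h: "x \<in> carrier M \<Longrightarrow> op u (h x) = h (act u x)"
  by (simp add: op_def)

lemma linear_op: "u \<in> U_A \<Longrightarrow> Vector_Spaces.linear fscale fscale (op u)"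
  by unfold_locales (simp_all add: op_def g_add act_add_right h_add g_fscale act_scal h_fscale)

lemma op_add_left: "u \<in> U_A \<Longrightarrow> u' \<in> U_A \<Longrightarrow> op (u + u') a = op u a + op u' a"
  by (simp add: op_def act_add_left h_add)

lemma op_mult: "u \<in> U_A \<Longrightarrow> u' \<in> U_A \<Longrightarrow> op (u * u') a = op u (op u' a)"
  by (simp add: op_def act_mult)

lemma op_scale: "u \<in> U_A \<Longrightarrow> d \<in> laurent \<Longrightarrow> op (d *q u) a = \<phi> d *f op u a"
  by (simp add: op_def act_scale h_fscale)

lemma op_sum: "finite I \<Longrightarrow> (\<And>i. i \<in> I \<Longrightarrow> u i \<in> U_A) \<Longrightarrow> op (\<Sum>i\<in>I. u i) a = (\<Sum>i\<in>I. op (u i) a)"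
proof (induction I rule: finite_induct)
  case empty
  have "op 0 a + op 0 a = op 0 a" using op_add_left[of 0 0 a] by simp
  then show ?case by simp
qed (simp add: op_add_left U_A_sum)

definition V :: "int \<Rightarrow> ('v \<Rightarrow> complex) set" where
  "V t = h ` WS t"

lemma h_V: "x \<in> carrier M \<Longrightarrow> h x \<in> V t \<longleftrightarrow> x \<in> WS t"
  unfolding V_def using h_inj weight_space_carrier by blast

lemma V_E:
  assumes "a \<in> V t" obtains x where "x \<in> WS t" "x \<in> carrier M" "a = h x"
  using assms weight_space_carrier by (auto simp: V_def)

lemma hg: "a \<in> V t \<Longrightarrow> h (g a) = a" "a \<in> V t \<Longrightarrow> g a \<in> WS t"
  by (auto elim!: V_E)

lemma subspace_V: "fv.subspace (V t)"
  unfolding fv.subspace_def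
proof (intro conjI ballI allI)
  show "0 \<in> V t" using h_V[of "\<zero>\<^bsub>M\<^esub>" t] weight_space_closed(1) by simp
  fix x assume x: "x \<in> V t"
  show "x + y \<in> V t" if "y \<in> V t" for y
    using x that by (elim V_E) (simp add: h_add[symmetric] h_V weight_space_closed)
  show "c *f x \<in> V t" for c
    using x by (elim V_E) (simp add: h_fscale[symmetric] h_V weight_space_closed)
qed

lemma zero_V [simp]: "0 \<in> V t"
  by (rule fv.subspace_0[OF subspace_V])

lemma op_0_if: "a \<in> V t \<Longrightarrow> op 1 a = a"
  by (elim V_E) (simp add: op_h)

lemma op_KB: "a \<in> V t \<Longrightarrow> op (ut.KB c r) a = \<phi> (q_binom (t + c) r) *f a"
  by (elim V_E) (simp add: op_h act_KB h_fscale)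

lemma op_swapped_KB: "a \<in> V t \<Longrightarrow> op (us.KB c r) a = \<phi> (q_binom (- t + c) r) *f a"
  by (elim V_E) (simp add: op_h act_swapped_KB h_fscale)

lemma op_K: "a \<in> V t \<Longrightarrow> op U_K a = \<phi> (qpow t) *f a"
  by (elim V_E) (simp add: op_h weight_space_iff h_fscale)

lemma op_Kinv: "a \<in> V t \<Longrightarrow> op U_Kinv a = \<phi> (qpow (- t)) *f a"
  by (elim V_E) (simp add: op_h act_Kinv h_fscale del: power_int_minus)

lemma op_div_E: "a \<in> V t \<Longrightarrow> op (div_E k) a \<in> V (t + 2 * int k)"
  and op_div_F: "a \<in> V t \<Longrightarrow> op (div_F k) a \<in> V (t - 2 * int k)"
  by (elim V_E, simp add: op_h h_V act_div_E_weight act_div_F_weight)+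

lemma swapped_KB_U_A: "us.KB c r \<in> U_A"
  unfolding swapped_KB by (intro U_A_scale KB_U_A laurent_power) simp

text \<open>E^(j-i) first raises the weight by 2 (j - i), and the Cartan factor adds 2 i - j - k.
  The resulting top entry t + j - k does not depend on i.\<close>

lemma op_e_f:
  assumes a: "a \<in> V t"
  shows "op (div_E j) (op (div_F k) a) =
    (\<Sum>i\<le>min j k. \<phi> (q_binom (t + int j - int k) i) *f op (div_F (k - i)) (op (div_E (j - i)) a))"
proof -
  have "op (div_E j) (op (div_F k) a)
      = (\<Sum>i\<le>min j k. op (div_F (k - i) * ut.KB (2 * int i - int j - int k) i * div_E (j - i)) a)"
    using ut.Ed_Fd[of j k] by (subst op_sum[symmetric])
      (simp_all add: op_mult[symmetric] KB_U_A div_E_eq(1)[symmetric] div_F_eq(1)[symmetric])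
  also have "\<dots> = (\<Sum>i\<le>min j k. \<phi> (q_binom (t + int j - int k) i) *f op (div_F (k - i)) (op (div_E (j - i)) a))"
  proof (rule sum.cong[OF refl])
    fix i assume i: "i \<in> {..min j k}"
    have e: "t + 2 * int (j - i) + (2 * int i - int j - int k) = t + int j - int k" using i by (simp add: of_nat_diff)
    have "op (ut.KB (2 * int i - int j - int k) i) (op (div_E (j - i)) a)
        = \<phi> (q_binom (t + int j - int k) i) *f op (div_E (j - i)) a"
      using op_KB[OF op_div_E[OF a, of "j - i"], of "2 * int i - int j - int k" i] unfolding e .
    then show "op (div_F (k - i) * ut.KB (2 * int i - int j - int k) i * div_E (j - i)) a
        = \<phi> (q_binom (t + int j - int k) i) *f op (div_F (k - i)) (op (div_E (j - i)) a)"
      by (simp add: op_mult KB_U_A vs_linear_scale[OF linear_op])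
  qed
  finally show ?thesis .
qed

lemma op_f_e:
  assumes a: "a \<in> V t"
  shows "op (div_F j) (op (div_E k) a) =
    (\<Sum>i\<le>min j k. \<phi> (q_binom (- t + int j - int k) i) *f op (div_E (k - i)) (op (div_F (j - i)) a))"
proof -
  have "op (div_F j) (op (div_E k) a)
      = (\<Sum>i\<le>min j k. op (div_E (k - i) * us.KB (2 * int i - int j - int k) i * div_F (j - i)) a)"
    using us.Ed_Fd[of j k] by (subst op_sum[symmetric])
      (simp_all add: op_mult[symmetric] swapped_KB_U_A div_E_eq(2)[symmetric] div_F_eq(2)[symmetric])
  also have "\<dots> = (\<Sum>i\<le>min j k. \<phi> (q_binom (- t + int j - int k) i) *f op (div_E (k - i)) (op (div_F (j - i)) a))"
  proof (rule sum.cong[OF refl])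
    fix i assume i: "i \<in> {..min j k}"
    have e: "- (t - 2 * int (j - i)) + (2 * int i - int j - int k) = - t + int j - int k"
      using i by (simp add: of_nat_diff)
    have "op (us.KB (2 * int i - int j - int k) i) (op (div_F (j - i)) a)
        = \<phi> (q_binom (- t + int j - int k) i) *f op (div_F (j - i)) a"
      using op_swapped_KB[OF op_div_F[OF a, of "j - i"], of "2 * int i - int j - int k" i] unfolding e .
    then show "op (div_E (k - i) * us.KB (2 * int i - int j - int k) i * div_F (j - i)) a
        = \<phi> (q_binom (- t + int j - int k) i) *f op (div_E (k - i)) (op (div_F (j - i)) a)"
      by (simp add: op_mult swapped_KB_U_A vs_linear_scale[OF linear_op])
  qed
  finally show ?thesis .
qed

lemma separating_operator:
  assumes "s \<noteq> t"
  shows "\<exists>u c. u \<in> U_A \<and> (\<forall>r. \<forall>a\<in>V r. op u a = c r *f a) \<and> c s \<noteq> (c t :: complex)"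
proof -
  consider "\<phi> (qpow s) \<noteq> \<phi> (qpow t)" | r where "\<phi> (q_binom s r) \<noteq> \<phi> (q_binom t r)"
    using weights_separated assms by blast
  then show ?thesis
  proof cases
    case 1
    then show ?thesis using op_K by (intro exI[of _ U_K] exI[of _ "\<lambda>t. \<phi> (qpow t)"]) auto
  next
    case 2
    then show ?thesis using op_KB[of _ _ 0 r]
      by (intro exI[of _ "ut.KB 0 r"] exI[of _ "\<lambda>t. \<phi> (q_binom t r)"]) (auto simp: KB_U_A)
  qed
qed

text \<open>Subspaces stable under the algebra are graded.\<close>

lemma component_in:
  assumes S: "fv.subspace S" "\<And>u a. u \<in> U_A \<Longrightarrow> a \<in> S \<Longrightarrow> op u a \<in> S"
  shows "finite I \<Longrightarrow> (\<And>i. i \<in> I \<Longrightarrow> \<tau> i \<noteq> t) \<Longrightarrow> a \<in> V t \<Longrightarrow> (\<And>i. i \<in> I \<Longrightarrow> y i \<in> V (\<tau> i)) \<Longrightarrow>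
    a + (\<Sum>i\<in>I. y i) \<in> S \<Longrightarrow> a \<in> S"
proof (induction I arbitrary: a y rule: finite_induct)
  case (insert s I)
  obtain u c where u: "u \<in> U_A" "\<And>r a. a \<in> V r \<Longrightarrow> op u a = c r *f a" "c (\<tau> s) \<noteq> c t"
    using separating_operator[of "\<tau> s" t] insert.prems(1)[of s] by blast
  let ?A = "a + (\<Sum>i\<in>insert s I. y i)"
  \<comment> \<open>Subtracting the eigenvalue of the component s removes that component. The others
    are rescaled and stay in their weight spaces, and the factor at weight t is nonzero, so the
    induction hypothesis applies to the rescaled vectors.\<close>
  have "op u ?A - c (\<tau> s) *f ?A \<in> S"
    by (rule fv.subspace_diff[OF S(1) S(2)[OF u(1) insert.prems(4)] fv.subspace_scale[OF S(1) insert.prems(4)]])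
  also have "op u ?A - c (\<tau> s) *f ?A
      = (op u a - c (\<tau> s) *f a) + (\<Sum>i\<in>insert s I. op u (y i) - c (\<tau> s) *f y i)"
    by (simp only: vs_linear_add[OF linear_op[OF u(1)]] vs_linear_sum[OF linear_op[OF u(1)]]
        fv.scale_right_distrib fv.scale_sum_right sum_subtractf) simp
  also have "(\<Sum>i\<in>insert s I. op u (y i) - c (\<tau> s) *f y i) = (\<Sum>i\<in>insert s I. (c (\<tau> i) - c (\<tau> s)) *f y i)"
    using insert.prems(3) by (intro sum.cong refl) (simp add: u(2) fv.scale_left_diff_distrib)
  also have "\<dots> = (\<Sum>i\<in>I. (c (\<tau> i) - c (\<tau> s)) *f y i)"
    using insert.hyps by simp
  also have "op u a - c (\<tau> s) *f a = (c t - c (\<tau> s)) *f a"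
    using insert.prems(2) by (simp add: u(2) fv.scale_left_diff_distrib)
  finally have "(c t - c (\<tau> s)) *f a + (\<Sum>i\<in>I. (c (\<tau> i) - c (\<tau> s)) *f y i) \<in> S" .
  then have "(c t - c (\<tau> s)) *f a \<in> S"
    using insert.prems by (intro insert.IH[of "(c t - c (\<tau> s)) *f a" "\<lambda>i. (c (\<tau> i) - c (\<tau> s)) *f y i"])
      (auto intro: fv.subspace_scale[OF subspace_V])
  from fv.subspace_scale[OF S(1) this, of "inverse (c t - c (\<tau> s))"] show ?case using u(3) by simp
qed simp

lemma subspace_image:
  assumes N: "Module.submodule N Z M"
  shows "fv.subspace (h ` N)" and "u \<in> U_A \<Longrightarrow> a \<in> h ` N \<Longrightarrow> op u a \<in> h ` N"
proof -
  note sN = submoduleD[OF N]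
  show "fv.subspace (h ` N)"
    unfolding fv.subspace_def
  proof (intro conjI ballI allI)
    show "0 \<in> h ` N" using imageI[OF sN(2), of h] by simp
    fix x assume "x \<in> h ` N"
    then obtain x' where x: "x = h x'" "x' \<in> N" by blast
    show "c *f x \<in> h ` N" for c
    proof -
      have "x' \<in> carrier M" using x(2) sN(1) by blast
      then have "c *f x = h (scal c x')" unfolding x(1) by (simp only: h_fscale)
      then show ?thesis using imageI[OF sN(4)[OF x(2)], of h c] by simp
    qed
    show "x + y \<in> h ` N" if "y \<in> h ` N" for y
    proof -
      obtain y' where y: "y = h y'" "y' \<in> N" using \<open>y \<in> h ` N\<close> by blast
      have "x' \<in> carrier M" "y' \<in> carrier M" using x(2) y(2) sN(1) by blast+
      then have "x + y = h (x' \<oplus>\<^bsub>M\<^esub> y')" unfolding x(1) y(1) by (simp only: h_add)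
      then show ?thesis using imageI[OF sN(3)[OF x(2) y(2)], of h] by simp
    qed
  qed
  show "op u a \<in> h ` N" if "u \<in> U_A" "a \<in> h ` N"
  proof -
    obtain x where x: "a = h x" "x \<in> N" using \<open>a \<in> h ` N\<close> by blast
    have "x \<in> carrier M" using x(2) sN(1) by blast
    then have "op u a = h (act u x)" unfolding x(1) by (rule op_h)
    then show ?thesis using imageI[OF sN(5)[OF \<open>u \<in> U_A\<close> x(2)], of h] by simp
  qed
qed

text \<open>Independence of distinct weight spaces is \<open>component_in\<close> for the zero
  subspace.\<close>

lemma graded_family_unique:
  assumes "finite I" "\<And>t. y t \<in> V t" "(\<Sum>t\<in>I. y t) = 0" "t \<in> I"
  shows "y t = 0"
proof -
  have "y t + (\<Sum>s\<in>I - {t}. y s) = 0" using assms by (simp add: sum.remove[symmetric])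
  then have "y t \<in> {0}"
    using assms by (intro component_in[of "{0}" "I - {t}" "\<lambda>s. s" t "y t" y])
      (auto simp: vs_linear_0[OF linear_op])
  then show ?thesis by simp
qed

end

section \<open>Weight decompositions and graded families of submodules\<close>

locale generated_module = modelled_module \<phi> M g h
  for \<phi> :: "qfield \<Rightarrow> complex" and M :: "(u_zeta, 'v) module"
    and g :: "('v \<Rightarrow> complex) \<Rightarrow> 'v" and h :: "'v \<Rightarrow> 'v \<Rightarrow> complex" +
  assumes generated: "carrier M = generate (add_monoid M) (\<Union>t. WS t)"
begin

lemma decomposition:
  assumes "x \<in> carrier M"
  shows "\<exists>I y. finite I \<and> (\<forall>t. y t \<in> V t) \<and> (\<forall>t. t \<notin> I \<longrightarrow> y t = 0) \<and> h x = (\<Sum>t\<in>I. y t)"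
  using subsetD[OF equalityD1[OF generated] assms]
proof (induction x rule: generate.induct)
  case one
  then show ?case by (intro exI[of _ "{}"] exI[of _ "\<lambda>t. 0"]) auto
next
  case (incl x)
  then obtain s where s: "x \<in> WS s" by blast
  then show ?case
    by (intro exI[of _ "{s}"] exI[of _ "\<lambda>t. if t = s then h x else 0"])
      (auto simp: h_V weight_space_carrier)
next
  case (inv x)
  then obtain s where s: "x \<in> WS s" by blast
  have xM: "x \<in> carrier M" by (rule weight_space_carrier[OF s])
  have "h (\<ominus>\<^bsub>M\<^esub> x) + h x = 0" using h_add[of "\<ominus>\<^bsub>M\<^esub> x" x] xM by (simp add: M.l_neg)
  then have "h (\<ominus>\<^bsub>M\<^esub> x) = - h x" by (simp add: eq_neg_iff_add_eq_0)
  then have "h (inv\<^bsub>add_monoid M\<^esub> x) = - h x" by (simp add: a_inv_def)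
  then show ?case using s
    by (intro exI[of _ "{s}"] exI[of _ "\<lambda>t. if t = s then - h x else 0"])
      (auto simp: V_def[symmetric] h_V xM intro: fv.subspace_neg[OF subspace_V])
next
  case (eng x x')
  obtain I y where y: "finite I" "\<And>t. y t \<in> V t" "\<And>t. t \<notin> I \<Longrightarrow> y t = 0" "h x = (\<Sum>t\<in>I. y t)"
    using eng.IH(1) by blast
  obtain I' y' where y': "finite I'" "\<And>t. y' t \<in> V t" "\<And>t. t \<notin> I' \<Longrightarrow> y' t = 0" "h x' = (\<Sum>t\<in>I'. y' t)"
    using eng.IH(2) by blast
  have "x \<in> carrier M" "x' \<in> carrier M" using eng.hyps by (auto intro: subsetD[OF equalityD2[OF generated]])
  then have "h (x \<otimes>\<^bsub>add_monoid M\<^esub> x') = h x + h x'" by (simp add: h_add)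
  also have "h x = (\<Sum>t\<in>I \<union> I'. y t)" unfolding y(4) using y(1,3) y'(1) by (intro sum.mono_neutral_left) auto
  also have "h x' = (\<Sum>t\<in>I \<union> I'. y' t)" unfolding y'(4) using y(1) y'(1,3) by (intro sum.mono_neutral_left) auto
  finally show ?case using y y'
    by (intro exI[of _ "I \<union> I'"] exI[of _ "\<lambda>t. y t + y' t"])
      (auto simp: sum.distrib intro: fv.subspace_add[OF subspace_V])
qed

lemma submodule_decomposition:
  assumes N: "Module.submodule N Z M" and x: "x \<in> N"
  shows "\<exists>I y. finite I \<and> (\<forall>t. y t \<in> V t \<and> y t \<in> h ` N) \<and> (\<forall>t. t \<notin> I \<longrightarrow> y t = 0) \<and> h x = (\<Sum>t\<in>I. y t)"
proof -
  note si = subspace_image[OF N]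
  have "x \<in> carrier M" using x submoduleD(1)[OF N] by blast
  from decomposition[OF this] obtain I y where y: "finite I" "\<And>t. y t \<in> V t" "\<And>t. t \<notin> I \<Longrightarrow> y t = 0" "h x = (\<Sum>t\<in>I. y t)"
    by blast
  have "y t \<in> h ` N" for t
  proof (cases "t \<in> I")
    case True
    have "y t + (\<Sum>s\<in>I - {t}. y s) = h x" using y(1,4) True by (simp add: sum.remove[symmetric])
    then have "y t + (\<Sum>s\<in>I - {t}. y s) \<in> h ` N" using x by simp
    then show ?thesis
      using y by (intro component_in[OF si, of "I - {t}" "\<lambda>s. s" t "y t" y]) auto
  next
    case False
    then show ?thesis using y(3) fv.subspace_0[OF si(1)] by simp
  qed
  then show ?thesis using y by blast
qed

text \<open>K and all [K; 0; r] act on the nonzero coordinate i by the eigenvalues of weight t and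
  by those of weight n - 2 i, and these eigenvalues determine the weight.\<close>

lemma coordinates_weight:
  assumes P: "coordinates C C' n P" and x: "x \<in> C'" "x \<in> WS t" and i: "i \<le> n" and nz: "P x i \<noteq> 0"
  shows "t = int n - 2 * int i"
proof (rule weights_separated)
  have sc: "P (scal c x) i = c * P x i" for c using P x i by (simp add: coordinates_def)
  have "P (act U_K x) i = \<phi> (qpow (int n - 2 * int i)) * P x i" using P x i by (simp add: coordinates_def)
  moreover have "act U_K x = scal (\<phi> (qpow t)) x" using x by (simp add: weight_space_iff)
  ultimately show "\<phi> (qpow t) = \<phi> (qpow (int n - 2 * int i))" using sc nz by simp
  fix r
  have "P (act (K_binom r) x) i = \<phi> (q_binom (int n - 2 * int i) r) * P x i" using P x i by (simp add: coordinates_def)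
  moreover have "act (K_binom r) x = scal (\<phi> (q_binom t r)) x" using x by (simp add: weight_space_iff)
  ultimately show "\<phi> (q_binom t r) = \<phi> (q_binom (int n - 2 * int i) r)" using sc nz by simp
qed

text \<open>Some weight component of a lift of the top basis vector has a nonzero coordinate 0 and
  therefore weight n. This bounds the highest weights of all filtration factors by m.\<close>

lemma coordinates_highest:
  assumes C': "Module.submodule C' Z M" and P: "coordinates C C' n P"
  shows "WS (int n) \<noteq> {\<zero>\<^bsub>M\<^esub>}"
proof -
  note sC' = submoduleD[OF C']
  obtain x where x: "x \<in> C'" "P x 0 = 1"
  proof -
    have "\<exists>x\<in>C'. \<forall>i\<le>n. P x i = 1" using P by (simp add: coordinates_def)
    then show thesis using that by blast
  qed
  obtain I y where y: "finite I" "\<And>t. y t \<in> V t" "\<And>t. y t \<in> h ` C'" "h x = (\<Sum>t\<in>I. y t)"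
    using submodule_decomposition[OF C' x(1)] by blast
  have gy: "g (y t) \<in> C'" for t using y(3)[of t] sC'(1) by auto
  have add: "P (a \<oplus>\<^bsub>M\<^esub> b) 0 = P a 0 + P b 0" if "a \<in> C'" "b \<in> C'" for a b
    using P that by (simp add: coordinates_def)
  have g0: "g 0 = \<zero>\<^bsub>M\<^esub>" using gh[of "\<zero>\<^bsub>M\<^esub>"] by simp
  have "g (\<Sum>t\<in>I. y t) \<in> C' \<and> P (g (\<Sum>t\<in>I. y t)) 0 = (\<Sum>t\<in>I. P (g (y t)) 0)"
    using y(1)
  proof (induction I rule: finite_induct)
    case empty
    have "P \<zero>\<^bsub>M\<^esub> 0 = 0" using add[of "\<zero>\<^bsub>M\<^esub>" "\<zero>\<^bsub>M\<^esub>"] sC'(2) by simp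
    then show ?case unfolding sum.empty g0 using sC'(2) by simp
  next
    case (insert t I)
    then show ?case using gy add sC'(3) by (simp add: g_add)
  qed
  moreover have "g (\<Sum>t\<in>I. y t) = x" using y(4) gh[of x] sC'(1) x(1) by auto
  ultimately have "(\<Sum>t\<in>I. P (g (y t)) 0) \<noteq> 0" using x(2) by simp
  then obtain t where t: "P (g (y t)) 0 \<noteq> 0" by (meson sum.neutral)
  have gW: "g (y t) \<in> WS t" using hg(2)[OF y(2)] .
  have "t = int n" using coordinates_weight[OF P gy gW _ t] by simp
  moreover have "g (y t) \<noteq> \<zero>\<^bsub>M\<^esub>" using t add[of "\<zero>\<^bsub>M\<^esub>" "\<zero>\<^bsub>M\<^esub>"] sC'(2) by auto
  ultimately show ?thesis using gW by blast
qed

definition family_submodule :: "(int \<Rightarrow> ('v \<Rightarrow> complex) set) \<Rightarrow> 'v set" where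
  "family_submodule N = {x \<in> carrier M. \<exists>I y. finite I \<and> (\<forall>t. y t \<in> N t) \<and> (\<forall>t. t \<notin> I \<longrightarrow> y t = 0) \<and> h x = (\<Sum>t\<in>I. y t)}"

lemma family_submodule_mem:
  assumes "fv.subspace (N t)" "N t \<subseteq> V t" "a \<in> N t" "\<And>t. 0 \<in> N t"
  shows "g a \<in> family_submodule N"
proof -
  have "h (g a) = a" using assms hg by blast
  then show ?thesis unfolding family_submodule_def using assms
    by (intro CollectI conjI exI[of _ "{t}"] exI[of _ "\<lambda>s. if s = t then a else 0"]) auto
qed

lemma family_submodule:
  assumes sub: "\<And>t. fv.subspace (N t)" "\<And>t. N t \<subseteq> V t"
    and E: "\<And>t a k. a \<in> N t \<Longrightarrow> op (div_E k) a \<in> N (t + 2 * int k)"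
    and F: "\<And>t a k. a \<in> N t \<Longrightarrow> op (div_F k) a \<in> N (t - 2 * int k)"
  shows "Module.submodule (family_submodule N) Z M"
proof (rule submoduleI)
  show "family_submodule N \<subseteq> carrier M" by (auto simp: family_submodule_def)
  note N0 = fv.subspace_0[OF sub(1)]
  have shifted: "act u x \<in> family_submodule N"
    if u: "u \<in> U_A" and x: "x \<in> family_submodule N"
      and stable: "\<And>t a. a \<in> N t \<Longrightarrow> op u a \<in> N (t + d)" for u x d
  proof -
    obtain I y where y: "x \<in> carrier M" "finite I" "\<And>t. y t \<in> N t" "\<And>t. t \<notin> I \<Longrightarrow> y t = 0" "h x = (\<Sum>t\<in>I. y t)"
      using x by (auto simp: family_submodule_def)
    have "h (act u x) = (\<Sum>t\<in>I. op u (y t))"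
      using y(1) by (simp add: op_h[symmetric] y(5) vs_linear_sum[OF linear_op[OF u]])
    also have "\<dots> = (\<Sum>t\<in>(\<lambda>t. t + d) ` I. op u (y (t - d)))"
      by (subst sum.reindex) (auto simp: inj_on_def)
    finally have s: "h (act u x) = (\<Sum>t\<in>(\<lambda>t. t + d) ` I. op u (y (t - d)))" .
    have "op u (y (t - d)) \<in> N t" for t using stable[OF y(3)[of "t - d"]] by simp
    moreover have "op u (y (t - d)) = 0" if "t \<notin> (\<lambda>t. t + d) ` I" for t
    proof -
      have "t - d \<notin> I" using that by (metis diff_add_cancel image_eqI)
      then show ?thesis using y(4) vs_linear_0[OF linear_op[OF u]] by simp
    qed
    ultimately show ?thesis unfolding family_submodule_def using s u y(1,2)
      by (intro CollectI conjI exI[of _ "(\<lambda>t. t + d) ` I"] exI[of _ "\<lambda>t. op u (y (t - d))"]) auto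
  qed
  show "\<zero>\<^bsub>M\<^esub> \<in> family_submodule N"
    unfolding family_submodule_def using N0 by (auto intro!: exI[of _ "{}"] exI[of _ "\<lambda>t. 0"])
  fix x assume x: "x \<in> family_submodule N"
  then obtain I y where y: "x \<in> carrier M" "finite I" "\<And>t. y t \<in> N t" "\<And>t. t \<notin> I \<Longrightarrow> y t = 0" "h x = (\<Sum>t\<in>I. y t)"
    by (auto simp: family_submodule_def)
  show "scal c x \<in> family_submodule N" for c
    unfolding family_submodule_def using y
    by (intro CollectI conjI exI[of _ I] exI[of _ "\<lambda>t. c *f y t"])
      (auto simp: h_fscale fv.scale_sum_right intro: fv.subspace_scale[OF sub(1)])
  show "act (div_E n) x \<in> family_submodule N" for n by (rule shifted[OF _ x E]) simp
  show "act (div_F n) x \<in> family_submodule N" for n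
    using F by (intro shifted[OF _ x, of _ "- 2 * int n"]) auto
  have "op U_K a \<in> N t" if "a \<in> N t" for a t
    using that sub(2)[of t] op_K[of a t] fv.subspace_scale[OF sub(1)] by auto
  then show "act U_K x \<in> family_submodule N" by (intro shifted[OF _ x, of _ 0]) auto
  have "op U_Kinv a \<in> N t" if "a \<in> N t" for a t
    using that sub(2)[of t] op_Kinv[of a t] fv.subspace_scale[OF sub(1)] by auto
  then show "act U_Kinv x \<in> family_submodule N" by (intro shifted[OF _ x, of _ 0]) auto
  fix x' assume "x' \<in> family_submodule N"
  then obtain I' y' where y': "x' \<in> carrier M" "finite I'" "\<And>t. y' t \<in> N t" "\<And>t. t \<notin> I' \<Longrightarrow> y' t = 0" "h x' = (\<Sum>t\<in>I'. y' t)"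
    by (auto simp: family_submodule_def)
  have "h (x \<oplus>\<^bsub>M\<^esub> x') = h x + h x'" using y(1) y'(1) by (rule h_add)
  also have "h x = (\<Sum>t\<in>I \<union> I'. y t)" unfolding y(5) using y(2,4) y'(2) by (intro sum.mono_neutral_left) auto
  also have "h x' = (\<Sum>t\<in>I \<union> I'. y' t)" unfolding y'(5) using y(2) y'(2,4) by (intro sum.mono_neutral_left) auto
  finally show "x \<oplus>\<^bsub>M\<^esub> x' \<in> family_submodule N"
    unfolding family_submodule_def using y y'
    by (intro CollectI conjI exI[of _ "I \<union> I'"] exI[of _ "\<lambda>t. y t + y' t"])
      (auto simp: sum.distrib intro: fv.subspace_add[OF sub(1)])
qed

text \<open>Converts a weight by weight splitting into complementary submodules of M. The
  intersection is zero because weight components are unique, and the sum is everything because M is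
  generated by its weight spaces.\<close>

lemma indecomposable_families:
  assumes ind: "indecomposable Z M"
    and M1: "Module.submodule (family_submodule N) Z M" "Module.submodule (family_submodule N') Z M"
    and sub: "\<And>t. fv.subspace (N t)" "\<And>t. N t \<subseteq> V t" "\<And>t. fv.subspace (N' t)" "\<And>t. N' t \<subseteq> V t"
    and int: "\<And>t. N t \<inter> N' t = {0}" and sum: "\<And>t. V t = {x + y | x y. x \<in> N t \<and> y \<in> N' t}"
  shows "(\<forall>t. N t = {0}) \<or> (\<forall>t. N' t = {0})"
proof -
  let ?F = "family_submodule N" and ?F' = "family_submodule N'"
  have "?F \<inter> ?F' = {\<zero>\<^bsub>M\<^esub>}"
  proof
    show "{\<zero>\<^bsub>M\<^esub>} \<subseteq> ?F \<inter> ?F'" using submoduleD(2)[OF M1(1)] submoduleD(2)[OF M1(2)] by simp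
    show "?F \<inter> ?F' \<subseteq> {\<zero>\<^bsub>M\<^esub>}"
    proof
      fix x assume x: "x \<in> ?F \<inter> ?F'"
      obtain I y where y: "x \<in> carrier M" "finite I" "\<And>t. y t \<in> N t" "\<And>t. t \<notin> I \<Longrightarrow> y t = 0" "h x = (\<Sum>t\<in>I. y t)"
        using IntD1[OF x] unfolding family_submodule_def by blast
      obtain I' y' where y': "finite I'" "\<And>t. y' t \<in> N' t" "\<And>t. t \<notin> I' \<Longrightarrow> y' t = 0" "h x = (\<Sum>t\<in>I'. y' t)"
        using IntD2[OF x] unfolding family_submodule_def by blast
      have "h x = (\<Sum>t\<in>I \<union> I'. y t)" unfolding y(5) using y(2,4) y'(1) by (intro sum.mono_neutral_left) auto
      moreover have "h x = (\<Sum>t\<in>I \<union> I'. y' t)" unfolding y'(4) using y(2) y'(1,3) by (intro sum.mono_neutral_left) auto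
      ultimately have s0: "(\<Sum>t\<in>I \<union> I'. y t - y' t) = 0" by (simp add: sum_subtractf)
      have inV: "y t - y' t \<in> V t" for t
        using y(3)[of t] y'(2)[of t] sub(2,4) by (blast intro: fv.subspace_diff[OF subspace_V])
      have "y t = 0" if "t \<in> I" for t
      proof -
        have "y t - y' t = 0"
          using y(2) y'(1) that by (intro graded_family_unique[of "I \<union> I'" "\<lambda>t. y t - y' t" t] inV s0) auto
        then have "y t \<in> N t \<inter> N' t" using y(3)[of t] y'(2)[of t] by simp
        then show ?thesis using int by blast
      qed
      then have "h x = 0" unfolding y(5) by (simp add: sum.neutral)
      then show "x \<in> {\<zero>\<^bsub>M\<^esub>}" using h_eq_0 y(1) by simp
    qed
  qed
  moreover have "?F <+>\<^bsub>M\<^esub> ?F' = carrier M"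
  proof
    show "?F <+>\<^bsub>M\<^esub> ?F' \<subseteq> carrier M"
      by (auto simp: set_add_def set_mult_def family_submodule_def)
    show "carrier M \<subseteq> ?F <+>\<^bsub>M\<^esub> ?F'"
    proof
      fix x assume x: "x \<in> carrier M"
      obtain I y where y: "finite I" "\<And>t. y t \<in> V t" "h x = (\<Sum>t\<in>I. y t)" using decomposition[OF x] by blast
      have "\<exists>a b. y t = a + b \<and> a \<in> N t \<and> b \<in> N' t" for t
        using y(2)[of t] unfolding sum[of t] by blast
      then obtain a b where ab: "\<And>t. y t = a t + b t" "\<And>t. a t \<in> N t" "\<And>t. b t \<in> N' t" by metis
      have part: "g (\<Sum>t\<in>I. a t) \<in> ?F \<and> g (\<Sum>t\<in>I. b t) \<in> ?F'"
        using y(1)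
      proof (induction I rule: finite_induct)
        case empty
        have "g 0 = \<zero>\<^bsub>M\<^esub>" using gh[of "\<zero>\<^bsub>M\<^esub>"] by simp
        then show ?case using submoduleD(2)[OF M1(1)] submoduleD(2)[OF M1(2)] by simp
      next
        case (insert s I)
        then show ?case
          using submoduleD(3)[OF M1(1)] submoduleD(3)[OF M1(2)]
            family_submodule_mem[of N s "a s"] family_submodule_mem[of N' s "b s"] ab sub fv.subspace_0
          by (simp add: g_add)
      qed
      have "x = g (\<Sum>t\<in>I. y t)" using gh[OF x] y(3) by simp
      also have "\<dots> = g (\<Sum>t\<in>I. a t) \<oplus>\<^bsub>M\<^esub> g (\<Sum>t\<in>I. b t)" by (simp add: ab(1) sum.distrib g_add)
      finally show "x \<in> ?F <+>\<^bsub>M\<^esub> ?F'" using part by (auto simp: set_add_def set_mult_def)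
    qed
  qed
  ultimately have "?F = {\<zero>\<^bsub>M\<^esub>} \<or> ?F' = {\<zero>\<^bsub>M\<^esub>}"
    using ind M1 by (auto simp: indecomposable_def)
  moreover have z: "N t = {0}" if "family_submodule N = {\<zero>\<^bsub>M\<^esub>}" "\<And>t. fv.subspace (N t)" "\<And>t. N t \<subseteq> V t" for N t
  proof -
    have "a = 0" if "a \<in> N t" for a
    proof -
      have "g a = \<zero>\<^bsub>M\<^esub>"
        using family_submodule_mem[of N t a] that \<open>family_submodule N = {\<zero>\<^bsub>M\<^esub>}\<close> \<open>\<And>t. fv.subspace (N t)\<close>
          \<open>\<And>t. N t \<subseteq> V t\<close> fv.subspace_0 by auto
      moreover have "h (g a) = a" using that \<open>\<And>t. N t \<subseteq> V t\<close> hg(1) by blast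
      ultimately show ?thesis by simp
    qed
    then show ?thesis using fv.subspace_0[OF \<open>\<And>t. fv.subspace (N t)\<close>] by blast
  qed
  ultimately show ?thesis using z[of N] z[of N'] sub by blast
qed

end

section \<open>Tilting modules\<close>

locale indecomposable_tilting_module = generated_module \<phi> M g h +
  root_binom "\<phi> q_par" l "\<lambda>t r. \<phi> (q_binom t r)"
  for \<phi> :: "qfield \<Rightarrow> complex" and M :: "(u_zeta, 'v) module"
    and g :: "('v \<Rightarrow> complex) \<Rightarrow> 'v" and h :: "'v \<Rightarrow> 'v \<Rightarrow> complex" and l m :: nat +
  assumes weyl: "filtration_by Z (\<lambda>D. \<exists>k. is_weyl \<phi> k D) M"
    and dual_weyl: "filtration_by Z (\<lambda>D. \<exists>k. is_dual_weyl \<phi> k D) M"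
    and indec: "indecomposable Z M" and highest: "highest_weight \<phi> M (int m)"
begin

lemma coordinates_le:
  assumes "Module.submodule C' Z M" "coordinates C C' k P"
  shows "k \<le> m"
  using coordinates_highest[OF assms] highest by (auto simp: highest_weight_def)

lemma weyl_filtration:
  obtains C and n :: nat where "C 0 = {\<zero>\<^bsub>M\<^esub>}" "C n = carrier M" "\<forall>i\<le>n. Module.submodule (C i) Z M"
    "\<forall>i<n. C i \<subseteq> C (Suc i) \<and> (\<exists>k\<le>m. \<exists>P. coordinates (C i) (C (Suc i)) k P \<and>
      (\<forall>x\<in>C (Suc i). \<forall>j\<le>k. P (act (div_F 1) x) j = (if j = 0 then 0 else \<phi> (q_int (int j)) * P x (j - 1))))"
proof -
  obtain n :: nat and C where C: "C 0 = {\<zero>\<^bsub>M\<^esub>}" "C n = carrier M" "\<forall>i\<le>n. Module.submodule (C i) Z M"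
    and step: "\<forall>i<n. C i \<subseteq> C (Suc i) \<and> (\<exists>k. is_weyl \<phi> k (quot_module (M\<lparr>carrier := C (Suc i)\<rparr>) (C i)))"
    using weyl unfolding filtration_by_def by blast
  have "C i \<subseteq> C (Suc i) \<and> (\<exists>k\<le>m. \<exists>P. coordinates (C i) (C (Suc i)) k P \<and>
      (\<forall>x\<in>C (Suc i). \<forall>j\<le>k. P (act (div_F 1) x) j = (if j = 0 then 0 else \<phi> (q_int (int j)) * P x (j - 1))))"
    if i: "i < n" for i
  proof -
    obtain k where k: "is_weyl \<phi> k (quot_module (M\<lparr>carrier := C (Suc i)\<rparr>) (C i))" and sub: "C i \<subseteq> C (Suc i)"
      using step i by blast
    have sm: "Module.submodule (C i) Z M" "Module.submodule (C (Suc i)) Z M" using C(3) i by auto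
    obtain P where P: "coordinates (C i) (C (Suc i)) k P"
      "\<forall>x\<in>C (Suc i). \<forall>j\<le>k. P (act (div_F 1) x) j = (if j = 0 then 0 else \<phi> (q_int (int j)) * P x (j - 1))"
      using weyl_coordinates[OF sm sub k] by blast
    show ?thesis using sub coordinates_le[OF sm(2) P(1)] P by blast
  qed
  then show thesis using C by (intro that[of C n]) auto
qed

lemma dual_weyl_filtration:
  obtains C and n :: nat where "C 0 = {\<zero>\<^bsub>M\<^esub>}" "C n = carrier M" "\<forall>i\<le>n. Module.submodule (C i) Z M"
    "\<forall>i<n. C i \<subseteq> C (Suc i) \<and> (\<exists>k\<le>m. \<exists>P. coordinates (C i) (C (Suc i)) k P \<and>
      (\<forall>x\<in>C (Suc i). \<forall>j\<le>k. P (act (div_E 1) x) j =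
         (if j = k then 0 else \<phi> (- q_int (int j + 1) * qpow (int k - 2 * int j - 2)) * P x (j + 1))))"
proof -
  obtain n :: nat and C where C: "C 0 = {\<zero>\<^bsub>M\<^esub>}" "C n = carrier M" "\<forall>i\<le>n. Module.submodule (C i) Z M"
    and step: "\<forall>i<n. C i \<subseteq> C (Suc i) \<and> (\<exists>k. is_dual_weyl \<phi> k (quot_module (M\<lparr>carrier := C (Suc i)\<rparr>) (C i)))"
    using dual_weyl unfolding filtration_by_def by blast
  have "C i \<subseteq> C (Suc i) \<and> (\<exists>k\<le>m. \<exists>P. coordinates (C i) (C (Suc i)) k P \<and>
      (\<forall>x\<in>C (Suc i). \<forall>j\<le>k. P (act (div_E 1) x) j =
         (if j = k then 0 else \<phi> (- q_int (int j + 1) * qpow (int k - 2 * int j - 2)) * P x (j + 1))))"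
    if i: "i < n" for i
  proof -
    obtain k where k: "is_dual_weyl \<phi> k (quot_module (M\<lparr>carrier := C (Suc i)\<rparr>) (C i))" and sub: "C i \<subseteq> C (Suc i)"
      using step i by blast
    have sm: "Module.submodule (C i) Z M" "Module.submodule (C (Suc i)) Z M" using C(3) i by auto
    obtain P where P: "coordinates (C i) (C (Suc i)) k P"
      "\<forall>x\<in>C (Suc i). \<forall>j\<le>k. P (act (div_E 1) x) j =
         (if j = k then 0 else \<phi> (- q_int (int j + 1) * qpow (int k - 2 * int j - 2)) * P x (j + 1))"
      using dual_weyl_coordinates[OF sm sub k] by blast
    show ?thesis using sub coordinates_le[OF sm(2) P(1)] P by blast
  qed
  then show thesis using C by (intro that[of C n]) auto
qed

lemma coordinates_kernel:
  "coordinates C C' k P \<Longrightarrow> x \<in> C' \<Longrightarrow> x \<in> C \<longleftrightarrow> (\<forall>j\<le>k. P x j = 0)"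
  by (simp add: coordinates_def)

text \<open>In a factor of highest weight k <= m all weights are at least - m, so every coordinate
  of x vanishes and x descends through the filtration to zero.\<close>

lemma weights_bounded_below:
  assumes "x \<in> WS t" "t < - int m"
  shows "x = \<zero>\<^bsub>M\<^esub>"
proof -
  obtain n :: nat and C where C: "C 0 = {\<zero>\<^bsub>M\<^esub>}" "C n = carrier M" "\<forall>i\<le>n. Module.submodule (C i) Z M"
    and step: "\<forall>i<n. C i \<subseteq> C (Suc i) \<and> (\<exists>k\<le>m. \<exists>P. coordinates (C i) (C (Suc i)) k P \<and>
      (\<forall>x\<in>C (Suc i). \<forall>j\<le>k. P (act (div_F 1) x) j = (if j = 0 then 0 else \<phi> (q_int (int j)) * P x (j - 1))))"
    by (rule weyl_filtration) (rule that; assumption)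
  have "i \<le> n \<Longrightarrow> x \<in> C i \<Longrightarrow> x = \<zero>\<^bsub>M\<^esub>" for i
  proof (induction i)
    case (Suc i)
    obtain k P where k: "k \<le> m" and P: "coordinates (C i) (C (Suc i)) k P"
      using step[rule_format, OF Suc_le_lessD[OF Suc.prems(1)]] by blast
    have "P x j = 0" if "j \<le> k" for j
      using coordinates_weight[OF P Suc.prems(2) assms(1) that] assms(2) k that by fastforce
    then show ?case using coordinates_kernel[OF P Suc.prems(2)] Suc by simp
  qed (simp add: C)
  then show ?thesis using C(2) weight_space_carrier[OF assms(1)] by blast
qed

text \<open>In a factor of highest weight k <= m, a vector of weight m - 2 b has its nonzero
  coordinates at some j <= b, and j < k since that weight is positive. F moves such a coordinate to
  j + 1 with factor [j + 1], nonzero as j + 1 < l. Hence x lies in the next smaller step.\<close>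

lemma div_F_injective:
  assumes x: "x \<in> WS (int m - 2 * int b)" "act (div_F 1) x = \<zero>\<^bsub>M\<^esub>" and b: "Suc b < l" "2 * b < m"
  shows "x = \<zero>\<^bsub>M\<^esub>"
proof -
  obtain n :: nat and C where C: "C 0 = {\<zero>\<^bsub>M\<^esub>}" "C n = carrier M" "\<forall>i\<le>n. Module.submodule (C i) Z M"
    and step: "\<forall>i<n. C i \<subseteq> C (Suc i) \<and> (\<exists>k\<le>m. \<exists>P. coordinates (C i) (C (Suc i)) k P \<and>
      (\<forall>x\<in>C (Suc i). \<forall>j\<le>k. P (act (div_F 1) x) j = (if j = 0 then 0 else \<phi> (q_int (int j)) * P x (j - 1))))"
    by (rule weyl_filtration) (rule that; assumption)
  have "i \<le> n \<Longrightarrow> x \<in> C i \<Longrightarrow> x = \<zero>\<^bsub>M\<^esub>" for i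
  proof (induction i)
    case (Suc i)
    obtain k P where k: "k \<le> m" and P: "coordinates (C i) (C (Suc i)) k P"
      and F: "\<And>j. j \<le> k \<Longrightarrow> P (act (div_F 1) x) j = (if j = 0 then 0 else \<phi> (q_int (int j)) * P x (j - 1))"
      using step[rule_format, OF Suc_le_lessD[OF Suc.prems(1)]] Suc.prems(2) by blast
    have sm: "Module.submodule (C i) Z M" "Module.submodule (C (Suc i)) Z M" using C(3) Suc.prems by auto
    have P0: "P \<zero>\<^bsub>M\<^esub> j = 0" if "j \<le> k" for j
      using coordinates_kernel[OF P submoduleD(2)[OF sm(2)]] submoduleD(2)[OF sm(1)] that by blast
    have "P x j = 0" if j: "j \<le> k" for j
    proof (rule ccontr)
      assume nz: "P x j \<noteq> 0"
      have e: "int m - 2 * int b = int k - 2 * int j" by (rule coordinates_weight[OF P Suc.prems(2) x(1) j nz])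
      then have jb: "j \<le> b" "Suc j \<le> k" using k b(2) by linarith+
      have "\<phi> (q_binom (int (Suc j)) (Suc 0)) \<noteq> 0" using b(1) jb(1) by (intro binom_small_nonzero) auto
      moreover have "\<phi> (q_int (int (Suc j))) * P x j = 0"
        using F[OF jb(2)] P0[OF jb(2)] unfolding x(2) by simp
      ultimately show False using nz by simp
    qed
    then show ?case using coordinates_kernel[OF P Suc.prems(2)] Suc by simp
  qed (simp add: C)
  then show ?thesis using C(2) weight_space_carrier[OF x(1)] by blast
qed

text \<open>Induction along the dual Weyl filtration. In the top factor a preimage is found by
  dividing coordinates by the entries of E, nonzero for the same reason as in
  \<open>div_F_injective\<close>; the error lies in the smaller step and is corrected by
  induction.\<close>

lemma div_E_surjective:
  assumes y: "y \<in> V (int m - 2 * int b)" and b: "Suc b < l" "2 * b < m"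
  shows "\<exists>x\<in>V (int m - 2 * int (Suc b)). op (div_E 1) x = y"
proof -
  let ?t = "int m - 2 * int b" and ?s = "int m - 2 * int (Suc b)"
  obtain n :: nat and C where C: "C 0 = {\<zero>\<^bsub>M\<^esub>}" "C n = carrier M" "\<forall>i\<le>n. Module.submodule (C i) Z M"
    and step: "\<forall>i<n. C i \<subseteq> C (Suc i) \<and> (\<exists>k\<le>m. \<exists>P. coordinates (C i) (C (Suc i)) k P \<and>
      (\<forall>x\<in>C (Suc i). \<forall>j\<le>k. P (act (div_E 1) x) j =
         (if j = k then 0 else \<phi> (- q_int (int j + 1) * qpow (int k - 2 * int j - 2)) * P x (j + 1))))"
    by (rule dual_weyl_filtration) (rule that; assumption)
  have "i \<le> n \<Longrightarrow> y \<in> V ?t \<Longrightarrow> y \<in> h ` C i \<Longrightarrow> \<exists>x\<in>V ?s. x \<in> h ` C i \<and> op (div_E 1) x = y" for i y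
  proof (induction i arbitrary: y)
    case 0
    then have "y = 0" using C(1) by simp
    then show ?case using C(1) by (intro bexI[of _ 0]) (simp_all add: vs_linear_0[OF linear_op])
  next
    case (Suc i)
    obtain k P where sub: "C i \<subseteq> C (Suc i)" and k: "k \<le> m" and P: "coordinates (C i) (C (Suc i)) k P"
      and E: "\<And>x j. x \<in> C (Suc i) \<Longrightarrow> j \<le> k \<Longrightarrow> P (act (div_E 1) x) j =
         (if j = k then 0 else \<phi> (- q_int (int j + 1) * qpow (int k - 2 * int j - 2)) * P x (j + 1))"
      using step[rule_format, OF Suc_le_lessD[OF Suc.prems(1)]] by blast
    have sm: "Module.submodule (C i) Z M" "Module.submodule (C (Suc i)) Z M" using C(3) Suc.prems by auto
    note sC = submoduleD[OF sm(2)]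
    obtain y' where y': "y = h y'" "y' \<in> C (Suc i)" using Suc.prems(3) by blast
    have y'M: "y' \<in> carrier M" using y'(2) sC(1) by blast
    then have y'W: "y' \<in> WS ?t" using Suc.prems(2) h_V y'(1) by simp
    define \<alpha> where "\<alpha> j = \<phi> (- q_int (int j + 1) * qpow (int k - 2 * int j - 2))" for j
    have nz: "j < k \<and> \<alpha> j \<noteq> 0" if "j \<le> k" "P y' j \<noteq> 0" for j
    proof -
      have "?t = int k - 2 * int j" by (rule coordinates_weight[OF P y'(2) y'W that])
      then have jb: "j \<le> b" "j < k" using k b(2) by linarith+
      have "\<phi> (q_binom (int (Suc j)) (Suc 0)) \<noteq> 0" using b(1) jb(1) by (intro binom_small_nonzero) auto
      then have "\<phi> (q_int (int j + 1)) \<noteq> 0" by (simp add: add.commute)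
      then show ?thesis using jb(2) \<phi>_qpow_nonzero
        by (simp add: \<alpha>_def \<phi>_mult \<phi>_uminus laurent_closed)
    qed
    \<comment> \<open>E sends coordinate j + 1 to coordinate j with factor
      \<open>\<alpha> j\<close>, hence the shift by one. Where \<open>\<alpha> (j - 1)\<close> is
      zero, so is the coordinate of y', and division by zero gives the right value.\<close>
    obtain x0 where x0: "x0 \<in> C (Suc i)" "\<forall>j\<le>k. P x0 j = (if j = 0 then 0 else P y' (j - 1) / \<alpha> (j - 1))"
    proof -
      have "\<forall>c. \<exists>x\<in>C (Suc i). \<forall>j\<le>k. P x j = c j" using P by (simp add: coordinates_def)
      then show thesis using that by (elim allE[of _ "\<lambda>j. if j = 0 then 0 else P y' (j - 1) / \<alpha> (j - 1)"]) blast
    qed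
    have PE: "P (act (div_E 1) x0) j = P y' j" if "j \<le> k" for j
      using E[OF x0(1) that] x0(2)[rule_format, of "Suc j"] nz[OF that] that unfolding \<alpha>_def[symmetric]
      by (cases "P y' j = 0") auto
    have "act (div_E 1) x0 \<oplus>\<^bsub>M\<^esub> scal (- 1) y' \<in> C (Suc i)"
      using x0(1) y'(2) by (intro sC) auto
    moreover have "P (act (div_E 1) x0 \<oplus>\<^bsub>M\<^esub> scal (- 1) y') j = 0" if "j \<le> k" for j
    proof -
      have "act (div_E 1) x0 \<in> C (Suc i)" "scal (- 1) y' \<in> C (Suc i)" using x0(1) y'(2) by (auto intro: sC)
      then have "P (act (div_E 1) x0 \<oplus>\<^bsub>M\<^esub> scal (- 1) y') j = P (act (div_E 1) x0) j + P (scal (- 1) y') j"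
        using P that unfolding coordinates_def by blast
      also have "P (scal (- 1) y') j = - 1 * P y' j" using P that y'(2) unfolding coordinates_def by blast
      finally show ?thesis using PE[OF that] by simp
    qed
    ultimately have "act (div_E 1) x0 \<oplus>\<^bsub>M\<^esub> scal (- 1) y' \<in> C i" using coordinates_kernel[OF P] by blast
    then have "h (act (div_E 1) x0 \<oplus>\<^bsub>M\<^esub> scal (- 1) y') \<in> h ` C i" by (rule imageI)
    moreover have x0M: "x0 \<in> carrier M" using x0(1) sC(1) by blast
    ultimately have z: "op (div_E 1) (h x0) + (- 1) *f y \<in> h ` C i"
      using y'M by (simp add: h_add h_fscale op_h y'(1))
    obtain I w where w: "finite I" "\<And>t. w t \<in> V t" "\<And>t. w t \<in> h ` C (Suc i)" "\<And>t. t \<notin> I \<Longrightarrow> w t = 0" "h x0 = (\<Sum>t\<in>I. w t)"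
      using submodule_decomposition[OF sm(2) x0(1)] by blast
    define a where "a = op (div_E 1) (w ?s) + (- 1) *f y"
    have aV: "a \<in> V ?t"
      unfolding a_def using op_div_E[OF w(2)[of ?s], of 1] Suc.prems(2)
      by (intro fv.subspace_add[OF subspace_V] fv.subspace_scale[OF subspace_V]) simp_all
    note si = subspace_image[OF sm(1)] and si' = subspace_image[OF sm(2)]
    have "(\<Sum>t\<in>I. w t) = (\<Sum>t\<in>insert ?s (I - {?s}). w t)"
      using w(1,4) by (intro sum.mono_neutral_left) auto
    also have "\<dots> = w ?s + (\<Sum>t\<in>I - {?s}. w t)" using w(1) by (subst sum.insert) auto
    finally have "op (div_E 1) (h x0) = op (div_E 1) (w ?s) + (\<Sum>t\<in>I - {?s}. op (div_E 1) (w t))"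
      unfolding w(5) by (simp only: vs_linear_add[OF linear_op] vs_linear_sum[OF linear_op] U_A_gens)
    then have "a + (\<Sum>t\<in>I - {?s}. op (div_E 1) (w t)) \<in> h ` C i"
      using z unfolding a_def by (simp only: ac_simps)
    then have "a \<in> h ` C i"
      using w(1) op_div_E[OF w(2), of 1] aV
      by (intro component_in[OF si, of "I - {?s}" "\<lambda>t. t + 2" ?t a "\<lambda>t. op (div_E 1) (w t)"]) auto
    then have "(- 1) *f a \<in> h ` C i" by (rule fv.subspace_scale[OF si(1)])
    moreover have "(- 1) *f a \<in> V ?t" by (rule fv.subspace_scale[OF subspace_V aV])
    ultimately obtain x2 where x2: "x2 \<in> V ?s" "x2 \<in> h ` C i" "op (div_E 1) x2 = (- 1) *f a"
      using Suc.IH[of "(- 1) *f a"] Suc.prems(1) by auto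
    have "op (div_E 1) (w ?s + x2) = op (div_E 1) (w ?s) + (- 1) *f a"
      by (simp only: vs_linear_add[OF linear_op] U_A_gens x2)
    also have "\<dots> = y" by (simp add: a_def)
    finally have "op (div_E 1) (w ?s + x2) = y" .
    moreover have "w ?s + x2 \<in> V ?s" by (rule fv.subspace_add[OF subspace_V w(2) x2(1)])
    moreover have "w ?s + x2 \<in> h ` C (Suc i)"
      using x2(2) sub by (intro fv.subspace_add[OF si'(1) w(3)]) blast
    ultimately show ?case by blast
  qed
  moreover have "y \<in> h ` C n" using y V_E C(2) by (metis imageI)
  ultimately show ?thesis using y by blast
qed

lemma V_eq_0_iff: "V t = {0} \<longleftrightarrow> WS t = {\<zero>\<^bsub>M\<^esub>}"
proof
  assume "V t = {0}"
  then show "WS t = {\<zero>\<^bsub>M\<^esub>}"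
    using h_V h_eq_0 weight_space_carrier weight_space_closed(1)[of t] by blast
next
  assume "WS t = {\<zero>\<^bsub>M\<^esub>}"
  then show "V t = {0}" by (simp add: V_def)
qed

lemma op_div_div:
  assumes "a \<in> V t"
  shows "op (div_E j) (op (div_E k) a) = \<phi> (q_binom (int (j + k)) j) *f op (div_E (j + k)) a"
    and "op (div_F j) (op (div_F k) a) = \<phi> (q_binom (int (j + k)) j) *f op (div_F (j + k)) a"
  using ut.Ed_Ed[of j k] us.Ed_Ed[of j k]
  by (simp_all add: op_mult[symmetric] op_scale div_E_eq(1)[symmetric] div_F_eq(2)[symmetric] del: of_nat_add)

sublocale divided_power_module "\<phi> q_par" l "\<lambda>t r. \<phi> (q_binom t r)" fscale V
  "\<lambda>k. op (div_E k)" "\<lambda>k. op (div_F k)" m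
proof (unfold_locales, goal_cases)
  case (8 x t) then show ?case using ut.Ed_0 by (simp add: div_E_eq(1) op_0_if)
next
  case (9 x t) then show ?case using ut.Fd_0 by (simp add: div_F_eq(1) op_0_if)
next
  case (14 t) then show ?case using highest unfolding V_eq_0_iff highest_weight_def by (meson not_le)
next
  case 15
  have "V t = {0}" if "t < - int m" for t
    using weights_bounded_below[OF _ that] weight_space_closed(1)[of t] unfolding V_eq_0_iff by blast
  then show ?case by blast
next
  case 16 then show ?case using highest by (simp add: V_eq_0_iff highest_weight_def)
qed (rule subspace_V | rule vs_linear_add[OF linear_op] vs_linear_scale[OF linear_op] U_A_gens |
    erule op_div_E op_div_F op_div_div op_e_f op_f_e)+

lemma indecomposable_graded:
  assumes N: "graded_submodule N" "graded_submodule N'" and "\<And>t. N t \<inter> N' t = {0}"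
    "\<And>t. V t = {x + y | x y. x \<in> N t \<and> y \<in> N' t}"
  shows "(\<forall>t. N t = {0}) \<or> (\<forall>t. N' t = {0})"
proof (rule indecomposable_families[OF indec family_submodule family_submodule])
qed (rule graded_submoduleD[OF N(1)] graded_submoduleD[OF N(2)] assms(3,4); assumption?)+

end

section \<open>Dimensions of weight spaces from explicit spanning vectors\<close>

context modelled_module
begin

lemma weight_dim_eq_card:
  assumes A: "finite A" "A \<subseteq> WS t"
    and span: "\<And>y. y \<in> WS t \<Longrightarrow> \<exists>c. h y = (\<Sum>a\<in>A. c a *f h a)"
    and indep: "\<And>c a. (\<Sum>a\<in>A. c a *f h a) = 0 \<Longrightarrow> a \<in> A \<Longrightarrow> c a = 0"
  shows "weight_dim \<phi> M t = card A"
proof -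
  let ?W = "(cspace \<phi> M)\<lparr>carrier := WS t\<rparr>"
  interpret cs: vectorspace class_ring "cspace \<phi> M" by (rule vectorspace_cspace)
  have cs: "carrier (cspace \<phi> M) = carrier M" "\<And>x y. x \<oplus>\<^bsub>cspace \<phi> M\<^esub> y = x \<oplus>\<^bsub>M\<^esub> y"
    "\<zero>\<^bsub>cspace \<phi> M\<^esub> = \<zero>\<^bsub>M\<^esub>" "\<And>c x. c \<odot>\<^bsub>cspace \<phi> M\<^esub> x = scal c x"
    by (simp_all add: cspace_def scal_def)
  have "LinearCombinations.submodule class_ring (WS t) (cspace \<phi> M)"
    using weight_space_closed weight_space_carrier
    by (intro LinearCombinations.submodule.intro module_cspace) (auto simp: cs)
  then have "VectorSpace.subspace class_ring (WS t) (cspace \<phi> M)"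
    by (intro VectorSpace.subspace.intro vectorspace_cspace)
  then interpret W: vectorspace class_ring ?W by (rule cs.subspace_is_vs)
  have Ws: "carrier ?W = WS t" "\<And>x y. x \<oplus>\<^bsub>?W\<^esub> y = x \<oplus>\<^bsub>M\<^esub> y" "\<zero>\<^bsub>?W\<^esub> = \<zero>\<^bsub>M\<^esub>" "\<And>c x. c \<odot>\<^bsub>?W\<^esub> x = scal c x"
    using cs by simp_all
  have lincomb: "W.lincomb c B \<in> WS t \<and> h (W.lincomb c B) = (\<Sum>a\<in>B. c a *f h a)"
    if "finite B" "B \<subseteq> A" for c B
    using that
  proof (induction B rule: finite_induct)
    case empty
    show ?case unfolding W.lincomb_def W.finsum_empty Ws(3) sum.empty
      using weight_space_closed(1) h_zero by blast
  next
    case (insert a B)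
    have aW: "a \<in> WS t" and BW: "B \<subseteq> WS t" using insert.prems A(2) by auto
    have "W.lincomb c (insert a B) = scal (c a) a \<oplus>\<^bsub>M\<^esub> W.lincomb c B"
      unfolding W.lincomb_def Ws(2)[symmetric] Ws(4)[symmetric]
      using insert.hyps aW BW weight_space_closed(3)
      by (intro W.finsum_insert) (auto simp: cs)
    then show ?case
      using insert aW weight_space_carrier[OF aW] weight_space_carrier[of "W.lincomb c B" t]
      by (simp add: weight_space_closed h_add h_fscale)
  qed
  have "W.basis A"
  proof (subst W.basis_criterion)
    show "A \<subseteq> carrier ?W" using A(2) by simp
    show "\<forall>v. v \<in> carrier ?W \<longrightarrow> (\<exists>!c. c \<in> A \<rightarrow>\<^sub>E carrier class_ring \<and> W.lincomb c A = v)"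
    proof (intro allI impI)
      fix v assume "v \<in> carrier ?W"
      then have v: "v \<in> WS t" by simp
      have eq: "W.lincomb c A = v \<longleftrightarrow> (\<Sum>a\<in>A. c a *f h a) = h v" for c
        using lincomb[OF A(1) subset_refl, of c] v h_inj weight_space_carrier by metis
      obtain c where c: "h v = (\<Sum>a\<in>A. c a *f h a)" using span[OF v] by blast
      show "\<exists>!c. c \<in> A \<rightarrow>\<^sub>E carrier class_ring \<and> W.lincomb c A = v"
        unfolding eq
      proof (rule ex1I[of _ "restrict c A"])
        show "restrict c A \<in> A \<rightarrow>\<^sub>E carrier class_ring \<and> (\<Sum>a\<in>A. restrict c A a *f h a) = h v"
          by (simp add: c)
        fix c' assume c': "c' \<in> A \<rightarrow>\<^sub>E carrier class_ring \<and> (\<Sum>a\<in>A. c' a *f h a) = h v"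
        then have "(\<Sum>a\<in>A. (c' a - c a) *f h a) = 0"
          using c by (simp add: fv.scale_left_diff_distrib sum_subtractf)
        then have "c' a = c a" if "a \<in> A" for a using indep[of "\<lambda>a. c' a - c a" a] that by simp
        then show "c' = restrict c A"
          using c' by (intro extensionalityI[of _ A]) (auto simp: PiE_def)
      qed
    qed
  qed (rule A(1))
  then show ?thesis unfolding weight_dim_def by (rule W.dim_basis[OF A(1)])
qed

lemma weight_dim_0: "V t = {0} \<Longrightarrow> weight_dim \<phi> M t = 0"
  using h_V weight_space_carrier by (subst weight_dim_eq_card[of "{}"]) auto

lemma weight_dim_1:
  assumes "x \<noteq> 0" "V t = range (\<lambda>c. c *f x)"
  shows "weight_dim \<phi> M t = 1"
proof -
  have x: "x \<in> V t" using assms(2) fv.scale_one[of x] by (metis rangeI)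
  have "\<exists>c. h y = c (g x) *f x" if "y \<in> WS t" for y
  proof -
    have "h y \<in> V t" using that h_V weight_space_carrier by blast
    then obtain c where "h y = c *f x" unfolding assms(2) by blast
    then show ?thesis by (intro exI[of _ "\<lambda>_. c"])
  qed
  then show ?thesis
    using hg[OF x] assms(1) by (subst weight_dim_eq_card[of "{g x}"]) auto
qed

lemma weight_dim_2:
  assumes indep: "\<And>A B. A *f x + B *f y = 0 \<Longrightarrow> A = 0 \<and> B = 0" and V: "V t = {A *f x + B *f y | A B. True}"
  shows "weight_dim \<phi> M t = 2"
proof -
  have "1 *f x + 0 *f y \<in> V t" "0 *f x + 1 *f y \<in> V t" unfolding V by blast+
  then have xy: "x \<in> V t" "y \<in> V t" by simp_all
  have "x \<noteq> y" using indep[of 1 "- 1"] by auto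
  then have ne: "g x \<noteq> g y" using hg(1)[OF xy(1)] hg(1)[OF xy(2)] by metis
  have sum: "(\<Sum>a\<in>{g x, g y}. c a *f h a) = c (g x) *f x + c (g y) *f y" for c
    using ne hg(1)[OF xy(1)] hg(1)[OF xy(2)] by simp
  have "weight_dim \<phi> M t = card {g x, g y}"
  proof (rule weight_dim_eq_card)
    show "{g x, g y} \<subseteq> WS t" using hg(2) xy by blast
    show "\<exists>c. h z = (\<Sum>a\<in>{g x, g y}. c a *f h a)" if "z \<in> WS t" for z
    proof -
      have "h z \<in> V t" using that h_V weight_space_carrier by blast
      then obtain A B where "h z = A *f x + B *f y" unfolding V by blast
      then show ?thesis unfolding sum using ne by (intro exI[of _ "\<lambda>a. if a = g x then A else B"]) simp
    qed
    show "c a = 0" if "(\<Sum>a\<in>{g x, g y}. c a *f h a) = 0" "a \<in> {g x, g y}" for c a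
      using that indep unfolding sum by blast
  qed simp
  then show ?thesis using ne by simp
qed

end

section \<open>Weight multiplicities of the indecomposable tilting module\<close>

context indecomposable_tilting_module
begin

lemma weight_dim_top_nonvanishing:
  assumes "\<And>k. k \<le> m \<Longrightarrow> \<phi> (q_binom (int m) k) \<noteq> 0"
  shows "weight_dim \<phi> M t = (if \<exists>i\<in>{0..int m}. t = int m - 2 * i then 1 else 0)"
proof (cases "\<exists>i\<in>{0..int m}. t = int m - 2 * i")
  case True
  then obtain i where i: "0 \<le> i" "i \<le> int m" "t = int m - 2 * i" by auto
  then have t: "nat i \<le> m" "t = int m - 2 * int (nat i)" by auto
  have "\<exists>x. x \<noteq> 0 \<and> V t = range (\<lambda>c. c *f x)"
    unfolding t(2) by (rule weights_top_nonvanishing(1)[OF indecomposable_graded assms t(1)])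
  then obtain x where x: "x \<noteq> 0" "V t = range (\<lambda>c. c *f x)" by blast
  show ?thesis unfolding weight_dim_1[OF x] using True by (simp only: if_True)
next
  case False
  then have out: "t \<noteq> int m - 2 * int k" if "k \<le> m" for k using that by force
  have "V t = {0}" by (rule weights_top_nonvanishing(2)[OF indecomposable_graded assms out])
  then show ?thesis using weight_dim_0 False by (simp only: if_False)
qed

lemma weight_dim_linked:
  assumes a: "1 \<le> a" and b: "Suc b < l" and m: "m = a * l + b"
  shows "weight_dim \<phi> M t =
    (if \<exists>j\<in>{int b + 1..int m - (int b + 1)}. t = int m - 2 * j then 2
     else if \<exists>j\<in>{0..int b} \<union> {int m - int b..int m}. t = int m - 2 * j then 1
     else 0)"
proof -
  have "l \<le> a * l" using a by simp
  then have bm: "2 * b < m" using b m by linarith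
  have inj: "x = 0" if x: "x \<in> V (int m - 2 * int b)" "op (div_F 1) x = 0" for x
  proof -
    have "act (div_F 1) (g x) = \<zero>\<^bsub>M\<^esub>" using x(2) by (simp add: op_def h_eq_0)
    then have "g x = \<zero>\<^bsub>M\<^esub>" using div_F_injective[OF hg(2)[OF x(1)] _ b bm] by simp
    then show ?thesis using hg(1)[OF x(1)] by simp
  qed
  have linked_1: "\<exists>x y. (\<forall>A B. A *f x + B *f y = 0 \<longrightarrow> A = 0 \<and> B = 0) \<and>
      V (int m - 2 * int k) = {A *f x + B *f y | A B. True}" if "b < k" "k < a * l" for k
    by (rule weights_linked(1)[OF indecomposable_graded a b m inj div_E_surjective[OF _ b bm] that])
  have linked_2: "\<exists>x. x \<noteq> 0 \<and> V (int m - 2 * int k) = range (\<lambda>c. c *f x)" if "k \<le> b \<or> a * l \<le> k" "k \<le> m" for k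
    by (rule weights_linked(2)[OF indecomposable_graded a b m inj div_E_surjective[OF _ b bm] that])
  \<comment> \<open>Because a l = m - b, the range b + 1 <= j <= m - (b + 1) is the same as b < j <
    a l.\<close>
  have L: "int m = int (a * l) + int b" using m by simp
  consider (mid) j where "int b + 1 \<le> j" "j \<le> int m - (int b + 1)" "t = int m - 2 * j"
    | (ends) j where "0 \<le> j \<and> j \<le> int b \<or> int m - int b \<le> j \<and> j \<le> int m" "t = int m - 2 * j"
    | (out) "\<And>j. 0 \<le> j \<Longrightarrow> j \<le> int m \<Longrightarrow> t \<noteq> int m - 2 * j"
  proof (cases "\<exists>j. 0 \<le> j \<and> j \<le> int m \<and> t = int m - 2 * j")
    case True
    then obtain j where "0 \<le> j" "j \<le> int m" "t = int m - 2 * j" by blast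
    then show thesis using mid[of j] ends[of j] by linarith
  next
    case False
    then show thesis using out by blast
  qed
  then show ?thesis
  proof cases
    case mid
    then have k: "b < nat j" "nat j < a * l" "t = int m - 2 * int (nat j)" using L by linarith+
    obtain x y where xy: "\<forall>A B. A *f x + B *f y = 0 \<longrightarrow> A = 0 \<and> B = 0" "V t = {A *f x + B *f y | A B. True}"
      using linked_1[OF k(1,2)] unfolding k(3)[symmetric] by blast
    have "weight_dim \<phi> M t = 2" by (rule weight_dim_2[OF _ xy(2)]) (use xy(1) in blast)
    then show ?thesis using mid by (simp only: if_True) (smt (verit) atLeastAtMost_iff)
  next
    case ends
    have "0 \<le> j" using ends L by linarith
    then have k: "nat j \<le> b \<or> a * l \<le> nat j" "nat j \<le> m" "t = int m - 2 * int (nat j)"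
      using ends L by linarith+
    obtain x where x: "x \<noteq> 0" "V t = range (\<lambda>c. c *f x)"
      using linked_2[OF k(1,2)] unfolding k(3)[symmetric] by blast
    have "weight_dim \<phi> M t = 1" by (rule weight_dim_1[OF x])
    moreover have "\<not> (\<exists>j\<in>{int b + 1..int m - (int b + 1)}. t = int m - 2 * j)" using ends L by auto
    moreover have "\<exists>j\<in>{0..int b} \<union> {int m - int b..int m}. t = int m - 2 * j" using ends by auto
    ultimately show ?thesis by presburger
  next
    case out
    have mb: "int b \<le> int m" using m by simp
    have outside: "j < 0 \<or> int m < j" if "t = int m - 2 * j" for j
      using out[of j] that by force
    have t: "t \<noteq> int m - 2 * int k" if "k \<le> m" for k using out[of "int k"] that by simp
    have "V t = {0}"
      by (rule weights_linked(3)[OF indecomposable_graded a b m inj div_E_surjective[OF _ b bm] t])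
    then have "weight_dim \<phi> M t = 0" by (rule weight_dim_0)
    moreover have "\<not> (\<exists>j\<in>{int b + 1..int m - (int b + 1)}. t = int m - 2 * j)"
      "\<not> (\<exists>j\<in>{0..int b} \<union> {int m - int b..int m}. t = int m - 2 * j)"
      using mb by (auto dest!: outside)
    ultimately show ?thesis by presburger
  qed
qed

end

theorem corollary6p2:
  fixes \<zeta> :: complex
    and \<phi> :: "qfield \<Rightarrow> complex"
    and T :: "(u_zeta, 'v) module"
    and l m :: nat
    and t :: int
  assumes "\<exists>n>0. \<zeta> ^ n = 1"
    and "l = (LEAST n. 0 < n \<and> (\<zeta>\<^sup>2) ^ n = 1)"
    and "\<phi> \<in> Ring.ring_hom laurent_ring class_ring"
    and "\<phi> q_par = \<zeta>"
    and "indecomposable_tilting \<phi> m T"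
  shows "(m < l \<or> [int m = - 1] (mod int l) \<longrightarrow>
      weight_dim \<phi> T t = (if \<exists>i\<in>{0..int m}. t = int m - 2 * i then 1 else 0)) \<and>
    (\<forall>a b :: nat. m = a * l + b \<and> 1 \<le> a \<and> int b < int l - 1 \<longrightarrow>
      weight_dim \<phi> T t =
        (if \<exists>j\<in>{int b + 1..int m - (int b + 1)}. t = int m - 2 * j then 2
         else if \<exists>j\<in>{0..int b} \<union> {int m - int b..int m}. t = int m - 2 * j then 1
         else 0))"
proof -
  have l: "0 < l" "(\<zeta>\<^sup>2) ^ l = 1" "\<And>i. 0 < i \<Longrightarrow> i < l \<Longrightarrow> (\<zeta>\<^sup>2) ^ i \<noteq> 1"
  proof -
    obtain n where "0 < n" "\<zeta> ^ n = 1" using assms(1) by blast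
    then have "0 < n \<and> (\<zeta>\<^sup>2) ^ n = 1" by (simp add: power_mult[symmetric] mult.commute[of 2] power_mult)
    then have "0 < l \<and> (\<zeta>\<^sup>2) ^ l = 1" unfolding assms(2) by (rule LeastI)
    then show "0 < l" "(\<zeta>\<^sup>2) ^ l = 1" by simp_all
    show "(\<zeta>\<^sup>2) ^ i \<noteq> 1" if "0 < i" "i < l" for i
      using not_less_Least[of i "\<lambda>n. 0 < n \<and> (\<zeta>\<^sup>2) ^ n = 1"] that assms(2) by blast
  qed
  have T: "left_module (U_zeta \<phi>) T" "vectorspace.fin_dim class_ring (cspace \<phi> T)"
    "carrier T = generate (add_monoid T) (\<Union>t. weight_space \<phi> T t)"
    and fil: "filtration_by (U_zeta \<phi>) (\<lambda>D. \<exists>k. is_weyl \<phi> k D) T"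
      "filtration_by (U_zeta \<phi>) (\<lambda>D. \<exists>k. is_dual_weyl \<phi> k D) T"
    and ind: "indecomposable (U_zeta \<phi>) T" "highest_weight \<phi> T (int m)"
    using assms(5) unfolding indecomposable_tilting_def tilting_def weight_module_def by blast+
  interpret zeta_module \<phi> T
    by (intro zeta_module.intro specialization.intro assms(3) T(1))
  obtain g :: "('v \<Rightarrow> complex) \<Rightarrow> 'v" and h where gh: "\<forall>a. g a \<in> carrier T" "\<forall>a b. g (a + b) = g a \<oplus>\<^bsub>T\<^esub> g b"
    "\<forall>c a. g (\<lambda>i. c * a i) = scal c (g a)" "\<forall>x\<in>carrier T. g (h x) = x"
    "\<forall>x\<in>carrier T. \<forall>y\<in>carrier T. h (x \<oplus>\<^bsub>T\<^esub> y) = h x + h y"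
    "\<forall>c. \<forall>x\<in>carrier T. h (scal c x) = (\<lambda>i. c * h x i)"
    using linear_model[OF T(2)] by blast
  interpret modelled_module \<phi> T g h by unfold_locales (simp_all add: gh)
  interpret generated_module \<phi> T g h by unfold_locales (rule T(3))
  interpret root_binom "\<phi> q_par" l "\<lambda>t r. \<phi> (q_binom t r)"
  proof
    show "\<phi> q_par \<noteq> 0" using \<phi>_qpow_nonzero[of 1] by simp
    show "\<phi> (q_binom (t + 1) (Suc r)) = \<phi> q_par ^ Suc r * \<phi> (q_binom t (Suc r)) +
        \<phi> q_par powi (int r - t) * \<phi> (q_binom t r)" for t r by (rule \<phi>_q_binom_pascal)
  qed (simp_all add: assms(4) l q_binom_0_left)
  interpret indecomposable_tilting_module \<phi> T g h l m
    by unfold_locales (rule fil ind)+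
  show ?thesis
  proof (intro conjI impI allI)
    assume case_1: "m < l \<or> [int m = - 1] (mod int l)"
    \<comment> \<open>Both alternatives make every coefficient with top entry m nonzero: for m < l
      nothing reaches the order of \<open>\<zeta>\<^sup>2\<close>, and for m = c l - 1 the remainder
      modulo l is the largest possible.\<close>
    have "\<phi> (q_binom (int m) k) \<noteq> 0" if k: "k \<le> m" for k
    proof (cases "m < l")
      case True
      then show ?thesis using k by (rule binom_small_nonzero[rotated])
    next
      case False
      then have "int l dvd int m + 1" using case_1 by (simp add: cong_iff_dvd_diff)
      then have "l dvd Suc m" by (metis int_dvd_int_iff of_nat_Suc add.commute)
      then obtain c where c: "Suc m = c * l" by (metis dvd_def mult.commute)
      then have e: "int (c * l) - 1 = int m" by (metis add_diff_cancel_left' of_nat_Suc)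
      have "k < c * l" using c k by linarith
      then show ?thesis using binom_pred_nonzero[of k c] unfolding e by blast
    qed
    then show "weight_dim \<phi> T t = (if \<exists>i\<in>{0..int m}. t = int m - 2 * i then 1 else 0)"
      by (rule weight_dim_top_nonvanishing)
  next
    fix a b assume "m = a * l + b \<and> 1 \<le> a \<and> int b < int l - 1"
    then show "weight_dim \<phi> T t =
        (if \<exists>j\<in>{int b + 1..int m - (int b + 1)}. t = int m - 2 * j then 2
         else if \<exists>j\<in>{0..int b} \<union> {int m - int b..int m}. t = int m - 2 * j then 1
         else 0)"
      by (intro weight_dim_linked) auto
  qed
qed

end
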